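(* Let $P$ be a dg-operad over $\mathfrak A$. Then $P$ is sane as soon as at least one of the following holds: (1) $P$ admits an augmentation, i.e. there is a morphism of dg-operads $P\to\mathbf 1$ to the unit operad; (2) $P$ is cofibrant; (3) $P(0)$ is dualisable and the unit $\mathbf 1\to P$ is a degree-wise split monomorphism.
   Context: Standing setting: $(\mathfrak A,\otimes,\mathbf 1)$ is a closed symmetric monoidal cocomplete additive category. $\mathrm{Ch}(\mathfrak A)$ denotes the symmetric monoidal category of chain complexes in $\mathfrak A$, with internal hom $[-,-]$. A dg-operad is a (symmetric, unital) operad in $\mathrm{Ch}(\mathfrak A)$. The unit operad, also written $\mathbf 1$, is the operad equal to $\mathbf 1$ in arity $1$ and $0$ in other arities; every dg-operad $P$ has a unit morphism $\mathbf 1\to P$. A $P$-coalgebra is a chain complex $V$ with a morphism of dg-operads $P\to \mathrm{Coend}_V$, where $\mathrm{Coend}_V(n)=[V,V^{\otimes n}]$ with the evident right $\mathbf S_n$-action and compositions; equivalently, it is given by maps $P(n)\otimes V\to V^{\otimes n}$ that are suitably associative, unital and equivariant. Standing assumption: for every morphism of dg-operads $f:P\to P'$, the restriction functor $f^*$ from $P'$-coalgebras to $P$-coalgebras admits a right adjoint $f_*$. In particular (taking $f$ to be the unit $\mathbf 1\to P$), the forgetful functor $\mathrm{Forget}$ from $P$-coalgebras to $\mathrm{Ch}(\mathfrak A)$ has a right adjoint $\mathrm{Cofree}$. Write $\mathrm L^P=\mathrm{Forget}\circ\mathrm{Cofree}$. A dg-operad $P$ is sane if the cofree $P$-coalgebra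 functor is faithful or, equivalently, if the counit $\mathrm L^PX\to X$ is an epimorphism for every chain complex $X$. A dg-operad $P$ is cofibrant if for every morphism $Q\to R$ of dg-operads that is both a degree-wise epimorphism and a quasi-isomorphism, every morphism of dg-operads $P\to R$ lifts to a morphism $P\to Q$. For a chain complex $X$ put $X^\vee=[X,\mathbf 1]$; $X$ is dualisable if the canonical map $X\otimes X^\vee\to[X,X]$ is an isomorphism. *)

theory Defs
  imports Main "HOL-Combinatorics.Permutations"
begin

section \<open>Categories, functors, adjunctions, colimits\<close>

record ('o, 'a) cat =
  Ob :: "'o set"
  Ar :: "'a set"
  Dom :: "'a \<Rightarrow> 'o"
  Cod :: "'a \<Rightarrow> 'o"
  Id :: "'o \<Rightarrow> 'a"
  Comp :: "'a \<Rightarrow> 'a \<Rightarrow> 'a"  (infixr "\<cdot>\<index>" 65)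

definition hom :: "('o, 'a, 'm) cat_scheme \<Rightarrow> 'o \<Rightarrow> 'o \<Rightarrow> 'a set" where
  "hom C X Y = {f \<in> Ar C. Dom C f = X \<and> Cod C f = Y}"

locale category =
  fixes C :: "('o, 'a, 'm) cat_scheme" (structure)
  assumes Dom_Ob: "f \<in> Ar C \<Longrightarrow> Dom C f \<in> Ob C"
    and Cod_Ob: "f \<in> Ar C \<Longrightarrow> Cod C f \<in> Ob C"
    and Id_hom: "X \<in> Ob C \<Longrightarrow> Id C X \<in> hom C X X"
    and Comp_hom: "f \<in> hom C X Y \<Longrightarrow> g \<in> hom C Y Z \<Longrightarrow> g \<cdot> f \<in> hom C X Z"
    and Id_left: "f \<in> hom C X Y \<Longrightarrow> Id C Y \<cdot> f = f"
    and Id_right: "f \<in> hom C X Y \<Longrightarrow> f \<cdot> Id C X = f"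
    and Comp_assoc: "f \<in> hom C W X \<Longrightarrow> g \<in> hom C X Y \<Longrightarrow> h \<in> hom C Y Z
      \<Longrightarrow> (h \<cdot> g) \<cdot> f = h \<cdot> (g \<cdot> f)"

definition inverse_of :: "('o, 'a, 'm) cat_scheme \<Rightarrow> 'a \<Rightarrow> 'a \<Rightarrow> bool" where
  "inverse_of C f g \<longleftrightarrow> f \<in> Ar C \<and> g \<in> hom C (Cod C f) (Dom C f)
     \<and> g \<cdot>\<^bsub>C\<^esub> f = Id C (Dom C f) \<and> f \<cdot>\<^bsub>C\<^esub> g = Id C (Cod C f)"

definition iso :: "('o, 'a, 'm) cat_scheme \<Rightarrow> 'a \<Rightarrow> bool" where
  "iso C f \<longleftrightarrow> (\<exists>g. inverse_of C f g)"

definition inv_ar :: "('o, 'a, 'm) cat_scheme \<Rightarrow> 'a \<Rightarrow> 'a" where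
  "inv_ar C f = (THE g. inverse_of C f g)"

definition epi :: "('o, 'a, 'm) cat_scheme \<Rightarrow> 'a \<Rightarrow> bool" where
  "epi C f \<longleftrightarrow> f \<in> Ar C \<and> (\<forall>Z \<in> Ob C. \<forall>g \<in> hom C (Cod C f) Z. \<forall>h \<in> hom C (Cod C f) Z.
     g \<cdot>\<^bsub>C\<^esub> f = h \<cdot>\<^bsub>C\<^esub> f \<longrightarrow> g = h)"

definition split_mono :: "('o, 'a, 'm) cat_scheme \<Rightarrow> 'a \<Rightarrow> bool" where
  "split_mono C f \<longleftrightarrow> f \<in> Ar C \<and> (\<exists>r \<in> hom C (Cod C f) (Dom C f). r \<cdot>\<^bsub>C\<^esub> f = Id C (Dom C f))"

definition is_zero_ob :: "('o, 'a, 'm) cat_scheme \<Rightarrow> 'o \<Rightarrow> bool" where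
  "is_zero_ob C z \<longleftrightarrow> z \<in> Ob C \<and> (\<forall>X \<in> Ob C. (\<exists>!f. f \<in> hom C z X) \<and> (\<exists>!f. f \<in> hom C X z))"

definition zero_ob :: "('o, 'a, 'm) cat_scheme \<Rightarrow> 'o" where
  "zero_ob C = (SOME z. is_zero_ob C z)"

definition zero_ar :: "('o, 'a, 'm) cat_scheme \<Rightarrow> 'o \<Rightarrow> 'o \<Rightarrow> 'a" where
  "zero_ar C X Y = (THE f. f \<in> hom C (zero_ob C) Y) \<cdot>\<^bsub>C\<^esub> (THE f. f \<in> hom C X (zero_ob C))"

record ('o, 'a, 'p, 'b) ftor =
  fob :: "'o \<Rightarrow> 'p"
  far :: "'a \<Rightarrow> 'b"

definition is_functor ::
  "('o, 'a, 'm) cat_scheme \<Rightarrow> ('p, 'b, 'n) cat_scheme \<Rightarrow> ('o, 'a, 'p, 'b) ftor \<Rightarrow> bool" where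
  "is_functor C D F \<longleftrightarrow>
     (\<forall>X \<in> Ob C. fob F X \<in> Ob D)
   \<and> (\<forall>X Y. \<forall>f \<in> hom C X Y. far F f \<in> hom D (fob F X) (fob F Y))
   \<and> (\<forall>X \<in> Ob C. far F (Id C X) = Id D (fob F X))
   \<and> (\<forall>X Y Z. \<forall>f \<in> hom C X Y. \<forall>g \<in> hom C Y Z. far F (g \<cdot>\<^bsub>C\<^esub> f) = far F g \<cdot>\<^bsub>D\<^esub> far F f)"

definition faithful ::
  "('o, 'a, 'm) cat_scheme \<Rightarrow> ('p, 'b, 'n) cat_scheme \<Rightarrow> ('o, 'a, 'p, 'b) ftor \<Rightarrow> bool" where
  "faithful C D F \<longleftrightarrow> is_functor C D F \<and> (\<forall>X \<in> Ob C. \<forall>Y \<in> Ob C. inj_on (far F) (hom C X Y))"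

definition right_adjoint ::
  "('o, 'a, 'm) cat_scheme \<Rightarrow> ('p, 'b, 'n) cat_scheme
    \<Rightarrow> ('o, 'a, 'p, 'b) ftor \<Rightarrow> ('p, 'b, 'o, 'a) ftor \<Rightarrow> bool" where
  "right_adjoint C D F G \<longleftrightarrow> is_functor C D F \<and> is_functor D C G \<and> (\<exists>\<epsilon>.
     (\<forall>Y \<in> Ob D. \<epsilon> Y \<in> hom D (fob F (fob G Y)) Y)
   \<and> (\<forall>Y Z. \<forall>g \<in> hom D Y Z. \<epsilon> Z \<cdot>\<^bsub>D\<^esub> far F (far G g) = g \<cdot>\<^bsub>D\<^esub> \<epsilon> Y)
   \<and> (\<forall>X \<in> Ob C. \<forall>Y \<in> Ob D. \<forall>f \<in> hom D (fob F X) Y.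
        \<exists>!g. g \<in> hom C X (fob G Y) \<and> \<epsilon> Y \<cdot>\<^bsub>D\<^esub> far F g = f))"

definition cocone ::
  "('i, 'j, 'n) cat_scheme \<Rightarrow> ('o, 'a, 'm) cat_scheme \<Rightarrow> ('i, 'j, 'o, 'a) ftor
    \<Rightarrow> 'o \<Rightarrow> ('i \<Rightarrow> 'a) \<Rightarrow> bool" where
  "cocone J C D X \<iota> \<longleftrightarrow> X \<in> Ob C \<and> (\<forall>j \<in> Ob J. \<iota> j \<in> hom C (fob D j) X)
     \<and> (\<forall>j k. \<forall>u \<in> hom J j k. \<iota> k \<cdot>\<^bsub>C\<^esub> far D u = \<iota> j)"

definition is_colimit ::
  "('i, 'j, 'n) cat_scheme \<Rightarrow> ('o, 'a, 'm) cat_scheme \<Rightarrow> ('i, 'j, 'o, 'a) ftor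
    \<Rightarrow> 'o \<Rightarrow> ('i \<Rightarrow> 'a) \<Rightarrow> bool" where
  "is_colimit J C D X \<iota> \<longleftrightarrow> cocone J C D X \<iota>
     \<and> (\<forall>Y \<kappa>. cocone J C D Y \<kappa> \<longrightarrow> (\<exists>!h. h \<in> hom C X Y \<and> (\<forall>j \<in> Ob J. h \<cdot>\<^bsub>C\<^esub> \<iota> j = \<kappa> j)))"

text \<open>HOL has no distinguished universe of small sets. A diagram counts as small when the objects
  and arrows of its index category are drawn from the type \<open>'s\<close>, which plays the role of a bound
  on small sets; it is a parameter and will be required to be infinite.\<close>

definition cocomplete :: "'s itself \<Rightarrow> ('o, 'a, 'm) cat_scheme \<Rightarrow> bool" where
  "cocomplete _ C \<longleftrightarrow> (\<forall>(J :: ('s, 's) cat) D. category J \<and> is_functor J C D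
     \<longrightarrow> (\<exists>X \<iota>. is_colimit J C D X \<iota>))"

definition is_coproduct ::
  "('o, 'a, 'm) cat_scheme \<Rightarrow> ('i \<Rightarrow> 'o) \<Rightarrow> 'o \<Rightarrow> ('i \<Rightarrow> 'a) \<Rightarrow> bool" where
  "is_coproduct C F S \<iota> \<longleftrightarrow> S \<in> Ob C \<and> (\<forall>i. \<iota> i \<in> hom C (F i) S)
     \<and> (\<forall>Y \<in> Ob C. \<forall>\<kappa>. (\<forall>i. \<kappa> i \<in> hom C (F i) Y)
          \<longrightarrow> (\<exists>!h. h \<in> hom C S Y \<and> (\<forall>i. h \<cdot>\<^bsub>C\<^esub> \<iota> i = \<kappa> i)))"

definition coprod :: "('o, 'a, 'm) cat_scheme \<Rightarrow> ('i \<Rightarrow> 'o) \<Rightarrow> 'o \<times> ('i \<Rightarrow> 'a)" where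
  "coprod C F = (SOME S. is_coproduct C F (fst S) (snd S))"

definition copair :: "('o, 'a, 'm) cat_scheme \<Rightarrow> ('i \<Rightarrow> 'o) \<Rightarrow> 'o \<Rightarrow> ('i \<Rightarrow> 'a) \<Rightarrow> 'a" where
  "copair C F Y \<kappa> = (THE h. h \<in> hom C (fst (coprod C F)) Y
     \<and> (\<forall>i. h \<cdot>\<^bsub>C\<^esub> snd (coprod C F) i = \<kappa> i))"


section \<open>Closed symmetric monoidal additive categories\<close>

record ('o, 'a) smcat = "('o, 'a) cat" +
  tensO :: "'o \<Rightarrow> 'o \<Rightarrow> 'o"  (infixr "\<otimes>\<index>" 75)
  tensA :: "'a \<Rightarrow> 'a \<Rightarrow> 'a"  (infixr "\<boxtimes>\<index>" 75)
  unit :: "'o"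
  assoc :: "'o \<Rightarrow> 'o \<Rightarrow> 'o \<Rightarrow> 'a"
  lunit :: "'o \<Rightarrow> 'a"
  runit :: "'o \<Rightarrow> 'a"
  braid :: "'o \<Rightarrow> 'o \<Rightarrow> 'a"

locale symmetric_monoidal = category M
  for M :: "('o, 'a, 'm) smcat_scheme" (structure) +
  assumes tens_Ob: "X \<in> Ob M \<Longrightarrow> Y \<in> Ob M \<Longrightarrow> X \<otimes> Y \<in> Ob M"
    and unit_Ob: "unit M \<in> Ob M"
    and tens_hom: "f \<in> hom M X X' \<Longrightarrow> g \<in> hom M Y Y' \<Longrightarrow> f \<boxtimes> g \<in> hom M (X \<otimes> Y) (X' \<otimes> Y')"
    and tens_Id: "X \<in> Ob M \<Longrightarrow> Y \<in> Ob M \<Longrightarrow> Id M X \<boxtimes> Id M Y = Id M (X \<otimes> Y)"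
    and tens_Comp: "f \<in> hom M X X' \<Longrightarrow> f' \<in> hom M X' X'' \<Longrightarrow> g \<in> hom M Y Y' \<Longrightarrow> g' \<in> hom M Y' Y''
      \<Longrightarrow> (f' \<cdot> f) \<boxtimes> (g' \<cdot> g) = (f' \<boxtimes> g') \<cdot> (f \<boxtimes> g)"
    and assoc_hom: "X \<in> Ob M \<Longrightarrow> Y \<in> Ob M \<Longrightarrow> Z \<in> Ob M
      \<Longrightarrow> assoc M X Y Z \<in> hom M ((X \<otimes> Y) \<otimes> Z) (X \<otimes> (Y \<otimes> Z))"
    and assoc_iso: "X \<in> Ob M \<Longrightarrow> Y \<in> Ob M \<Longrightarrow> Z \<in> Ob M \<Longrightarrow> iso M (assoc M X Y Z)"
    and assoc_nat: "f \<in> hom M X X' \<Longrightarrow> g \<in> hom M Y Y' \<Longrightarrow> h \<in> hom M Z Z'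
      \<Longrightarrow> assoc M X' Y' Z' \<cdot> ((f \<boxtimes> g) \<boxtimes> h) = (f \<boxtimes> (g \<boxtimes> h)) \<cdot> assoc M X Y Z"
    and lunit_hom: "X \<in> Ob M \<Longrightarrow> lunit M X \<in> hom M (unit M \<otimes> X) X"
    and lunit_iso: "X \<in> Ob M \<Longrightarrow> iso M (lunit M X)"
    and lunit_nat: "f \<in> hom M X X' \<Longrightarrow> lunit M X' \<cdot> (Id M (unit M) \<boxtimes> f) = f \<cdot> lunit M X"
    and runit_hom: "X \<in> Ob M \<Longrightarrow> runit M X \<in> hom M (X \<otimes> unit M) X"
    and runit_iso: "X \<in> Ob M \<Longrightarrow> iso M (runit M X)"
    and runit_nat: "f \<in> hom M X X' \<Longrightarrow> runit M X' \<cdot> (f \<boxtimes> Id M (unit M)) = f \<cdot> runit M X"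
    and braid_hom: "X \<in> Ob M \<Longrightarrow> Y \<in> Ob M \<Longrightarrow> braid M X Y \<in> hom M (X \<otimes> Y) (Y \<otimes> X)"
    and braid_nat: "f \<in> hom M X X' \<Longrightarrow> g \<in> hom M Y Y'
      \<Longrightarrow> braid M X' Y' \<cdot> (f \<boxtimes> g) = (g \<boxtimes> f) \<cdot> braid M X Y"
    and symmetry: "X \<in> Ob M \<Longrightarrow> Y \<in> Ob M \<Longrightarrow> braid M Y X \<cdot> braid M X Y = Id M (X \<otimes> Y)"
    and triangle: "X \<in> Ob M \<Longrightarrow> Y \<in> Ob M
      \<Longrightarrow> (Id M X \<boxtimes> lunit M Y) \<cdot> assoc M X (unit M) Y = runit M X \<boxtimes> Id M Y"
    and pentagon: "W \<in> Ob M \<Longrightarrow> X \<in> Ob M \<Longrightarrow> Y \<in> Ob M \<Longrightarrow> Z \<in> Ob M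
      \<Longrightarrow> assoc M W X (Y \<otimes> Z) \<cdot> assoc M (W \<otimes> X) Y Z
        = (Id M W \<boxtimes> assoc M X Y Z) \<cdot> assoc M W (X \<otimes> Y) Z \<cdot> (assoc M W X Y \<boxtimes> Id M Z)"
    and hexagon: "X \<in> Ob M \<Longrightarrow> Y \<in> Ob M \<Longrightarrow> Z \<in> Ob M
      \<Longrightarrow> assoc M Y Z X \<cdot> braid M X (Y \<otimes> Z) \<cdot> assoc M X Y Z
        = (Id M Y \<boxtimes> braid M X Z) \<cdot> assoc M Y X Z \<cdot> (braid M X Y \<boxtimes> Id M Z)"

definition is_ihom :: "('o, 'a, 'm) smcat_scheme \<Rightarrow> 'o \<Rightarrow> 'o \<Rightarrow> 'o \<Rightarrow> 'a \<Rightarrow> bool" where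
  "is_ihom M X Y H e \<longleftrightarrow> H \<in> Ob M \<and> e \<in> hom M (H \<otimes>\<^bsub>M\<^esub> X) Y
     \<and> (\<forall>Z \<in> Ob M. \<forall>f \<in> hom M (Z \<otimes>\<^bsub>M\<^esub> X) Y.
          \<exists>!g. g \<in> hom M Z H \<and> e \<cdot>\<^bsub>M\<^esub> (g \<boxtimes>\<^bsub>M\<^esub> Id M X) = f)"

definition has_internal_homs :: "('o, 'a, 'm) smcat_scheme \<Rightarrow> bool" where
  "has_internal_homs M \<longleftrightarrow> (\<forall>X \<in> Ob M. \<forall>Y \<in> Ob M. \<exists>H e. is_ihom M X Y H e)"

definition ihom :: "('o, 'a, 'm) smcat_scheme \<Rightarrow> 'o \<Rightarrow> 'o \<Rightarrow> 'o" where
  "ihom M X Y = fst (SOME He. is_ihom M X Y (fst He) (snd He))"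

definition ev :: "('o, 'a, 'm) smcat_scheme \<Rightarrow> 'o \<Rightarrow> 'o \<Rightarrow> 'a" where
  "ev M X Y = snd (SOME He. is_ihom M X Y (fst He) (snd He))"

definition curry_ar :: "('o, 'a, 'm) smcat_scheme \<Rightarrow> 'o \<Rightarrow> 'o \<Rightarrow> 'o \<Rightarrow> 'a \<Rightarrow> 'a" where
  "curry_ar M Z X Y f = (THE g. g \<in> hom M Z (ihom M X Y) \<and> ev M X Y \<cdot>\<^bsub>M\<^esub> (g \<boxtimes>\<^bsub>M\<^esub> Id M X) = f)"

definition dual :: "('o, 'a, 'm) smcat_scheme \<Rightarrow> 'o \<Rightarrow> 'o" where
  "dual M X = ihom M X (unit M)"

definition dual_to_end :: "('o, 'a, 'm) smcat_scheme \<Rightarrow> 'o \<Rightarrow> 'a" where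
  "dual_to_end M X = curry_ar M (X \<otimes>\<^bsub>M\<^esub> dual M X) X X
     (runit M X \<cdot>\<^bsub>M\<^esub> (Id M X \<boxtimes>\<^bsub>M\<^esub> ev M X (unit M)) \<cdot>\<^bsub>M\<^esub> assoc M X (dual M X) X)"

definition dualisable :: "('o, 'a, 'm) smcat_scheme \<Rightarrow> 'o \<Rightarrow> bool" where
  "dualisable M X \<longleftrightarrow> X \<in> Ob M \<and> iso M (dual_to_end M X)"

record ('o, 'a) asmcat = "('o, 'a) smcat" +
  hzero :: "'o \<Rightarrow> 'o \<Rightarrow> 'a"
  hadd :: "'a \<Rightarrow> 'a \<Rightarrow> 'a"  (infixl "\<oplus>\<index>" 60)

locale additive_category = category A
  for A :: "('o, 'a, 'm) asmcat_scheme" (structure) +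
  assumes hzero_hom: "X \<in> Ob A \<Longrightarrow> Y \<in> Ob A \<Longrightarrow> hzero A X Y \<in> hom A X Y"
    and hadd_hom: "f \<in> hom A X Y \<Longrightarrow> g \<in> hom A X Y \<Longrightarrow> f \<oplus> g \<in> hom A X Y"
    and hadd_assoc: "f \<in> hom A X Y \<Longrightarrow> g \<in> hom A X Y \<Longrightarrow> h \<in> hom A X Y
      \<Longrightarrow> (f \<oplus> g) \<oplus> h = f \<oplus> (g \<oplus> h)"
    and hadd_comm: "f \<in> hom A X Y \<Longrightarrow> g \<in> hom A X Y \<Longrightarrow> f \<oplus> g = g \<oplus> f"
    and hadd_zero: "f \<in> hom A X Y \<Longrightarrow> f \<oplus> hzero A X Y = f"
    and hadd_neg: "f \<in> hom A X Y \<Longrightarrow> \<exists>g \<in> hom A X Y. f \<oplus> g = hzero A X Y"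
    and Comp_hadd_left: "f \<in> hom A X Y \<Longrightarrow> g \<in> hom A Y Z \<Longrightarrow> h \<in> hom A Y Z
      \<Longrightarrow> (g \<oplus> h) \<cdot> f = (g \<cdot> f) \<oplus> (h \<cdot> f)"
    and Comp_hadd_right: "f \<in> hom A X Y \<Longrightarrow> g \<in> hom A X Y \<Longrightarrow> h \<in> hom A Y Z
      \<Longrightarrow> h \<cdot> (f \<oplus> g) = (h \<cdot> f) \<oplus> (h \<cdot> g)"
    and zero_ob_exists: "\<exists>z. is_zero_ob A z"
    and biproduct_exists: "X \<in> Ob A \<Longrightarrow> Y \<in> Ob A \<Longrightarrow> \<exists>S \<in> Ob A.
      \<exists>i \<in> hom A X S. \<exists>j \<in> hom A Y S. \<exists>p \<in> hom A S X. \<exists>q \<in> hom A S Y.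
        p \<cdot> i = Id A X \<and> q \<cdot> j = Id A Y \<and> p \<cdot> j = hzero A Y X \<and> q \<cdot> i = hzero A X Y
        \<and> (i \<cdot> p) \<oplus> (j \<cdot> q) = Id A S"

definition neg :: "('o, 'a, 'm) asmcat_scheme \<Rightarrow> 'a \<Rightarrow> 'a" where
  "neg A f = (THE g. g \<in> hom A (Dom A f) (Cod A f)
     \<and> f \<oplus>\<^bsub>A\<^esub> g = hzero A (Dom A f) (Cod A f))"

definition signed :: "('o, 'a, 'm) asmcat_scheme \<Rightarrow> int \<Rightarrow> 'a \<Rightarrow> 'a" where
  "signed A k f = (if even k then f else neg A f)"


section \<open>Chain complexes\<close>

text \<open>Complexes are indexed by all integers, and the differential lowers the degree.\<close>

record ('o, 'a) chain =
  deg :: "int \<Rightarrow> 'o"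
  diff :: "int \<Rightarrow> 'a"

record ('o, 'a) chmap =
  src :: "('o, 'a) chain"
  tgt :: "('o, 'a) chain"
  at :: "int \<Rightarrow> 'a"

definition is_chain :: "('o, 'a, 'm) asmcat_scheme \<Rightarrow> ('o, 'a) chain \<Rightarrow> bool" where
  "is_chain A X \<longleftrightarrow> (\<forall>n. deg X n \<in> Ob A \<and> diff X n \<in> hom A (deg X n) (deg X (n - 1))
     \<and> diff X (n - 1) \<cdot>\<^bsub>A\<^esub> diff X n = hzero A (deg X n) (deg X (n - 2)))"

definition is_chmap :: "('o, 'a, 'm) asmcat_scheme \<Rightarrow> ('o, 'a) chmap \<Rightarrow> bool" where
  "is_chmap A f \<longleftrightarrow> is_chain A (src f) \<and> is_chain A (tgt f)
     \<and> (\<forall>n. at f n \<in> hom A (deg (src f) n) (deg (tgt f) n)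
          \<and> diff (tgt f) n \<cdot>\<^bsub>A\<^esub> at f n = at f (n - 1) \<cdot>\<^bsub>A\<^esub> diff (src f) n)"

definition tens_summand ::
  "('o, 'a, 'm) asmcat_scheme \<Rightarrow> ('o, 'a) chain \<Rightarrow> ('o, 'a) chain \<Rightarrow> int \<Rightarrow> int \<Rightarrow> 'o" where
  "tens_summand A X Y n = (\<lambda>p. deg X p \<otimes>\<^bsub>A\<^esub> deg Y (n - p))"

definition tens_inj ::
  "('o, 'a, 'm) asmcat_scheme \<Rightarrow> ('o, 'a) chain \<Rightarrow> ('o, 'a) chain \<Rightarrow> int \<Rightarrow> int \<Rightarrow> 'a" where
  "tens_inj A X Y p q = snd (coprod A (tens_summand A X Y (p + q))) p"

definition ch_tens ::
  "('o, 'a, 'm) asmcat_scheme \<Rightarrow> ('o, 'a) chain \<Rightarrow> ('o, 'a) chain \<Rightarrow> ('o, 'a) chain" where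
  "ch_tens A X Y = \<lparr>
     deg = (\<lambda>n. fst (coprod A (tens_summand A X Y n))),
     diff = (\<lambda>n. copair A (tens_summand A X Y n) (fst (coprod A (tens_summand A X Y (n - 1))))
       (\<lambda>p. (tens_inj A X Y (p - 1) (n - p) \<cdot>\<^bsub>A\<^esub> (diff X p \<boxtimes>\<^bsub>A\<^esub> Id A (deg Y (n - p))))
         \<oplus>\<^bsub>A\<^esub> signed A p
             (tens_inj A X Y p (n - p - 1) \<cdot>\<^bsub>A\<^esub> (Id A (deg X p) \<boxtimes>\<^bsub>A\<^esub> diff Y (n - p)))))\<rparr>"

definition ch_tens_map ::
  "('o, 'a, 'm) asmcat_scheme \<Rightarrow> ('o, 'a) chmap \<Rightarrow> ('o, 'a) chmap \<Rightarrow> ('o, 'a) chmap" where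
  "ch_tens_map A f g = \<lparr>src = ch_tens A (src f) (src g), tgt = ch_tens A (tgt f) (tgt g),
     at = (\<lambda>n. copair A (tens_summand A (src f) (src g) n) (deg (ch_tens A (tgt f) (tgt g)) n)
       (\<lambda>p. tens_inj A (tgt f) (tgt g) p (n - p) \<cdot>\<^bsub>A\<^esub> (at f p \<boxtimes>\<^bsub>A\<^esub> at g (n - p))))\<rparr>"

definition ch_unit :: "('o, 'a, 'm) asmcat_scheme \<Rightarrow> ('o, 'a) chain" where
  "ch_unit A = (let X = (\<lambda>n. if n = 0 then unit A else zero_ob A)
     in \<lparr>deg = X, diff = (\<lambda>n. hzero A (X n) (X (n - 1)))\<rparr>)"

definition ch_assoc ::
  "('o, 'a, 'm) asmcat_scheme \<Rightarrow> ('o, 'a) chain \<Rightarrow> ('o, 'a) chain \<Rightarrow> ('o, 'a) chain \<Rightarrow> ('o, 'a) chmap"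
where
  "ch_assoc A X Y Z = (let L = ch_tens A (ch_tens A X Y) Z; R = ch_tens A X (ch_tens A Y Z)
     in \<lparr>src = L, tgt = R,
         at = (\<lambda>n. THE h. h \<in> hom A (deg L n) (deg R n)
           \<and> (\<forall>p q r. p + q + r = n \<longrightarrow>
                h \<cdot>\<^bsub>A\<^esub> tens_inj A (ch_tens A X Y) Z (p + q) r
                  \<cdot>\<^bsub>A\<^esub> (tens_inj A X Y p q \<boxtimes>\<^bsub>A\<^esub> Id A (deg Z r))
              = tens_inj A X (ch_tens A Y Z) p (q + r)
                  \<cdot>\<^bsub>A\<^esub> (Id A (deg X p) \<boxtimes>\<^bsub>A\<^esub> tens_inj A Y Z q r)
                  \<cdot>\<^bsub>A\<^esub> assoc A (deg X p) (deg Y q) (deg Z r)))\<rparr>)"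

definition ch_lunit :: "('o, 'a, 'm) asmcat_scheme \<Rightarrow> ('o, 'a) chain \<Rightarrow> ('o, 'a) chmap" where
  "ch_lunit A X = \<lparr>src = ch_tens A (ch_unit A) X, tgt = X,
     at = (\<lambda>n. copair A (tens_summand A (ch_unit A) X n) (deg X n)
       (\<lambda>p. if p = 0 then lunit A (deg X n)
            else hzero A (tens_summand A (ch_unit A) X n p) (deg X n)))\<rparr>"

definition ch_runit :: "('o, 'a, 'm) asmcat_scheme \<Rightarrow> ('o, 'a) chain \<Rightarrow> ('o, 'a) chmap" where
  "ch_runit A X = \<lparr>src = ch_tens A X (ch_unit A), tgt = X,
     at = (\<lambda>n. copair A (tens_summand A X (ch_unit A) n) (deg X n)
       (\<lambda>p. if p = n then runit A (deg X n)
            else hzero A (tens_summand A X (ch_unit A) n p) (deg X n)))\<rparr>"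

definition ch_braid ::
  "('o, 'a, 'm) asmcat_scheme \<Rightarrow> ('o, 'a) chain \<Rightarrow> ('o, 'a) chain \<Rightarrow> ('o, 'a) chmap" where
  "ch_braid A X Y = \<lparr>src = ch_tens A X Y, tgt = ch_tens A Y X,
     at = (\<lambda>n. copair A (tens_summand A X Y n) (deg (ch_tens A Y X) n)
       (\<lambda>p. signed A (p * (n - p))
          (tens_inj A Y X (n - p) p \<cdot>\<^bsub>A\<^esub> braid A (deg X p) (deg Y (n - p)))))\<rparr>"

definition Ch :: "('o, 'a, 'm) asmcat_scheme \<Rightarrow> (('o, 'a) chain, ('o, 'a) chmap) smcat" where
  "Ch A = \<lparr>
     Ob = {X. is_chain A X},
     Ar = {f. is_chmap A f},
     Dom = src,
     Cod = tgt,
     Id = (\<lambda>X. \<lparr>src = X, tgt = X, at = (\<lambda>n. Id A (deg X n))\<rparr>),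
     Comp = (\<lambda>g f. \<lparr>src = src f, tgt = tgt g, at = (\<lambda>n. at g n \<cdot>\<^bsub>A\<^esub> at f n)\<rparr>),
     tensO = ch_tens A,
     tensA = ch_tens_map A,
     unit = ch_unit A,
     assoc = ch_assoc A,
     lunit = ch_lunit A,
     runit = ch_runit A,
     braid = ch_braid A\<rparr>"

definition is_kernel :: "('o, 'a, 'm) asmcat_scheme \<Rightarrow> 'a \<Rightarrow> 'a \<Rightarrow> bool" where
  "is_kernel A f k \<longleftrightarrow> f \<in> Ar A \<and> k \<in> Ar A \<and> Cod A k = Dom A f
     \<and> f \<cdot>\<^bsub>A\<^esub> k = hzero A (Dom A k) (Cod A f)
     \<and> (\<forall>W \<in> Ob A. \<forall>g \<in> hom A W (Dom A f). f \<cdot>\<^bsub>A\<^esub> g = hzero A W (Cod A f)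
          \<longrightarrow> (\<exists>!h. h \<in> hom A W (Dom A k) \<and> k \<cdot>\<^bsub>A\<^esub> h = g))"

definition is_cokernel :: "('o, 'a, 'm) asmcat_scheme \<Rightarrow> 'a \<Rightarrow> 'a \<Rightarrow> bool" where
  "is_cokernel A f c \<longleftrightarrow> f \<in> Ar A \<and> c \<in> Ar A \<and> Dom A c = Cod A f
     \<and> c \<cdot>\<^bsub>A\<^esub> f = hzero A (Dom A f) (Cod A c)
     \<and> (\<forall>W \<in> Ob A. \<forall>g \<in> hom A (Cod A f) W. g \<cdot>\<^bsub>A\<^esub> f = hzero A (Dom A f) W
          \<longrightarrow> (\<exists>!h. h \<in> hom A (Cod A c) W \<and> h \<cdot>\<^bsub>A\<^esub> c = g))"

text \<open>\<open>z\<close> is the inclusion of the cycles of degree \<open>n\<close> and \<open>\<pi>\<close> is the projection from the cycles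
  onto the homology, namely the cokernel of the map \<open>b\<close> into the cycles induced by the
  differential.\<close>

definition homology_data ::
  "('o, 'a, 'm) asmcat_scheme \<Rightarrow> ('o, 'a) chain \<Rightarrow> int \<Rightarrow> 'a \<Rightarrow> 'a \<Rightarrow> bool" where
  "homology_data A X n z \<pi> \<longleftrightarrow> is_kernel A (diff X n) z
     \<and> (\<exists>b \<in> hom A (deg X (n + 1)) (Dom A z). z \<cdot>\<^bsub>A\<^esub> b = diff X (n + 1) \<and> is_cokernel A b \<pi>)"

text \<open>The category need not have kernels, so being a quasi-isomorphism includes the requirement
  that the homology of both complexes exists in every degree.\<close>

definition quasi_iso :: "('o, 'a, 'm) asmcat_scheme \<Rightarrow> ('o, 'a) chmap \<Rightarrow> bool" where
  "quasi_iso A f \<longleftrightarrow> f \<in> Ar (Ch A) \<and> (\<forall>n. \<exists>z \<pi> z' \<pi>' c h.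
     homology_data A (src f) n z \<pi> \<and> homology_data A (tgt f) n z' \<pi>'
   \<and> c \<in> hom A (Dom A z) (Dom A z') \<and> z' \<cdot>\<^bsub>A\<^esub> c = at f n \<cdot>\<^bsub>A\<^esub> z
   \<and> h \<in> hom A (Cod A \<pi>) (Cod A \<pi>') \<and> h \<cdot>\<^bsub>A\<^esub> \<pi> = \<pi>' \<cdot>\<^bsub>A\<^esub> c \<and> iso A h)"


section \<open>Operads\<close>

text \<open>Symmetric unital operads in a symmetric monoidal category, given by partial compositions
  \<open>pcomp P m n i : P(m) \<otimes> P(n) \<rightarrow> P(m + n - 1)\<close> for \<open>i < m\<close> (inputs are numbered from \<open>0\<close>) and a
  right action of the symmetric groups, \<open>act P n \<sigma>\<close> being the action of the permutation \<open>\<sigma>\<close>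
  of \<open>{..<n}\<close>.\<close>

record ('o, 'a) operad =
  arity :: "nat \<Rightarrow> 'o"
  act :: "nat \<Rightarrow> (nat \<Rightarrow> nat) \<Rightarrow> 'a"
  pcomp :: "nat \<Rightarrow> nat \<Rightarrow> nat \<Rightarrow> 'a"
  opunit :: "'a"

text \<open>The permutation \<open>\<sigma> \<circ>\<^sub>i \<tau>\<close> of \<open>{..<m + n - 1}\<close> with
  \<open>(\<mu> \<cdot> \<sigma>) \<circ>\<^sub>i (\<nu> \<cdot> \<tau>) = (\<mu> \<circ>\<^sub>j \<nu>) \<cdot> (\<sigma> \<circ>\<^sub>i \<tau>)\<close>, where \<open>j = \<sigma> i\<close>.\<close>

definition perm_pcomp ::
  "nat \<Rightarrow> nat \<Rightarrow> nat \<Rightarrow> (nat \<Rightarrow> nat) \<Rightarrow> (nat \<Rightarrow> nat) \<Rightarrow> nat \<Rightarrow> nat" where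
  "perm_pcomp m n i \<sigma> \<tau> k =
    (let shift = (\<lambda>q. if q < \<sigma> i then q else q + n - 1) in
     if k \<ge> m + n - 1 then k
     else if k < i then shift (\<sigma> k)
     else if k < i + n then \<sigma> i + \<tau> (k - i)
     else shift (\<sigma> (k + 1 - n)))"

locale operad =
  fixes M :: "('o, 'a, 'm) smcat_scheme" (structure)
    and P :: "('o, 'a) operad"
  assumes arity_Ob: "arity P n \<in> Ob M"
    and act_hom: "\<sigma> permutes {..<n} \<Longrightarrow> act P n \<sigma> \<in> hom M (arity P n) (arity P n)"
    and act_id: "act P n id = Id M (arity P n)"
    and act_comp: "\<sigma> permutes {..<n} \<Longrightarrow> \<tau> permutes {..<n}
      \<Longrightarrow> act P n (\<sigma> \<circ> \<tau>) = act P n \<tau> \<cdot> act P n \<sigma>"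
    and pcomp_hom: "i < m \<Longrightarrow> pcomp P m n i \<in> hom M (arity P m \<otimes> arity P n) (arity P (m + n - 1))"
    and opunit_hom: "opunit P \<in> hom M (unit M) (arity P 1)"
    and pcomp_equivariant: "i < m \<Longrightarrow> \<sigma> permutes {..<m} \<Longrightarrow> \<tau> permutes {..<n}
      \<Longrightarrow> pcomp P m n i \<cdot> (act P m \<sigma> \<boxtimes> act P n \<tau>)
        = act P (m + n - 1) (perm_pcomp m n i \<sigma> \<tau>) \<cdot> pcomp P m n (\<sigma> i)"
    and pcomp_unit_left:
      "pcomp P 1 n 0 \<cdot> (opunit P \<boxtimes> Id M (arity P n)) = lunit M (arity P n)"
    and pcomp_unit_right: "i < m
      \<Longrightarrow> pcomp P m 1 i \<cdot> (Id M (arity P m) \<boxtimes> opunit P) = runit M (arity P m)"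
    and pcomp_sequential: "i < l \<Longrightarrow> j < m
      \<Longrightarrow> pcomp P (l + m - 1) n (i + j) \<cdot> (pcomp P l m i \<boxtimes> Id M (arity P n))
        = pcomp P l (m + n - 1) i \<cdot> (Id M (arity P l) \<boxtimes> pcomp P m n j)
            \<cdot> assoc M (arity P l) (arity P m) (arity P n)"
    and pcomp_parallel: "i < k \<Longrightarrow> k < l
      \<Longrightarrow> pcomp P (l + m - 1) n (k + m - 1) \<cdot> (pcomp P l m i \<boxtimes> Id M (arity P n))
        = pcomp P (l + n - 1) m i \<cdot> (pcomp P l n k \<boxtimes> Id M (arity P m))
            \<cdot> inv_ar M (assoc M (arity P l) (arity P n) (arity P m))
            \<cdot> (Id M (arity P l) \<boxtimes> braid M (arity P m) (arity P n))
            \<cdot> assoc M (arity P l) (arity P m) (arity P n)"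

definition operad_hom ::
  "('o, 'a, 'm) smcat_scheme \<Rightarrow> ('o, 'a) operad \<Rightarrow> ('o, 'a) operad \<Rightarrow> (nat \<Rightarrow> 'a) \<Rightarrow> bool" where
  "operad_hom M P Q f \<longleftrightarrow>
     (\<forall>n. f n \<in> hom M (arity P n) (arity Q n))
   \<and> (\<forall>n \<sigma>. \<sigma> permutes {..<n} \<longrightarrow> f n \<cdot>\<^bsub>M\<^esub> act P n \<sigma> = act Q n \<sigma> \<cdot>\<^bsub>M\<^esub> f n)
   \<and> (\<forall>m n i. i < m \<longrightarrow>
        f (m + n - 1) \<cdot>\<^bsub>M\<^esub> pcomp P m n i = pcomp Q m n i \<cdot>\<^bsub>M\<^esub> (f m \<boxtimes>\<^bsub>M\<^esub> f n))
   \<and> f 1 \<cdot>\<^bsub>M\<^esub> opunit P = opunit Q"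

definition unit_operad :: "('o, 'a, 'm) smcat_scheme \<Rightarrow> ('o, 'a) operad" where
  "unit_operad M = (let I = (\<lambda>n. if n = 1 then unit M else zero_ob M) in \<lparr>
     arity = I,
     act = (\<lambda>n \<sigma>. Id M (I n)),
     pcomp = (\<lambda>m n i. if m = 1 \<and> n = 1 then lunit M (unit M)
                      else zero_ar M (I m \<otimes>\<^bsub>M\<^esub> I n) (I (m + n - 1))),
     opunit = Id M (unit M)\<rparr>)"

definition unit_operad_hom :: "('o, 'a, 'm) smcat_scheme \<Rightarrow> ('o, 'a) operad \<Rightarrow> nat \<Rightarrow> 'a" where
  "unit_operad_hom M P = (\<lambda>n. if n = 1 then opunit P else zero_ar M (zero_ob M) (arity P n))"


section \<open>Coendomorphism operads\<close>

fun tpow :: "('o, 'a, 'm) smcat_scheme \<Rightarrow> 'o \<Rightarrow> nat \<Rightarrow> 'o" where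
  "tpow M V 0 = unit M"
| "tpow M V (Suc n) = V \<otimes>\<^bsub>M\<^esub> tpow M V n"

fun tpow_map :: "('o, 'a, 'm) smcat_scheme \<Rightarrow> 'a \<Rightarrow> nat \<Rightarrow> 'a" where
  "tpow_map M f 0 = Id M (unit M)"
| "tpow_map M f (Suc n) = f \<boxtimes>\<^bsub>M\<^esub> tpow_map M f n"

text \<open>\<open>to_front M V k n\<close> is the automorphism of the tensor power \<open>n + 1\<close> of \<open>V\<close> that moves the
  factor in position \<open>k \<le> n\<close> to position \<open>0\<close> and keeps the order of the others.\<close>

fun to_front :: "('o, 'a, 'm) smcat_scheme \<Rightarrow> 'o \<Rightarrow> nat \<Rightarrow> nat \<Rightarrow> 'a" where
  "to_front M V 0 n = Id M (tpow M V (Suc n))"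
| "to_front M V (Suc k) n =
     (let W = tpow M V (n - 1) in
      assoc M V V W \<cdot>\<^bsub>M\<^esub> (braid M V V \<boxtimes>\<^bsub>M\<^esub> Id M W) \<cdot>\<^bsub>M\<^esub> inv_ar M (assoc M V V W)
        \<cdot>\<^bsub>M\<^esub> (Id M V \<boxtimes>\<^bsub>M\<^esub> to_front M V k (n - 1)))"

text \<open>In terms of elements, \<open>tperm M V n \<sigma>\<close> sends \<open>v\<^sub>0 \<otimes> \<dots> \<otimes> v\<^sub>n\<^sub>-\<^sub>1\<close> to the tensor with
  \<open>v (\<sigma> j)\<close> in position \<open>j\<close>, up to Koszul sign; this is a right action.\<close>

fun tperm :: "('o, 'a, 'm) smcat_scheme \<Rightarrow> 'o \<Rightarrow> nat \<Rightarrow> (nat \<Rightarrow> nat) \<Rightarrow> 'a" where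
  "tperm M V 0 \<sigma> = Id M (unit M)"
| "tperm M V (Suc n) \<sigma> =
     (Id M V \<boxtimes>\<^bsub>M\<^esub> tperm M V n (\<lambda>j. let q = \<sigma> (Suc j) in if q < \<sigma> 0 then q else q - 1))
       \<cdot>\<^bsub>M\<^esub> to_front M V (\<sigma> 0) n"

fun tconcat :: "('o, 'a, 'm) smcat_scheme \<Rightarrow> 'o \<Rightarrow> nat \<Rightarrow> nat \<Rightarrow> 'a" where
  "tconcat M V 0 b = lunit M (tpow M V b)"
| "tconcat M V (Suc a) b =
     (Id M V \<boxtimes>\<^bsub>M\<^esub> tconcat M V a b) \<cdot>\<^bsub>M\<^esub> assoc M V (tpow M V a) (tpow M V b)"

text \<open>For \<open>i < m\<close>, the map from \<open>[V, V\<^sup>n] \<otimes> V\<^sup>m\<close> to the tensor power \<open>m + n - 1\<close> of \<open>V\<close> that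
  evaluates the first argument on the factor in position \<open>i\<close> (powers are tensor powers).\<close>

fun ev_at :: "('o, 'a, 'm) smcat_scheme \<Rightarrow> 'o \<Rightarrow> nat \<Rightarrow> nat \<Rightarrow> nat \<Rightarrow> 'a" where
  "ev_at M V n 0 m =
     (let W = tpow M V (m - 1); E = ihom M V (tpow M V n) in
      tconcat M V n (m - 1) \<cdot>\<^bsub>M\<^esub> (ev M V (tpow M V n) \<boxtimes>\<^bsub>M\<^esub> Id M W) \<cdot>\<^bsub>M\<^esub> inv_ar M (assoc M E V W))"
| "ev_at M V n (Suc i) m =
     (let W = tpow M V (m - 1); E = ihom M V (tpow M V n) in
      (Id M V \<boxtimes>\<^bsub>M\<^esub> ev_at M V n i (m - 1)) \<cdot>\<^bsub>M\<^esub> assoc M V E W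
        \<cdot>\<^bsub>M\<^esub> (braid M E V \<boxtimes>\<^bsub>M\<^esub> Id M W) \<cdot>\<^bsub>M\<^esub> inv_ar M (assoc M E V W))"

definition Coend :: "('o, 'a, 'm) smcat_scheme \<Rightarrow> 'o \<Rightarrow> ('o, 'a) operad" where
  "Coend M V = (let T = tpow M V; E = (\<lambda>n. ihom M V (T n)) in \<lparr>
     arity = E,
     act = (\<lambda>n \<sigma>. curry_ar M (E n) V (T n) (tperm M V n \<sigma> \<cdot>\<^bsub>M\<^esub> ev M V (T n))),
     pcomp = (\<lambda>m n i. curry_ar M (E m \<otimes>\<^bsub>M\<^esub> E n) V (T (m + n - 1))
       (ev_at M V n i m \<cdot>\<^bsub>M\<^esub> (Id M (E n) \<boxtimes>\<^bsub>M\<^esub> ev M V (T m)) \<cdot>\<^bsub>M\<^esub> assoc M (E n) (E m) V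
          \<cdot>\<^bsub>M\<^esub> (braid M (E m) (E n) \<boxtimes>\<^bsub>M\<^esub> Id M V))),
     opunit = curry_ar M (unit M) V (T 1) (inv_ar M (runit M V) \<cdot>\<^bsub>M\<^esub> lunit M V)\<rparr>)"


section \<open>Coalgebras over operads\<close>

record ('o, 'a) coalg =
  carr :: "'o"
  coact :: "nat \<Rightarrow> 'a"

record ('o, 'a) coalg_map =
  csrc :: "('o, 'a) coalg"
  ctgt :: "('o, 'a) coalg"
  cmap :: "'a"

definition is_coalg ::
  "('o, 'a, 'm) smcat_scheme \<Rightarrow> ('o, 'a) operad \<Rightarrow> ('o, 'a) coalg \<Rightarrow> bool" where
  "is_coalg M P V \<longleftrightarrow> carr V \<in> Ob M \<and> operad_hom M P (Coend M (carr V)) (coact V)"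

definition cooperation :: "('o, 'a, 'm) smcat_scheme \<Rightarrow> ('o, 'a) coalg \<Rightarrow> nat \<Rightarrow> 'a" where
  "cooperation M V n =
     ev M (carr V) (tpow M (carr V) n) \<cdot>\<^bsub>M\<^esub> (coact V n \<boxtimes>\<^bsub>M\<^esub> Id M (carr V))"

definition is_coalg_map ::
  "('o, 'a, 'm) smcat_scheme \<Rightarrow> ('o, 'a) operad \<Rightarrow> ('o, 'a) coalg_map \<Rightarrow> bool" where
  "is_coalg_map M P h \<longleftrightarrow> is_coalg M P (csrc h) \<and> is_coalg M P (ctgt h)
     \<and> cmap h \<in> hom M (carr (csrc h)) (carr (ctgt h))
     \<and> (\<forall>n. tpow_map M (cmap h) n \<cdot>\<^bsub>M\<^esub> cooperation M (csrc h) n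
            = cooperation M (ctgt h) n \<cdot>\<^bsub>M\<^esub> (Id M (arity P n) \<boxtimes>\<^bsub>M\<^esub> cmap h))"

definition Coalg ::
  "('o, 'a, 'm) smcat_scheme \<Rightarrow> ('o, 'a) operad \<Rightarrow> (('o, 'a) coalg, ('o, 'a) coalg_map) cat" where
  "Coalg M P = \<lparr>
     Ob = {V. is_coalg M P V},
     Ar = {h. is_coalg_map M P h},
     Dom = csrc,
     Cod = ctgt,
     Id = (\<lambda>V. \<lparr>csrc = V, ctgt = V, cmap = Id M (carr V)\<rparr>),
     Comp = (\<lambda>g f. \<lparr>csrc = csrc f, ctgt = ctgt g, cmap = cmap g \<cdot>\<^bsub>M\<^esub> cmap f\<rparr>)\<rparr>"

definition restrict_coalg ::
  "('o, 'a, 'm) smcat_scheme \<Rightarrow> (nat \<Rightarrow> 'a) \<Rightarrow> ('o, 'a) coalg \<Rightarrow> ('o, 'a) coalg" where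
  "restrict_coalg M f V = \<lparr>carr = carr V, coact = (\<lambda>n. coact V n \<cdot>\<^bsub>M\<^esub> f n)\<rparr>"

text \<open>For a morphism \<open>f\<close> from \<open>P\<close> to \<open>P'\<close>, a functor from \<open>P'\<close>-coalgebras to \<open>P\<close>-coalgebras.\<close>

definition Restrict ::
  "('o, 'a, 'm) smcat_scheme \<Rightarrow> (nat \<Rightarrow> 'a)
    \<Rightarrow> (('o, 'a) coalg, ('o, 'a) coalg_map, ('o, 'a) coalg, ('o, 'a) coalg_map) ftor" where
  "Restrict M f = \<lparr>fob = restrict_coalg M f,
     far = (\<lambda>h. \<lparr>csrc = restrict_coalg M f (csrc h), ctgt = restrict_coalg M f (ctgt h),
                 cmap = cmap h\<rparr>)\<rparr>"

definition Forget :: "(('o, 'a) coalg, ('o, 'a) coalg_map, 'o, 'a) ftor" where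
  "Forget = \<lparr>fob = carr, far = cmap\<rparr>"

definition Cofree ::
  "('o, 'a, 'm) smcat_scheme \<Rightarrow> ('o, 'a) operad
    \<Rightarrow> ('o, 'a, ('o, 'a) coalg, ('o, 'a) coalg_map) ftor" where
  "Cofree M P = (SOME G. right_adjoint (Coalg M P) M Forget G)"

definition sane :: "('o, 'a, 'm) smcat_scheme \<Rightarrow> ('o, 'a) operad \<Rightarrow> bool" where
  "sane M P \<longleftrightarrow> faithful M (Coalg M P) (Cofree M P)"


section \<open>dg-operads\<close>

type_synonym ('o, 'a) dg_operad = "(('o, 'a) chain, ('o, 'a) chmap) operad"

definition cofibrant :: "('o, 'a, 'm) asmcat_scheme \<Rightarrow> ('o, 'a) dg_operad \<Rightarrow> bool" where
  "cofibrant A P \<longleftrightarrow> (\<forall>Q R p f.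
     operad (Ch A) Q \<and> operad (Ch A) R \<and> operad_hom (Ch A) Q R p
     \<and> (\<forall>n k. epi A (at (p n) k)) \<and> (\<forall>n. quasi_iso A (p n))
     \<and> operad_hom (Ch A) P R f
     \<longrightarrow> (\<exists>g. operad_hom (Ch A) P Q g \<and> (\<forall>n. p n \<cdot>\<^bsub>Ch A\<^esub> g n = f n)))"

end

(* Let P map to an operad Q for which K = Q(0) is dualisable, with dual D. For a complex X, the complex
   H = [Q(1), X] is a Q(1)-module, and V = D + H is a Q-coalgebra: an operation acts on v by filling its
   inputs with the dual basis sum d_s (x) k_s, recording d_s in the position of the filled input. Either
   all inputs are filled, which leaves an element of K to be paired with v, or all but one, which leaves
   an element of Q(1) that acts on v.

   If the unit of Q(1) splits in degree 0, then evaluation at the unit H -> X is epi: maps from a disk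
   into H are families of maps out of the Q(1)_q, and these reach every degree of X. Restricting V to P
   gives an epimorphism onto X from a P-coalgebra. It factors through the counit of Cofree, which is
   therefore epi.

   Cases (1) and (3) take for Q the unit operad and P itself. In case (2) let Q be concentrated in arity
   one, with Q(1) the contractible algebra spanned by 1 and h, d h = 1, h^2 = 0. The morphism from Q to
   the zero operad is an epimorphic quasi-isomorphism, so the zero morphism of P lifts to Q. *)
theory Submission
  imports Defs "HOL-Library.Nat_Bijection"
begin

text \<open>The coalgebra V has a dual origin. In the free Q-algebra on Y the words of length at
  least two form an ideal, and the quotient by it is Q(0) + Q(1) (x) Y. If Y is the dual of X, the
  dual of this quotient is D + [Q(1), X]. Its structure maps make sense for every X, and only Q(0)
  has to be dualisable, because its dual basis records the filled inputs.

  The summand D cannot be dropped: an operation with all inputs but one filled by constants must act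
  as its unary composite, so the cooperations need factors on which constants take nonzero values.
  Truncating at one open input keeps the axioms consistent, since unary operations vanish on D and
  constants vanish on H, and these two facts remove all mixed terms.

  The coalgebra is built in an arbitrary additive closed symmetric monoidal category, so all Koszul
  signs stay hidden in the braiding until that category becomes \<open>Ch A\<close>.

  The unit has to split only in degree 0, as a map in A and not as a map of complexes. This is what
  admits the contractible algebra of case (2). The unit operad would not serve there: it is not
  acyclic, so its map to the zero operad offers no lifting.\<close>

section \<open>Symmetric monoidal categories\<close>

text \<open>In \<open>Ch A\<close> sources and targets are fields of the morphisms and are computed correctly even for
  ill-formed composites. Recording this makes typing conditions provable by plain rewriting.\<close>

locale typed_smc = symmetric_monoidal M
  for M :: "('o, 'a, 'm) smcat_scheme" (structure) +
  assumes Dom_Comp [simp]: "Dom M (g \<cdot> f) = Dom M f"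
    and Cod_Comp [simp]: "Cod M (g \<cdot> f) = Cod M g"
    and Dom_Id [simp]: "Dom M (Id M X) = X"
    and Cod_Id [simp]: "Cod M (Id M X) = X"
    and Dom_tens [simp]: "Dom M (f \<boxtimes> g) = Dom M f \<otimes> Dom M g"
    and Cod_tens [simp]: "Cod M (f \<boxtimes> g) = Cod M f \<otimes> Cod M g"
    and Dom_assoc [simp]: "Dom M (assoc M X Y Z) = (X \<otimes> Y) \<otimes> Z"
    and Cod_assoc [simp]: "Cod M (assoc M X Y Z) = X \<otimes> (Y \<otimes> Z)"
    and Dom_lunit [simp]: "Dom M (lunit M X) = unit M \<otimes> X"
    and Cod_lunit [simp]: "Cod M (lunit M X) = X"
    and Dom_runit [simp]: "Dom M (runit M X) = X \<otimes> unit M"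
    and Cod_runit [simp]: "Cod M (runit M X) = X"
    and Dom_braid [simp]: "Dom M (braid M X Y) = X \<otimes> Y"
    and Cod_braid [simp]: "Cod M (braid M X Y) = Y \<otimes> X"
begin

lemma hom_iff: "f \<in> hom M X Y \<longleftrightarrow> f \<in> Ar M \<and> Dom M f = X \<and> Cod M f = Y"
  by (auto simp: hom_def)

lemma Ar_hom: "f \<in> Ar M \<Longrightarrow> f \<in> hom M (Dom M f) (Cod M f)"
  by (simp add: hom_iff)

declare Dom_Ob [simp] Cod_Ob [simp] unit_Ob [simp] tens_Ob [simp]

lemma Ar_Comp [simp]: "f \<in> Ar M \<Longrightarrow> g \<in> Ar M \<Longrightarrow> Dom M g = Cod M f \<Longrightarrow> g \<cdot> f \<in> Ar M"
  using Comp_hom[of f _ _ g] by (auto simp: hom_iff)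

lemma Ar_Id [simp]: "X \<in> Ob M \<Longrightarrow> Id M X \<in> Ar M"
  using Id_hom by (auto simp: hom_iff)

lemma Ar_tens [simp]: "f \<in> Ar M \<Longrightarrow> g \<in> Ar M \<Longrightarrow> f \<boxtimes> g \<in> Ar M"
  using tens_hom[of f _ _ g] by (auto simp: hom_iff)

lemma Ar_assoc [simp]:
  "X \<in> Ob M \<Longrightarrow> Y \<in> Ob M \<Longrightarrow> Z \<in> Ob M \<Longrightarrow> assoc M X Y Z \<in> Ar M"
  using assoc_hom by (auto simp: hom_iff)

lemma Ar_lunit [simp]: "X \<in> Ob M \<Longrightarrow> lunit M X \<in> Ar M"
  using lunit_hom by (auto simp: hom_iff)

lemma Ar_runit [simp]: "X \<in> Ob M \<Longrightarrow> runit M X \<in> Ar M"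
  using runit_hom by (auto simp: hom_iff)

lemma Ar_braid [simp]: "X \<in> Ob M \<Longrightarrow> Y \<in> Ob M \<Longrightarrow> braid M X Y \<in> Ar M"
  using braid_hom by (auto simp: hom_iff)

lemma Comp_Id_left [simp]: "f \<in> Ar M \<Longrightarrow> Cod M f = Y \<Longrightarrow> Id M Y \<cdot> f = f"
  using Id_left[of f] by (auto simp: hom_iff)

lemma Comp_Id_right [simp]: "f \<in> Ar M \<Longrightarrow> Dom M f = X \<Longrightarrow> f \<cdot> Id M X = f"
  using Id_right[of f] by (auto simp: hom_iff)

lemma assoc_Comp [simp]:
  "f \<in> Ar M \<Longrightarrow> g \<in> Ar M \<Longrightarrow> h \<in> Ar M \<Longrightarrow> Dom M g = Cod M f \<Longrightarrow> Dom M h = Cod M g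
    \<Longrightarrow> (h \<cdot> g) \<cdot> f = h \<cdot> g \<cdot> f"
  using Comp_assoc[of f _ _ g _ h] by (auto simp: hom_iff)

lemma tens_Id_Id [simp]: "X \<in> Ob M \<Longrightarrow> Y \<in> Ob M \<Longrightarrow> Id M X \<boxtimes> Id M Y = Id M (X \<otimes> Y)"
  by (rule tens_Id)

lemma tens_Comp_tens:
  "f \<in> Ar M \<Longrightarrow> f' \<in> Ar M \<Longrightarrow> Dom M f' = Cod M f \<Longrightarrow> g \<in> Ar M \<Longrightarrow> g' \<in> Ar M
    \<Longrightarrow> Dom M g' = Cod M g \<Longrightarrow> (f' \<boxtimes> g') \<cdot> (f \<boxtimes> g) = (f' \<cdot> f) \<boxtimes> (g' \<cdot> g)"
  using tens_Comp[of f _ _ f' _ g _ _ g'] by (auto simp: hom_iff)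

text \<open>The form of an equation of composites that rewrites inside a right-nested composite.\<close>

lemma pre:
  assumes "g \<cdot> f = g' \<cdot> f'" "f \<in> Ar M" "g \<in> Ar M" "Dom M g = Cod M f"
    "f' \<in> Ar M" "g' \<in> Ar M" "Dom M g' = Cod M f'" "h \<in> Ar M" "Cod M h = Dom M f"
  shows "g \<cdot> f \<cdot> h = g' \<cdot> f' \<cdot> h"
proof -
  have "Dom M f' = Dom M f"
    using assms(1) by (metis Dom_Comp)
  then show ?thesis
    using assms assoc_Comp[of h f g] assoc_Comp[of h f' g'] by simp
qed

lemma pre1:
  assumes "g \<cdot> f = k" "f \<in> Ar M" "g \<in> Ar M" "Dom M g = Cod M f" "h \<in> Ar M" "Cod M h = Dom M f"
  shows "g \<cdot> f \<cdot> h = k \<cdot> h"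
  using assms assoc_Comp[of h f g] by simp

abbreviation wh :: "'o \<Rightarrow> 'a \<Rightarrow> 'a" (infixr "\<rhd>" 76) where
  "X \<rhd> f \<equiv> Id M X \<boxtimes> f"

lemma wh_Comp:
  "X \<in> Ob M \<Longrightarrow> f \<in> Ar M \<Longrightarrow> g \<in> Ar M \<Longrightarrow> Dom M g = Cod M f \<Longrightarrow> X \<rhd> (g \<cdot> f) = X \<rhd> g \<cdot> X \<rhd> f"
  by (subst tens_Comp_tens) auto

lemma Comp_wh:
  "f \<in> Ar M \<Longrightarrow> g \<in> Ar M \<Longrightarrow> W \<in> Ob M \<Longrightarrow> Dom M g = Cod M f
    \<Longrightarrow> (g \<cdot> f) \<boxtimes> Id M W = (g \<boxtimes> Id M W) \<cdot> (f \<boxtimes> Id M W)"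
  by (subst tens_Comp_tens) auto

lemma tens_swap:
  "f \<in> Ar M \<Longrightarrow> g \<in> Ar M \<Longrightarrow> Dom M f = X \<Longrightarrow> Cod M f = X' \<Longrightarrow> Dom M g = Y \<Longrightarrow> Cod M g = Y'
    \<Longrightarrow> (f \<boxtimes> Id M Y') \<cdot> X \<rhd> g = X' \<rhd> g \<cdot> (f \<boxtimes> Id M Y)"
  by (auto simp: tens_Comp_tens)

lemma inverse_ofD:
  "inverse_of M f g \<Longrightarrow> g \<in> Ar M \<and> Dom M g = Cod M f \<and> Cod M g = Dom M f
     \<and> g \<cdot> f = Id M (Dom M f) \<and> f \<cdot> g = Id M (Cod M f)"
  by (auto simp: inverse_of_def hom_iff)

lemma inverse_of_unique:
  assumes "inverse_of M f g" "inverse_of M f h" shows "g = h"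
proof -
  have f: "f \<in> Ar M" using assms(1) by (simp add: inverse_of_def)
  have "g = g \<cdot> f \<cdot> h"
    using f inverse_ofD[OF assms(1)] inverse_ofD[OF assms(2)] by simp
  also have "\<dots> = (g \<cdot> f) \<cdot> h"
    using f inverse_ofD[OF assms(1)] inverse_ofD[OF assms(2)] by (intro assoc_Comp[symmetric]) auto
  finally show ?thesis
    using inverse_ofD[OF assms(1)] inverse_ofD[OF assms(2)] by simp
qed

lemma inv_ar_eq: "inverse_of M f g \<Longrightarrow> inv_ar M f = g"
  unfolding inv_ar_def using inverse_of_unique by blast

lemma inverse_of_inv_ar: "iso M f \<Longrightarrow> inverse_of M f (inv_ar M f)"
  using inv_ar_eq unfolding iso_def by metis

lemma Ar_inv_ar: "iso M f \<Longrightarrow> inv_ar M f \<in> Ar M"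
  and Dom_inv_ar: "iso M f \<Longrightarrow> Dom M (inv_ar M f) = Cod M f"
  and Cod_inv_ar: "iso M f \<Longrightarrow> Cod M (inv_ar M f) = Dom M f"
  and inv_ar_left: "iso M f \<Longrightarrow> inv_ar M f \<cdot> f = Id M (Dom M f)"
  and inv_ar_right: "iso M f \<Longrightarrow> f \<cdot> inv_ar M f = Id M (Cod M f)"
  using inverse_ofD[OF inverse_of_inv_ar] by auto

abbreviation ai :: "'o \<Rightarrow> 'o \<Rightarrow> 'o \<Rightarrow> 'a" where "ai X Y Z \<equiv> inv_ar M (assoc M X Y Z)"
abbreviation li :: "'o \<Rightarrow> 'a" where "li X \<equiv> inv_ar M (lunit M X)"
abbreviation ri :: "'o \<Rightarrow> 'a" where "ri X \<equiv> inv_ar M (runit M X)"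

lemma
  assumes "X \<in> Ob M" "Y \<in> Ob M" "Z \<in> Ob M"
  shows Ar_ai [simp]: "ai X Y Z \<in> Ar M"
    and Dom_ai [simp]: "Dom M (ai X Y Z) = X \<otimes> (Y \<otimes> Z)"
    and Cod_ai [simp]: "Cod M (ai X Y Z) = (X \<otimes> Y) \<otimes> Z"
    and ai_assoc [simp]: "ai X Y Z \<cdot> assoc M X Y Z = Id M ((X \<otimes> Y) \<otimes> Z)"
    and assoc_ai [simp]: "assoc M X Y Z \<cdot> ai X Y Z = Id M (X \<otimes> (Y \<otimes> Z))"
  using assms assoc_iso[of X Y Z]
  by (auto simp: Ar_inv_ar Dom_inv_ar Cod_inv_ar inv_ar_left inv_ar_right)

lemma
  assumes "X \<in> Ob M"
  shows Ar_li [simp]: "li X \<in> Ar M"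
    and Dom_li [simp]: "Dom M (li X) = X"
    and Cod_li [simp]: "Cod M (li X) = unit M \<otimes> X"
    and li_lunit [simp]: "li X \<cdot> lunit M X = Id M (unit M \<otimes> X)"
    and lunit_li [simp]: "lunit M X \<cdot> li X = Id M X"
  using assms lunit_iso[of X]
  by (auto simp: Ar_inv_ar Dom_inv_ar Cod_inv_ar inv_ar_left inv_ar_right)

lemma
  assumes "X \<in> Ob M"
  shows Ar_ri [simp]: "ri X \<in> Ar M"
    and Dom_ri [simp]: "Dom M (ri X) = X"
    and Cod_ri [simp]: "Cod M (ri X) = X \<otimes> unit M"
    and ri_runit [simp]: "ri X \<cdot> runit M X = Id M (X \<otimes> unit M)"
    and runit_ri [simp]: "runit M X \<cdot> ri X = Id M X"
  using assms runit_iso[of X]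
  by (auto simp: Ar_inv_ar Dom_inv_ar Cod_inv_ar inv_ar_left inv_ar_right)

lemma ai_assoc' [simp]:
  "X \<in> Ob M \<Longrightarrow> Y \<in> Ob M \<Longrightarrow> Z \<in> Ob M \<Longrightarrow> h \<in> Ar M \<Longrightarrow> Cod M h = (X \<otimes> Y) \<otimes> Z
    \<Longrightarrow> ai X Y Z \<cdot> assoc M X Y Z \<cdot> h = h"
  by (subst pre1[OF ai_assoc]) auto

lemma assoc_ai' [simp]:
  "X \<in> Ob M \<Longrightarrow> Y \<in> Ob M \<Longrightarrow> Z \<in> Ob M \<Longrightarrow> h \<in> Ar M \<Longrightarrow> Cod M h = X \<otimes> (Y \<otimes> Z)
    \<Longrightarrow> assoc M X Y Z \<cdot> ai X Y Z \<cdot> h = h"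
  by (subst pre1[OF assoc_ai]) auto

lemma lunit_li' [simp]:
  "X \<in> Ob M \<Longrightarrow> h \<in> Ar M \<Longrightarrow> Cod M h = X \<Longrightarrow> lunit M X \<cdot> li X \<cdot> h = h"
  by (subst pre1[OF lunit_li]) auto

lemma li_lunit' [simp]:
  "X \<in> Ob M \<Longrightarrow> h \<in> Ar M \<Longrightarrow> Cod M h = unit M \<otimes> X \<Longrightarrow> li X \<cdot> lunit M X \<cdot> h = h"
  by (subst pre1[OF li_lunit]) auto

lemma runit_ri' [simp]:
  "X \<in> Ob M \<Longrightarrow> h \<in> Ar M \<Longrightarrow> Cod M h = X \<Longrightarrow> runit M X \<cdot> ri X \<cdot> h = h"
  by (subst pre1[OF runit_ri]) auto

lemma ri_runit' [simp]:
  "X \<in> Ob M \<Longrightarrow> h \<in> Ar M \<Longrightarrow> Cod M h = X \<otimes> unit M \<Longrightarrow> ri X \<cdot> runit M X \<cdot> h = h"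
  by (subst pre1[OF ri_runit]) auto

lemma assoc_natural:
  "f \<in> Ar M \<Longrightarrow> g \<in> Ar M \<Longrightarrow> h \<in> Ar M
    \<Longrightarrow> Cod M f = X' \<Longrightarrow> Cod M g = Y' \<Longrightarrow> Cod M h = Z'
    \<Longrightarrow> Dom M f = X \<Longrightarrow> Dom M g = Y \<Longrightarrow> Dom M h = Z
    \<Longrightarrow> assoc M X' Y' Z' \<cdot> ((f \<boxtimes> g) \<boxtimes> h) = (f \<boxtimes> (g \<boxtimes> h)) \<cdot> assoc M X Y Z"
  using assoc_nat[of f X X' g Y Y' h Z Z'] by (auto simp: hom_iff)

lemma ai_natural:
  assumes "f \<in> Ar M" "g \<in> Ar M" "h \<in> Ar M" "Cod M f = X'" "Cod M g = Y'" "Cod M h = Z'"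
    "Dom M f = X" "Dom M g = Y" "Dom M h = Z"
  shows "ai X' Y' Z' \<cdot> (f \<boxtimes> (g \<boxtimes> h)) = ((f \<boxtimes> g) \<boxtimes> h) \<cdot> ai X Y Z"
proof -
  have [simp]: "X \<in> Ob M" "Y \<in> Ob M" "Z \<in> Ob M" "X' \<in> Ob M" "Y' \<in> Ob M" "Z' \<in> Ob M"
    using assms by auto
  have "ai X' Y' Z' \<cdot> (f \<boxtimes> (g \<boxtimes> h)) = ai X' Y' Z' \<cdot> ((f \<boxtimes> (g \<boxtimes> h)) \<cdot> assoc M X Y Z) \<cdot> ai X Y Z"
    using assms by simp
  also have "\<dots> = ((f \<boxtimes> g) \<boxtimes> h) \<cdot> ai X Y Z"
    using assms by (subst assoc_natural[symmetric, of f g h X' Y' Z']) auto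
  finally show ?thesis .
qed

section \<open>Cancellation and coherence of the units\<close>

lemma cancel_mono:
  assumes "l \<cdot> f = l \<cdot> g" "k \<cdot> l = Id M X" "f \<in> Ar M" "g \<in> Ar M" "l \<in> Ar M" "k \<in> Ar M"
    "Cod M f = X" "Cod M g = X" "Dom M l = X" "Dom M k = Cod M l"
  shows "f = g"
proof -
  have "(k \<cdot> l) \<cdot> f = (k \<cdot> l) \<cdot> g"
    using assms assoc_Comp[of f l k] assoc_Comp[of g l k] by metis
  then show ?thesis
    using assms(2-) by simp
qed

lemma cancel_epi:
  assumes "f \<cdot> l = g \<cdot> l" "l \<cdot> k = Id M X" "f \<in> Ar M" "g \<in> Ar M" "l \<in> Ar M" "k \<in> Ar M"
    "Dom M f = X" "Dom M g = X" "Cod M l = X" "Dom M l = Cod M k"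
  shows "f = g"
proof -
  have "f \<cdot> l \<cdot> k = g \<cdot> l \<cdot> k"
    using assms assoc_Comp[of k l f] assoc_Comp[of k l g] by metis
  then show ?thesis
    using assms(2-) by simp
qed

text \<open>\<open>lunit\<close> makes tensoring with the unit isomorphic to the identity functor,
  which is faithful. Unit identities may therefore be checked after whiskering with
  \<open>unit M\<close>.\<close>

lemma unit_wh_inject:
  assumes "unit M \<rhd> f = unit M \<rhd> g" "f \<in> Ar M" "g \<in> Ar M" "Dom M f = Dom M g" "Cod M f = Cod M g"
  shows "f = g"
proof -
  have "f \<cdot> lunit M (Dom M f) = g \<cdot> lunit M (Dom M f)"
    using assms lunit_nat[OF Ar_hom[of f]] lunit_nat[OF Ar_hom[of g]] by simp
  then show ?thesis
    by (rule cancel_epi[where k = "li (Dom M f)"]) (use assms in auto)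
qed

lemma triangle': "X \<in> Ob M \<Longrightarrow> Y \<in> Ob M
      \<Longrightarrow> X \<rhd> lunit M Y \<cdot> assoc M X (unit M) Y = runit M X \<boxtimes> Id M Y"
  using triangle by simp

text \<open>Kelly's argument: after whiskering with the unit, and up to invertible associators, the
  pentagon and two instances of the triangle identify both sides.\<close>

lemma lunit_tens:
  assumes [simp]: "X \<in> Ob M" "Y \<in> Ob M"
  shows "lunit M (X \<otimes> Y) \<cdot> assoc M (unit M) X Y = lunit M X \<boxtimes> Id M Y"
proof (rule unit_wh_inject)
  let ?I = "unit M"
  have "(?I \<rhd> (lunit M (X \<otimes> Y) \<cdot> assoc M ?I X Y) \<cdot> assoc M ?I (?I \<otimes> X) Y) \<cdot> (assoc M ?I ?I X \<boxtimes> Id M Y)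
    = ?I \<rhd> lunit M (X \<otimes> Y) \<cdot> assoc M ?I ?I (X \<otimes> Y) \<cdot> assoc M (?I \<otimes> ?I) X Y"
    by (simp add: pentagon wh_Comp)
  also have "\<dots> = (runit M ?I \<boxtimes> Id M (X \<otimes> Y)) \<cdot> assoc M (?I \<otimes> ?I) X Y"
    by (subst pre1[OF triangle']) auto
  also have "\<dots> = assoc M ?I X Y \<cdot> ((runit M ?I \<boxtimes> Id M X) \<boxtimes> Id M Y)"
    by (subst assoc_natural[where X = "?I \<otimes> ?I" and Y = X and Z = Y]) auto
  also have "\<dots> = assoc M ?I X Y \<cdot> ((?I \<rhd> lunit M X) \<boxtimes> Id M Y) \<cdot> (assoc M ?I ?I X \<boxtimes> Id M Y)"
    by (simp add: triangle'[symmetric] Comp_wh)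
  also have "\<dots> = (?I \<rhd> (lunit M X \<boxtimes> Id M Y) \<cdot> assoc M ?I (?I \<otimes> X) Y) \<cdot> (assoc M ?I ?I X \<boxtimes> Id M Y)"
    by (subst pre[OF assoc_natural[of "Id M ?I" "lunit M X" "Id M Y"]]) auto
  finally have "?I \<rhd> (lunit M (X \<otimes> Y) \<cdot> assoc M ?I X Y) \<cdot> assoc M ?I (?I \<otimes> X) Y
     = ?I \<rhd> (lunit M X \<boxtimes> Id M Y) \<cdot> assoc M ?I (?I \<otimes> X) Y"
    by (rule cancel_epi[where k = "ai ?I ?I X \<boxtimes> Id M Y"]) (auto simp: Comp_wh[symmetric])
  then show "?I \<rhd> (lunit M (X \<otimes> Y) \<cdot> assoc M ?I X Y) = ?I \<rhd> (lunit M X \<boxtimes> Id M Y)"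
    by (rule cancel_epi[where k = "ai ?I (?I \<otimes> X) Y"]) auto
qed auto

lemma wh_inverse:
  "g \<cdot> f = Id M Y \<Longrightarrow> X \<in> Ob M \<Longrightarrow> Y \<in> Ob M \<Longrightarrow> f \<in> Ar M \<Longrightarrow> g \<in> Ar M \<Longrightarrow> Dom M g = Cod M f
    \<Longrightarrow> X \<rhd> g \<cdot> X \<rhd> f = Id M (X \<otimes> Y)"
  by (simp add: wh_Comp[symmetric])

lemma wh_inverse':
  "g \<cdot> f = Id M Y \<Longrightarrow> X \<in> Ob M \<Longrightarrow> Y \<in> Ob M \<Longrightarrow> f \<in> Ar M \<Longrightarrow> g \<in> Ar M \<Longrightarrow> Dom M g = Cod M f
    \<Longrightarrow> h \<in> Ar M \<Longrightarrow> Cod M h = X \<otimes> Dom M f \<Longrightarrow> Dom M f = Y \<Longrightarrow> X \<rhd> g \<cdot> X \<rhd> f \<cdot> h = h"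
  by (subst pre1[OF wh_inverse[where Y = Y]]) auto

lemmas wh_inverses [simp] =
  wh_inverse[OF ai_assoc] wh_inverse'[OF ai_assoc] wh_inverse[OF assoc_ai] wh_inverse'[OF assoc_ai]
  wh_inverse[OF li_lunit] wh_inverse'[OF li_lunit] wh_inverse[OF lunit_li] wh_inverse'[OF lunit_li]

lemma hw_inverse:
  "g \<cdot> f = Id M Y \<Longrightarrow> X \<in> Ob M \<Longrightarrow> Y \<in> Ob M \<Longrightarrow> f \<in> Ar M \<Longrightarrow> g \<in> Ar M \<Longrightarrow> Dom M g = Cod M f
    \<Longrightarrow> (g \<boxtimes> Id M X) \<cdot> (f \<boxtimes> Id M X) = Id M (Y \<otimes> X)"
  by (simp add: Comp_wh[symmetric])

lemma hw_inverse':
  "g \<cdot> f = Id M Y \<Longrightarrow> X \<in> Ob M \<Longrightarrow> Y \<in> Ob M \<Longrightarrow> f \<in> Ar M \<Longrightarrow> g \<in> Ar M \<Longrightarrow> Dom M g = Cod M f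
    \<Longrightarrow> h \<in> Ar M \<Longrightarrow> Cod M h = Dom M f \<otimes> X \<Longrightarrow> Dom M f = Y
    \<Longrightarrow> (g \<boxtimes> Id M X) \<cdot> (f \<boxtimes> Id M X) \<cdot> h = h"
  by (subst pre1[OF hw_inverse[where Y = Y]]) auto

lemmas hw_inverses [simp] =
  hw_inverse[OF ai_assoc] hw_inverse'[OF ai_assoc] hw_inverse[OF assoc_ai] hw_inverse'[OF assoc_ai]
  hw_inverse[OF li_lunit] hw_inverse'[OF li_lunit] hw_inverse[OF lunit_li] hw_inverse'[OF lunit_li]
  hw_inverse[OF runit_ri] hw_inverse'[OF runit_ri] hw_inverse[OF ri_runit] hw_inverse'[OF ri_runit]

text \<open>From here on every structure map acts on the first factors of a right-nested product and carries
  an arbitrary tail \<open>W\<close>; in this form the identities between them involve no associators.\<close>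

definition sw :: "'o \<Rightarrow> 'o \<Rightarrow> 'o \<Rightarrow> 'a" where
  "sw X Y W = assoc M Y X W \<cdot> (braid M X Y \<boxtimes> Id M W) \<cdot> ai X Y W"

lemma Ar_sw [simp]: "X \<in> Ob M \<Longrightarrow> Y \<in> Ob M \<Longrightarrow> W \<in> Ob M \<Longrightarrow> sw X Y W \<in> Ar M"
  and Dom_sw [simp]: "X \<in> Ob M \<Longrightarrow> Y \<in> Ob M \<Longrightarrow> W \<in> Ob M \<Longrightarrow> Dom M (sw X Y W) = X \<otimes> (Y \<otimes> W)"
  and Cod_sw [simp]: "Cod M (sw X Y W) = Y \<otimes> (X \<otimes> W)"
  by (auto simp: sw_def)

lemma braid_natural:
  "f \<in> Ar M \<Longrightarrow> g \<in> Ar M \<Longrightarrow> Dom M f = X \<Longrightarrow> Dom M g = Y \<Longrightarrow> Cod M f = X' \<Longrightarrow> Cod M g = Y'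
    \<Longrightarrow> braid M X' Y' \<cdot> (f \<boxtimes> g) = (g \<boxtimes> f) \<cdot> braid M X Y"
  using braid_nat[of f X X' g Y Y'] by (auto simp: hom_iff)

lemma sw_natural:
  assumes f: "f \<in> Ar M" "g \<in> Ar M" "h \<in> Ar M"
    and d: "Dom M f = X" "Dom M g = Y" "Dom M h = W" "Cod M f = X'" "Cod M g = Y'" "Cod M h = W'"
  shows "sw X' Y' W' \<cdot> (f \<boxtimes> (g \<boxtimes> h)) = (g \<boxtimes> (f \<boxtimes> h)) \<cdot> sw X Y W"
proof -
  have [simp]: "X \<in> Ob M" "Y \<in> Ob M" "W \<in> Ob M" "X' \<in> Ob M" "Y' \<in> Ob M" "W' \<in> Ob M"
    using assms by auto
  have "sw X' Y' W' \<cdot> (f \<boxtimes> (g \<boxtimes> h))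
      = assoc M Y' X' W' \<cdot> (braid M X' Y' \<boxtimes> Id M W') \<cdot> ((f \<boxtimes> g) \<boxtimes> h) \<cdot> ai X Y W"
    using assms by (simp add: sw_def ai_natural[of f g h])
  also have "\<dots> = assoc M Y' X' W' \<cdot> ((g \<boxtimes> f) \<boxtimes> h) \<cdot> (braid M X Y \<boxtimes> Id M W) \<cdot> ai X Y W"
    using assms
    by (subst pre[of "braid M X' Y' \<boxtimes> Id M W'" _ "(g \<boxtimes> f) \<boxtimes> h" "braid M X Y \<boxtimes> Id M W"])
      (auto simp: tens_Comp_tens braid_natural[of f g X Y X' Y'])
  also have "\<dots> = (g \<boxtimes> (f \<boxtimes> h)) \<cdot> sw X Y W"
    using assms unfolding sw_def
    by (subst pre[OF assoc_natural[of g f h Y' X' W' Y X W]]) auto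
  finally show ?thesis .
qed

lemma sw_sw [simp]:
  assumes [simp]: "X \<in> Ob M" "Y \<in> Ob M" "W \<in> Ob M"
  shows "sw Y X W \<cdot> sw X Y W = Id M (X \<otimes> (Y \<otimes> W))"
proof -
  have "(braid M Y X \<boxtimes> Id M W) \<cdot> (braid M X Y \<boxtimes> Id M W) \<cdot> ai X Y W = ai X Y W"
    by (subst pre1[of _ _ "Id M ((X \<otimes> Y) \<otimes> W)"]) (auto simp: Comp_wh[symmetric] symmetry)
  then show ?thesis by (simp add: sw_def)
qed

lemma sw_sw' [simp]:
  "X \<in> Ob M \<Longrightarrow> Y \<in> Ob M \<Longrightarrow> W \<in> Ob M \<Longrightarrow> h \<in> Ar M \<Longrightarrow> Cod M h = X \<otimes> (Y \<otimes> W)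
    \<Longrightarrow> sw Y X W \<cdot> sw X Y W \<cdot> h = h"
  by (subst pre1[OF sw_sw]) auto

lemmas wh_sw_sw [simp] = wh_inverse[OF sw_sw] wh_inverse'[OF sw_sw]

text \<open>The hexagon with a tail. The invertible map \<open>?l\<close> turns both sides into the
  same composite \<open>?z\<close>, the left side by the pentagon and the hexagon, the right side by
  the pentagon and naturality.\<close>

lemma sw_tens_right:
  assumes [simp]: "U \<in> Ob M" "X \<in> Ob M" "Y \<in> Ob M" "W \<in> Ob M"
  shows "assoc M X Y (U \<otimes> W) \<cdot> sw U (X \<otimes> Y) W
    = X \<rhd> sw U Y W \<cdot> sw U X (Y \<otimes> W) \<cdot> U \<rhd> assoc M X Y W"
proof -
  let ?l = "assoc M U (X \<otimes> Y) W \<cdot> (assoc M U X Y \<boxtimes> Id M W)"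
  let ?z = "X \<rhd> assoc M Y U W \<cdot> X \<rhd> (braid M U Y \<boxtimes> Id M W) \<cdot> assoc M X (U \<otimes> Y) W
    \<cdot> (assoc M X U Y \<boxtimes> Id M W) \<cdot> ((braid M U X \<boxtimes> Id M Y) \<boxtimes> Id M W)"
  have "(assoc M X Y (U \<otimes> W) \<cdot> sw U (X \<otimes> Y) W) \<cdot> ?l
      = (assoc M X Y (U \<otimes> W) \<cdot> assoc M (X \<otimes> Y) U W)
        \<cdot> (braid M U (X \<otimes> Y) \<boxtimes> Id M W) \<cdot> (assoc M U X Y \<boxtimes> Id M W)"
    by (simp add: sw_def)
  also have "\<dots> = X \<rhd> assoc M Y U W \<cdot> assoc M X (Y \<otimes> U) W \<cdot>
      ((assoc M X Y U \<cdot> braid M U (X \<otimes> Y) \<cdot> assoc M U X Y) \<boxtimes> Id M W)"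
    by (simp add: pentagon Comp_wh)
  also have "\<dots> = X \<rhd> assoc M Y U W \<cdot> (assoc M X (Y \<otimes> U) W \<cdot> ((X \<rhd> braid M U Y) \<boxtimes> Id M W))
      \<cdot> (assoc M X U Y \<boxtimes> Id M W) \<cdot> ((braid M U X \<boxtimes> Id M Y) \<boxtimes> Id M W)"
    by (subst hexagon) (auto simp: Comp_wh)
  also have "\<dots> = ?z"
    by (subst assoc_natural[where X = X and Y = "U \<otimes> Y" and Z = W]) auto
  finally have 1: "(assoc M X Y (U \<otimes> W) \<cdot> sw U (X \<otimes> Y) W) \<cdot> ?l = ?z" .
  have "(X \<rhd> sw U Y W \<cdot> sw U X (Y \<otimes> W) \<cdot> U \<rhd> assoc M X Y W) \<cdot> ?l
      = X \<rhd> sw U Y W \<cdot> sw U X (Y \<otimes> W) \<cdot> (U \<rhd> assoc M X Y W \<cdot> assoc M U (X \<otimes> Y) W \<cdot> (assoc M U X Y \<boxtimes> Id M W))"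
    by simp
  also have "\<dots> = X \<rhd> sw U Y W \<cdot> sw U X (Y \<otimes> W) \<cdot> assoc M U X (Y \<otimes> W) \<cdot> assoc M (U \<otimes> X) Y W"
    by (subst pentagon) auto
  also have "\<dots> = X \<rhd> sw U Y W \<cdot> assoc M X U (Y \<otimes> W) \<cdot> (braid M U X \<boxtimes> Id M (Y \<otimes> W)) \<cdot> assoc M (U \<otimes> X) Y W"
    by (simp add: sw_def[of U X])
  also have "\<dots> = X \<rhd> sw U Y W \<cdot> (assoc M X U (Y \<otimes> W) \<cdot> assoc M (X \<otimes> U) Y W) \<cdot> ((braid M U X \<boxtimes> Id M Y) \<boxtimes> Id M W)"
    using assoc_natural[of "braid M U X" "Id M Y" "Id M W" "X \<otimes> U" Y W "U \<otimes> X" Y W] by simp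
  also have "\<dots> = ?z"
    by (simp add: pentagon sw_def wh_Comp)
  finally have "(assoc M X Y (U \<otimes> W) \<cdot> sw U (X \<otimes> Y) W) \<cdot> ?l
      = (X \<rhd> sw U Y W \<cdot> sw U X (Y \<otimes> W) \<cdot> U \<rhd> assoc M X Y W) \<cdot> ?l"
    unfolding 1 by (rule sym)
  then show ?thesis
    by (rule cancel_epi[where l = ?l and k = "(ai U X Y \<boxtimes> Id M W) \<cdot> ai U (X \<otimes> Y) W"])
      auto
qed

text \<open>Passing \<open>unit M \<otimes> unit M\<close> is, by \<open>sw_tens_right\<close>,
  passing two units in turn, and by naturality along \<open>lunit\<close> it is passing a single
  one. Cancelling one invertible swap leaves the claim.\<close>

lemma sw_unit_right:
  assumes [simp]: "U \<in> Ob M" "W \<in> Ob M"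
  shows "lunit M (U \<otimes> W) \<cdot> sw U (unit M) W = U \<rhd> lunit M W"
proof -
  let ?I = "unit M"
  have "sw U ?I W \<cdot> U \<rhd> (lunit M ?I \<boxtimes> Id M W) = (lunit M ?I \<boxtimes> Id M (U \<otimes> W)) \<cdot> sw U (?I \<otimes> ?I) W"
    by (subst sw_natural[where Y = "?I \<otimes> ?I" and X = U and W = W]) auto
  also have "\<dots> = lunit M (?I \<otimes> (U \<otimes> W)) \<cdot> assoc M ?I ?I (U \<otimes> W) \<cdot> sw U (?I \<otimes> ?I) W"
    by (simp add: lunit_tens[symmetric])
  also have "\<dots> = lunit M (?I \<otimes> (U \<otimes> W)) \<cdot> ?I \<rhd> sw U ?I W \<cdot> sw U ?I (?I \<otimes> W) \<cdot> U \<rhd> assoc M ?I ?I W"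
    by (simp add: sw_tens_right)
  also have "\<dots> = sw U ?I W \<cdot> lunit M (U \<otimes> (?I \<otimes> W)) \<cdot> sw U ?I (?I \<otimes> W) \<cdot> U \<rhd> assoc M ?I ?I W"
    using lunit_nat[of "sw U ?I W"] by (subst pre[where g' = "sw U ?I W" and f'
      = "lunit M (U \<otimes> (?I \<otimes> W))"]) (auto simp: hom_iff)
  finally have "U \<rhd> (lunit M ?I \<boxtimes> Id M W) = lunit M (U \<otimes> (?I \<otimes> W)) \<cdot> sw U ?I (?I \<otimes> W) \<cdot> U \<rhd> assoc M ?I ?I W"
    by (rule cancel_mono[where k = "sw ?I U W"]) auto
  then have "U \<rhd> lunit M (?I \<otimes> W) \<cdot> U \<rhd> assoc M ?I ?I W
     = (lunit M (U \<otimes> (?I \<otimes> W)) \<cdot> sw U ?I (?I \<otimes> W)) \<cdot> U \<rhd> assoc M ?I ?I W"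
    by (simp add: lunit_tens[symmetric] wh_Comp)
  then have 1: "U \<rhd> lunit M (?I \<otimes> W) = lunit M (U \<otimes> (?I \<otimes> W)) \<cdot> sw U ?I (?I \<otimes> W)"
    by (rule cancel_epi[where k = "U \<rhd> ai ?I ?I W"]) (auto simp: wh_Comp[symmetric])
  \<comment> \<open>Fact \<open>1\<close> is the claim for the tail \<open>?I \<otimes> W\<close>;
    naturality along \<open>lunit M W\<close> removes the extra unit.\<close>
  have "(lunit M (U \<otimes> W) \<cdot> sw U ?I W) \<cdot> U \<rhd> (?I \<rhd> lunit M W)
     = lunit M (U \<otimes> W) \<cdot> ?I \<rhd> (U \<rhd> lunit M W) \<cdot> sw U ?I (?I \<otimes> W)"
    by (simp add: sw_natural[where W = "?I \<otimes> W" and X = U and Y = ?I])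
  also have "\<dots> = U \<rhd> lunit M W \<cdot> U \<rhd> lunit M (?I \<otimes> W)"
    using lunit_nat[of "U \<rhd> lunit M W"]
    by (subst pre[where g' = "U \<rhd> lunit M W" and f' = "lunit M (U \<otimes> (?I \<otimes> W))"]) (auto simp: hom_iff 1)
  also have "\<dots> = U \<rhd> lunit M W \<cdot> U \<rhd> (?I \<rhd> lunit M W)"
    using lunit_nat[of "lunit M W"] by (simp add: wh_Comp[symmetric] hom_iff)
  finally show ?thesis
    by (rule cancel_epi[where k = "U \<rhd> (?I \<rhd> li W)"]) (auto simp: wh_Comp[symmetric])
qed

lemma sw_unit_left:
  assumes [simp]: "U \<in> Ob M" "W \<in> Ob M"
  shows "U \<rhd> lunit M W \<cdot> sw (unit M) U W = lunit M (U \<otimes> W)"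
  by (simp add: sw_unit_right[symmetric])

text \<open>\<open>f : X \<otimes> Y \<rightarrow> Z\<close> with tail.\<close>

definition l2 :: "'a \<Rightarrow> 'o \<Rightarrow> 'o \<Rightarrow> 'o \<Rightarrow> 'a" where
  "l2 f X Y W = (f \<boxtimes> Id M W) \<cdot> ai X Y W"

lemma Ar_l2 [simp]:
  "f \<in> Ar M \<Longrightarrow> Dom M f = X \<otimes> Y \<Longrightarrow> X \<in> Ob M \<Longrightarrow> Y \<in> Ob M \<Longrightarrow> W \<in> Ob M \<Longrightarrow> l2 f X Y W \<in> Ar M"
  by (simp add: l2_def)

lemma Dom_l2 [simp]:
  "X \<in> Ob M \<Longrightarrow> Y \<in> Ob M \<Longrightarrow> W \<in> Ob M \<Longrightarrow> Dom M (l2 f X Y W) = X \<otimes> (Y \<otimes> W)"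
  by (simp add: l2_def)

lemma Cod_l2 [simp]: "Cod M (l2 f X Y W) = Cod M f \<otimes> W"
  by (simp add: l2_def)

lemma l2_natural:
  assumes f: "f \<in> Ar M" "Dom M f = X \<otimes> Y" "X \<in> Ob M" "Y \<in> Ob M"
    and h: "h \<in> Ar M" "Dom M h = W" "Cod M h = W'"
  shows "l2 f X Y W' \<cdot> X \<rhd> (Y \<rhd> h) = (Cod M f \<rhd> h) \<cdot> l2 f X Y W"
proof -
  have [simp]: "W \<in> Ob M" "W' \<in> Ob M" using h by auto
  have "l2 f X Y W' \<cdot> X \<rhd> (Y \<rhd> h) = (f \<boxtimes> Id M W') \<cdot> (X \<otimes> Y) \<rhd> h \<cdot> ai X Y W"
    using assms by (simp add: l2_def ai_natural[where X = X and Y = Y and Z = W])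
  also have "\<dots> = (Cod M f \<rhd> h) \<cdot> l2 f X Y W"
    using assms unfolding l2_def by (subst pre[OF tens_swap]) auto
  finally show ?thesis .
qed

lemma l2_cod: "g \<in> Ar M \<Longrightarrow> f \<in> Ar M \<Longrightarrow> Dom M g = Cod M f \<Longrightarrow> Dom M f = X \<otimes> Y
    \<Longrightarrow> X \<in> Ob M \<Longrightarrow> Y \<in> Ob M \<Longrightarrow> W \<in> Ob M
    \<Longrightarrow> (g \<boxtimes> Id M W) \<cdot> l2 f X Y W = l2 (g \<cdot> f) X Y W"
  by (simp add: l2_def Comp_wh)

lemma l2_dom:
  assumes "f \<in> Ar M" "Dom M f = X' \<otimes> Y'" "g \<in> Ar M" "h \<in> Ar M"
    "Dom M g = X" "Dom M h = Y" "Cod M g = X'" "Cod M h = Y'" "W \<in> Ob M"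
  shows "l2 f X' Y' W \<cdot> (g \<boxtimes> (h \<boxtimes> Id M W)) = l2 (f \<cdot> (g \<boxtimes> h)) X Y W"
proof -
  have [simp]: "X \<in> Ob M" "X' \<in> Ob M" "Y \<in> Ob M" "Y' \<in> Ob M" using assms by auto
  show ?thesis
    using assms by (simp add: l2_def Comp_wh ai_natural[where X = X and Y = Y and Z = W])
qed

text \<open>Naturality of the swap lets U pass the inputs instead of the output, and
  \<open>sw_tens_right\<close> splits that passage into one swap for each input.\<close>

lemma l2_slide_left:
  assumes [simp]: "f \<in> Ar M" "Dom M f = X \<otimes> Y" "X \<in> Ob M" "Y \<in> Ob M" "U \<in> Ob M" "W \<in> Ob M" "Cod M f = Z"
  shows "sw U Z W \<cdot> U \<rhd> l2 f X Y W = l2 f X Y (U \<otimes> W) \<cdot> X \<rhd> sw U Y W \<cdot> sw U X (Y \<otimes> W)"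
proof -
  have [simp]: "Z \<in> Ob M" using Cod_Ob[of f] by simp
  have "sw U Z W \<cdot> U \<rhd> l2 f X Y W = (sw U Z W \<cdot> U \<rhd> (f \<boxtimes> Id M W)) \<cdot> U \<rhd> ai X Y W"
    by (simp add: l2_def wh_Comp)
  also have "\<dots> = (f \<boxtimes> Id M (U \<otimes> W)) \<cdot> sw U (X \<otimes> Y) W \<cdot> U \<rhd> ai X Y W"
    by (subst sw_natural[where X = U and Y = "X \<otimes> Y" and W = W]) auto
  also have "sw U (X \<otimes> Y) W = ai X Y (U \<otimes> W) \<cdot> assoc M X Y (U \<otimes> W) \<cdot> sw U (X \<otimes> Y) W"
    by simp
  also have "assoc M X Y (U \<otimes> W) \<cdot> sw U (X \<otimes> Y) W = X \<rhd> sw U Y W \<cdot> sw U X (Y \<otimes> W) \<cdot> U \<rhd> assoc M X Y W"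
    by (rule sw_tens_right) auto
  finally show ?thesis by (simp add: l2_def)
qed

lemma l2_slide_right:
  assumes [simp]: "f \<in> Ar M" "Dom M f = X \<otimes> Y" "X \<in> Ob M" "Y \<in> Ob M" "U \<in> Ob M" "W \<in> Ob M" "Cod M f = Z"
  shows "sw Z U W \<cdot> l2 f X Y (U \<otimes> W) = U \<rhd> l2 f X Y W \<cdot> sw X U (Y \<otimes> W) \<cdot> X \<rhd> sw Y U W"
proof -
  have [simp]: "Z \<in> Ob M" using Cod_Ob[of f] by simp
  have "U \<rhd> l2 f X Y W \<cdot> sw X U (Y \<otimes> W) \<cdot> X \<rhd> sw Y U W
     = sw Z U W \<cdot> (sw U Z W \<cdot> U \<rhd> l2 f X Y W) \<cdot> sw X U (Y \<otimes> W) \<cdot> X \<rhd> sw Y U W"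
    by simp
  then show ?thesis by (simp add: l2_slide_left)
qed

text \<open>The braiding of X and Y is itself an operation with two inputs, so
  \<open>l2_slide_left\<close> applies to it.\<close>

lemma sw_yang_baxter:
  assumes [simp]: "X \<in> Ob M" "Y \<in> Ob M" "U \<in> Ob M" "W \<in> Ob M"
  shows "Y \<rhd> sw U X W \<cdot> sw U Y (X \<otimes> W) \<cdot> U \<rhd> sw X Y W
    = sw X Y (U \<otimes> W) \<cdot> X \<rhd> sw U Y W \<cdot> sw U X (Y \<otimes> W)"
proof -
  have "Y \<rhd> sw U X W \<cdot> sw U Y (X \<otimes> W) \<cdot> U \<rhd> sw X Y W
    = (Y \<rhd> sw U X W \<cdot> sw U Y (X \<otimes> W) \<cdot> U \<rhd> assoc M Y X W) \<cdot> U \<rhd> l2 (braid M X Y) X Y W"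
    by (simp add: sw_def[of X Y] wh_Comp l2_def)
  also have "\<dots> = assoc M Y X (U \<otimes> W) \<cdot> sw U (Y \<otimes> X) W \<cdot> U \<rhd> l2 (braid M X Y) X Y W"
    by (simp add: sw_tens_right[symmetric])
  also have "\<dots> = sw X Y (U \<otimes> W) \<cdot> X \<rhd> sw U Y W \<cdot> sw U X (Y \<otimes> W)"
    by (subst l2_slide_left) (auto simp: sw_def[of X Y] l2_def)
  finally show ?thesis .
qed

text \<open>This lemma and \<open>l2_l2_right\<close> bring both nestings to a common shape, a map
  tensored with the tail after two inverse associators. An associativity law with associators thus
  turns into one without.\<close>

lemma l2_l2_left:
  assumes [simp]: "X \<in> Ob M" "Y \<in> Ob M" "Z \<in> Ob M" "W \<in> Ob M"
    "g \<in> Ar M" "Dom M g = X \<otimes> Y" "f \<in> Ar M" "Cod M g = B" "Dom M f = B \<otimes> Z"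
  shows "l2 f B Z W \<cdot> l2 g X Y (Z \<otimes> W)
    = ((f \<cdot> (g \<boxtimes> Id M Z)) \<boxtimes> Id M W) \<cdot> ai (X \<otimes> Y) Z W \<cdot> ai X Y (Z \<otimes> W)"
proof -
  have [simp]: "B \<in> Ob M" using Cod_Ob[of g] by simp
  have "ai B Z W \<cdot> (g \<boxtimes> Id M (Z \<otimes> W)) = ((g \<boxtimes> Id M Z) \<boxtimes> Id M W) \<cdot> ai (X \<otimes> Y) Z W"
    using ai_natural[of g "Id M Z" "Id M W" B Z W "X \<otimes> Y" Z W] by simp
  then show ?thesis
    by (simp add: l2_def Comp_wh pre[of "ai B Z W" _ "(g \<boxtimes> Id M Z) \<boxtimes> Id M W"])
qed

lemma ai_pentagon:
  assumes [simp]: "X \<in> Ob M" "Y \<in> Ob M" "Z \<in> Ob M" "W \<in> Ob M"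
  shows "ai X (Y \<otimes> Z) W \<cdot> X \<rhd> ai Y Z W = (assoc M X Y Z \<boxtimes> Id M W) \<cdot> ai (X \<otimes> Y) Z W \<cdot> ai X Y (Z \<otimes> W)"
proof (rule cancel_epi[where l = "assoc M X Y (Z \<otimes> W) \<cdot> assoc M (X \<otimes> Y) Z W" and k
  = "ai (X \<otimes> Y) Z W \<cdot> ai X Y (Z \<otimes> W)"])
  show "(ai X (Y \<otimes> Z) W \<cdot> X \<rhd> ai Y Z W) \<cdot> assoc M X Y (Z \<otimes> W) \<cdot> assoc M (X \<otimes> Y) Z W
     = ((assoc M X Y Z \<boxtimes> Id M W) \<cdot> ai (X \<otimes> Y) Z W \<cdot> ai X Y (Z \<otimes> W)) \<cdot> assoc M X Y (Z \<otimes> W) \<cdot> assoc M (X \<otimes> Y) Z W"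
    by (subst (1) assoc_Comp, simp_all del: assoc_Comp, subst pentagon, auto)
qed auto

lemma l2_l2_right:
  assumes [simp]: "X \<in> Ob M" "Y \<in> Ob M" "Z \<in> Ob M" "W \<in> Ob M"
    "g \<in> Ar M" "Dom M g = Y \<otimes> Z" "f \<in> Ar M" "Cod M g = B" "Dom M f = X \<otimes> B"
  shows "l2 f X B W \<cdot> X \<rhd> l2 g Y Z W
    = ((f \<cdot> X \<rhd> g \<cdot> assoc M X Y Z) \<boxtimes> Id M W) \<cdot> ai (X \<otimes> Y) Z W \<cdot> ai X Y (Z \<otimes> W)"
proof -
  have [simp]: "B \<in> Ob M" using Cod_Ob[of g] by simp
  have "ai X B W \<cdot> X \<rhd> (g \<boxtimes> Id M W) = ((X \<rhd> g) \<boxtimes> Id M W) \<cdot> ai X (Y \<otimes> Z) W"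
    by (rule ai_natural) auto
  then have "l2 f X B W \<cdot> X \<rhd> l2 g Y Z W
    = (f \<boxtimes> Id M W) \<cdot> ((X \<rhd> g) \<boxtimes> Id M W) \<cdot> ai X (Y \<otimes> Z) W \<cdot> X \<rhd> ai Y Z W"
    by (simp add: l2_def wh_Comp pre[of "ai X B W" _ "(X \<rhd> g) \<boxtimes> Id M W"])
  then show ?thesis
    by (simp add: ai_pentagon Comp_wh)
qed

section \<open>Caps and cups with a tail\<close>

definition counit_op :: "'a \<Rightarrow> 'o \<Rightarrow> 'o \<Rightarrow> 'o \<Rightarrow> 'a" where
  "counit_op e X Y W = lunit M W \<cdot> l2 e X Y W"

definition unit_op :: "'a \<Rightarrow> 'o \<Rightarrow> 'o \<Rightarrow> 'o \<Rightarrow> 'a" where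
  "unit_op h X Y W = assoc M X Y W \<cdot> (h \<boxtimes> Id M W) \<cdot> li W"

lemma lunit_natural:
  "f \<in> Ar M \<Longrightarrow> Dom M f = X \<Longrightarrow> Cod M f = X' \<Longrightarrow> lunit M X' \<cdot> unit M \<rhd> f = f \<cdot> lunit M X"
  using lunit_nat[of f X X'] by (simp add: hom_iff)

lemma li_natural:
  assumes "f \<in> Ar M" "Dom M f = X" "Cod M f = X'"
  shows "li X' \<cdot> f = unit M \<rhd> f \<cdot> li X"
proof -
  have [simp]: "X \<in> Ob M" "X' \<in> Ob M" using assms by auto
  have "li X' \<cdot> f = li X' \<cdot> (f \<cdot> lunit M X) \<cdot> li X" using assms by simp
  also have "\<dots> = unit M \<rhd> f \<cdot> li X"
    using assms by (subst lunit_natural[symmetric]) auto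
  finally show ?thesis .
qed

context
  fixes e X Y
  assumes e [simp]: "e \<in> Ar M" "Dom M e = X \<otimes> Y" "Cod M e = unit M" "X \<in> Ob M" "Y \<in> Ob M"
begin

lemma
  assumes [simp]: "W \<in> Ob M"
  shows Ar_counit_op: "counit_op e X Y W \<in> Ar M"
    and Dom_counit_op: "Dom M (counit_op e X Y W) = X \<otimes> (Y \<otimes> W)"
    and Cod_counit_op: "Cod M (counit_op e X Y W) = W"
  by (auto simp: counit_op_def)

lemma counit_op_natural:
  assumes [simp]: "h \<in> Ar M" "Dom M h = W" "Cod M h = W'"
  shows "counit_op e X Y W' \<cdot> X \<rhd> (Y \<rhd> h) = h \<cdot> counit_op e X Y W"
proof -
  have [simp]: "W \<in> Ob M" "W' \<in> Ob M" using Dom_Ob[of h] Cod_Ob[of h] by auto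
  have "counit_op e X Y W' \<cdot> X \<rhd> (Y \<rhd> h) = (lunit M W' \<cdot> unit M \<rhd> h) \<cdot> l2 e X Y W"
    by (simp add: counit_op_def l2_natural[where W = W])
  then show ?thesis by (simp add: counit_op_def lunit_natural[where X = W])
qed

text \<open>A strand slides over a cap because the cap ends in the unit, past which the swap is
  trivial by \<open>sw_unit_right\<close>.\<close>

lemma counit_op_slide_left:
  assumes [simp]: "U \<in> Ob M" "W \<in> Ob M"
  shows "U \<rhd> counit_op e X Y W = counit_op e X Y (U \<otimes> W) \<cdot> X \<rhd> sw U Y W \<cdot> sw U X (Y \<otimes> W)"
proof -
  have "U \<rhd> counit_op e X Y W = lunit M (U \<otimes> W) \<cdot> sw U (unit M) W \<cdot> U \<rhd> l2 e X Y W"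
    using pre1[OF sw_unit_right[of U W], of "U \<rhd> l2 e X Y W"] by (simp add: counit_op_def wh_Comp)
  then show ?thesis by (simp add: counit_op_def l2_slide_left)
qed

end

context
  fixes h X Y
  assumes h [simp]: "h \<in> Ar M" "Cod M h = X \<otimes> Y" "Dom M h = unit M" "X \<in> Ob M" "Y \<in> Ob M"
begin

lemma
  assumes [simp]: "W \<in> Ob M"
  shows Ar_unit_op: "unit_op h X Y W \<in> Ar M"
    and Cod_unit_op: "Cod M (unit_op h X Y W) = X \<otimes> (Y \<otimes> W)"
    and Dom_unit_op: "Dom M (unit_op h X Y W) = W"
  by (auto simp: unit_op_def)

lemma unit_op_natural:
  assumes [simp]: "g \<in> Ar M" "Dom M g = W" "Cod M g = W'"
  shows "unit_op h X Y W' \<cdot> g = X \<rhd> (Y \<rhd> g) \<cdot> unit_op h X Y W"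
proof -
  have [simp]: "W \<in> Ob M" "W' \<in> Ob M" using Dom_Ob[of g] Cod_Ob[of g] by auto
  have "unit_op h X Y W' \<cdot> g = assoc M X Y W' \<cdot> ((h \<boxtimes> Id M W') \<cdot> unit M \<rhd> g) \<cdot> li W"
    by (simp add: unit_op_def li_natural[where X = W])
  also have "\<dots> = (assoc M X Y W' \<cdot> (X \<otimes> Y) \<rhd> g) \<cdot> (h \<boxtimes> Id M W) \<cdot> li W"
    by (subst tens_swap) auto
  also have "assoc M X Y W' \<cdot> (X \<otimes> Y) \<rhd> g = X \<rhd> (Y \<rhd> g) \<cdot> assoc M X Y W"
    using assoc_natural[of "Id M X" "Id M Y" g X Y W' X Y W] by simp
  finally show ?thesis by (simp add: unit_op_def)
qed

text \<open>A strand passes a whole cup freely, since the cup starts from the unit. Undoing the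
  passage of one leg leaves the passage of the other.\<close>

lemma unit_op_slide:
  assumes [simp]: "U \<in> Ob M" "W \<in> Ob M"
  shows "sw U X (Y \<otimes> W) \<cdot> U \<rhd> unit_op h X Y W = X \<rhd> sw Y U W \<cdot> unit_op h X Y (U \<otimes> W)"
proof -
  have "(X \<rhd> sw U Y W \<cdot> sw U X (Y \<otimes> W) \<cdot> U \<rhd> unit_op h X Y W) \<cdot> U \<rhd> lunit M W
     = (X \<rhd> sw U Y W \<cdot> sw U X (Y \<otimes> W) \<cdot> U \<rhd> assoc M X Y W) \<cdot> U \<rhd> (h \<boxtimes> Id M W)"
    by (simp add: unit_op_def wh_Comp)
  also have "\<dots> = assoc M X Y (U \<otimes> W) \<cdot> sw U (X \<otimes> Y) W \<cdot> U \<rhd> (h \<boxtimes> Id M W)"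
    by (simp add: sw_tens_right[symmetric])
  also have "\<dots> = assoc M X Y (U \<otimes> W) \<cdot> (h \<boxtimes> Id M (U \<otimes> W)) \<cdot> sw U (unit M) W"
    by (subst sw_natural[where X = U and Y = "unit M" and W = W]) auto
  also have "\<dots> = unit_op h X Y (U \<otimes> W) \<cdot> U \<rhd> lunit M W"
    by (simp add: unit_op_def sw_unit_right[symmetric])
  finally have "X \<rhd> sw U Y W \<cdot> sw U X (Y \<otimes> W) \<cdot> U \<rhd> unit_op h X Y W = unit_op h X Y (U \<otimes> W)"
    by (rule cancel_epi[where k = "U \<rhd> li W"]) (auto simp: Ar_unit_op Dom_unit_op Cod_unit_op)
  then have "X \<rhd> sw Y U W \<cdot> unit_op h X Y (U \<otimes> W)
    = X \<rhd> sw Y U W \<cdot> X \<rhd> sw U Y W \<cdot> sw U X (Y \<otimes> W) \<cdot> U \<rhd> unit_op h X Y W" by simp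
  then show ?thesis by (simp add: Ar_unit_op Dom_unit_op Cod_unit_op)
qed

end

end

section \<open>Filling inputs of operations by dual basis elements\<close>

text \<open>\<open>Ch A\<close> is a plain \<open>smcat\<close> record and carries no addition, so
  sums and zero maps enter as parameters; \<open>ch_add\<close> and \<open>ch_zero\<close> will be
  supplied for them.\<close>

locale additive_smc = typed_smc M
  for M :: "('o, 'a, 'm) smcat_scheme" (structure) +
  fixes pl :: "'a \<Rightarrow> 'a \<Rightarrow> 'a" (infixl "\<oplus>\<oplus>" 60)
    and nul :: "'o \<Rightarrow> 'o \<Rightarrow> 'a"
  assumes Ar_pl [simp]: "f \<in> Ar M \<Longrightarrow> g \<in> Ar M \<Longrightarrow> Dom M g = Dom M f \<Longrightarrow> Cod M g = Cod M f \<Longrightarrow> f \<oplus>\<oplus> g \<in> Ar M"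
    and Dom_pl [simp]: "Dom M (f \<oplus>\<oplus> g) = Dom M f"
    and Cod_pl [simp]: "Cod M (f \<oplus>\<oplus> g) = Cod M f"
    and Ar_nul [simp]: "X \<in> Ob M \<Longrightarrow> Y \<in> Ob M \<Longrightarrow> nul X Y \<in> Ar M"
    and Dom_nul [simp]: "Dom M (nul X Y) = X"
    and Cod_nul [simp]: "Cod M (nul X Y) = Y"
    and pl_comm: "f \<in> Ar M \<Longrightarrow> g \<in> Ar M \<Longrightarrow> Dom M g = Dom M f \<Longrightarrow> Cod M g = Cod M f \<Longrightarrow> f \<oplus>\<oplus> g = g \<oplus>\<oplus> f"
    and pl_assoc: "f \<in> Ar M \<Longrightarrow> g \<in> Ar M \<Longrightarrow> h \<in> Ar M \<Longrightarrow> Dom M g = Dom M f \<Longrightarrow> Cod M g = Cod M f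
      \<Longrightarrow> Dom M h = Dom M f \<Longrightarrow> Cod M h = Cod M f \<Longrightarrow> (f \<oplus>\<oplus> g) \<oplus>\<oplus> h = f \<oplus>\<oplus> (g \<oplus>\<oplus> h)"
    and pl_nul [simp]: "f \<in> Ar M \<Longrightarrow> Dom M f = X \<Longrightarrow> Cod M f = Y \<Longrightarrow> f \<oplus>\<oplus> nul X Y = f"
    and Comp_pl: "f \<in> Ar M \<Longrightarrow> g \<in> Ar M \<Longrightarrow> h \<in> Ar M \<Longrightarrow> Dom M g = Dom M f \<Longrightarrow> Cod M g = Cod M f
      \<Longrightarrow> Dom M h = Cod M f \<Longrightarrow> h \<cdot> (f \<oplus>\<oplus> g) = (h \<cdot> f) \<oplus>\<oplus> (h \<cdot> g)"
    and pl_Comp: "f \<in> Ar M \<Longrightarrow> g \<in> Ar M \<Longrightarrow> h \<in> Ar M \<Longrightarrow> Dom M g = Dom M f \<Longrightarrow> Cod M g = Cod M f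
      \<Longrightarrow> Cod M h = Dom M f \<Longrightarrow> (f \<oplus>\<oplus> g) \<cdot> h = (f \<cdot> h) \<oplus>\<oplus> (g \<cdot> h)"
    and wh_pl: "f \<in> Ar M \<Longrightarrow> g \<in> Ar M \<Longrightarrow> X \<in> Ob M \<Longrightarrow> Dom M g = Dom M f \<Longrightarrow> Cod M g = Cod M f
      \<Longrightarrow> X \<rhd> (f \<oplus>\<oplus> g) = X \<rhd> f \<oplus>\<oplus> X \<rhd> g"
    and pl_wh: "f \<in> Ar M \<Longrightarrow> g \<in> Ar M \<Longrightarrow> X \<in> Ob M \<Longrightarrow> Dom M g = Dom M f \<Longrightarrow> Cod M g = Cod M f
      \<Longrightarrow> (f \<oplus>\<oplus> g) \<boxtimes> Id M X = (f \<boxtimes> Id M X) \<oplus>\<oplus> (g \<boxtimes> Id M X)"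
    and Comp_nul [simp]: "f \<in> Ar M \<Longrightarrow> X \<in> Ob M \<Longrightarrow> Dom M f = Y \<Longrightarrow> f \<cdot> nul X Y = nul X (Cod M f)"
    and nul_Comp [simp]: "f \<in> Ar M \<Longrightarrow> Z \<in> Ob M \<Longrightarrow> Cod M f = Y \<Longrightarrow> nul Y Z \<cdot> f = nul (Dom M f) Z"
    and wh_nul [simp]: "X \<in> Ob M \<Longrightarrow> Y \<in> Ob M \<Longrightarrow> Z \<in> Ob M \<Longrightarrow> X \<rhd> nul Y Z = nul (X \<otimes> Y) (X \<otimes> Z)"
    and nul_wh [simp]: "X \<in> Ob M \<Longrightarrow> Y \<in> Ob M \<Longrightarrow> Z \<in> Ob M \<Longrightarrow> nul Y Z \<boxtimes> Id M X = nul (Y \<otimes> X) (Z \<otimes> X)"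
begin

lemma nul_pl [simp]: "f \<in> Ar M \<Longrightarrow> Dom M f = X \<Longrightarrow> Cod M f = Y \<Longrightarrow> nul X Y \<oplus>\<oplus> f = f"
  by (subst pl_comm) auto

end

context typed_smc begin

lemma sw_tail:
  "g \<in> Ar M \<Longrightarrow> X \<in> Ob M \<Longrightarrow> Y \<in> Ob M \<Longrightarrow> Cod M g = W'
    \<Longrightarrow> sw X Y W' \<cdot> X \<rhd> (Y \<rhd> g) = Y \<rhd> (X \<rhd> g) \<cdot> sw X Y (Dom M g)"
  by (rule sw_natural) auto

lemma sw_first:
  "g \<in> Ar M \<Longrightarrow> W \<in> Ob M \<Longrightarrow> Y \<in> Ob M \<Longrightarrow> Cod M g = X' \<Longrightarrow> Z = Y \<otimes> W
    \<Longrightarrow> sw X' Y W \<cdot> (g \<boxtimes> Id M Z) = Y \<rhd> (g \<boxtimes> Id M W) \<cdot> sw (Dom M g) Y W"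
  using sw_natural[of g "Id M Y" "Id M W" "Dom M g" Y W X' Y W] by simp

lemma sw_second:
  "g \<in> Ar M \<Longrightarrow> W \<in> Ob M \<Longrightarrow> X \<in> Ob M \<Longrightarrow> Cod M g = Y'
    \<Longrightarrow> sw X Y' W \<cdot> X \<rhd> (g \<boxtimes> Id M W) = (g \<boxtimes> Id M (X \<otimes> W)) \<cdot> sw X (Dom M g) W"
  using sw_natural[of "Id M X" g "Id M W" X "Dom M g" W X Y' W] by simp

end

text \<open>The dual \<open>D\<close> of \<open>P(0)\<close> is included in \<open>V\<close> by \<open>io\<close>, and \<open>eta = \<Sum> d\<^sub>s \<otimes> \<kappa>\<^sub>s\<close> is the coevaluation. The
  pairing \<open>e\<close> of \<open>P(0)\<close> with \<open>D\<close> is extended to \<open>V\<close>.\<close>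

locale pointed_operad = typed_smc M + operad M P
  for M :: "('o, 'a, 'm) smcat_scheme" (structure) and P :: "('o, 'a) operad" +
  fixes V D :: 'o and e eta io :: 'a
  assumes V_Ob [simp]: "V \<in> Ob M" and D_Ob [simp]: "D \<in> Ob M"
    and e [simp]: "e \<in> Ar M" "Dom M e = arity P 0 \<otimes> V" "Cod M e = unit M"
    and eta [simp]: "eta \<in> Ar M" "Dom M eta = unit M" "Cod M eta = D \<otimes> arity P 0"
    and io [simp]: "io \<in> Ar M" "Dom M io = D" "Cod M io = V"
    and zigzag: "W \<in> Ob M \<Longrightarrow> counit_op e (arity P 0) V (arity P 0 \<otimes> W)
       \<cdot> arity P 0 \<rhd> (io \<boxtimes> Id M (arity P 0 \<otimes> W)) \<cdot> arity P 0 \<rhd> unit_op eta D (arity P 0) W = Id M (arity P 0 \<otimes> W)"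
begin

abbreviation "p \<equiv> arity P"

declare arity_Ob [simp]

lemma
  assumes "i < m"
  shows Ar_pcomp [simp]: "pcomp P m n i \<in> Ar M"
    and Dom_pcomp [simp]: "Dom M (pcomp P m n i) = p m \<otimes> p n"
    and Cod_pcomp [simp]: "Cod M (pcomp P m n i) = p (m + n - 1)"
  using pcomp_hom[OF assms, of n] by (auto simp: hom_iff)

section \<open>Partial compositions with a tail\<close>

definition c :: "nat \<Rightarrow> nat \<Rightarrow> nat \<Rightarrow> 'o \<Rightarrow> 'a" where
  "c m n i W = l2 (pcomp P m n i) (p m) (p n) W"

lemma
  assumes [simp]: "i < m" "W \<in> Ob M"
  shows Ar_c [simp]: "c m n i W \<in> Ar M"
    and Dom_c [simp]: "Dom M (c m n i W) = p m \<otimes> (p n \<otimes> W)"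
    and Cod_c [simp]: "Cod M (c m n i W) = p (m + n - 1) \<otimes> W"
  by (auto simp: c_def)

lemma c_tail:
  "i < m \<Longrightarrow> g \<in> Ar M \<Longrightarrow> Cod M g = W' \<Longrightarrow> Q = p m \<Longrightarrow> R = p n
    \<Longrightarrow> c m n i W' \<cdot> Q \<rhd> (R \<rhd> g) = p (m + n - 1) \<rhd> g \<cdot> c m n i (Dom M g)"
  by (simp add: c_def l2_natural[where W = "Dom M g"])

lemma c_sequential:
  assumes [simp]: "i < l" "j < m" "W \<in> Ob M"
  shows "c (l + m - 1) n (i + j) W \<cdot> c l m i (p n \<otimes> W) = c l (m + n - 1) i W \<cdot> p l \<rhd> c m n j W"
proof -
  have [simp]: "i + j < l + m - 1" using assms(1,2) by linarith
  show ?thesis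
    by (simp add: c_def l2_l2_left l2_l2_right pcomp_sequential del: One_nat_def)
qed

text \<open>The associators of the parallel axiom are absorbed by the tail form; what remains of its
  braiding is the swap of the two inner operations.\<close>

lemma c_parallel:
  assumes [simp]: "i < k" "k < l" "W \<in> Ob M"
  shows "c (l + m - 1) n (k + m - 1) W \<cdot> c l m i (p n \<otimes> W)
    = c (l + n - 1) m i W \<cdot> c l n k (p m \<otimes> W) \<cdot> p l \<rhd> sw (p m) (p n) W"
proof -
  have [simp]: "i < l" "k + m - 1 < l + m - 1" "i < l + n - 1" using assms(1,2) by linarith+
  have "c (l + n - 1) m i W \<cdot> c l n k (p m \<otimes> W) \<cdot> p l \<rhd> sw (p m) (p n) W
    = ((pcomp P (l + n - 1) m i \<cdot> (pcomp P l n k \<boxtimes> Id M (p m))) \<boxtimes> Id M W)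
      \<cdot> ai (p l \<otimes> p n) (p m) W \<cdot> ai (p l) (p n) (p m \<otimes> W) \<cdot> p l \<rhd> assoc M (p n) (p m) W
      \<cdot> p l \<rhd> (braid M (p m) (p n) \<boxtimes> Id M W) \<cdot> p l \<rhd> ai (p m) (p n) W"
    using pre1[OF l2_l2_left[of "p l" "p n" "p m" W "pcomp P l n k" "pcomp P (l + n - 1) m i" "p (l + n - 1)"],
      of "p l \<rhd> sw (p m) (p n) W"]
    by (simp add: c_def sw_def wh_Comp del: One_nat_def)
  also have "\<dots> = ((pcomp P (l + n - 1) m i \<cdot> (pcomp P l n k \<boxtimes> Id M (p m))) \<boxtimes> Id M W)
      \<cdot> (ai (p l) (p n) (p m) \<boxtimes> Id M W) \<cdot> (ai (p l) (p n \<otimes> p m) W \<cdot> p l \<rhd> ai (p n) (p m) W)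
      \<cdot> p l \<rhd> assoc M (p n) (p m) W
      \<cdot> p l \<rhd> (braid M (p m) (p n) \<boxtimes> Id M W) \<cdot> p l \<rhd> ai (p m) (p n) W"
    by (subst ai_pentagon) (auto simp del: One_nat_def)
  also have "\<dots> = ((pcomp P (l + n - 1) m i \<cdot> (pcomp P l n k \<boxtimes> Id M (p m))) \<boxtimes> Id M W)
      \<cdot> (ai (p l) (p n) (p m) \<boxtimes> Id M W) \<cdot> (ai (p l) (p n \<otimes> p m) W
      \<cdot> p l \<rhd> (braid M (p m) (p n) \<boxtimes> Id M W)) \<cdot> p l \<rhd> ai (p m) (p n) W"
    by (simp del: One_nat_def)
  also have "ai (p l) (p n \<otimes> p m) W \<cdot> p l \<rhd> (braid M (p m) (p n) \<boxtimes> Id M W)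
     = ((p l \<rhd> braid M (p m) (p n)) \<boxtimes> Id M W) \<cdot> ai (p l) (p m \<otimes> p n) W"
    by (rule ai_natural) auto
  finally show ?thesis
    by (simp add: c_def l2_l2_left pcomp_parallel ai_pentagon Comp_wh del: One_nat_def)
qed

text \<open>\<open>ins n j\<close> sends \<open>\<kappa> \<otimes> \<mu>\<close> to \<open>\<mu> \<circ>\<^sub>j \<kappa>\<close>, and \<open>dl n j\<close>, \<open>dv n j\<close> below send \<open>\<mu>\<close> to \<open>\<Sum> d\<^sub>s \<otimes> (\<mu> \<circ>\<^sub>j \<kappa>\<^sub>s)\<close> in
  \<open>D \<otimes> P(n)\<close> and \<open>V \<otimes> P(n)\<close>.\<close>

definition ins :: "nat \<Rightarrow> nat \<Rightarrow> 'o \<Rightarrow> 'a" where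
  "ins n j W = l2 (pcomp P (Suc n) 0 j \<cdot> braid M (p 0) (p (Suc n))) (p 0) (p (Suc n)) W"

lemma
  assumes [simp]: "j \<le> n" "W \<in> Ob M"
  shows Ar_ins [simp]: "ins n j W \<in> Ar M"
    and Dom_ins [simp]: "Dom M (ins n j W) = p 0 \<otimes> (p (Suc n) \<otimes> W)"
    and Cod_ins [simp]: "Cod M (ins n j W) = p n \<otimes> W"
  by (auto simp: ins_def less_Suc_eq_le)

lemma ins_eq: "j \<le> n \<Longrightarrow> W \<in> Ob M \<Longrightarrow> ins n j W = c (Suc n) 0 j W \<cdot> sw (p 0) (p (Suc n)) W"
  by (simp add: ins_def c_def l2_def sw_def Comp_wh less_Suc_eq_le)

lemma ins_tail:
  "j \<le> n \<Longrightarrow> g \<in> Ar M \<Longrightarrow> Cod M g = W'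
    \<Longrightarrow> ins n j W' \<cdot> p 0 \<rhd> (p (Suc n) \<rhd> g) = p n \<rhd> g \<cdot> ins n j (Dom M g)"
  by (simp add: ins_def l2_natural[where W = "Dom M g"] less_Suc_eq_le)

lemma ins_slide:
  assumes [simp]: "j \<le> n" "U \<in> Ob M" "W \<in> Ob M"
  shows "sw U (p n) W \<cdot> U \<rhd> ins n j W = ins n j (U \<otimes> W) \<cdot> p 0 \<rhd> sw U (p (Suc n)) W \<cdot> sw U (p 0) (p (Suc n) \<otimes> W)"
  unfolding ins_def by (rule l2_slide_left) (auto simp: less_Suc_eq_le)

lemma ins_c_slide:
  assumes [simp]: "i < m" "W \<in> Ob M" "U \<in> Ob M"
  shows "sw U (p (m + n - 1)) W \<cdot> U \<rhd> c m n i W = c m n i (U \<otimes> W) \<cdot> p m \<rhd> sw U (p n) W \<cdot> sw U (p m) (p n \<otimes> W)"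
  unfolding c_def by (rule l2_slide_left) auto

text \<open>The parallel axiom with one inner operation a constant. The constant closes an input in
  front of the slot \<open>Suc i\<close>, which therefore drops to \<open>i\<close>.\<close>

lemma ins_c_before:
  assumes [simp]: "j \<le> i" "i \<le> m" "W \<in> Ob M"
  shows "ins (m + n) j W \<cdot> p 0 \<rhd> c (Suc (Suc m)) n (Suc i) W = c (Suc m) n i W \<cdot> ins (Suc m) j (p n \<otimes> W)"
proof -
  have [simp]: "j \<le> m + n" "j \<le> Suc m" "j < Suc (m + n)" "Suc i < Suc (Suc m)" "j < Suc (Suc m)" "i < Suc m"
    "j < Suc i"
    using assms(1,2) by linarith+
  have "ins (m + n) j W \<cdot> p 0 \<rhd> c (Suc (Suc m)) n (Suc i) W
     = c (Suc (m + n)) 0 j W \<cdot> sw (p 0) (p (Suc (m + n))) W \<cdot> p 0 \<rhd> c (Suc (Suc m)) n (Suc i) W"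
    by (simp add: ins_eq)
  also have "\<dots> = (c (Suc (m + n)) 0 j W \<cdot> c (Suc (Suc m)) n (Suc i) (p 0 \<otimes> W))
       \<cdot> p (Suc (Suc m)) \<rhd> sw (p 0) (p n) W \<cdot> sw (p 0) (p (Suc (Suc m))) (p n \<otimes> W)"
    using ins_c_slide[of "Suc i" "Suc (Suc m)" W "p 0" n] by simp
  also have "\<dots> = c (Suc m) n i W \<cdot> c (Suc (Suc m)) 0 j (p n \<otimes> W) \<cdot> sw (p 0) (p (Suc (Suc m))) (p n \<otimes> W)"
    using c_parallel[of j "Suc i" "Suc (Suc m)" W 0 n] by (simp add: pre1[where g = "c (Suc m) n i W"])
  also have "\<dots> = c (Suc m) n i W \<cdot> ins (Suc m) j (p n \<otimes> W)"
    by (simp add: ins_eq)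
  finally show ?thesis .
qed

text \<open>A unary inner operation does not renumber the later inputs, so the index
  \<open>Suc j\<close> is the same on both sides.\<close>

lemma ins_c_after:
  assumes [simp]: "i \<le> j" "j \<le> m" "W \<in> Ob M"
  shows "ins (Suc m) (Suc j) W \<cdot> p 0 \<rhd> c (Suc (Suc m)) (Suc 0) i W
    = c (Suc m) (Suc 0) i W \<cdot> ins (Suc m) (Suc j) (p (Suc 0) \<otimes> W)"
proof -
  have [simp]: "i < Suc m" "i < Suc (Suc m)" "j < Suc m" "i < Suc j"
    using assms(1,2) by linarith+
  have "ins (Suc m) (Suc j) W \<cdot> p 0 \<rhd> c (Suc (Suc m)) (Suc 0) i W
     = c (Suc (Suc m)) 0 (Suc j) W \<cdot> sw (p 0) (p (Suc (Suc m))) W \<cdot> p 0 \<rhd> c (Suc (Suc m)) (Suc 0) i W"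
    by (simp add: ins_eq)
  also have "\<dots> = (c (Suc (Suc m)) 0 (Suc j) W \<cdot> c (Suc (Suc m)) (Suc 0) i (p 0 \<otimes> W))
       \<cdot> p (Suc (Suc m)) \<rhd> sw (p 0) (p (Suc 0)) W \<cdot> sw (p 0) (p (Suc (Suc m))) (p (Suc 0) \<otimes> W)"
    using ins_c_slide[of i "Suc (Suc m)" W "p 0" "Suc 0"] by simp
  also have "\<dots> = c (Suc m) (Suc 0) i W \<cdot> c (Suc (Suc m)) 0 (Suc j) (p (Suc 0) \<otimes> W)
    \<cdot> sw (p 0) (p (Suc (Suc m))) (p (Suc 0) \<otimes> W)"
    using c_parallel[of i "Suc j" "Suc (Suc m)" W "Suc 0" 0] by simp
  also have "\<dots> = c (Suc m) (Suc 0) i W \<cdot> ins (Suc m) (Suc j) (p (Suc 0) \<otimes> W)"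
    by (simp add: ins_eq)
  finally show ?thesis .
qed

text \<open>The sequential axiom with a constant innermost: input \<open>i + j\<close> of the
  composite is input \<open>j\<close> of the inner operation. The constant first has to pass the
  outer operation.\<close>

lemma ins_c_inside:
  assumes [simp]: "i \<le> m" "j \<le> n" "W \<in> Ob M"
  shows "ins (m + n) (i + j) W \<cdot> p 0 \<rhd> c (Suc m) (Suc n) i W
    = c (Suc m) n i W \<cdot> p (Suc m) \<rhd> ins n j W \<cdot> sw (p 0) (p (Suc m)) (p (Suc n) \<otimes> W)"
proof -
  have [simp]: "i + j \<le> m + n" "i < Suc m" "j < Suc n" "i + j < Suc (m + n)"
    using assms(1,2) by linarith+
  have "ins (m + n) (i + j) W \<cdot> p 0 \<rhd> c (Suc m) (Suc n) i W
     = c (Suc (m + n)) 0 (i + j) W \<cdot> sw (p 0) (p (Suc (m + n))) W \<cdot> p 0 \<rhd> c (Suc m) (Suc n) i W"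
    by (simp add: ins_eq)
  also have "\<dots> = (c (Suc (m + n)) 0 (i + j) W \<cdot> c (Suc m) (Suc n) i (p 0 \<otimes> W))
       \<cdot> p (Suc m) \<rhd> sw (p 0) (p (Suc n)) W \<cdot> sw (p 0) (p (Suc m)) (p (Suc n) \<otimes> W)"
    using ins_c_slide[of i "Suc m" W "p 0" "Suc n"] by simp
  also have "\<dots> = c (Suc m) n i W \<cdot> p (Suc m) \<rhd> c (Suc n) 0 j W
       \<cdot> p (Suc m) \<rhd> sw (p 0) (p (Suc n)) W \<cdot> sw (p 0) (p (Suc m)) (p (Suc n) \<otimes> W)"
    using c_sequential[of i "Suc m" j "Suc n" W 0] by simp
  also have "\<dots> = c (Suc m) n i W \<cdot> p (Suc m) \<rhd> ins n j W \<cdot> sw (p 0) (p (Suc m)) (p (Suc n) \<otimes> W)"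
    by (simp add: ins_eq wh_Comp)
  finally show ?thesis .
qed

text \<open>The parallel axiom with two constants: filling the earlier input \<open>i\<close> first
  moves the later one from \<open>Suc j\<close> down to \<open>j\<close>, and the constants are used
  in the opposite order.\<close>

lemma ins_ins:
  assumes [simp]: "i \<le> j" "j \<le> n" "W \<in> Ob M"
  shows "ins n i W \<cdot> p 0 \<rhd> ins (Suc n) (Suc j) W
    = ins n j W \<cdot> p 0 \<rhd> ins (Suc n) i W \<cdot> sw (p 0) (p 0) (p (Suc (Suc n)) \<otimes> W)"
proof -
  have [simp]: "i \<le> n" "i \<le> Suc n" "Suc j < Suc (Suc n)" "j < Suc n"
    using assms(1,2) by linarith+
  have "ins n i W \<cdot> p 0 \<rhd> ins (Suc n) (Suc j) W
    = (ins n i W \<cdot> p 0 \<rhd> c (Suc (Suc n)) 0 (Suc j) W) \<cdot> p 0 \<rhd> sw (p 0) (p (Suc (Suc n))) W"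
    by (simp add: ins_eq[of "Suc j"] wh_Comp)
  also have "\<dots> = c (Suc n) 0 j W \<cdot> ins (Suc n) i (p 0 \<otimes> W) \<cdot> p 0 \<rhd> sw (p 0) (p (Suc (Suc n))) W"
    using ins_c_before[of i j n W 0] by simp
  also have "\<dots> = c (Suc n) 0 j W \<cdot> (ins (Suc n) i (p 0 \<otimes> W) \<cdot> p 0 \<rhd> sw (p 0) (p (Suc (Suc n))) W
      \<cdot> sw (p 0) (p 0) (p (Suc (Suc n)) \<otimes> W)) \<cdot> sw (p 0) (p 0) (p (Suc (Suc n)) \<otimes> W)"
    by simp
  also have "\<dots> = c (Suc n) 0 j W \<cdot> sw (p 0) (p (Suc n)) W \<cdot> p 0 \<rhd> ins (Suc n) i W \<cdot> sw (p 0) (p 0) (p (Suc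
    (Suc n)) \<otimes> W)"
    by (subst ins_slide[symmetric]) auto
  also have "\<dots> = ins n j W \<cdot> p 0 \<rhd> ins (Suc n) i W \<cdot> sw (p 0) (p 0) (p (Suc (Suc n)) \<otimes> W)"
    by (simp add: ins_eq[of j])
  finally show ?thesis .
qed

end

section \<open>Recording filled inputs by the coevaluation\<close>

context typed_smc begin

lemma whisker_swap:
  "f \<in> Ar M \<Longrightarrow> g \<in> Ar M \<Longrightarrow> Dom M f = X \<Longrightarrow> Cod M g = Y'
    \<Longrightarrow> (f \<boxtimes> Id M Y') \<cdot> X \<rhd> g = Cod M f \<rhd> g \<cdot> (f \<boxtimes> Id M (Dom M g))"
  by (rule tens_swap) auto

lemma counit_op_tail:
  assumes "e \<in> Ar M" "Dom M e = X \<otimes> Y" "Cod M e = unit M" "X \<in> Ob M" "Y \<in> Ob M" "h \<in> Ar M" "Cod M h = W'"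
  shows "counit_op e X Y W' \<cdot> X \<rhd> (Y \<rhd> h) = h \<cdot> counit_op e X Y (Dom M h)"
  using assms by (intro counit_op_natural) auto

lemma unit_op_tail:
  assumes "h \<in> Ar M" "Cod M h = X \<otimes> Y" "Dom M h = unit M" "X \<in> Ob M" "Y \<in> Ob M" "g \<in> Ar M" "Cod M g = W'"
  shows "unit_op h X Y W' \<cdot> g = X \<rhd> (Y \<rhd> g) \<cdot> unit_op h X Y (Dom M g)"
  using assms by (intro unit_op_natural) auto

end

context pointed_operad begin

abbreviation eV :: "'o \<Rightarrow> 'a" where "eV \<equiv> counit_op e (p 0) V"
abbreviation hD :: "'o \<Rightarrow> 'a" where "hD \<equiv> unit_op eta D (p 0)"

lemma
  assumes [simp]: "W \<in> Ob M"
  shows Ar_eV [simp]: "eV W \<in> Ar M"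
    and Dom_eV [simp]: "Dom M (eV W) = p 0 \<otimes> (V \<otimes> W)"
    and Cod_eV [simp]: "Cod M (eV W) = W"
    and Ar_hD [simp]: "hD W \<in> Ar M"
    and Dom_hD [simp]: "Dom M (hD W) = W"
    and Cod_hD [simp]: "Cod M (hD W) = D \<otimes> (p 0 \<otimes> W)"
  by (simp_all add: Ar_counit_op Dom_counit_op Cod_counit_op Ar_unit_op Dom_unit_op Cod_unit_op)

lemma eV_tail: "g \<in> Ar M \<Longrightarrow> Cod M g = W' \<Longrightarrow> eV W' \<cdot> p 0 \<rhd> (V \<rhd> g) = g \<cdot> eV (Dom M g)"
  by (rule counit_op_tail) auto

lemma hD_tail: "g \<in> Ar M \<Longrightarrow> Cod M g = W' \<Longrightarrow> hD W' \<cdot> g = D \<rhd> (p 0 \<rhd> g) \<cdot> hD (Dom M g)"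
  by (rule unit_op_tail) auto

lemma hD_slide: "U \<in> Ob M \<Longrightarrow> W \<in> Ob M \<Longrightarrow> Z = p 0 \<otimes> W
    \<Longrightarrow> sw U D Z \<cdot> U \<rhd> hD W = D \<rhd> sw (p 0) U W \<cdot> hD (U \<otimes> W)"
  by (simp add: unit_op_slide)

lemma eV_slide: "U \<in> Ob M \<Longrightarrow> W \<in> Ob M
    \<Longrightarrow> eV (U \<otimes> W) \<cdot> p 0 \<rhd> sw U V W = U \<rhd> eV W \<cdot> sw (p 0) U (V \<otimes> W)"
  by (simp add: counit_op_slide_left)

definition dl :: "nat \<Rightarrow> nat \<Rightarrow> 'o \<Rightarrow> 'a" where
  "dl n j W = D \<rhd> ins n j W \<cdot> hD (p (Suc n) \<otimes> W)"

lemma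
  assumes [simp]: "j \<le> n" "W \<in> Ob M"
  shows Ar_dl [simp]: "dl n j W \<in> Ar M"
    and Dom_dl [simp]: "Dom M (dl n j W) = p (Suc n) \<otimes> W"
    and Cod_dl [simp]: "Cod M (dl n j W) = D \<otimes> (p n \<otimes> W)"
  by (auto simp: dl_def)

lemma dl_tail:
  assumes [simp]: "j \<le> n" "g \<in> Ar M" "Cod M g = W'" "Z = p (Suc n)"
  shows "dl n j W' \<cdot> Z \<rhd> g = D \<rhd> (p n \<rhd> g) \<cdot> dl n j (Dom M g)"
proof -
  have [simp]: "W' \<in> Ob M" using Cod_Ob[of g] by simp
  have "dl n j W' \<cdot> Z \<rhd> g = D \<rhd> (ins n j W' \<cdot> p 0 \<rhd> (p (Suc n) \<rhd> g)) \<cdot> hD (p (Suc n) \<otimes> Dom M g)"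
    by (simp add: dl_def hD_tail wh_Comp)
  then show ?thesis by (simp add: ins_tail dl_def wh_Comp)
qed

lemma dl_c_before:
  assumes [simp]: "j \<le> i" "i \<le> m" "W \<in> Ob M"
  shows "dl (m + n) j W \<cdot> c (Suc (Suc m)) n (Suc i) W = D \<rhd> c (Suc m) n i W \<cdot> dl (Suc m) j (p n \<otimes> W)"
proof -
  have [simp]: "j \<le> m" "j \<le> m + n" "j \<le> Suc m" "i < Suc m" "i < Suc (Suc m)" using assms(1,2) by linarith+
  have "dl (m + n) j W \<cdot> c (Suc (Suc m)) n (Suc i) W
    = D \<rhd> (ins (m + n) j W \<cdot> p 0 \<rhd> c (Suc (Suc m)) n (Suc i) W) \<cdot> hD (p (Suc (Suc m)) \<otimes> (p n \<otimes> W))"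
    by (simp add: dl_def hD_tail wh_Comp)
  then show ?thesis by (simp add: ins_c_before dl_def wh_Comp)
qed

lemma dl_c_after:
  assumes [simp]: "i \<le> j" "j \<le> m" "W \<in> Ob M"
  shows "dl (Suc m) (Suc j) W \<cdot> c (Suc (Suc m)) (Suc 0) i W
    = D \<rhd> c (Suc m) (Suc 0) i W \<cdot> dl (Suc m) (Suc j) (p (Suc 0) \<otimes> W)"
proof -
  have [simp]: "i \<le> m" "i < Suc m" "i < Suc (Suc m)" using assms(1,2) by linarith+
  have "dl (Suc m) (Suc j) W \<cdot> c (Suc (Suc m)) (Suc 0) i W
    = D \<rhd> (ins (Suc m) (Suc j) W \<cdot> p 0 \<rhd> c (Suc (Suc m)) (Suc 0) i W) \<cdot> hD (p (Suc (Suc m)) \<otimes> (p (Suc 0) \<otimes> W))"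
    by (simp add: dl_def hD_tail wh_Comp)
  then show ?thesis by (simp add: ins_c_after dl_def wh_Comp)
qed

text \<open>On the right the dual element is created behind the outer operation, so it has to be
  carried past it; this is the swap.\<close>

lemma dl_c_inside:
  assumes [simp]: "i \<le> m" "j \<le> n" "W \<in> Ob M"
  shows "dl (m + n) (i + j) W \<cdot> c (Suc m) (Suc n) i W
    = D \<rhd> c (Suc m) n i W \<cdot> sw (p (Suc m)) D (p n \<otimes> W) \<cdot> p (Suc m) \<rhd> dl n j W"
proof -
  have [simp]: "i < Suc m" "j < Suc n" "i + j \<le> m + n" using assms(1,2) by linarith+
  have "dl (m + n) (i + j) W \<cdot> c (Suc m) (Suc n) i W
    = D \<rhd> (ins (m + n) (i + j) W \<cdot> p 0 \<rhd> c (Suc m) (Suc n) i W) \<cdot> hD (p (Suc m) \<otimes> (p (Suc n) \<otimes> W))"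
    by (simp add: dl_def hD_tail wh_Comp)
  also have "\<dots> = D \<rhd> c (Suc m) n i W \<cdot> D \<rhd> (p (Suc m) \<rhd> ins n j W)
      \<cdot> D \<rhd> sw (p 0) (p (Suc m)) (p (Suc n) \<otimes> W) \<cdot> hD (p (Suc m) \<otimes> (p (Suc n) \<otimes> W))"
    by (simp add: ins_c_inside wh_Comp)
  also have "\<dots> = D \<rhd> c (Suc m) n i W \<cdot> (D \<rhd> (p (Suc m) \<rhd> ins n j W)
      \<cdot> sw (p (Suc m)) D (p 0 \<otimes> (p (Suc n) \<otimes> W))) \<cdot> p (Suc m) \<rhd> hD (p (Suc n) \<otimes> W)"
    by (simp add: hD_slide)
  also have "\<dots> = D \<rhd> c (Suc m) n i W \<cdot> (sw (p (Suc m)) D (p n \<otimes> W)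
      \<cdot> p (Suc m) \<rhd> (D \<rhd> ins n j W)) \<cdot> p (Suc m) \<rhd> hD (p (Suc n) \<otimes> W)"
    by (simp add: sw_tail)
  finally show ?thesis by (simp add: dl_def wh_Comp)
qed

text \<open>By \<open>ins_ins\<close> the two orders of filling differ by a swap of the constants.
  The tensor square of the coevaluation is symmetric, so this may be traded for a swap of the
  recorded dual elements.\<close>

lemma dl_dl:
  assumes [simp]: "i \<le> j" "j \<le> n" "W \<in> Ob M"
  shows "D \<rhd> dl n i W \<cdot> dl (Suc n) (Suc j) W = sw D D (p n \<otimes> W) \<cdot> D \<rhd> dl n j W \<cdot> dl (Suc n) i W"
proof -
  have [simp]: "i \<le> n" "i \<le> Suc n" using assms(1,2) by linarith+
  let ?U = "p (Suc (Suc n)) \<otimes> W"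
  have 1: "D \<rhd> dl n i' W \<cdot> dl (Suc n) j' W
      = D \<rhd> (D \<rhd> (ins n i' W \<cdot> p 0 \<rhd> ins (Suc n) j' W)) \<cdot> D \<rhd> hD (p 0 \<otimes> ?U) \<cdot> hD ?U"
    if [simp]: "i' \<le> n" "j' \<le> Suc n" for i' j'
  proof -
    have "D \<rhd> hD (p (Suc n) \<otimes> W) \<cdot> D \<rhd> ins (Suc n) j' W
      = D \<rhd> (D \<rhd> (p 0 \<rhd> ins (Suc n) j' W)) \<cdot> D \<rhd> hD (p 0 \<otimes> ?U)"
      by (simp add: wh_Comp[symmetric] hD_tail)
    then have "D \<rhd> hD (p (Suc n) \<otimes> W) \<cdot> D \<rhd> ins (Suc n) j' W \<cdot> hD ?U
      = D \<rhd> (D \<rhd> (p 0 \<rhd> ins (Suc n) j' W)) \<cdot> D \<rhd> hD (p 0 \<otimes> ?U) \<cdot> hD ?U"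
      by (simp add: pre[of "D \<rhd> hD (p (Suc n) \<otimes> W)"])
    then show ?thesis by (simp add: dl_def wh_Comp)
  qed
  \<comment> \<open>Two cups are exchanged by sliding one across the other. Exchanging their
    constants is thus the same as exchanging their dual elements, which is fact
    \<open>2\<close>.\<close>
  have "D \<rhd> (sw (p 0) D (p 0 \<otimes> ?U) \<cdot> p 0 \<rhd> hD ?U) \<cdot> hD ?U
    = D \<rhd> (D \<rhd> sw (p 0) (p 0) ?U) \<cdot> D \<rhd> hD (p 0 \<otimes> ?U) \<cdot> hD ?U"
    by (simp add: hD_slide wh_Comp)
  also have "D \<rhd> (sw (p 0) D (p 0 \<otimes> ?U) \<cdot> p 0 \<rhd> hD ?U) \<cdot> hD ?U
    = D \<rhd> sw (p 0) D (p 0 \<otimes> ?U) \<cdot> D \<rhd> (p 0 \<rhd> hD ?U) \<cdot> hD ?U"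
    by (simp add: wh_Comp)
  also have "\<dots> = (D \<rhd> sw (p 0) D (p 0 \<otimes> ?U) \<cdot> hD (D \<otimes> (p 0 \<otimes> ?U))) \<cdot> hD ?U"
    by (simp add: hD_tail)
  also have "\<dots> = sw D D (p 0 \<otimes> (p 0 \<otimes> ?U)) \<cdot> D \<rhd> hD (p 0 \<otimes> ?U) \<cdot> hD ?U"
    by (simp add: hD_slide[symmetric])
  finally have 2: "D \<rhd> (D \<rhd> sw (p 0) (p 0) ?U) \<cdot> D \<rhd> hD (p 0 \<otimes> ?U) \<cdot> hD ?U
    = sw D D (p 0 \<otimes> (p 0 \<otimes> ?U)) \<cdot> D \<rhd> hD (p 0 \<otimes> ?U) \<cdot> hD ?U" by simp
  have "D \<rhd> dl n i W \<cdot> dl (Suc n) (Suc j) W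
     = D \<rhd> (D \<rhd> (ins n j W \<cdot> p 0 \<rhd> ins (Suc n) i W)) \<cdot> D \<rhd> (D \<rhd> sw (p 0) (p 0) ?U) \<cdot> D \<rhd> hD (p 0 \<otimes> ?U) \<cdot> hD ?U"
    by (subst 1) (auto simp: ins_ins wh_Comp)
  also have "\<dots> = (D \<rhd> (D \<rhd> (ins n j W \<cdot> p 0 \<rhd> ins (Suc n) i W)) \<cdot> sw D D (p 0 \<otimes> (p 0 \<otimes> ?U)))
    \<cdot> D \<rhd> hD (p 0 \<otimes> ?U) \<cdot> hD ?U"
    by (simp add: 2)
  also have "D \<rhd> (D \<rhd> (ins n j W \<cdot> p 0 \<rhd> ins (Suc n) i W)) \<cdot> sw D D (p 0 \<otimes> (p 0 \<otimes> ?U))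
    = sw D D (p n \<otimes> W) \<cdot> D \<rhd> (D \<rhd> (ins n j W \<cdot> p 0 \<rhd> ins (Suc n) i W))"
    by (subst sw_tail) auto
  finally show ?thesis by (simp add: 1)
qed

lemma dl_slide:
  assumes [simp]: "j \<le> n" "U \<in> Ob M" "W \<in> Ob M"
  shows "dl n j (U \<otimes> W) \<cdot> sw U (p (Suc n)) W = D \<rhd> sw U (p n) W \<cdot> sw U D (p n \<otimes> W) \<cdot> U \<rhd> dl n j W"
proof -
  have "sw U D (p n \<otimes> W) \<cdot> U \<rhd> dl n j W = (sw U D (p n \<otimes> W) \<cdot> U \<rhd> (D \<rhd> ins n j W)) \<cdot> U \<rhd> hD (p (Suc n) \<otimes> W)"
    by (simp add: dl_def wh_Comp)
  also have "\<dots> = D \<rhd> (U \<rhd> ins n j W) \<cdot> sw U D (p 0 \<otimes> (p (Suc n) \<otimes> W)) \<cdot> U \<rhd> hD (p (Suc n) \<otimes> W)"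
    by (simp add: sw_tail)
  also have "\<dots> = D \<rhd> (U \<rhd> ins n j W) \<cdot> D \<rhd> sw (p 0) U (p (Suc n) \<otimes> W) \<cdot> hD (U \<otimes> (p (Suc n) \<otimes> W))"
    by (simp add: hD_slide)
  finally have "D \<rhd> sw U (p n) W \<cdot> sw U D (p n \<otimes> W) \<cdot> U \<rhd> dl n j W
     = D \<rhd> (sw U (p n) W \<cdot> U \<rhd> ins n j W) \<cdot> D \<rhd> sw (p 0) U (p (Suc n) \<otimes> W) \<cdot> hD (U \<otimes> (p (Suc n) \<otimes> W))"
    by (simp add: wh_Comp)
  also have "\<dots> = D \<rhd> ins n j (U \<otimes> W) \<cdot> D \<rhd> (p 0 \<rhd> sw U (p (Suc n)) W) \<cdot> hD (U \<otimes> (p (Suc n) \<otimes> W))"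
    by (simp add: ins_slide wh_Comp)
  also have "\<dots> = dl n j (U \<otimes> W) \<cdot> sw U (p (Suc n)) W"
    by (simp add: dl_def hD_tail)
  finally show ?thesis by simp
qed

text \<open>The zigzag identity: pairing a constant with the record of a filled input amounts to
  filling the input with that constant.\<close>

lemma eV_dl:
  assumes [simp]: "j \<le> n" "W \<in> Ob M"
  shows "eV (p n \<otimes> W) \<cdot> p 0 \<rhd> (io \<boxtimes> Id M (p n \<otimes> W)) \<cdot> p 0 \<rhd> dl n j W = ins n j W"
proof -
  let ?U = "p (Suc n) \<otimes> W"
  have "p 0 \<rhd> (io \<boxtimes> Id M (p n \<otimes> W)) \<cdot> p 0 \<rhd> (D \<rhd> ins n j W)
    = p 0 \<rhd> (V \<rhd> ins n j W) \<cdot> p 0 \<rhd> (io \<boxtimes> Id M (p 0 \<otimes> ?U))"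
    by (simp add: wh_Comp[symmetric] tens_swap)
  then have "eV (p n \<otimes> W) \<cdot> p 0 \<rhd> (io \<boxtimes> Id M (p n \<otimes> W)) \<cdot> p 0 \<rhd> dl n j W
    = (eV (p n \<otimes> W) \<cdot> p 0 \<rhd> (V \<rhd> ins n j W)) \<cdot> p 0 \<rhd> (io \<boxtimes> Id M (p 0 \<otimes> ?U)) \<cdot> p 0 \<rhd> hD ?U"
    by (simp add: dl_def wh_Comp pre[of "p 0 \<rhd> (io \<boxtimes> Id M (p n \<otimes> W))"])
  also have "\<dots> = ins n j W \<cdot> eV (p 0 \<otimes> ?U) \<cdot> p 0 \<rhd> (io \<boxtimes> Id M (p 0 \<otimes> ?U)) \<cdot> p 0 \<rhd> hD ?U"
    by (subst eV_tail) auto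
  also have "\<dots> = ins n j W"
    by (simp add: zigzag)
  finally show ?thesis .
qed

definition dv :: "nat \<Rightarrow> nat \<Rightarrow> 'o \<Rightarrow> 'a" where
  "dv n j W = (io \<boxtimes> Id M (p n \<otimes> W)) \<cdot> dl n j W"

lemma
  assumes [simp]: "j \<le> n" "W \<in> Ob M"
  shows Ar_dv [simp]: "dv n j W \<in> Ar M"
    and Dom_dv [simp]: "Dom M (dv n j W) = p (Suc n) \<otimes> W"
    and Cod_dv [simp]: "Cod M (dv n j W) = V \<otimes> (p n \<otimes> W)"
  by (auto simp: dv_def)

lemma eV_dv: "j \<le> n \<Longrightarrow> W \<in> Ob M \<Longrightarrow> eV (p n \<otimes> W) \<cdot> p 0 \<rhd> dv n j W = ins n j W"
  by (simp add: dv_def wh_Comp eV_dl)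

lemma dv_tail:
  assumes [simp]: "j \<le> n" "g \<in> Ar M" "Cod M g = W'" "Z = p (Suc n)"
  shows "dv n j W' \<cdot> Z \<rhd> g = V \<rhd> (p n \<rhd> g) \<cdot> dv n j (Dom M g)"
proof -
  have [simp]: "W' \<in> Ob M" using Cod_Ob[of g] by simp
  show ?thesis
    by (simp add: dv_def dl_tail pre[OF whisker_swap[of io]])
qed

lemma dv_c_before:
  assumes [simp]: "j \<le> i" "i \<le> m" "W \<in> Ob M"
  shows "dv (m + n) j W \<cdot> c (Suc (Suc m)) n (Suc i) W = V \<rhd> c (Suc m) n i W \<cdot> dv (Suc m) j (p n \<otimes> W)"
proof -
  have [simp]: "j \<le> m" "j \<le> m + n" "j \<le> Suc m" "i < Suc m" "i < Suc (Suc m)" using assms(1,2) by linarith+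
  show ?thesis
    by (simp add: dv_def dl_c_before pre[OF whisker_swap[of io]])
qed

lemma dv_c_after:
  assumes [simp]: "i \<le> j" "j \<le> m" "W \<in> Ob M"
  shows "dv (Suc m) (Suc j) W \<cdot> c (Suc (Suc m)) (Suc 0) i W
    = V \<rhd> c (Suc m) (Suc 0) i W \<cdot> dv (Suc m) (Suc j) (p (Suc 0) \<otimes> W)"
proof -
  have [simp]: "i \<le> m" "i < Suc m" "i < Suc (Suc m)" using assms(1,2) by linarith+
  show ?thesis
    by (simp add: dv_def dl_c_after pre[OF whisker_swap[of io]])
qed

lemma dv_c_inside:
  assumes [simp]: "i \<le> m" "j \<le> n" "W \<in> Ob M"
  shows "dv (m + n) (i + j) W \<cdot> c (Suc m) (Suc n) i W
    = V \<rhd> c (Suc m) n i W \<cdot> sw (p (Suc m)) V (p n \<otimes> W) \<cdot> p (Suc m) \<rhd> dv n j W"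
proof -
  have [simp]: "i < Suc m" "j < Suc n" "i + j \<le> m + n" using assms(1,2) by linarith+
  show ?thesis
    by (simp add: dv_def dl_c_inside wh_Comp pre[OF sw_second[of io]] pre[OF whisker_swap[of io]])
qed

lemma dv_dv:
  assumes [simp]: "i \<le> j" "j \<le> n" "W \<in> Ob M"
  shows "V \<rhd> dv n i W \<cdot> dv (Suc n) (Suc j) W = sw V V (p n \<otimes> W) \<cdot> V \<rhd> dv n j W \<cdot> dv (Suc n) i W"
proof -
  have [simp]: "i \<le> n" "i \<le> Suc n" using assms(1,2) by linarith+
  have 1: "V \<rhd> dv n i' W \<cdot> dv (Suc n) j' W
     = (io \<boxtimes> (io \<boxtimes> Id M (p n \<otimes> W))) \<cdot> D \<rhd> dl n i' W \<cdot> dl (Suc n) j' W"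
    if [simp]: "i' \<le> n" "j' \<le> Suc n" for i' j'
  proof -
    have "V \<rhd> dv n i' W \<cdot> (io \<boxtimes> Id M (p (Suc n) \<otimes> W)) = io \<boxtimes> dv n i' W"
      by (simp add: tens_Comp_tens)
    also have "\<dots> = (io \<boxtimes> (io \<boxtimes> Id M (p n \<otimes> W))) \<cdot> D \<rhd> dl n i' W"
      by (simp add: tens_Comp_tens dv_def)
    finally show ?thesis
      by (simp add: dv_def[of "Suc n"] pre[of "V \<rhd> dv n i' W"])
  qed
  have "sw V V (p n \<otimes> W) \<cdot> V \<rhd> dv n j W \<cdot> dv (Suc n) i W
     = (sw V V (p n \<otimes> W) \<cdot> (io \<boxtimes> (io \<boxtimes> Id M (p n \<otimes> W)))) \<cdot> D \<rhd> dl n j W \<cdot> dl (Suc n) i W"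
    by (simp add: 1)
  also have "\<dots> = (io \<boxtimes> (io \<boxtimes> Id M (p n \<otimes> W))) \<cdot> sw D D (p n \<otimes> W) \<cdot> D \<rhd> dl n j W \<cdot> dl (Suc n) i W"
    by (subst sw_natural[where X = D and Y = D and W = "p n \<otimes> W"]) auto
  also have "\<dots> = V \<rhd> dv n i W \<cdot> dv (Suc n) (Suc j) W"
    by (simp add: 1 dl_dl)
  finally show ?thesis by simp
qed

lemma dv_slide:
  assumes [simp]: "j \<le> n" "U \<in> Ob M" "W \<in> Ob M"
  shows "dv n j (U \<otimes> W) \<cdot> sw U (p (Suc n)) W = V \<rhd> sw U (p n) W \<cdot> sw U V (p n \<otimes> W) \<cdot> U \<rhd> dv n j W"
  by (simp add: dv_def wh_Comp dl_slide pre[OF whisker_swap[of io]]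
      pre[OF sw_second[of io]])

end

section \<open>The coaction\<close>

text \<open>\<open>V\<close> is a sum of \<open>D\<close>, on which \<open>e\<close> is the pairing and the action \<open>a\<close> of \<open>P(1)\<close> vanishes, and of a
  summand on which \<open>e\<close> vanishes and \<open>a\<close> is a module structure.\<close>

locale truncated_action = pointed_operad M P V D e eta io + additive_smc M pl nul
  for M :: "('o, 'a, 'm) smcat_scheme" (structure) and P V D e eta io
    and pl (infixl "\<oplus>\<oplus>" 60) and nul +
  fixes a :: 'a
  assumes a [simp]: "a \<in> Ar M" "Dom M a = arity P (Suc 0) \<otimes> V" "Cod M a = V"
    and a_io: "a \<cdot> arity P (Suc 0) \<rhd> io = nul (arity P (Suc 0) \<otimes> D) V"
    and eV_a: "W \<in> Ob M \<Longrightarrow> counit_op e (arity P 0) V W \<cdot> arity P 0 \<rhd> l2 a (arity P (Suc 0)) V W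
        = nul (arity P 0 \<otimes> (arity P (Suc 0) \<otimes> (V \<otimes> W))) W"
    and a_a: "W \<in> Ob M \<Longrightarrow> l2 a (arity P (Suc 0)) V W \<cdot> l2 (pcomp P (Suc 0) (Suc 0) 0) (arity P (Suc 0))
      (arity P (Suc 0)) (V \<otimes> W)
      = l2 a (arity P (Suc 0)) V W \<cdot> arity P (Suc 0) \<rhd> l2 a (arity P (Suc 0)) V W
        \<cdot> sw (arity P (Suc 0)) (arity P (Suc 0)) (V \<otimes> W)"
begin

abbreviation aV :: "'o \<Rightarrow> 'a" where "aV \<equiv> l2 a (p (Suc 0)) V"

text \<open>The swap reflects that coactions compose in reverse: a composite of unary operations
  lets the outer one act first and the inner one second.\<close>

lemma a_a': "W \<in> Ob M \<Longrightarrow> aV W \<cdot> c (Suc 0) (Suc 0) 0 (V \<otimes> W)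
      = aV W \<cdot> p (Suc 0) \<rhd> aV W \<cdot> sw (p (Suc 0)) (p (Suc 0)) (V \<otimes> W)"
  using a_a by (simp add: c_def)

text \<open>\<open>tpow\<close> with an arbitrary tail in place of the unit.\<close>

primrec pw :: "nat \<Rightarrow> 'o \<Rightarrow> 'o" where
  "pw 0 W = W"
| "pw (Suc n) W = V \<otimes> pw n W"

lemma pw_Ob [simp]: "W \<in> Ob M \<Longrightarrow> pw n W \<in> Ob M"
  by (induction n) auto

lemma pw_pw [simp]: "pw n (pw m W) = pw (n + m) W"
  by (induction n) auto

text \<open>\<open>T n\<close> fills all inputs of an operation but the first and lets the resulting unary operation act
  on the last argument. \<open>\<Delta> n\<close> is the sum of the term that fills all inputs and pairs with \<open>e\<close>, and of
  the \<open>n\<close> terms that leave one input open; the recursion splits off the first input.\<close>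

primrec T :: "nat \<Rightarrow> 'o \<Rightarrow> 'a" where
  "T 0 W = aV W"
| "T (Suc n) W = sw V V (pw n W) \<cdot> V \<rhd> T n W \<cdot> dv (Suc n) 1 (V \<otimes> W)"

lemma T_typing: "W \<in> Ob M \<Longrightarrow> T n W \<in> Ar M \<and> Dom M (T n W) = p (Suc n) \<otimes> (V \<otimes> W) \<and> Cod M (T n W) = V \<otimes> pw n W"
  by (induction n) auto

lemma
  assumes [simp]: "W \<in> Ob M"
  shows Ar_T [simp]: "T n W \<in> Ar M"
    and Dom_T [simp]: "Dom M (T n W) = p (Suc n) \<otimes> (V \<otimes> W)"
    and Cod_T [simp]: "Cod M (T n W) = V \<otimes> pw n W"
  using T_typing by auto

primrec \<Delta> :: "nat \<Rightarrow> 'o \<Rightarrow> 'a" where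
  "\<Delta> 0 W = eV W"
| "\<Delta> (Suc n) W = (V \<rhd> \<Delta> n W \<cdot> dv n 0 (V \<otimes> W)) \<oplus>\<oplus> T n W"

lemma \<Delta>_typing: "W \<in> Ob M \<Longrightarrow> \<Delta> n W \<in> Ar M \<and> Dom M (\<Delta> n W) = p n \<otimes> (V \<otimes> W) \<and> Cod M (\<Delta> n W) = pw n W"
  by (induction n) auto

lemma
  assumes [simp]: "W \<in> Ob M"
  shows Ar_\<Delta> [simp]: "\<Delta> n W \<in> Ar M"
    and Dom_\<Delta> [simp]: "Dom M (\<Delta> n W) = p n \<otimes> (V \<otimes> W)"
    and Cod_\<Delta> [simp]: "Cod M (\<Delta> n W) = pw n W"
  using \<Delta>_typing by auto

text \<open>The counterpart of \<open>ev_at\<close> with a tail: the operation is carried past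
  \<open>i\<close> factors and then acts by \<open>\<Delta>\<close>.\<close>

fun at_slot :: "nat \<Rightarrow> nat \<Rightarrow> nat \<Rightarrow> 'o \<Rightarrow> 'a" where
  "at_slot n 0 m W = \<Delta> n (pw (m - 1) W)"
| "at_slot n (Suc i) m W = V \<rhd> at_slot n i (m - 1) W \<cdot> sw (p n) V (pw (m - 1) W)"

lemma at_slot_typing:
  "W \<in> Ob M \<Longrightarrow> i \<le> m \<Longrightarrow> at_slot n i (Suc m) W \<in> Ar M \<and> Dom M (at_slot n i (Suc m) W) = p n \<otimes> (V \<otimes> pw m W)
    \<and> Cod M (at_slot n i (Suc m) W) = pw (n + m) W"
proof (induction i arbitrary: m)
  case (Suc i)
  then obtain m' where "m = Suc m'" by (cases m) auto
  with Suc show ?case by simp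
qed auto

lemma
  assumes "W \<in> Ob M" "i \<le> m"
  shows Ar_at_slot [simp]: "at_slot n i (Suc m) W \<in> Ar M"
    and Dom_at_slot [simp]: "Dom M (at_slot n i (Suc m) W) = p n \<otimes> (V \<otimes> pw m W)"
    and Cod_at_slot [simp]: "Cod M (at_slot n i (Suc m) W) = pw (n + m) W"
  using at_slot_typing[OF assms] by auto

text \<open>\<open>T\<close> fills inputs and finally applies \<open>a\<close> to its argument, and
  \<open>a\<close> vanishes on D by \<open>a_io\<close>.\<close>

lemma T_io:
  "W \<in> Ob M \<Longrightarrow> T n W \<cdot> p (Suc n) \<rhd> (io \<boxtimes> Id M W) = nul (p (Suc n) \<otimes> (D \<otimes> W)) (V \<otimes> pw n W)"
proof (induction n)
  case 0
  then show ?case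
    using l2_dom[of a "p (Suc 0)" V "Id M (p (Suc 0))" io "p (Suc 0)" D W]
    by (simp add: a_io) (simp add: l2_def)
next
  case (Suc n)
  have "T (Suc n) W \<cdot> p (Suc (Suc n)) \<rhd> (io \<boxtimes> Id M W)
    = sw V V (pw n W) \<cdot> V \<rhd> (T n W \<cdot> p (Suc n) \<rhd> (io \<boxtimes> Id M W)) \<cdot> dv (Suc n) 1 (D \<otimes> W)"
    using Suc.prems by (simp add: dv_tail wh_Comp)
  then show ?case
    using Suc by simp
qed

text \<open>The first output factor of \<open>T\<close> is a value of \<open>a\<close>, which every
  constant kills by \<open>eV_a\<close>. In the induction \<open>eV_slide\<close> carries the
  pairing past the swap that keeps this factor in front.\<close>

lemma eV_T: "W \<in> Ob M \<Longrightarrow> eV (pw m W) \<cdot> p 0 \<rhd> T m W = nul (p 0 \<otimes> (p (Suc m) \<otimes> (V \<otimes> W))) (pw m W)"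
proof (induction m)
  case 0
  then show ?case by (simp add: eV_a)
next
  case (Suc m)
  note [simp] = Suc.prems
  have "eV (pw (Suc m) W) \<cdot> p 0 \<rhd> T (Suc m) W
    = (eV (V \<otimes> pw m W) \<cdot> p 0 \<rhd> sw V V (pw m W)) \<cdot> p 0 \<rhd> (V \<rhd> T m W) \<cdot> p 0 \<rhd> dv (Suc m) 1 (V \<otimes> W)"
    by (simp add: wh_Comp)
  also have "\<dots> = V \<rhd> eV (pw m W) \<cdot> (sw (p 0) V (V \<otimes> pw m W) \<cdot> p 0 \<rhd> (V \<rhd> T m W)) \<cdot> p 0 \<rhd> dv (Suc m) 1 (V \<otimes> W)"
    by (subst eV_slide) auto
  also have "\<dots> = V \<rhd> (eV (pw m W) \<cdot> p 0 \<rhd> T m W) \<cdot> sw (p 0) V (p (Suc m) \<otimes> (V \<otimes> W)) \<cdot> p 0 \<rhd> dv (Suc m) 1 (V \<otimes> W)"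
    by (subst sw_tail) (auto simp: wh_Comp)
  finally show ?case
    by (simp add: Suc.IH)
qed

text \<open>Makes visible that the factor right behind the open one is a recorded element of
  D.\<close>

lemma T_Suc_io:
  assumes [simp]: "W \<in> Ob M"
  shows "T (Suc m) W = V \<rhd> (io \<boxtimes> Id M (pw m W)) \<cdot> sw D V (pw m W) \<cdot> D \<rhd> T m W \<cdot> dl (Suc m) 1 (V \<otimes> W)"
proof -
  let ?U = "V \<otimes> pw m W"
  have "T (Suc m) W = sw V V (pw m W) \<cdot> (V \<rhd> T m W \<cdot> (io \<boxtimes> Id M (p (Suc m) \<otimes> (V \<otimes> W)))) \<cdot> dl (Suc m) 1 (V \<otimes> W)"
    by (simp add: dv_def)
  also have "\<dots> = (sw V V (pw m W) \<cdot> (io \<boxtimes> Id M ?U)) \<cdot> D \<rhd> T m W \<cdot> dl (Suc m) 1 (V \<otimes> W)"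
    by (subst tens_swap[symmetric, where X = D and Y' = ?U]) auto
  also have "\<dots> = V \<rhd> (io \<boxtimes> Id M (pw m W)) \<cdot> sw D V (pw m W) \<cdot> D \<rhd> T m W \<cdot> dl (Suc m) 1 (V \<otimes> W)"
    by (subst sw_first) auto
  finally show ?thesis .
qed

text \<open>A second operation with an open input would act on a recorded factor. That factor lies
  in D by \<open>T_Suc_io\<close>, where \<open>T_io\<close> gives zero. Hence two factors never lie
  in H at once.\<close>

lemma T_T_other:
  assumes [simp]: "W \<in> Ob M"
  shows "V \<rhd> T n (pw m W) \<cdot> sw (p (Suc n)) V (V \<otimes> pw m W) \<cdot> p (Suc n) \<rhd> T (Suc m) W
    = nul (p (Suc n) \<otimes> (p (Suc (Suc m)) \<otimes> (V \<otimes> W))) (V \<otimes> (V \<otimes> pw (n + m) W))"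
proof -
  let ?U = "pw m W" and ?q = "p (Suc n)"
  have "V \<rhd> T n ?U \<cdot> sw ?q V (V \<otimes> ?U) \<cdot> ?q \<rhd> T (Suc m) W
     = V \<rhd> T n ?U \<cdot> (sw ?q V (V \<otimes> ?U) \<cdot> ?q \<rhd> (V \<rhd> (io \<boxtimes> Id M (pw m W))))
       \<cdot> ?q \<rhd> (sw D V (pw m W) \<cdot> D \<rhd> T m W \<cdot> dl (Suc m) 1 (V \<otimes> W))"
    by (simp add: T_Suc_io wh_Comp del: T.simps)
  also have "\<dots> = V \<rhd> (T n ?U \<cdot> ?q \<rhd> (io \<boxtimes> Id M (pw m W))) \<cdot> sw ?q V (D \<otimes> ?U)
       \<cdot> ?q \<rhd> (sw D V (pw m W) \<cdot> D \<rhd> T m W \<cdot> dl (Suc m) 1 (V \<otimes> W))"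
    by (subst sw_tail) (auto simp: wh_Comp)
  finally show ?thesis
    by (simp add: T_io)
qed

text \<open>Here the first factor comes from \<open>dv\<close>, so it lies in D and
  \<open>T_io\<close> applies.\<close>

lemma T_D_first:
  assumes [simp]: "W \<in> Ob M"
  shows "T n (pw m W) \<cdot> p (Suc n) \<rhd> (V \<rhd> \<Delta> m W) \<cdot> p (Suc n) \<rhd> dv m 0 (V \<otimes> W)
    = nul (p (Suc n) \<otimes> (p (Suc m) \<otimes> (V \<otimes> W))) (V \<otimes> pw (n + m) W)"
proof -
  let ?q = "p (Suc n)"
  have "T n (pw m W) \<cdot> ?q \<rhd> (V \<rhd> \<Delta> m W) \<cdot> ?q \<rhd> dv m 0 (V \<otimes> W)
    = T n (pw m W) \<cdot> ?q \<rhd> (V \<rhd> \<Delta> m W \<cdot> (io \<boxtimes> Id M (p m \<otimes> (V \<otimes> W)))) \<cdot> ?q \<rhd> dl m 0 (V \<otimes> W)"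
    by (simp add: dv_def wh_Comp)
  also have "\<dots> = (T n (pw m W) \<cdot> ?q \<rhd> (io \<boxtimes> Id M (pw m W))) \<cdot> ?q \<rhd> (D \<rhd> \<Delta> m W) \<cdot> ?q \<rhd> dl m 0 (V \<otimes> W)"
    by (subst tens_swap[symmetric, where X = D and Y' = "pw m W"]) (auto simp: wh_Comp)
  finally show ?thesis
    by (simp add: T_io)
qed

text \<open>Filling all inputs of \<open>\<mu> \<circ>\<^sub>0 \<nu>\<close> but the first one lets the filled \<open>\<mu>\<close> act first and the filled
  \<open>\<nu>\<close> second.\<close>

lemma T_c_first:
  "W \<in> Ob M \<Longrightarrow> T (m + n) W \<cdot> c (Suc m) (Suc n) 0 (V \<otimes> W)
    = T n (pw m W) \<cdot> p (Suc n) \<rhd> T m W \<cdot> sw (p (Suc m)) (p (Suc n)) (V \<otimes> W)"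
proof (induction n)
  case 0
  note [simp] = 0
  show ?case
  \<comment> \<open>With a unary inner operation only the later inputs of the outer one are left to
    be filled; \<open>dv_c_after\<close> peels them off.\<close>
  proof (induction m)
    case 0
    then show ?case by (simp add: a_a')
  next
    case (Suc m)
    let ?q = "p (Suc 0)" and ?p = "p (Suc m)" and ?P = "p (Suc (Suc m))"
    have "T (Suc m + 0) W \<cdot> c (Suc (Suc m)) (Suc 0) 0 (V \<otimes> W)
      = sw V V (pw m W) \<cdot> V \<rhd> T m W \<cdot> dv (Suc m) (Suc 0) (V \<otimes> W) \<cdot> c (Suc (Suc m)) (Suc 0) 0 (V \<otimes> W)"
      by simp
    also have "\<dots> = sw V V (pw m W) \<cdot> V \<rhd> (T (m + 0) W \<cdot> c (Suc m) (Suc 0) 0 (V \<otimes> W))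
      \<cdot> dv (Suc m) (Suc 0) (?q \<otimes> (V \<otimes> W))"
      by (simp add: dv_c_after wh_Comp)
    also have "\<dots> = sw V V (pw m W) \<cdot> V \<rhd> aV (pw m W) \<cdot> V \<rhd> (?q \<rhd> T m W)
        \<cdot> V \<rhd> sw ?p ?q (V \<otimes> W) \<cdot> dv (Suc m) (Suc 0) (?q \<otimes> (V \<otimes> W))"
      by (subst Suc) (simp add: wh_Comp)
    also have "\<dots> = sw V V (pw m W) \<cdot> V \<rhd> aV (pw m W) \<cdot> V \<rhd> (?q \<rhd> T m W)
        \<cdot> V \<rhd> sw ?p ?q (V \<otimes> W) \<cdot> (dv (Suc m) (Suc 0) (?q \<otimes> (V \<otimes> W)) \<cdot> sw ?q ?P (V \<otimes> W)) \<cdot> sw ?P ?q (V \<otimes> W)"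
      by simp
    also have "\<dots> = sw V V (pw m W) \<cdot> V \<rhd> aV (pw m W) \<cdot> (V \<rhd> (?q \<rhd> T m W)
        \<cdot> sw ?q V (?p \<otimes> (V \<otimes> W))) \<cdot> ?q \<rhd> dv (Suc m) (Suc 0) (V \<otimes> W) \<cdot> sw ?P ?q (V \<otimes> W)"
      by (subst dv_slide) auto
    also have "\<dots> = sw V V (pw m W) \<cdot> V \<rhd> aV (pw m W) \<cdot> (sw ?q V (V \<otimes> pw m W)
        \<cdot> ?q \<rhd> (V \<rhd> T m W)) \<cdot> ?q \<rhd> dv (Suc m) (Suc 0) (V \<otimes> W) \<cdot> sw ?P ?q (V \<otimes> W)"
      by (simp add: sw_tail)
    also have "\<dots> = (sw V V (pw m W) \<cdot> V \<rhd> aV (pw m W) \<cdot> sw ?q V (V \<otimes> pw m W))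
        \<cdot> ?q \<rhd> (V \<rhd> T m W) \<cdot> ?q \<rhd> dv (Suc m) (Suc 0) (V \<otimes> W) \<cdot> sw ?P ?q (V \<otimes> W)"
      by simp
    also have "sw V V (pw m W) \<cdot> V \<rhd> aV (pw m W) \<cdot> sw ?q V (V \<otimes> pw m W) = aV (V \<otimes> pw m W) \<cdot> ?q \<rhd> sw V V (pw m W)"
      using pre1[OF l2_slide_left[of a ?q V V "pw m W" V], of "sw ?q V (V \<otimes> pw m W)"] by simp
    finally show ?case by (simp add: wh_Comp)
  qed
next
  case (Suc n)
  note [simp] = Suc.prems
  let ?q = "p (Suc n)" and ?Q = "p (Suc (Suc n))" and ?P = "p (Suc m)"
  \<comment> \<open>Input 1 of the composite is input 1 of the inner operation; it is written
    \<open>0 + Suc 0\<close> to match \<open>dv_c_inside\<close>.\<close>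
  have "T (m + Suc n) W \<cdot> c (Suc m) (Suc (Suc n)) 0 (V \<otimes> W)
    = sw V V (pw (m + n) W) \<cdot> V \<rhd> T (m + n) W \<cdot> dv (m + Suc n) (0 + Suc 0) (V \<otimes> W) \<cdot> c (Suc m) (Suc (Suc n))
      0 (V \<otimes> W)"
    by simp
  also have "\<dots> = sw V V (pw (m + n) W) \<cdot> V \<rhd> (T (m + n) W \<cdot> c (Suc m) (Suc n) 0 (V \<otimes> W))
     \<cdot> sw ?P V (?q \<otimes> (V \<otimes> W)) \<cdot> ?P \<rhd> dv (Suc n) (Suc 0) (V \<otimes> W)"
    by (subst dv_c_inside) (auto simp: wh_Comp)
  also have "\<dots> = sw V V (pw (m + n) W) \<cdot> V \<rhd> T n (pw m W) \<cdot> V \<rhd> (?q \<rhd> T m W) \<cdot> V \<rhd> sw ?P ?q (V \<otimes> W)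
     \<cdot> sw ?P V (?q \<otimes> (V \<otimes> W)) \<cdot> ?P \<rhd> dv (Suc n) (Suc 0) (V \<otimes> W)"
    by (subst Suc.IH) (auto simp: wh_Comp add.commute)
  also have "\<dots> = sw V V (pw (m + n) W) \<cdot> V \<rhd> T n (pw m W) \<cdot> (V \<rhd> (?q \<rhd> T m W)
     \<cdot> dv (Suc n) (Suc 0) (?P \<otimes> (V \<otimes> W))) \<cdot> sw ?P ?Q (V \<otimes> W)"
    by (simp add: dv_slide)
  also have "\<dots> = sw V V (pw (m + n) W) \<cdot> V \<rhd> T n (pw m W) \<cdot> dv (Suc n) (Suc 0) (V \<otimes> pw m W) \<cdot> ?Q \<rhd> T m W
     \<cdot> sw ?P ?Q (V \<otimes> W)"
    by (simp add: dv_tail pre[OF dv_tail])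
  finally show ?case
    by (simp add: add.commute)
qed

text \<open>The open input belongs to the outer operation, so all inputs of the inner one get
  filled. On the right the inner operation acts by \<open>\<Delta>\<close> on a recorded element of
  D, where the terms with an open input vanish by \<open>T_T_other\<close>. For a constant this is
  the zigzag in the form \<open>eV_dv\<close>.\<close>

lemma T_c_Suc_0:
  "W \<in> Ob M \<Longrightarrow> T (m + n) W \<cdot> c (Suc (Suc m)) n (Suc 0) (V \<otimes> W)
    = V \<rhd> \<Delta> n (pw m W) \<cdot> sw (p n) V (V \<otimes> pw m W) \<cdot> p n \<rhd> T (Suc m) W \<cdot> sw (p (Suc (Suc m))) (p n) (V \<otimes> W)"
proof (induction n)
  case 0
  note [simp] = 0
  let ?k = "p 0" and ?P = "p (Suc (Suc m))"
  have "V \<rhd> eV (pw m W) \<cdot> sw ?k V (V \<otimes> pw m W) \<cdot> ?k \<rhd> T (Suc m) W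
    = (V \<rhd> eV (pw m W) \<cdot> sw ?k V (V \<otimes> pw m W)) \<cdot> ?k \<rhd> sw V V (pw m W) \<cdot> ?k \<rhd> (V \<rhd> T m W) \<cdot> ?k \<rhd> dv (Suc m) 1 (V \<otimes> W)"
    by (simp add: wh_Comp)
  also have "\<dots> = (eV (V \<otimes> pw m W) \<cdot> ?k \<rhd> (V \<rhd> T m W)) \<cdot> ?k \<rhd> dv (Suc m) 1 (V \<otimes> W)"
    by (subst eV_slide[symmetric]) auto
  also have "\<dots> = T m W \<cdot> eV (p (Suc m) \<otimes> (V \<otimes> W)) \<cdot> ?k \<rhd> dv (Suc m) 1 (V \<otimes> W)"
    by (subst eV_tail) auto
  also have "\<dots> = T m W \<cdot> ins (Suc m) 1 (V \<otimes> W)"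
    by (simp add: eV_dv)
  finally have "(V \<rhd> eV (pw m W) \<cdot> sw ?k V (V \<otimes> pw m W) \<cdot> ?k \<rhd> T (Suc m) W) \<cdot> sw ?P ?k (V \<otimes> W)
     = T m W \<cdot> ins (Suc m) 1 (V \<otimes> W) \<cdot> sw ?P ?k (V \<otimes> W)"
    by simp
  then show ?case by (simp add: ins_eq)
next
  case (Suc n)
  note [simp] = Suc.prems
  let ?q = "p n" and ?Q = "p (Suc n)" and ?P = "p (Suc (Suc m))" and ?U = "V \<otimes> pw m W"
  have "T (m + Suc n) W \<cdot> c (Suc (Suc m)) (Suc n) (Suc 0) (V \<otimes> W)
    = sw V V (pw (m + n) W) \<cdot> V \<rhd> T (m + n) W \<cdot> dv (Suc m + n) (Suc 0 + 0) (V \<otimes> W) \<cdot> c (Suc (Suc m)) (Suc n)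
      (Suc 0) (V \<otimes> W)"
    by simp
  also have "\<dots> = sw V V (pw (m + n) W) \<cdot> V \<rhd> (T (m + n) W \<cdot> c (Suc (Suc m)) n (Suc 0) (V \<otimes> W))
     \<cdot> sw ?P V (?q \<otimes> (V \<otimes> W)) \<cdot> ?P \<rhd> dv n 0 (V \<otimes> W)"
    by (subst dv_c_inside) (auto simp: wh_Comp)
  also have "\<dots> = sw V V (pw (m + n) W) \<cdot> V \<rhd> (V \<rhd> \<Delta> n (pw m W)) \<cdot> V \<rhd> sw ?q V ?U \<cdot> V \<rhd> (?q \<rhd> T (Suc m) W)
    \<cdot> V \<rhd> sw ?P ?q (V \<otimes> W)
     \<cdot> sw ?P V (?q \<otimes> (V \<otimes> W)) \<cdot> ?P \<rhd> dv n 0 (V \<otimes> W)"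
    by (subst Suc.IH) (auto simp: wh_Comp add.commute simp del: T.simps)
  also have "\<dots> = sw V V (pw (m + n) W) \<cdot> V \<rhd> (V \<rhd> \<Delta> n (pw m W)) \<cdot> V \<rhd> sw ?q V ?U \<cdot> (V \<rhd> (?q \<rhd> T (Suc m) W)
     \<cdot> dv n 0 (?P \<otimes> (V \<otimes> W))) \<cdot> sw ?P ?Q (V \<otimes> W)"
    by (simp add: dv_slide del: T.simps)
  also have "\<dots> = (sw V V (pw (n + m) W) \<cdot> V \<rhd> (V \<rhd> \<Delta> n (pw m W))) \<cdot> V \<rhd> sw ?q V ?U \<cdot> dv n 0 (V \<otimes> ?U)
     \<cdot> ?Q \<rhd> T (Suc m) W \<cdot> sw ?P ?Q (V \<otimes> W)"
    by (simp add: dv_tail pre[OF dv_tail] add.commute del: T.simps)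
  also have "\<dots> = V \<rhd> (V \<rhd> \<Delta> n (pw m W)) \<cdot> sw V V (?q \<otimes> ?U) \<cdot> V \<rhd> sw ?q V ?U \<cdot> (dv n 0 (V \<otimes> ?U) \<cdot> sw V ?Q ?U)
     \<cdot> sw ?Q V ?U \<cdot> ?Q \<rhd> T (Suc m) W \<cdot> sw ?P ?Q (V \<otimes> W)"
    by (subst sw_tail) (auto simp del: T.simps)
  also have "\<dots> = V \<rhd> (V \<rhd> \<Delta> n (pw m W)) \<cdot> V \<rhd> dv n 0 ?U
     \<cdot> sw ?Q V ?U \<cdot> ?Q \<rhd> T (Suc m) W \<cdot> sw ?P ?Q (V \<otimes> W)"
    by (subst dv_slide) (auto simp del: T.simps)
  \<comment> \<open>The added summand is zero by \<open>T_T_other\<close>; it completes the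
    recursion of \<open>\<Delta>\<close>.\<close>
  also have "\<dots> = (V \<rhd> (V \<rhd> \<Delta> n (pw m W) \<cdot> dv n 0 ?U) \<cdot> sw ?Q V ?U \<cdot> ?Q \<rhd> T (Suc m) W
       \<oplus>\<oplus> V \<rhd> T n (pw m W) \<cdot> sw ?Q V ?U \<cdot> ?Q \<rhd> T (Suc m) W) \<cdot> sw ?P ?Q (V \<otimes> W)"
    by (subst T_T_other) (auto simp: wh_Comp simp del: T.simps)
  also have "\<dots> = V \<rhd> \<Delta> (Suc n) (pw m W) \<cdot> sw ?Q V ?U \<cdot> ?Q \<rhd> T (Suc m) W \<cdot> sw ?P ?Q (V \<otimes> W)"
    by (simp add: wh_pl pl_Comp del: T.simps)
  finally show ?case .
qed

text \<open>Induction on the slot. The input in position 1 lies before the slot and is filled first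
  by \<open>dv_c_before\<close>. The record, the open factor and the inner operation then have to
  pass each other, and \<open>sw_yang_baxter\<close> puts the three swaps in order.\<close>

lemma T_c_Suc:
  "W \<in> Ob M \<Longrightarrow> i \<le> m \<Longrightarrow> T (m + n) W \<cdot> c (Suc (Suc m)) n (Suc i) (V \<otimes> W)
    = V \<rhd> at_slot n i (Suc m) W \<cdot> sw (p n) V (pw (Suc m) W) \<cdot> p n \<rhd> T (Suc m) W \<cdot> sw (p (Suc (Suc m))) (p n) (V \<otimes> W)"
proof (induction i arbitrary: m)
  case 0
  then show ?case using T_c_Suc_0[of W m n] by simp
next
  case (Suc i)
  then obtain m' where m: "m = Suc m'" by (cases m) auto
  note [simp] = Suc.prems(1)
  have [simp]: "i \<le> m'" "i < Suc m'" "i < Suc (Suc m')" using Suc.prems m by simp_all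
  let ?q = "p n" and ?P = "p (Suc (Suc m'))" and ?Q = "p (Suc (Suc (Suc m')))" and ?F = "at_slot n i (Suc m') W"
  have "T (m + n) W \<cdot> c (Suc (Suc m)) n (Suc (Suc i)) (V \<otimes> W)
    = sw V V (pw (m' + n) W) \<cdot> V \<rhd> T (m' + n) W \<cdot> dv (Suc m' + n) 1 (V \<otimes> W) \<cdot> c (Suc (Suc (Suc m'))) n (Suc
      (Suc i)) (V \<otimes> W)"
    by (simp add: m)
  also have "\<dots> = sw V V (pw (m' + n) W) \<cdot> V \<rhd> (T (m' + n) W \<cdot> c (Suc (Suc m')) n (Suc i) (V \<otimes> W))
    \<cdot> dv (Suc (Suc m')) 1 (?q \<otimes> (V \<otimes> W))"
    by (subst dv_c_before) (auto simp: wh_Comp)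
  also have "\<dots> = (sw V V (pw (n + m') W) \<cdot> V \<rhd> (V \<rhd> ?F)) \<cdot> V \<rhd> sw ?q V (V \<otimes> pw m' W) \<cdot> V \<rhd> (?q \<rhd> T (Suc m') W)
      \<cdot> V \<rhd> sw ?P ?q (V \<otimes> W) \<cdot> dv (Suc (Suc m')) 1 (?q \<otimes> (V \<otimes> W))"
    by (subst Suc.IH) (auto simp: wh_Comp add.commute simp del: T.simps)
  also have "\<dots> = V \<rhd> (V \<rhd> ?F) \<cdot> sw V V (?q \<otimes> (V \<otimes> pw m' W)) \<cdot> V \<rhd> sw ?q V (V \<otimes> pw m' W) \<cdot> V \<rhd> (?q \<rhd> T (Suc m') W)
      \<cdot> V \<rhd> sw ?P ?q (V \<otimes> W) \<cdot> (dv (Suc (Suc m')) 1 (?q \<otimes> (V \<otimes> W)) \<cdot> sw ?q ?Q (V \<otimes> W)) \<cdot> sw ?Q ?q (V \<otimes> W)"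
    by (subst sw_tail) (auto simp del: T.simps)
  also have "\<dots> = V \<rhd> (V \<rhd> ?F) \<cdot> sw V V (?q \<otimes> (V \<otimes> pw m' W)) \<cdot> V \<rhd> sw ?q V (V \<otimes> pw m' W) \<cdot> V \<rhd> (?q \<rhd> T (Suc m') W)
      \<cdot> sw ?q V (?P \<otimes> (V \<otimes> W)) \<cdot> ?q \<rhd> dv (Suc (Suc m')) 1 (V \<otimes> W) \<cdot> sw ?Q ?q (V \<otimes> W)"
    by (subst dv_slide) (auto simp del: T.simps)
  also have "\<dots> = V \<rhd> (V \<rhd> ?F) \<cdot> (sw V V (?q \<otimes> (V \<otimes> pw m' W)) \<cdot> V \<rhd> sw ?q V (V \<otimes> pw m' W)
      \<cdot> sw ?q V (V \<otimes> (V \<otimes> pw m' W))) \<cdot> ?q \<rhd> (V \<rhd> T (Suc m') W) \<cdot> ?q \<rhd> dv (Suc (Suc m')) 1 (V \<otimes> W) \<cdot> sw ?Q ?q (V \<otimes> W)"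
    by (simp add: pre[OF sw_tail] del: T.simps)
  also have "\<dots> = V \<rhd> (V \<rhd> ?F) \<cdot> (V \<rhd> sw ?q V (V \<otimes> pw m' W) \<cdot> sw ?q V (V \<otimes> (V \<otimes> pw m' W)) \<cdot> ?q \<rhd> sw V V (V \<otimes> pw m' W))
      \<cdot> ?q \<rhd> (V \<rhd> T (Suc m') W) \<cdot> ?q \<rhd> dv (Suc (Suc m')) 1 (V \<otimes> W) \<cdot> sw ?Q ?q (V \<otimes> W)"
    by (subst sw_yang_baxter) (auto simp del: T.simps)
  finally show ?case
    by (simp add: m wh_Comp)
qed

text \<open>The composition law of the coaction: the outer operation acts on the argument and the
  inner one on factor \<open>i\<close> of the result. Both sides split according to whether the
  first input of the composite is filled or left open.\<close>

theorem \<Delta>_c: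
  "W \<in> Ob M \<Longrightarrow> i \<le> m \<Longrightarrow> \<Delta> (m + n) W \<cdot> c (Suc m) n i (V \<otimes> W)
    = at_slot n i (Suc m) W \<cdot> p n \<rhd> \<Delta> (Suc m) W \<cdot> sw (p (Suc m)) (p n) (V \<otimes> W)"
proof (induction i arbitrary: m)
  case 0
  note [simp] = 0(1)
  let ?P = "p (Suc m)"
  show ?case
  proof (induction n)
    case 0
    let ?k = "p 0"
    \<comment> \<open>A constant plugged into the first slot is paired with the first output factor.
      The summand \<open>T\<close> of \<open>\<Delta>\<close> dies by \<open>eV_T\<close>, and on
      the recorded factor the pairing fills the input by \<open>eV_dv\<close>.\<close>
    have "at_slot 0 0 (Suc m) W \<cdot> ?k \<rhd> \<Delta> (Suc m) W \<cdot> sw ?P ?k (V \<otimes> W)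
       = (eV (pw m W) \<cdot> ?k \<rhd> (V \<rhd> \<Delta> m W)) \<cdot> ?k \<rhd> dv m 0 (V \<otimes> W) \<cdot> sw ?P ?k (V \<otimes> W)"
      by (simp add: wh_pl Comp_pl pl_Comp wh_Comp pre1[OF eV_T])
    also have "\<dots> = \<Delta> m W \<cdot> (eV (p m \<otimes> (V \<otimes> W)) \<cdot> ?k \<rhd> dv m 0 (V \<otimes> W)) \<cdot> sw ?P ?k (V \<otimes> W)"
      by (subst eV_tail) auto
    also have "\<dots> = \<Delta> m W \<cdot> ins m 0 (V \<otimes> W) \<cdot> sw ?P ?k (V \<otimes> W)"
      by (simp add: eV_dv)
    finally show ?case by (simp add: ins_eq)
  next
    case (Suc n)
    let ?q = "p n" and ?Q = "p (Suc n)" and ?U = "pw m W"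
    have "V \<rhd> \<Delta> (m + n) W \<cdot> dv (m + n) (0 + 0) (V \<otimes> W) \<cdot> c (Suc m) (Suc n) 0 (V \<otimes> W)
      = V \<rhd> (\<Delta> (m + n) W \<cdot> c (Suc m) n 0 (V \<otimes> W)) \<cdot> sw ?P V (?q \<otimes> (V \<otimes> W)) \<cdot> ?P \<rhd> dv n 0 (V \<otimes> W)"
      by (subst dv_c_inside) (auto simp: wh_Comp)
    also have "\<dots> = V \<rhd> \<Delta> n ?U \<cdot> V \<rhd> (?q \<rhd> \<Delta> (Suc m) W) \<cdot> V \<rhd> sw ?P ?q (V \<otimes> W) \<cdot> sw ?P V (?q \<otimes> (V \<otimes> W))
      \<cdot> ?P \<rhd> dv n 0 (V \<otimes> W)"
      by (subst Suc.IH) (auto simp: wh_Comp add.commute simp del: \<Delta>.simps)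
    also have "\<dots> = V \<rhd> \<Delta> n ?U \<cdot> (V \<rhd> (?q \<rhd> \<Delta> (Suc m) W) \<cdot> dv n 0 (?P \<otimes> (V \<otimes> W))) \<cdot> sw ?P ?Q (V \<otimes> W)"
      by (simp add: dv_slide del: \<Delta>.simps)
    also have "\<dots> = V \<rhd> \<Delta> n ?U \<cdot> dv n 0 (V \<otimes> ?U) \<cdot> ?Q \<rhd> \<Delta> (Suc m) W \<cdot> sw ?P ?Q (V \<otimes> W)"
      by (simp add: dv_tail pre[OF dv_tail] del: \<Delta>.simps)
    finally have 1: "V \<rhd> \<Delta> (m + n) W \<cdot> dv (m + n) 0 (V \<otimes> W) \<cdot> c (Suc m) (Suc n) 0 (V \<otimes> W)
      = V \<rhd> \<Delta> n ?U \<cdot> dv n 0 (V \<otimes> ?U) \<cdot> ?Q \<rhd> \<Delta> (Suc m) W \<cdot> sw ?P ?Q (V \<otimes> W)" by simp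
    \<comment> \<open>If the first input stays open, both operations must leave it open: a factor
      recorded by the outer one lies in D and is killed by \<open>T_D_first\<close>.\<close>
    have 2: "T (m + n) W \<cdot> c (Suc m) (Suc n) 0 (V \<otimes> W) = T n ?U \<cdot> ?Q \<rhd> \<Delta> (Suc m) W \<cdot> sw ?P ?Q (V \<otimes> W)"
    proof -
      have "T n ?U \<cdot> ?Q \<rhd> \<Delta> (Suc m) W = T n ?U \<cdot> ?Q \<rhd> T m W"
        by (simp add: wh_pl Comp_pl wh_Comp T_D_first)
      then have "T n ?U \<cdot> ?Q \<rhd> \<Delta> (Suc m) W \<cdot> sw ?P ?Q (V \<otimes> W) = T n ?U \<cdot> ?Q \<rhd> T m W \<cdot> sw ?P ?Q (V \<otimes> W)"
        by (rule pre) auto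
      then show ?thesis by (simp add: T_c_first)
    qed
    have "\<Delta> (m + Suc n) W \<cdot> c (Suc m) (Suc n) 0 (V \<otimes> W)
      = (V \<rhd> \<Delta> n ?U \<cdot> dv n 0 (V \<otimes> ?U) \<cdot> ?Q \<rhd> \<Delta> (Suc m) W \<cdot> sw ?P ?Q (V \<otimes> W))
        \<oplus>\<oplus> (T n ?U \<cdot> ?Q \<rhd> \<Delta> (Suc m) W \<cdot> sw ?P ?Q (V \<otimes> W))"
      unfolding 1[symmetric] 2[symmetric] by (simp add: pl_Comp)
    also have "\<dots> = \<Delta> (Suc n) ?U \<cdot> ?Q \<rhd> \<Delta> (Suc m) W \<cdot> sw ?P ?Q (V \<otimes> W)"
      unfolding \<Delta>.simps(2)[of n] by (subst pl_Comp) (auto simp: add.commute)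
    finally show ?case by (simp del: \<Delta>.simps)
  qed
next
  case (Suc i)
  then obtain m' where m: "m = Suc m'" by (cases m) auto
  note [simp] = Suc.prems(1)
  have [simp]: "i \<le> m'" "i < Suc m'" "i < Suc (Suc m')" using Suc.prems m by simp_all
  let ?q = "p n" and ?P = "p (Suc m')" and ?Q = "p (Suc (Suc m'))" and ?F = "at_slot n i (Suc m') W"
  \<comment> \<open>For a later slot the first input belongs to the outer operation. Filling it
    leads to the induction hypothesis, and leaving it open to \<open>T_c_Suc\<close>.\<close>
  have "V \<rhd> \<Delta> (m' + n) W \<cdot> dv (m' + n) 0 (V \<otimes> W) \<cdot> c (Suc (Suc m')) n (Suc i) (V \<otimes> W)
    = V \<rhd> (\<Delta> (m' + n) W \<cdot> c (Suc m') n i (V \<otimes> W)) \<cdot> dv (Suc m') 0 (?q \<otimes> (V \<otimes> W))"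
    by (subst dv_c_before) (auto simp: wh_Comp)
  also have "\<dots> = V \<rhd> ?F \<cdot> V \<rhd> (?q \<rhd> \<Delta> (Suc m') W) \<cdot> V \<rhd> sw ?P ?q (V \<otimes> W)
      \<cdot> (dv (Suc m') 0 (?q \<otimes> (V \<otimes> W)) \<cdot> sw ?q ?Q (V \<otimes> W)) \<cdot> sw ?Q ?q (V \<otimes> W)"
    by (subst Suc.IH) (auto simp: wh_Comp add.commute simp del: \<Delta>.simps)
  also have "\<dots> = V \<rhd> ?F \<cdot> V \<rhd> (?q \<rhd> \<Delta> (Suc m') W) \<cdot> sw ?q V (?P \<otimes> (V \<otimes> W)) \<cdot> ?q \<rhd> dv (Suc m') 0 (V \<otimes> W)
    \<cdot> sw ?Q ?q (V \<otimes> W)"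
    by (subst dv_slide) (auto simp del: \<Delta>.simps)
  also have "\<dots> = V \<rhd> ?F \<cdot> sw ?q V (V \<otimes> pw m' W) \<cdot> (?q \<rhd> (V \<rhd> \<Delta> (Suc m') W) \<cdot> ?q \<rhd> dv (Suc m') 0 (V \<otimes> W))
    \<cdot> sw ?Q ?q (V \<otimes> W)"
    by (simp add: pre[OF sw_tail] del: \<Delta>.simps)
  finally have 1: "V \<rhd> \<Delta> (m' + n) W \<cdot> dv (m' + n) 0 (V \<otimes> W) \<cdot> c (Suc (Suc m')) n (Suc i) (V \<otimes> W)
    = V \<rhd> ?F \<cdot> sw ?q V (V \<otimes> pw m' W) \<cdot> ?q \<rhd> (V \<rhd> \<Delta> (Suc m') W \<cdot> dv (Suc m') 0 (V \<otimes> W)) \<cdot> sw ?Q ?q (V \<otimes> W)"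
    by (simp add: wh_Comp del: \<Delta>.simps)
  have "\<Delta> (m + n) W \<cdot> c (Suc m) n (Suc i) (V \<otimes> W)
    = (V \<rhd> \<Delta> (m' + n) W \<cdot> dv (m' + n) 0 (V \<otimes> W) \<cdot> c (Suc (Suc m')) n (Suc i) (V \<otimes> W))
     \<oplus>\<oplus> (T (m' + n) W \<cdot> c (Suc (Suc m')) n (Suc i) (V \<otimes> W))"
    by (simp add: m pl_Comp)
  also have "\<dots> = V \<rhd> ?F \<cdot> sw ?q V (V \<otimes> pw m' W) \<cdot> (?q \<rhd> (V \<rhd> \<Delta> (Suc m') W \<cdot> dv (Suc m') 0 (V \<otimes> W))
     \<oplus>\<oplus> ?q \<rhd> T (Suc m') W) \<cdot> sw ?Q ?q (V \<otimes> W)"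
    unfolding 1 by (subst T_c_Suc) (auto simp: pl_Comp Comp_pl add.commute simp del: \<Delta>.simps T.simps)
  also have "\<dots> = at_slot n (Suc i) (Suc m) W \<cdot> ?q \<rhd> \<Delta> (Suc m) W \<cdot> sw (p (Suc m)) ?q (V \<otimes> W)"
    unfolding \<Delta>.simps(2)[of "Suc m'"] m by (subst wh_pl[symmetric]) (auto simp del: \<Delta>.simps T.simps)
  finally show ?case .
qed

end

section \<open>Permutations and the equivariance of the coaction\<close>

definition lift_perm :: "(nat \<Rightarrow> nat) \<Rightarrow> nat \<Rightarrow> nat" where
  "lift_perm \<sigma> k = (case k of 0 \<Rightarrow> 0 | Suc j \<Rightarrow> Suc (\<sigma> j))"

lemma lift_perm_simps [simp]: "lift_perm \<sigma> 0 = 0" "lift_perm \<sigma> (Suc k) = Suc (\<sigma> k)"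
  by (auto simp: lift_perm_def)

lemma lift_perm_comp: "lift_perm (\<sigma> \<circ> \<tau>) = lift_perm \<sigma> \<circ> lift_perm \<tau>"
  by (auto simp: lift_perm_def fun_eq_iff split: nat.split)

lemma lift_perm_id [simp]: "lift_perm id = id"
  by (auto simp: lift_perm_def fun_eq_iff split: nat.split)

lemma lift_perm_permutes:
  assumes "\<sigma> permutes {..<n}"
  shows "lift_perm \<sigma> permutes {..<Suc n}"
proof (rule bij_imp_permutes)
  have "inj_on (lift_perm \<sigma>) {..<Suc n}"
    using permutes_inj[OF assms] by (auto simp: inj_on_def lift_perm_def inj_def split: nat.split)
  moreover have "lift_perm \<sigma> k < Suc n" if "k < Suc n" for k
    using permutes_in_image[OF assms, of "k - 1"] that by (cases k) simp_all
  then have "lift_perm \<sigma> ` {..<Suc n} \<subseteq> {..<Suc n}" by blast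
  ultimately show "bij_betw (lift_perm \<sigma>) {..<Suc n} {..<Suc n}"
    by (simp add: bij_betw_def endo_inj_surj)
  show "lift_perm \<sigma> x = x" if "x \<notin> {..<Suc n}" for x
    using permutes_not_in[OF assms, of "x - 1"] that by (cases x) simp_all
qed

text \<open>The permutation realised by \<open>to_front\<close>: position 0 reads the old position
  \<open>k\<close>, and the other positions keep their order.\<close>

definition front_perm :: "nat \<Rightarrow> nat \<Rightarrow> nat" where
  "front_perm k j = (case j of 0 \<Rightarrow> k | Suc i \<Rightarrow> if i < k then i else Suc i)"

lemma front_perm_0: "front_perm 0 = id"
  by (auto simp: front_perm_def fun_eq_iff split: nat.split)

lemma front_perm_Suc: "front_perm (Suc k) = lift_perm (front_perm k) \<circ> transpose 0 (Suc 0)"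
  by (auto simp: front_perm_def fun_eq_iff transpose_def lift_perm_def split: nat.split)

definition tail_perm :: "(nat \<Rightarrow> nat) \<Rightarrow> nat \<Rightarrow> nat" where
  "tail_perm \<sigma> = (\<lambda>j. let q = \<sigma> (Suc j) in if q < \<sigma> 0 then q else q - 1)"

text \<open>The factorisation along which \<open>tperm\<close> recurses; \<open>tail_perm\<close> is
  the permutation in its recursive call.\<close>

lemma front_perm_tail_perm:
  assumes "\<sigma> permutes {..<Suc n}"
  shows "\<sigma> = front_perm (\<sigma> 0) \<circ> lift_perm (tail_perm \<sigma>)"
proof
  fix j
  show "\<sigma> j = (front_perm (\<sigma> 0) \<circ> lift_perm (tail_perm \<sigma>)) j"
  proof (cases j)
    case (Suc i)
    have "\<sigma> (Suc i) \<noteq> \<sigma> 0"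
      using permutes_inj[OF assms] by (metis injD nat.distinct(1))
    with Suc show ?thesis
      by (auto simp: front_perm_def tail_perm_def Let_def)
  qed (simp add: front_perm_def)
qed

lemma tail_perm_permutes:
  assumes "\<sigma> permutes {..<Suc n}"
  shows "tail_perm \<sigma> permutes {..<n}"
proof (rule bij_imp_permutes)
  have inj: "inj \<sigma>" using permutes_inj[OF assms] .
  have ne: "\<sigma> (Suc i) \<noteq> \<sigma> 0" for i using inj by (metis injD nat.distinct(1))
  have s0: "\<sigma> 0 < Suc n" using permutes_in_image[OF assms, of 0] by simp
  have "i = j" if "tail_perm \<sigma> i = tail_perm \<sigma> j" for i j
  proof -
    have "\<sigma> (Suc i) = \<sigma> (Suc j)"
      using that ne[of i] ne[of j] by (auto simp: tail_perm_def Let_def split: if_splits)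
    then show ?thesis using inj by (auto dest: injD)
  qed
  then have "inj_on (tail_perm \<sigma>) {..<n}" by (auto simp: inj_on_def)
  moreover have "tail_perm \<sigma> i < n" if "i < n" for i
  proof -
    have "\<sigma> (Suc i) < Suc n" using permutes_in_image[OF assms, of "Suc i"] that by simp
    then show ?thesis using ne[of i] s0 by (auto simp: tail_perm_def Let_def)
  qed
  then have "tail_perm \<sigma> ` {..<n} \<subseteq> {..<n}" by blast
  ultimately show "bij_betw (tail_perm \<sigma>) {..<n} {..<n}"
    by (simp add: bij_betw_def endo_inj_surj)
  show "tail_perm \<sigma> x = x" if "x \<notin> {..<n}" for x
    using permutes_not_in[OF assms, of "Suc x"] that s0 by (auto simp: tail_perm_def Let_def)
qed

context pointed_operad begin

lemma
  assumes "\<sigma> permutes {..<n}"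
  shows Ar_act [simp]: "act P n \<sigma> \<in> Ar M"
    and Dom_act [simp]: "Dom M (act P n \<sigma>) = p n"
    and Cod_act [simp]: "Cod M (act P n \<sigma>) = p n"
  using act_hom[OF assms] by (auto simp: hom_iff)

text \<open>The equivariance axiom for a constant: with \<open>n = 0\<close> the permutation
  \<open>\<tau>\<close> is \<open>\<sigma>\<close> with the point \<open>j\<close> and its image
  deleted, and the numbering closed up.\<close>

lemma ins_act:
  assumes [simp]: "\<sigma> permutes {..<Suc n}" "\<tau> permutes {..<n}" "j \<le> n" "W \<in> Ob M"
    and \<tau>: "perm_pcomp (Suc n) 0 j \<sigma> id = \<tau>"
  shows "ins n j W \<cdot> p 0 \<rhd> (act P (Suc n) \<sigma> \<boxtimes> Id M W) = (act P n \<tau> \<boxtimes> Id M W) \<cdot> ins n (\<sigma> j) W"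
proof -
  have [simp]: "\<sigma> j < Suc n" using permutes_in_image[OF assms(1), of j] assms(3) by simp
  have [simp]: "j < Suc n" "\<sigma> j \<le> n" using assms(3) \<open>\<sigma> j < Suc n\<close> by linarith+
  have "(pcomp P (Suc n) 0 j \<cdot> braid M (p 0) (p (Suc n))) \<cdot> p 0 \<rhd> act P (Suc n) \<sigma>
     = pcomp P (Suc n) 0 j \<cdot> (act P (Suc n) \<sigma> \<boxtimes> act P 0 id) \<cdot> braid M (p 0) (p (Suc n))"
    by (simp add: act_id braid_natural)
  also have "\<dots> = act P n \<tau> \<cdot> pcomp P (Suc n) 0 (\<sigma> j) \<cdot> braid M (p 0) (p (Suc n))"
    using pcomp_equivariant[of j "Suc n" \<sigma> id 0] \<tau> permutes_id
    by (subst pre[where g = "pcomp P (Suc n) 0 j" and g' = "act P n \<tau>" and f' = "pcomp P (Suc n) 0 (\<sigma> j)"]) auto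
  finally show ?thesis
    unfolding ins_def by (subst l2_dom) (auto simp: l2_cod)
qed

lemma dv_act:
  assumes [simp]: "\<sigma> permutes {..<Suc n}" "\<tau> permutes {..<n}" "j \<le> n" "W \<in> Ob M"
    and \<tau>: "perm_pcomp (Suc n) 0 j \<sigma> id = \<tau>"
  shows "dv n j W \<cdot> (act P (Suc n) \<sigma> \<boxtimes> Id M W) = V \<rhd> (act P n \<tau> \<boxtimes> Id M W) \<cdot> dv n (\<sigma> j) W"
proof -
  have [simp]: "\<sigma> j \<le> n" using permutes_in_image[OF assms(1), of j] assms(3) by simp
  have "dl n j W \<cdot> (act P (Suc n) \<sigma> \<boxtimes> Id M W)
    = D \<rhd> (ins n j W \<cdot> p 0 \<rhd> (act P (Suc n) \<sigma> \<boxtimes> Id M W)) \<cdot> hD (p (Suc n) \<otimes> W)"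
    by (simp add: dl_def hD_tail wh_Comp)
  also have "\<dots> = D \<rhd> (act P n \<tau> \<boxtimes> Id M W) \<cdot> dl n (\<sigma> j) W"
    by (subst ins_act[where \<tau> = \<tau>]) (auto simp: dl_def wh_Comp \<tau>)
  finally show ?thesis
    by (simp add: dv_def pre[OF whisker_swap[of io]])
qed

lemma perm_pcomp_lift: "\<sigma> permutes {..<n} \<Longrightarrow> perm_pcomp (Suc n) 0 0 (lift_perm \<sigma>) id = \<sigma>"
  by (auto simp: perm_pcomp_def fun_eq_iff permutes_not_in Let_def)

lemma perm_pcomp_lift_lift:
  assumes "\<sigma> permutes {..<n}"
  shows "perm_pcomp (Suc (Suc n)) 0 (Suc 0) (lift_perm (lift_perm \<sigma>)) id = lift_perm \<sigma>"
proof
  fix k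
  show "perm_pcomp (Suc (Suc n)) 0 (Suc 0) (lift_perm (lift_perm \<sigma>)) id k = lift_perm \<sigma> k"
    using permutes_not_in[OF assms] by (cases k) (auto simp: perm_pcomp_def Let_def)
qed

lemma perm_pcomp_transpose:
  "perm_pcomp (Suc (Suc n)) 0 0 (transpose 0 (Suc 0)) id = id"
  "perm_pcomp (Suc (Suc n)) 0 (Suc 0) (transpose 0 (Suc 0)) id = id"
  by (auto simp: perm_pcomp_def fun_eq_iff Let_def transpose_def)

lemma perm_pcomp_lift_transpose:
  "perm_pcomp (Suc (Suc (Suc n))) 0 (Suc 0) (lift_perm (transpose 0 (Suc 0))) id = id"
  by (auto simp: perm_pcomp_def fun_eq_iff Let_def transpose_def lift_perm_def split: nat.split)

lemma transpose_permutes: "transpose 0 (Suc 0) permutes {..<Suc (Suc n)}"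
  by (rule permutes_swap_id) auto

lemma dv_lift:
  assumes [simp]: "\<sigma> permutes {..<n}" "W \<in> Ob M"
  shows "dv n 0 W \<cdot> (act P (Suc n) (lift_perm \<sigma>) \<boxtimes> Id M W) = V \<rhd> (act P n \<sigma> \<boxtimes> Id M W) \<cdot> dv n 0 W"
  by (subst dv_act[where \<tau> = \<sigma>]) (auto simp: perm_pcomp_lift lift_perm_permutes)

lemma dv_lift_lift:
  assumes [simp]: "\<sigma> permutes {..<n}" "W \<in> Ob M"
  shows "dv (Suc n) (Suc 0) W \<cdot> (act P (Suc (Suc n)) (lift_perm (lift_perm \<sigma>)) \<boxtimes> Id M W)
    = V \<rhd> (act P (Suc n) (lift_perm \<sigma>) \<boxtimes> Id M W) \<cdot> dv (Suc n) (Suc 0) W"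
  by (subst dv_act[where \<tau> = "lift_perm \<sigma>"]) (auto simp: perm_pcomp_lift_lift lift_perm_permutes)

lemma dv_transpose:
  assumes [simp]: "W \<in> Ob M"
  shows "dv (Suc n) 0 W \<cdot> (act P (Suc (Suc n)) (transpose 0 (Suc 0)) \<boxtimes> Id M W) = dv (Suc n) (Suc 0) W"
    and "dv (Suc n) (Suc 0) W \<cdot> (act P (Suc (Suc n)) (transpose 0 (Suc 0)) \<boxtimes> Id M W) = dv (Suc n) 0 W"
  using dv_act[OF transpose_permutes[of n] permutes_id, of 0 W] dv_act[OF transpose_permutes[of n]
    permutes_id, of "Suc 0" W]
  by (simp_all add: perm_pcomp_transpose act_id transpose_permutes permutes_id)

lemma dv_lift_transpose:
  assumes [simp]: "W \<in> Ob M"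
  shows "dv (Suc (Suc n)) (Suc 0) W \<cdot> (act P (Suc (Suc (Suc n))) (lift_perm (transpose 0 (Suc 0))) \<boxtimes> Id M W)
    = dv (Suc (Suc n)) (Suc (Suc 0)) W"
  by (subst dv_act[where \<tau> = id])
    (auto simp: perm_pcomp_lift_transpose act_id lift_perm_permutes[OF transpose_permutes] permutes_id)

end

context truncated_action begin

text \<open>\<open>T\<close> is included because the recursion of \<open>\<Delta>\<close> calls it.
  Its open input stays first, so there \<open>\<sigma>\<close> acts on the remaining inputs through
  \<open>lift_perm\<close>.\<close>

definition equivariant :: "nat \<Rightarrow> (nat \<Rightarrow> nat) \<Rightarrow> 'a \<Rightarrow> 'o \<Rightarrow> bool" where
  "equivariant n \<sigma> \<tau> W \<longleftrightarrow> \<sigma> permutes {..<n} \<and> \<tau> \<in> Ar M \<and> Dom M \<tau> = pw n W \<and> Cod M \<tau> = pw n W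
     \<and> \<Delta> n W \<cdot> (act P n \<sigma> \<boxtimes> Id M (V \<otimes> W)) = \<tau> \<cdot> \<Delta> n W
     \<and> T n W \<cdot> (act P (Suc n) (lift_perm \<sigma>) \<boxtimes> Id M (V \<otimes> W)) = V \<rhd> \<tau> \<cdot> T n W"

lemma equivariant_id: "W \<in> Ob M \<Longrightarrow> equivariant n id (Id M (pw n W)) W"
  by (simp add: equivariant_def act_id permutes_id)

lemma equivariant_comp:
  assumes [simp]: "W \<in> Ob M" and "equivariant n \<sigma> \<tau> W" "equivariant n \<sigma>' \<tau>' W"
  shows "equivariant n (\<sigma> \<circ> \<sigma>') (\<tau>' \<cdot> \<tau>) W"
proof -
  have [simp]: "\<sigma> permutes {..<n}" "\<sigma>' permutes {..<n}" "\<tau> \<in> Ar M" "\<tau>' \<in> Ar M"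
    "Dom M \<tau> = pw n W" "Cod M \<tau> = pw n W" "Dom M \<tau>' = pw n W" "Cod M \<tau>' = pw n W"
    "lift_perm \<sigma> permutes {..<Suc n}" "lift_perm \<sigma>' permutes {..<Suc n}"
    and \<Delta>: "\<Delta> n W \<cdot> (act P n \<sigma> \<boxtimes> Id M (V \<otimes> W)) = \<tau> \<cdot> \<Delta> n W"
      "\<Delta> n W \<cdot> (act P n \<sigma>' \<boxtimes> Id M (V \<otimes> W)) = \<tau>' \<cdot> \<Delta> n W"
    and T: "T n W \<cdot> (act P (Suc n) (lift_perm \<sigma>) \<boxtimes> Id M (V \<otimes> W)) = V \<rhd> \<tau> \<cdot> T n W"
      "T n W \<cdot> (act P (Suc n) (lift_perm \<sigma>') \<boxtimes> Id M (V \<otimes> W)) = V \<rhd> \<tau>' \<cdot> T n W"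
    using assms by (auto simp: equivariant_def lift_perm_permutes)
  show ?thesis
    by (simp add: equivariant_def permutes_compose act_comp lift_perm_comp Comp_wh wh_Comp
        \<Delta> pre[OF \<Delta>(2)] T pre[OF T(2)])
qed

lemma equivariant_lift:
  assumes [simp]: "W \<in> Ob M" and "equivariant n \<sigma> \<tau> W"
  shows "equivariant (Suc n) (lift_perm \<sigma>) (V \<rhd> \<tau>) W"
proof -
  have [simp]: "\<sigma> permutes {..<n}" "\<tau> \<in> Ar M"
    "Dom M \<tau> = pw n W" "Cod M \<tau> = pw n W" "lift_perm \<sigma> permutes {..<Suc n}"
      "lift_perm (lift_perm \<sigma>) permutes {..<Suc (Suc n)}"
    and \<Delta>: "\<Delta> n W \<cdot> (act P n \<sigma> \<boxtimes> Id M (V \<otimes> W)) = \<tau> \<cdot> \<Delta> n W"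
    and T: "T n W \<cdot> (act P (Suc n) (lift_perm \<sigma>) \<boxtimes> Id M (V \<otimes> W)) = V \<rhd> \<tau> \<cdot> T n W"
    using assms by (auto simp: equivariant_def lift_perm_permutes)
  have 1: "V \<rhd> \<Delta> n W \<cdot> V \<rhd> (act P n \<sigma> \<boxtimes> Id M (V \<otimes> W)) = V \<rhd> \<tau> \<cdot> V \<rhd> \<Delta> n W"
    by (simp add: wh_Comp[symmetric] \<Delta>)
  have 2: "V \<rhd> T n W \<cdot> V \<rhd> (act P (Suc n) (lift_perm \<sigma>) \<boxtimes> Id M (V \<otimes> W)) = V \<rhd> (V \<rhd> \<tau>) \<cdot> V \<rhd> T n W"
    by (simp add: wh_Comp[symmetric] T)
  show ?thesis
    by (simp add: equivariant_def pl_Comp Comp_pl dv_lift dv_lift_lift T pre[OF 1] pre[OF 2] pre[OF sw_tail])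
qed

text \<open>Of the summands of \<open>\<Delta>\<close>, split by the first two inputs, the one with
  both inputs filled is symmetric by \<open>dv_dv\<close>, and the two with exactly one of them open
  change places.\<close>

lemma equivariant_transpose:
  assumes [simp]: "W \<in> Ob M"
  shows "equivariant (Suc (Suc n)) (transpose 0 (Suc 0)) (sw V V (pw n W)) W"
proof -
  let ?t = "transpose 0 (Suc 0) :: nat \<Rightarrow> nat"
  note [simp] = transpose_permutes lift_perm_permutes[OF transpose_permutes]
  let ?A = "act P (Suc (Suc n)) ?t \<boxtimes> Id M (V \<otimes> W)"
  let ?d0 = "dv (Suc n) 0 (V \<otimes> W)" and ?d1 = "dv (Suc n) (Suc 0) (V \<otimes> W)" and ?b = "dv n 0 (V \<otimes> W)"
  have 1: "V \<rhd> ?b \<cdot> ?d1 = sw V V (p n \<otimes> (V \<otimes> W)) \<cdot> V \<rhd> ?b \<cdot> ?d0"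
    by (rule dv_dv) auto
  have D: "\<Delta> (Suc (Suc n)) W = (V \<rhd> (V \<rhd> \<Delta> n W) \<cdot> V \<rhd> ?b \<cdot> ?d0 \<oplus>\<oplus> V \<rhd> T n W \<cdot> ?d0) \<oplus>\<oplus> sw V V (pw n W)
    \<cdot> V \<rhd> T n W \<cdot> ?d1"
    by (simp add: wh_pl wh_Comp pl_Comp)
  have "\<Delta> (Suc (Suc n)) W \<cdot> ?A
     = (V \<rhd> (V \<rhd> \<Delta> n W) \<cdot> V \<rhd> ?b \<cdot> ?d1 \<oplus>\<oplus> V \<rhd> T n W \<cdot> ?d1) \<oplus>\<oplus> sw V V (pw n W) \<cdot> V \<rhd> T n W \<cdot> ?d0"
    unfolding D by (simp add: pl_Comp dv_transpose)
  also have "\<dots> = sw V V (pw n W) \<cdot> V \<rhd> (V \<rhd> \<Delta> n W) \<cdot> V \<rhd> ?b \<cdot> ?d0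
      \<oplus>\<oplus> (sw V V (pw n W) \<cdot> V \<rhd> T n W \<cdot> ?d0 \<oplus>\<oplus> V \<rhd> T n W \<cdot> ?d1)"
    by (simp add: pl_assoc 1 pre[OF sw_tail] pl_comm[of "V \<rhd> T n W \<cdot> ?d1"])
  also have "\<dots> = sw V V (pw n W) \<cdot> \<Delta> (Suc (Suc n)) W"
    unfolding D by (simp add: Comp_pl pl_assoc)
  finally have 2: "\<Delta> (Suc (Suc n)) W \<cdot> ?A = sw V V (pw n W) \<cdot> \<Delta> (Suc (Suc n)) W" .
  let ?e0 = "dv (Suc (Suc n)) 0 (V \<otimes> W)" and ?e1 = "dv (Suc (Suc n)) (Suc 0) (V \<otimes> W)"
    and ?e2 = "dv (Suc (Suc n)) (Suc (Suc 0)) (V \<otimes> W)"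
  \<comment> \<open>For \<open>T\<close> the first input stays open and the next two, both filled,
    are exchanged. The swap of the records is then moved past the open factor by
    \<open>sw_yang_baxter\<close>.\<close>
  have 3: "V \<rhd> ?d1 \<cdot> ?e2 = sw V V (p (Suc n) \<otimes> (V \<otimes> W)) \<cdot> V \<rhd> ?d1 \<cdot> ?e1"
    by (rule dv_dv) auto
  have "T (Suc (Suc n)) W \<cdot> (act P (Suc (Suc (Suc n))) (lift_perm ?t) \<boxtimes> Id M (V \<otimes> W))
    = sw V V (V \<otimes> pw n W) \<cdot> V \<rhd> sw V V (pw n W) \<cdot> V \<rhd> (V \<rhd> T n W) \<cdot> V \<rhd> ?d1 \<cdot> ?e2"
    by (simp add: wh_Comp dv_lift_transpose)
  also have "\<dots> = sw V V (V \<otimes> pw n W) \<cdot> V \<rhd> sw V V (pw n W) \<cdot> (V \<rhd> (V \<rhd> T n W) \<cdot> sw V V (p (Suc n) \<otimes> (V \<otimes>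
    W))) \<cdot> V \<rhd> ?d1 \<cdot> ?e1"
    by (simp add: 3)
  also have "V \<rhd> (V \<rhd> T n W) \<cdot> sw V V (p (Suc n) \<otimes> (V \<otimes> W)) = sw V V (V \<otimes> pw n W) \<cdot> V \<rhd> (V \<rhd> T n W)"
    by (simp add: sw_tail)
  also have "sw V V (V \<otimes> pw n W) \<cdot> V \<rhd> sw V V (pw n W) \<cdot> (sw V V (V \<otimes> pw n W) \<cdot> V \<rhd> (V \<rhd> T n W)) \<cdot> V \<rhd> ?d1 \<cdot> ?e1
    = (sw V V (V \<otimes> pw n W) \<cdot> V \<rhd> sw V V (pw n W) \<cdot> sw V V (V \<otimes> pw n W)) \<cdot> V \<rhd> (V \<rhd> T n W) \<cdot> V \<rhd> ?d1 \<cdot> ?e1"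
    by simp
  also have "\<dots> = (V \<rhd> sw V V (pw n W) \<cdot> sw V V (V \<otimes> pw n W) \<cdot> V \<rhd> sw V V (pw n W)) \<cdot> V \<rhd> (V \<rhd> T n W) \<cdot> V \<rhd> ?d1 \<cdot> ?e1"
    by (subst sw_yang_baxter) auto
  also have "\<dots> = V \<rhd> sw V V (pw n W) \<cdot> T (Suc (Suc n)) W"
    by (simp add: wh_Comp)
  finally show ?thesis
    by (simp add: equivariant_def 2 del: T.simps \<Delta>.simps)
qed

lemma pw_unit: "pw n (unit M) = tpow M V n"
  by (induction n) auto

lemma equivariant_to_front: "k \<le> n \<Longrightarrow> equivariant (Suc n) (front_perm k) (to_front M V k n) (unit M)"
proof (induction k arbitrary: n)
  case 0
  have "to_front M V 0 n = Id M (pw (Suc n) (unit M))" by (simp add: pw_unit)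
  then show ?case
    using equivariant_id[of "unit M" "Suc n"] by (metis front_perm_0 unit_Ob)
next
  case (Suc k)
  then obtain n' where n: "n = Suc n'" by (cases n) auto
  with Suc have IH: "equivariant (Suc n') (front_perm k) (to_front M V k n') (unit M)" by simp
  then have [simp]: "to_front M V k n' \<in> Ar M" "Cod M (to_front M V k n') = tpow M V (Suc n')"
    by (auto simp: equivariant_def pw_unit)
  have [simp]: "tpow M V n' \<in> Ob M" by (simp add: pw_unit[symmetric])
  have eq: "to_front M V (Suc k) n = sw V V (pw n' (unit M)) \<cdot> V \<rhd> to_front M V k n'"
    by (simp add: sw_def n pw_unit Let_def)
  show ?case
    unfolding front_perm_Suc eq unfolding n
    by (rule equivariant_comp[OF unit_Ob equivariant_lift[OF unit_Ob IH] equivariant_transpose[OF unit_Ob]])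
qed

text \<open>By \<open>front_perm_tail_perm\<close> every permutation is built from adjacent
  transpositions at the front, block sums and composites, and \<open>equivariant\<close> is closed
  under these.\<close>

theorem equivariant_tperm: "\<sigma> permutes {..<n} \<Longrightarrow> equivariant n \<sigma> (tperm M V n \<sigma>) (unit M)"
proof (induction n arbitrary: \<sigma>)
  case 0
  then have "\<sigma> = id" by simp
  moreover have "equivariant 0 id (tperm M V 0 \<sigma>) (unit M)" using equivariant_id[of "unit M" 0] by simp
  ultimately show ?case by metis
next
  case (Suc n)
  have k: "\<sigma> 0 \<le> n" using permutes_in_image[OF Suc.prems, of 0] by simp
  have eq: "tperm M V (Suc n) \<sigma> = V \<rhd> tperm M V n (tail_perm \<sigma>) \<cdot> to_front M V (\<sigma> 0) n"
    by (simp add: tail_perm_def)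
  have "equivariant (Suc n) (front_perm (\<sigma> 0) \<circ> lift_perm (tail_perm \<sigma>)) (tperm M V (Suc n) \<sigma>) (unit M)"
    unfolding eq
    by (rule equivariant_comp[OF unit_Ob equivariant_to_front[OF k] equivariant_lift[OF unit_Ob Suc.IH[OF
      tail_perm_permutes[OF Suc.prems]]]])
  then show ?case
    unfolding front_perm_tail_perm[OF Suc.prems, symmetric] .
qed

end

section \<open>Strength: enlarging the tail\<close>

context typed_smc begin

lemma pentagon': "W \<in> Ob M \<Longrightarrow> X \<in> Ob M \<Longrightarrow> Y \<in> Ob M \<Longrightarrow> Z \<in> Ob M
      \<Longrightarrow> W \<rhd> assoc M X Y Z \<cdot> assoc M W (X \<otimes> Y) Z \<cdot> (assoc M W X Y \<boxtimes> Id M Z)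
        = assoc M W X (Y \<otimes> Z) \<cdot> assoc M (W \<otimes> X) Y Z"
  by (simp add: pentagon)

lemma assoc_tail:
  "g \<in> Ar M \<Longrightarrow> X \<in> Ob M \<Longrightarrow> W \<in> Ob M \<Longrightarrow> Cod M g = Y'
    \<Longrightarrow> assoc M X Y' W \<cdot> ((X \<rhd> g) \<boxtimes> Id M W) = X \<rhd> (g \<boxtimes> Id M W) \<cdot> assoc M X (Dom M g) W"
  by (rule assoc_natural) auto

lemma assoc_first:
  "g \<in> Ar M \<Longrightarrow> Y \<in> Ob M \<Longrightarrow> W \<in> Ob M \<Longrightarrow> Cod M g = X'
    \<Longrightarrow> assoc M X' Y W \<cdot> ((g \<boxtimes> Id M Y) \<boxtimes> Id M W) = (g \<boxtimes> Id M (Y \<otimes> W)) \<cdot> assoc M (Dom M g) Y W"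
  using assoc_natural[of g "Id M Y" "Id M W" X' Y W "Dom M g" Y W] by simp

text \<open>An operation on the first factors does not see how its tail is bracketed; after an
  invertible associator this is the pentagon.\<close>

lemma l2_strength:
  assumes [simp]: "f \<in> Ar M" "Dom M f = X \<otimes> Y" "Cod M f = Z" "X \<in> Ob M" "Y \<in> Ob M" "U \<in> Ob M" "W \<in> Ob M"
  shows "assoc M Z U W \<cdot> (l2 f X Y U \<boxtimes> Id M W)
    = l2 f X Y (U \<otimes> W) \<cdot> X \<rhd> assoc M Y U W \<cdot> assoc M X (Y \<otimes> U) W"
proof -
  have [simp]: "Z \<in> Ob M" using Cod_Ob[of f] by simp
  have "(assoc M Z U W \<cdot> (l2 f X Y U \<boxtimes> Id M W)) \<cdot> (assoc M X Y U \<boxtimes> Id M W)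
      = (f \<boxtimes> Id M (U \<otimes> W)) \<cdot> assoc M (X \<otimes> Y) U W"
    by (simp add: l2_def Comp_wh assoc_first)
  also have "\<dots> = l2 f X Y (U \<otimes> W) \<cdot> assoc M X Y (U \<otimes> W) \<cdot> assoc M (X \<otimes> Y) U W"
    by (simp add: l2_def)
  also have "\<dots> = (l2 f X Y (U \<otimes> W) \<cdot> X \<rhd> assoc M Y U W \<cdot> assoc M X (Y \<otimes> U) W) \<cdot> (assoc M X Y U \<boxtimes> Id M W)"
    by (simp add: pentagon)
  finally show ?thesis
    by (rule cancel_epi[where k = "ai X Y U \<boxtimes> Id M W"]) auto
qed

lemma counit_op_strength:
  assumes [simp]: "f \<in> Ar M" "Dom M f = X \<otimes> Y" "Cod M f = unit M" "X \<in> Ob M" "Y \<in> Ob M" "U \<in> Ob M" "W \<in> Ob M"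
  shows "counit_op f X Y U \<boxtimes> Id M W = counit_op f X Y (U \<otimes> W) \<cdot> X \<rhd> assoc M Y U W \<cdot> assoc M X (Y \<otimes> U) W"
proof -
  have "counit_op f X Y U \<boxtimes> Id M W = lunit M (U \<otimes> W) \<cdot> assoc M (unit M) U W \<cdot> (l2 f X Y U \<boxtimes> Id M W)"
    by (simp add: counit_op_def Comp_wh lunit_tens[symmetric])
  then show ?thesis by (simp add: l2_strength counit_op_def)
qed

lemma unit_op_strength:
  assumes [simp]: "h \<in> Ar M" "Cod M h = X \<otimes> Y" "Dom M h = unit M" "X \<in> Ob M" "Y \<in> Ob M" "U \<in> Ob M" "W \<in> Ob M"
  shows "X \<rhd> assoc M Y U W \<cdot> assoc M X (Y \<otimes> U) W \<cdot> (unit_op h X Y U \<boxtimes> Id M W) = unit_op h X Y (U \<otimes> W)"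
proof -
  have "X \<rhd> assoc M Y U W \<cdot> assoc M X (Y \<otimes> U) W \<cdot> (unit_op h X Y U \<boxtimes> Id M W)
    = (X \<rhd> assoc M Y U W \<cdot> assoc M X (Y \<otimes> U) W \<cdot> (assoc M X Y U \<boxtimes> Id M W))
      \<cdot> ((h \<boxtimes> Id M U) \<boxtimes> Id M W) \<cdot> (li U \<boxtimes> Id M W)"
    by (simp add: unit_op_def Comp_wh)
  also have "\<dots> = assoc M X Y (U \<otimes> W) \<cdot> (assoc M (X \<otimes> Y) U W \<cdot> ((h \<boxtimes> Id M U) \<boxtimes> Id M W)) \<cdot> (li U \<boxtimes> Id M W)"
    by (subst pentagon') auto
  also have "\<dots> = assoc M X Y (U \<otimes> W) \<cdot> (h \<boxtimes> Id M (U \<otimes> W)) \<cdot> assoc M (unit M) U W \<cdot> (li U \<boxtimes> Id M W)"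
    by (subst assoc_first) auto
  also have "assoc M (unit M) U W \<cdot> (li U \<boxtimes> Id M W) = li (U \<otimes> W)"
  proof (rule cancel_mono[where k = "li (U \<otimes> W)" and l = "lunit M (U \<otimes> W)"])
    have "(lunit M (U \<otimes> W) \<cdot> assoc M (unit M) U W) \<cdot> (li U \<boxtimes> Id M W) = Id M (U \<otimes> W)"
      unfolding lunit_tens[OF \<open>U \<in> Ob M\<close> \<open>W \<in> Ob M\<close>] by simp
    then show "lunit M (U \<otimes> W) \<cdot> assoc M (unit M) U W \<cdot> (li U \<boxtimes> Id M W) = lunit M (U \<otimes> W) \<cdot> li (U \<otimes> W)"
      by simp
  qed auto
  finally show ?thesis by (simp add: unit_op_def)
qed

lemma sw_strength:
  assumes [simp]: "X \<in> Ob M" "Y \<in> Ob M" "U \<in> Ob M" "W \<in> Ob M"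
  shows "Y \<rhd> assoc M X U W \<cdot> assoc M Y (X \<otimes> U) W \<cdot> (sw X Y U \<boxtimes> Id M W)
    = sw X Y (U \<otimes> W) \<cdot> X \<rhd> assoc M Y U W \<cdot> assoc M X (Y \<otimes> U) W"
proof -
  have "Y \<rhd> assoc M X U W \<cdot> assoc M Y (X \<otimes> U) W \<cdot> (sw X Y U \<boxtimes> Id M W)
    = (Y \<rhd> assoc M X U W \<cdot> assoc M Y (X \<otimes> U) W \<cdot> (assoc M Y X U \<boxtimes> Id M W)) \<cdot> (l2 (braid M X Y) X Y U \<boxtimes> Id M W)"
    by (simp add: sw_def l2_def Comp_wh)
  also have "\<dots> = assoc M Y X (U \<otimes> W) \<cdot> assoc M (Y \<otimes> X) U W \<cdot> (l2 (braid M X Y) X Y U \<boxtimes> Id M W)"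
    by (subst pentagon') auto
  also have "\<dots> = assoc M Y X (U \<otimes> W) \<cdot> l2 (braid M X Y) X Y (U \<otimes> W) \<cdot> X \<rhd> assoc M Y U W \<cdot> assoc M X (Y \<otimes> U) W"
    by (simp add: l2_strength)
  finally show ?thesis by (simp add: sw_def l2_def)
qed

lemma ihom_exists:
  assumes "has_internal_homs M" "X \<in> Ob M" "Y \<in> Ob M"
  shows "is_ihom M X Y (ihom M X Y) (ev M X Y)"
proof -
  have "\<exists>He. is_ihom M X Y (fst He) (snd He)"
    using assms unfolding has_internal_homs_def by auto
  then show ?thesis
    unfolding ihom_def ev_def by (rule someI_ex)
qed

end

section \<open>Internal homs and the coendomorphism operad\<close>

locale closed_typed_smc = typed_smc M for M :: "('o, 'a, 'm) smcat_scheme" (structure) +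
  assumes closed: "has_internal_homs M"
begin

lemma
  assumes "X \<in> Ob M" "Y \<in> Ob M"
  shows ihom_Ob [simp]: "ihom M X Y \<in> Ob M"
    and Ar_ev [simp]: "ev M X Y \<in> Ar M"
    and Dom_ev [simp]: "Dom M (ev M X Y) = ihom M X Y \<otimes> X"
    and Cod_ev [simp]: "Cod M (ev M X Y) = Y"
  using ihom_exists[OF closed assms] by (auto simp: is_ihom_def hom_iff)

lemma curry_unique:
  assumes "ev M X Y \<cdot> (g \<boxtimes> Id M X) = ev M X Y \<cdot> (h \<boxtimes> Id M X)" "g \<in> Ar M" "h \<in> Ar M" "X \<in> Ob M" "Y \<in> Ob M"
    "Cod M g = ihom M X Y" "Cod M h = ihom M X Y" "Dom M g = Dom M h"
  shows "g = h"
proof -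
  let ?f = "ev M X Y \<cdot> (g \<boxtimes> Id M X)"
  have "Dom M g \<in> Ob M" "?f \<in> hom M (Dom M g \<otimes> X) Y"
    using assms by (auto simp: hom_iff)
  then have "\<exists>!k. k \<in> hom M (Dom M g) (ihom M X Y) \<and> ev M X Y \<cdot> (k \<boxtimes> Id M X) = ?f"
    using ihom_exists[OF closed assms(4,5)] unfolding is_ihom_def by blast
  moreover have "g \<in> hom M (Dom M g) (ihom M X Y)" "h \<in> hom M (Dom M g) (ihom M X Y)"
    using assms by (auto simp: hom_iff)
  ultimately show ?thesis using assms(1) by auto
qed

lemma curry_props:
  assumes "f \<in> Ar M" "Dom M f = Z \<otimes> X" "Cod M f = Y" "X \<in> Ob M" "Z \<in> Ob M"
  shows "curry_ar M Z X Y f \<in> hom M Z (ihom M X Y) \<and> ev M X Y \<cdot> (curry_ar M Z X Y f \<boxtimes> Id M X) = f"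
proof -
  have "f \<in> hom M (Z \<otimes> X) Y" "Y \<in> Ob M" using assms by (auto simp: hom_iff)
  then have "\<exists>!g. g \<in> hom M Z (ihom M X Y) \<and> ev M X Y \<cdot> (g \<boxtimes> Id M X) = f"
    using ihom_exists[OF closed, of X Y] assms unfolding is_ihom_def by blast
  then show ?thesis unfolding curry_ar_def by (rule theI')
qed

lemma
  assumes "f \<in> Ar M" "Dom M f = Z \<otimes> X" "Cod M f = Y" "X \<in> Ob M" "Z \<in> Ob M"
  shows Ar_curry [simp]: "curry_ar M Z X Y f \<in> Ar M"
    and Dom_curry [simp]: "Dom M (curry_ar M Z X Y f) = Z"
    and Cod_curry [simp]: "Cod M (curry_ar M Z X Y f) = ihom M X Y"
    and ev_curry: "ev M X Y \<cdot> (curry_ar M Z X Y f \<boxtimes> Id M X) = f"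
  using curry_props[OF assms] by (auto simp: hom_iff)

lemma curry_Comp:
  assumes [simp]: "f \<in> Ar M" "Dom M f = Z \<otimes> X" "Cod M f = Y" "X \<in> Ob M" "Z \<in> Ob M" "g \<in> Ar M" "Cod M g = Z"
  shows "curry_ar M Z X Y f \<cdot> g = curry_ar M (Dom M g) X Y (f \<cdot> (g \<boxtimes> Id M X))"
proof (rule curry_unique[where X = X and Y = Y])
  have [simp]: "Y \<in> Ob M" using Cod_Ob[of f] by simp
  show "Y \<in> Ob M" by simp
  show "ev M X Y \<cdot> ((curry_ar M Z X Y f \<cdot> g) \<boxtimes> Id M X)
    = ev M X Y \<cdot> (curry_ar M (Dom M g) X Y (f \<cdot> (g \<boxtimes> Id M X)) \<boxtimes> Id M X)"
    by (simp add: Comp_wh pre1[OF ev_curry] ev_curry)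
qed auto

lemma curry_eqI:
  assumes "g \<in> Ar M" "Dom M g = Z" "Cod M g = ihom M X Y" "X \<in> Ob M" "Y \<in> Ob M" "ev M X Y \<cdot> (g \<boxtimes> Id M X) = f"
  shows "g = curry_ar M Z X Y f"
proof (rule curry_unique[OF _ assms(1) _ assms(4,5) assms(3)])
  have f: "f \<in> Ar M" "Dom M f = Z \<otimes> X" "Cod M f = Y" "Z \<in> Ob M" using assms by auto
  then show "curry_ar M Z X Y f \<in> Ar M" "Cod M (curry_ar M Z X Y f) = ihom M X Y"
    "Dom M g = Dom M (curry_ar M Z X Y f)"
    using assms by auto
  show "ev M X Y \<cdot> (g \<boxtimes> Id M X) = ev M X Y \<cdot> (curry_ar M Z X Y f \<boxtimes> Id M X)"
    using assms f by (simp add: ev_curry)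
qed

lemma tpow_Ob [simp]: "V \<in> Ob M \<Longrightarrow> tpow M V n \<in> Ob M"
  by (induction n) auto

end

context pointed_operad begin

lemma dv_strength:
  assumes [simp]: "j \<le> n" "U \<in> Ob M" "W \<in> Ob M"
  shows "V \<rhd> assoc M (p n) U W \<cdot> assoc M V (p n \<otimes> U) W \<cdot> (dv n j U \<boxtimes> Id M W)
    = dv n j (U \<otimes> W) \<cdot> assoc M (p (Suc n)) U W"
proof -
  let ?q = "p (Suc n)"
  have 1: "assoc M (p n) U W \<cdot> (ins n j U \<boxtimes> Id M W) = ins n j (U \<otimes> W) \<cdot> p 0 \<rhd> assoc M ?q U W
    \<cdot> assoc M (p 0) (?q \<otimes> U) W"
    unfolding ins_def by (rule l2_strength) (auto simp: less_Suc_eq_le)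
  have "D \<rhd> assoc M (p n) U W \<cdot> assoc M D (p n \<otimes> U) W \<cdot> (dl n j U \<boxtimes> Id M W)
    = D \<rhd> (assoc M (p n) U W \<cdot> (ins n j U \<boxtimes> Id M W)) \<cdot> assoc M D (p 0 \<otimes> (?q \<otimes> U)) W \<cdot> (hD (?q \<otimes> U) \<boxtimes> Id M W)"
    by (simp add: dl_def Comp_wh pre[OF assoc_tail] wh_Comp)
  also have "\<dots> = D \<rhd> ins n j (U \<otimes> W) \<cdot> D \<rhd> (p 0 \<rhd> assoc M ?q U W)
      \<cdot> (D \<rhd> assoc M (p 0) (?q \<otimes> U) W \<cdot> assoc M D (p 0 \<otimes> (?q \<otimes> U)) W \<cdot> (hD (?q \<otimes> U) \<boxtimes> Id M W))"
    unfolding 1 by (simp add: wh_Comp)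
  also have "\<dots> = D \<rhd> ins n j (U \<otimes> W) \<cdot> (D \<rhd> (p 0 \<rhd> assoc M ?q U W) \<cdot> hD ((?q \<otimes> U) \<otimes> W))"
    by (subst unit_op_strength) auto
  also have "D \<rhd> (p 0 \<rhd> assoc M ?q U W) \<cdot> hD ((?q \<otimes> U) \<otimes> W) = hD (?q \<otimes> (U \<otimes> W)) \<cdot> assoc M ?q U W"
    by (simp add: hD_tail)
  finally have 2: "D \<rhd> assoc M (p n) U W \<cdot> assoc M D (p n \<otimes> U) W \<cdot> (dl n j U \<boxtimes> Id M W)
    = dl n j (U \<otimes> W) \<cdot> assoc M ?q U W"
    by (simp add: dl_def)
  have "V \<rhd> assoc M (p n) U W \<cdot> assoc M V (p n \<otimes> U) W \<cdot> (dv n j U \<boxtimes> Id M W)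
    = (io \<boxtimes> Id M (p n \<otimes> (U \<otimes> W))) \<cdot> D \<rhd> assoc M (p n) U W \<cdot> assoc M D (p n \<otimes> U) W \<cdot> (dl n j U \<boxtimes> Id M W)"
    by (simp add: dv_def Comp_wh pre[OF assoc_first] pre[OF whisker_swap[of io]])
  also have "\<dots> = dv n j (U \<otimes> W) \<cdot> assoc M ?q U W"
    unfolding 2 by (simp add: dv_def)
  finally show ?thesis .
qed

end

context truncated_action begin

text \<open>\<open>T\<close> and \<open>\<Delta>\<close> with tail \<open>1\<close> determine them with an arbitrary tail, which brings the
  identities proved with tails down to the coendomorphism operad.\<close>

primrec tcon :: "nat \<Rightarrow> 'o \<Rightarrow> 'a" where
  "tcon 0 W = lunit M W"
| "tcon (Suc n) W = V \<rhd> tcon n W \<cdot> assoc M V (pw n (unit M)) W"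

lemma
  assumes [simp]: "W \<in> Ob M"
  shows Ar_tcon [simp]: "tcon n W \<in> Ar M"
    and Dom_tcon [simp]: "Dom M (tcon n W) = pw n (unit M) \<otimes> W"
    and Cod_tcon [simp]: "Cod M (tcon n W) = pw n W"
proof -
  have "tcon n W \<in> Ar M \<and> Dom M (tcon n W) = pw n (unit M) \<otimes> W \<and> Cod M (tcon n W) = pw n W"
    by (induction n) auto
  then show "tcon n W \<in> Ar M" "Dom M (tcon n W) = pw n (unit M) \<otimes> W" "Cod M (tcon n W) = pw n W" by auto
qed

lemma tconcat_tcon: "tconcat M V n b = tcon n (tpow M V b)"
  by (induction n) (auto simp: pw_unit)

abbreviation tl :: "'o \<Rightarrow> 'a" where
  "tl W \<equiv> V \<rhd> lunit M W \<cdot> assoc M V (unit M) W"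

lemma T_strength:
  "W \<in> Ob M \<Longrightarrow> tcon (Suc n) W \<cdot> (T n (unit M) \<boxtimes> Id M W) = T n W \<cdot> p (Suc n) \<rhd> tl W \<cdot> assoc M (p (Suc n)) (V \<otimes>
    unit M) W"
proof (induction n)
  case 0
  note [simp] = 0
  have "aV W \<cdot> p (Suc 0) \<rhd> (V \<rhd> lunit M W) = V \<rhd> lunit M W \<cdot> aV (unit M \<otimes> W)"
    by (subst l2_natural[where W = "unit M \<otimes> W"]) auto
  then show ?case
    by (simp add: l2_strength wh_Comp pre[where g = "aV W"])
next
  case (Suc n)
  note [simp] = Suc.prems
  let ?I = "unit M" and ?Q = "pw n (unit M)" and ?q = "p (Suc n)" and ?P = "p (Suc (Suc n))"
  have "tcon (Suc (Suc n)) W \<cdot> (T (Suc n) ?I \<boxtimes> Id M W)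
    = V \<rhd> (V \<rhd> tcon n W) \<cdot> (V \<rhd> assoc M V ?Q W \<cdot> assoc M V (V \<otimes> ?Q) W \<cdot> (sw V V ?Q \<boxtimes> Id M W))
      \<cdot> ((V \<rhd> T n ?I) \<boxtimes> Id M W) \<cdot> (dv (Suc n) 1 (V \<otimes> ?I) \<boxtimes> Id M W)"
    by (simp add: wh_Comp Comp_wh)
  also have "\<dots> = V \<rhd> (V \<rhd> tcon n W) \<cdot> sw V V (?Q \<otimes> W) \<cdot> V \<rhd> assoc M V ?Q W \<cdot> (assoc M V (V \<otimes> ?Q) W
      \<cdot> ((V \<rhd> T n ?I) \<boxtimes> Id M W)) \<cdot> (dv (Suc n) 1 (V \<otimes> ?I) \<boxtimes> Id M W)"
    by (subst sw_strength) auto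
  also have "\<dots> = sw V V (pw n W) \<cdot> V \<rhd> (tcon (Suc n) W \<cdot> (T n ?I \<boxtimes> Id M W)) \<cdot> assoc M V (?q \<otimes> (V \<otimes> ?I)) W
       \<cdot> (dv (Suc n) 1 (V \<otimes> ?I) \<boxtimes> Id M W)"
    by (simp add: assoc_tail wh_Comp pre[OF sw_tail])
  also have "\<dots> = sw V V (pw n W) \<cdot> V \<rhd> T n W \<cdot> V \<rhd> (?q \<rhd> tl W) \<cdot> (V \<rhd> assoc M ?q (V \<otimes> ?I) W
       \<cdot> assoc M V (?q \<otimes> (V \<otimes> ?I)) W \<cdot> (dv (Suc n) 1 (V \<otimes> ?I) \<boxtimes> Id M W))"
    unfolding Suc.IH[OF Suc.prems] by (simp add: wh_Comp)
  also have "\<dots> = sw V V (pw n W) \<cdot> V \<rhd> T n W \<cdot> (V \<rhd> (?q \<rhd> tl W) \<cdot> dv (Suc n) 1 ((V \<otimes> ?I) \<otimes> W))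
    \<cdot> assoc M ?P (V \<otimes> ?I) W"
    by (subst dv_strength) auto
  also have "V \<rhd> (?q \<rhd> tl W) \<cdot> dv (Suc n) 1 ((V \<otimes> ?I) \<otimes> W) = dv (Suc n) 1 (V \<otimes> W) \<cdot> ?P \<rhd> tl W"
    by (subst dv_tail) auto
  finally show ?case by simp
qed

lemma \<Delta>_strength:
  "W \<in> Ob M \<Longrightarrow> tcon n W \<cdot> (\<Delta> n (unit M) \<boxtimes> Id M W) = \<Delta> n W \<cdot> p n \<rhd> tl W \<cdot> assoc M (p n) (V \<otimes> unit M) W"
proof (induction n)
  case 0
  note [simp] = 0
  have "lunit M W \<cdot> eV (unit M \<otimes> W) = eV W \<cdot> p 0 \<rhd> (V \<rhd> lunit M W)"
    by (simp add: eV_tail)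
  then show ?case
    by (simp add: counit_op_strength wh_Comp pre[where g = "lunit M W"])
next
  case (Suc n)
  note [simp] = Suc.prems
  let ?I = "unit M" and ?Q = "pw n (unit M)" and ?q = "p n" and ?P = "p (Suc n)"
  have "tcon (Suc n) W \<cdot> ((V \<rhd> \<Delta> n ?I \<cdot> dv n 0 (V \<otimes> ?I)) \<boxtimes> Id M W)
    = V \<rhd> (tcon n W \<cdot> (\<Delta> n ?I \<boxtimes> Id M W)) \<cdot> assoc M V (?q \<otimes> (V \<otimes> ?I)) W \<cdot> (dv n 0 (V \<otimes> ?I) \<boxtimes> Id M W)"
    by (simp add: Comp_wh wh_Comp pre[OF assoc_tail])
  also have "\<dots> = V \<rhd> \<Delta> n W \<cdot> V \<rhd> (?q \<rhd> tl W) \<cdot> (V \<rhd> assoc M ?q (V \<otimes> ?I) W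
       \<cdot> assoc M V (?q \<otimes> (V \<otimes> ?I)) W \<cdot> (dv n 0 (V \<otimes> ?I) \<boxtimes> Id M W))"
    unfolding Suc.IH[OF Suc.prems] by (simp add: wh_Comp)
  also have "\<dots> = V \<rhd> \<Delta> n W \<cdot> (V \<rhd> (?q \<rhd> tl W) \<cdot> dv n 0 ((V \<otimes> ?I) \<otimes> W)) \<cdot> assoc M ?P (V \<otimes> ?I) W"
    by (subst dv_strength) auto
  also have "V \<rhd> (?q \<rhd> tl W) \<cdot> dv n 0 ((V \<otimes> ?I) \<otimes> W) = dv n 0 (V \<otimes> W) \<cdot> ?P \<rhd> tl W"
    by (subst dv_tail) auto
  finally show ?case
    using T_strength[OF Suc.prems, of n] by (simp add: pl_wh Comp_pl pl_Comp del: tcon.simps T.simps)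
qed

text \<open>The left side is what \<open>ev_at\<close> yields at slot 0 for the curried coaction:
  evaluation with tail 1, followed by concatenation with the other factors.\<close>

lemma tcon_\<Delta>:
  assumes [simp]: "W \<in> Ob M"
  shows "tcon n W \<cdot> ((\<Delta> n (unit M) \<cdot> p n \<rhd> ri V) \<boxtimes> Id M W) \<cdot> ai (p n) V W = \<Delta> n W"
proof -
  have "tcon n W \<cdot> ((\<Delta> n (unit M) \<cdot> p n \<rhd> ri V) \<boxtimes> Id M W) \<cdot> ai (p n) V W
    = (tcon n W \<cdot> (\<Delta> n (unit M) \<boxtimes> Id M W)) \<cdot> ((p n \<rhd> ri V) \<boxtimes> Id M W) \<cdot> ai (p n) V W"
    by (simp add: Comp_wh)
  also have "\<dots> = \<Delta> n W \<cdot> p n \<rhd> tl W \<cdot> (assoc M (p n) (V \<otimes> unit M) W \<cdot> ((p n \<rhd> ri V) \<boxtimes> Id M W)) \<cdot> ai (p n) V W"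
    unfolding \<Delta>_strength[OF assms] by simp
  also have "\<dots> = \<Delta> n W \<cdot> p n \<rhd> (tl W \<cdot> (ri V \<boxtimes> Id M W))"
    by (simp add: assoc_tail wh_Comp)
  also have "tl W \<cdot> (ri V \<boxtimes> Id M W) = Id M (V \<otimes> W)"
    by (simp add: triangle')
  finally show ?thesis by simp
qed

end

text \<open>In \<open>unital\<close> the first summand pairs with the constants and records the
  result, which is the projection onto D. The second lets the unit operation act, which is the
  projection onto H. Together they form \<open>\<Delta>\<close> of arity one evaluated at the
  unit.\<close>

locale truncated_coalgebra = truncated_action M P V D e eta io pl nul a + closed_typed_smc M
  for M :: "('o, 'a, 'm) smcat_scheme" (structure) and P V D e eta io
    and pl (infixl "\<oplus>\<oplus>" 60) and nul and a +
  assumes unital: "W \<in> Ob M \<Longrightarrow>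
    (V \<rhd> counit_op e (arity P 0) V W \<cdot> (io \<boxtimes> Id M (arity P 0 \<otimes> (V \<otimes> W))) \<cdot> unit_op eta D (arity P 0) (V \<otimes> W))
    \<oplus>\<oplus> (l2 a (arity P (Suc 0)) V W \<cdot> (opunit P \<boxtimes> Id M (V \<otimes> W)) \<cdot> inv_ar M (lunit M (V \<otimes> W))) = Id M (V \<otimes> W)"
begin

lemma
  shows Ar_opunit [simp]: "opunit P \<in> Ar M"
    and Dom_opunit [simp]: "Dom M (opunit P) = unit M"
    and Cod_opunit [simp]: "Cod M (opunit P) = p (Suc 0)"
  using opunit_hom by (auto simp: hom_iff)

text \<open>Filling the single input of the identity operation gives the filling constant
  back.\<close>

lemma ins_opunit:
  assumes [simp]: "W \<in> Ob M"
  shows "ins 0 0 W \<cdot> p 0 \<rhd> (opunit P \<boxtimes> Id M W) = p 0 \<rhd> lunit M W"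
proof -
  have 1: "c (Suc 0) 0 0 W \<cdot> (opunit P \<boxtimes> Id M (p 0 \<otimes> W)) = lunit M (p 0 \<otimes> W)"
    using l2_dom[of "pcomp P (Suc 0) 0 0" "p (Suc 0)" "p 0" "opunit P" "Id M (p 0)" "unit M"
      "p 0" W] pcomp_unit_left[of 0]
    by (simp add: c_def) (simp add: l2_def lunit_tens[symmetric])
  have "ins 0 0 W \<cdot> p 0 \<rhd> (opunit P \<boxtimes> Id M W)
    = (c (Suc 0) 0 0 W \<cdot> (opunit P \<boxtimes> Id M (p 0 \<otimes> W))) \<cdot> sw (p 0) (unit M) W"
    by (simp add: ins_eq sw_second)
  then show ?thesis unfolding 1 by (simp add: sw_unit_right)
qed

lemma dv_opunit:
  assumes [simp]: "W \<in> Ob M"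
  shows "dv 0 0 W \<cdot> (opunit P \<boxtimes> Id M W) \<cdot> li W = (io \<boxtimes> Id M (p 0 \<otimes> W)) \<cdot> hD W"
proof -
  have "hD (p (Suc 0) \<otimes> W) \<cdot> (opunit P \<boxtimes> Id M W) \<cdot> li W
    = D \<rhd> (p 0 \<rhd> (opunit P \<boxtimes> Id M W)) \<cdot> D \<rhd> (p 0 \<rhd> li W) \<cdot> hD W"
    by (simp add: hD_tail wh_Comp)
  then have "dl 0 0 W \<cdot> (opunit P \<boxtimes> Id M W) \<cdot> li W
    = D \<rhd> (ins 0 0 W \<cdot> p 0 \<rhd> (opunit P \<boxtimes> Id M W)) \<cdot> D \<rhd> (p 0 \<rhd> li W) \<cdot> hD W"
    by (simp add: dl_def wh_Comp)
  also have "\<dots> = D \<rhd> (p 0 \<rhd> lunit M W \<cdot> p 0 \<rhd> li W) \<cdot> hD W"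
    unfolding ins_opunit[OF assms] by (simp add: wh_inverse'[OF wh_inverse[OF lunit_li]])
  finally show ?thesis by (simp add: dv_def)
qed

lemma \<Delta>_opunit:
  assumes [simp]: "W \<in> Ob M"
  shows "\<Delta> (Suc 0) W \<cdot> (opunit P \<boxtimes> Id M (V \<otimes> W)) = lunit M (V \<otimes> W)"
proof -
  have "\<Delta> (Suc 0) W \<cdot> (opunit P \<boxtimes> Id M (V \<otimes> W)) \<cdot> li (V \<otimes> W) = Id M (V \<otimes> W)"
    using unital[OF assms] by (simp add: pl_Comp dv_opunit)
  then have "(\<Delta> (Suc 0) W \<cdot> (opunit P \<boxtimes> Id M (V \<otimes> W)) \<cdot> li (V \<otimes> W)) \<cdot> lunit M (V \<otimes> W) = lunit M (V \<otimes> W)"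
    by simp
  then show ?thesis by (simp del: \<Delta>.simps)
qed

definition coop :: "nat \<Rightarrow> 'a" where
  "coop n = \<Delta> n (unit M) \<cdot> p n \<rhd> ri V"

lemma
  shows Ar_coop [simp]: "coop n \<in> Ar M"
    and Dom_coop [simp]: "Dom M (coop n) = p n \<otimes> V"
    and Cod_coop [simp]: "Cod M (coop n) = tpow M V n"
  by (auto simp: coop_def pw_unit)

definition coaction :: "nat \<Rightarrow> 'a" where
  "coaction n = curry_ar M (p n) V (tpow M V n) (coop n)"

lemma
  shows Ar_coaction [simp]: "coaction n \<in> Ar M"
    and Dom_coaction [simp]: "Dom M (coaction n) = p n"
    and Cod_coaction [simp]: "Cod M (coaction n) = ihom M V (tpow M V n)"
    and ev_coaction: "ev M V (tpow M V n) \<cdot> (coaction n \<boxtimes> Id M V) = coop n"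
  by (auto simp: coaction_def ev_curry)

lemma coaction_equivariant:
  assumes [simp]: "\<sigma> permutes {..<n}"
  shows "coaction n \<cdot> act P n \<sigma> = act (Coend M V) n \<sigma> \<cdot> coaction n"
proof -
  let ?t = "tperm M V n \<sigma>"
  have e: "?t \<in> Ar M" "Dom M ?t = tpow M V n" "Cod M ?t = tpow M V n"
     "\<Delta> n (unit M) \<cdot> (act P n \<sigma> \<boxtimes> Id M (V \<otimes> unit M)) = ?t \<cdot> \<Delta> n (unit M)"
    using equivariant_tperm[OF assms] by (auto simp: equivariant_def pw_unit)
  note [simp] = e(1-3)
  have "coop n \<cdot> (act P n \<sigma> \<boxtimes> Id M V) = (\<Delta> n (unit M) \<cdot> (act P n \<sigma> \<boxtimes> Id M (V \<otimes> unit M))) \<cdot> p n \<rhd> ri V"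
    by (simp add: coop_def whisker_swap)
  also have "\<dots> = ?t \<cdot> coop n"
    unfolding e(4) by (simp add: coop_def pw_unit)
  finally have "coaction n \<cdot> act P n \<sigma> = curry_ar M (p n) V (tpow M V n) (?t \<cdot> coop n)"
    by (simp add: coaction_def curry_Comp)
  also have "\<dots> = act (Coend M V) n \<sigma> \<cdot> coaction n"
    by (simp add: Coend_def Let_def curry_Comp ev_coaction)
  finally show ?thesis .
qed

text \<open>Typing and equation are proved together because the induction step composes with the
  previous \<open>ev_at\<close> and needs its type.\<close>

lemma ev_at_coaction:
  "i \<le> m \<Longrightarrow> ev_at M V n i (Suc m) \<in> Ar M \<and> Dom M (ev_at M V n i (Suc m)) = ihom M V (tpow M V n) \<otimes> tpow M V (Suc m)
    \<and> ev_at M V n i (Suc m) \<cdot> (coaction n \<boxtimes> Id M (tpow M V (Suc m))) = at_slot n i (Suc m) (unit M)"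
proof (induction i arbitrary: m)
  case 0
  let ?W = "tpow M V m" and ?E = "ihom M V (tpow M V n)"
  have "ai ?E V ?W \<cdot> (coaction n \<boxtimes> Id M (V \<otimes> ?W)) = ((coaction n \<boxtimes> Id M V) \<boxtimes> Id M ?W) \<cdot> ai (p n) V ?W"
    using ai_natural[of "coaction n" "Id M V" "Id M ?W" ?E V ?W "p n" V ?W] by simp
  then have "ev_at M V n 0 (Suc m) \<cdot> (coaction n \<boxtimes> Id M (tpow M V (Suc m)))
    = tcon n ?W \<cdot> (ev M V (tpow M V n) \<boxtimes> Id M ?W) \<cdot> ((coaction n \<boxtimes> Id M V) \<boxtimes> Id M ?W) \<cdot> ai (p n) V ?W"
    by (simp add: tconcat_tcon Let_def pw_unit)
  also have "\<dots> = tcon n ?W \<cdot> ((ev M V (tpow M V n) \<cdot> (coaction n \<boxtimes> Id M V)) \<boxtimes> Id M ?W) \<cdot> ai (p n) V ?W"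
    by (simp add: Comp_wh pw_unit)
  also have "\<dots> = \<Delta> n ?W"
    unfolding ev_coaction coop_def by (rule tcon_\<Delta>) simp
  finally show ?case
    by (simp add: tconcat_tcon Let_def pw_unit)
next
  case (Suc i)
  then obtain m' where m: "m = Suc m'" by (cases m) auto
  let ?W = "tpow M V m" and ?E = "ihom M V (tpow M V n)" and ?F = "ev_at M V n i m"
  have IH: "?F \<in> Ar M" "Dom M ?F = ?E \<otimes> tpow M V m"
    "?F \<cdot> (coaction n \<boxtimes> Id M (tpow M V m)) = at_slot n i m (unit M)"
    using Suc m by auto
  note [simp] = IH(1,2)
  have eq: "ev_at M V n (Suc i) (Suc m) = V \<rhd> ?F \<cdot> sw ?E V ?W"
    by (simp add: Let_def sw_def)
  have "(V \<rhd> ?F \<cdot> sw ?E V ?W) \<cdot> (coaction n \<boxtimes> Id M (tpow M V (Suc m)))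
    = V \<rhd> (?F \<cdot> (coaction n \<boxtimes> Id M (tpow M V m))) \<cdot> sw (p n) V ?W"
    by (simp add: sw_first wh_Comp)
  then show ?case
    unfolding eq IH(3) by (simp add: pw_unit)
qed

text \<open>Both sides are curried maps, so their evaluations are compared. Once the operations are
  braided into the order in which \<open>Coend\<close> evaluates them, the claim is
  \<open>\<Delta>_c\<close> with tail 1.\<close>

lemma coaction_pcomp:
  assumes [simp]: "i < m"
  shows "coaction (m + n - 1) \<cdot> pcomp P m n i = pcomp (Coend M V) m n i \<cdot> (coaction m \<boxtimes> coaction n)"
proof -
  let ?I = "unit M" and ?V = "tpow M V" and ?E = "\<lambda>n. ihom M V (tpow M V n)"
  let ?F = "ev_at M V n i m"
  obtain m' where m: "m = Suc m'" using assms by (cases m) auto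
  have i [simp]: "i \<le> m'" using assms m by simp
  have F: "?F \<in> Ar M" "Dom M ?F = ?E n \<otimes> ?V m" "?F \<cdot> (coaction n \<boxtimes> Id M (?V m)) = at_slot n i m ?I"
    using ev_at_coaction[OF i, of n] by (auto simp: m)
  note [simp] = F(1,2)
  have CF [simp]: "Cod M ?F = ?V (m + n - 1)"
  proof -
    have "Cod M (?F \<cdot> (coaction n \<boxtimes> Id M (?V m))) = pw (n + m') ?I"
      unfolding F(3) by (simp add: m)
    then show ?thesis by (simp add: pw_unit m add.commute)
  qed
  let ?comp = "?F \<cdot> ?E n \<rhd> ev M V (?V m) \<cdot> assoc M (?E n) (?E m) V \<cdot> (braid M (?E m) (?E n) \<boxtimes> Id M V)"
  have 1: "assoc M (?E n) (?E m) V \<cdot> (braid M (?E m) (?E n) \<boxtimes> Id M V) \<cdot> ((coaction m \<boxtimes> coaction n) \<boxtimes> Id M V)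
      = (coaction n \<boxtimes> (coaction m \<boxtimes> Id M V)) \<cdot> sw (p m) (p n) V \<cdot> assoc M (p m) (p n) V"
  proof -
    have "(braid M (?E m) (?E n) \<boxtimes> Id M V) \<cdot> ((coaction m \<boxtimes> coaction n) \<boxtimes> Id M V)
      = ((coaction n \<boxtimes> coaction m) \<boxtimes> Id M V) \<cdot> (braid M (p m) (p n) \<boxtimes> Id M V)"
      by (simp add: Comp_wh[symmetric] braid_natural[where X = "p m" and Y = "p n"])
    then show ?thesis
      using pre[OF assoc_natural[of "coaction n" "coaction m" "Id M V" "?E n" "?E m" V "p n" "p m" V],
        of "braid M (p m) (p n) \<boxtimes> Id M V"]
      by (simp add: sw_def)
  qed
  have 2: "?E n \<rhd> ev M V (?V m) \<cdot> (coaction n \<boxtimes> (coaction m \<boxtimes> Id M V))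
      = (coaction n \<boxtimes> Id M (?V m)) \<cdot> p n \<rhd> coop m"
    by (simp add: tens_Comp_tens ev_coaction)
  have 3: "sw (p m) (p n) (V \<otimes> ?I) \<cdot> p m \<rhd> (p n \<rhd> ri V) = p n \<rhd> (p m \<rhd> ri V) \<cdot> sw (p m) (p n) V"
    by (subst sw_tail) auto
  have "?comp \<cdot> ((coaction m \<boxtimes> coaction n) \<boxtimes> Id M V)
    = ?F \<cdot> ?E n \<rhd> ev M V (?V m) \<cdot> (coaction n \<boxtimes> (coaction m \<boxtimes> Id M V)) \<cdot> sw (p m) (p n) V \<cdot> assoc M (p m) (p n) V"
    by (simp add: 1)
  also have "\<dots> = (?F \<cdot> (coaction n \<boxtimes> Id M (?V m))) \<cdot> p n \<rhd> coop m \<cdot> sw (p m) (p n) V \<cdot> assoc M (p m) (p n) V"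
    by (simp add: pre[OF 2])
  also have "\<dots> = at_slot n i m ?I \<cdot> p n \<rhd> \<Delta> m ?I \<cdot> (p n \<rhd> (p m \<rhd> ri V) \<cdot> sw (p m) (p n) V) \<cdot> assoc M (p m) (p n) V"
    unfolding F(3) by (simp add: coop_def wh_Comp m pw_unit)
  also have "\<dots> = (at_slot n i m ?I \<cdot> p n \<rhd> \<Delta> m ?I \<cdot> sw (p m) (p n) (V \<otimes> ?I)) \<cdot> p m \<rhd> (p n \<rhd> ri V)
    \<cdot> assoc M (p m) (p n) V"
    unfolding 3[symmetric] by (simp add: m pw_unit)
  also have "at_slot n i m ?I \<cdot> p n \<rhd> \<Delta> m ?I \<cdot> sw (p m) (p n) (V \<otimes> ?I) = \<Delta> (m + n - 1) ?I \<cdot> c m n i (V \<otimes> ?I)"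
    using \<Delta>_c[OF unit_Ob i, of n] by (simp add: m del: \<Delta>.simps)
  also have "(\<Delta> (m + n - 1) ?I \<cdot> c m n i (V \<otimes> ?I)) \<cdot> p m \<rhd> (p n \<rhd> ri V) \<cdot> assoc M (p m) (p n) V
      = \<Delta> (m + n - 1) ?I \<cdot> p (m + n - 1) \<rhd> ri V \<cdot> c m n i V \<cdot> assoc M (p m) (p n) V"
    by (simp add: pre[OF c_tail])
  also have "\<dots> = coop (m + n - 1) \<cdot> (pcomp P m n i \<boxtimes> Id M V)"
    by (simp add: coop_def c_def l2_def)
  finally have 4: "?comp \<cdot> ((coaction m \<boxtimes> coaction n) \<boxtimes> Id M V) = coop (m + n - 1) \<cdot> (pcomp P m n i \<boxtimes> Id M V)" .
  have "pcomp (Coend M V) m n i \<cdot> (coaction m \<boxtimes> coaction n)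
    = curry_ar M (p m \<otimes> p n) V (?V (m + n - 1)) (?comp \<cdot> ((coaction m \<boxtimes> coaction n) \<boxtimes> Id M V))"
    unfolding Coend_def Let_def by (simp add: curry_Comp)
  also have "\<dots> = curry_ar M (p m \<otimes> p n) V (?V (m + n - 1)) (coop (m + n - 1) \<cdot> (pcomp P m n i \<boxtimes> Id M V))"
    unfolding 4 ..
  also have "\<dots> = coaction (m + n - 1) \<cdot> pcomp P m n i"
    unfolding coaction_def by (simp add: curry_Comp)
  finally show ?thesis by simp
qed

theorem operad_hom_coaction: "operad_hom M P (Coend M V) coaction"
  unfolding operad_hom_def
proof (intro conjI allI impI)
  show "coaction n \<in> hom M (arity P n) (arity (Coend M V) n)" for n
    by (simp add: hom_iff Coend_def Let_def)
  show "coaction n \<cdot> act P n \<sigma> = act (Coend M V) n \<sigma> \<cdot> coaction n" if "\<sigma> permutes {..<n}" for n \<sigma>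
    using that by (rule coaction_equivariant)
  show "coaction (m + n - 1) \<cdot> pcomp P m n i = pcomp (Coend M V) m n i \<cdot> coaction m \<boxtimes> coaction n" if "i < m" for m n i
    using that by (rule coaction_pcomp)
  have "coop (Suc 0) \<cdot> (opunit P \<boxtimes> Id M V)
    = (\<Delta> (Suc 0) (unit M) \<cdot> (opunit P \<boxtimes> Id M (V \<otimes> unit M))) \<cdot> unit M \<rhd> ri V"
    by (simp add: coop_def whisker_swap del: \<Delta>.simps)
  also have "\<dots> = ri V \<cdot> lunit M V"
    unfolding \<Delta>_opunit[OF unit_Ob] by (simp add: lunit_natural)
  finally show "coaction 1 \<cdot> opunit P = opunit (Coend M V)"
    by (simp add: coaction_def curry_Comp Coend_def Let_def)
qed

theorem is_coalg_coaction: "is_coalg M P \<lparr>carr = V, coact = coaction\<rparr>"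
  by (simp add: is_coalg_def operad_hom_coaction)

end

section \<open>Further coherence of the units\<close>

context typed_smc begin

lemma runit_natural:
  "f \<in> Ar M \<Longrightarrow> Dom M f = X \<Longrightarrow> Cod M f = X' \<Longrightarrow> runit M X' \<cdot> (f \<boxtimes> Id M (unit M)) = f \<cdot> runit M X"
  using runit_nat[of f X X'] by (simp add: hom_iff)

lemma ri_natural:
  assumes "f \<in> Ar M" "Dom M f = X" "Cod M f = X'"
  shows "ri X' \<cdot> f = (f \<boxtimes> Id M (unit M)) \<cdot> ri X"
proof -
  have [simp]: "X \<in> Ob M" "X' \<in> Ob M" using assms by auto
  have "ri X' \<cdot> f = ri X' \<cdot> (f \<cdot> runit M X) \<cdot> ri X" using assms by simp
  also have "\<dots> = (f \<boxtimes> Id M (unit M)) \<cdot> ri X"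
    using assms by (subst runit_natural[symmetric]) auto
  finally show ?thesis .
qed

lemma unit_hw_inject:
  assumes "f \<boxtimes> Id M (unit M) = g \<boxtimes> Id M (unit M)" "f \<in> Ar M" "g \<in> Ar M" "Dom M f = Dom M g" "Cod M f = Cod M g"
  shows "f = g"
proof -
  have "f \<cdot> runit M (Dom M f) = g \<cdot> runit M (Dom M f)"
    using assms runit_nat[OF Ar_hom[of f]] runit_nat[OF Ar_hom[of g]] by simp
  then show ?thesis
    by (rule cancel_epi[where k = "ri (Dom M f)"]) (use assms in auto)
qed

text \<open>The mirror image of \<open>lunit_tens\<close>, from the pentagon and the triangle after
  tensoring with the unit on the right.\<close>

lemma runit_tens:
  assumes [simp]: "X \<in> Ob M" "Y \<in> Ob M"
  shows "X \<rhd> runit M Y \<cdot> assoc M X Y (unit M) = runit M (X \<otimes> Y)"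
proof (rule unit_hw_inject)
  let ?I = "unit M"
  have "assoc M X Y ?I \<cdot> (runit M (X \<otimes> Y) \<boxtimes> Id M ?I)
    = (assoc M X Y ?I \<cdot> (X \<otimes> Y) \<rhd> lunit M ?I) \<cdot> assoc M (X \<otimes> Y) ?I ?I"
    by (simp add: triangle')
  also have "assoc M X Y ?I \<cdot> (X \<otimes> Y) \<rhd> lunit M ?I = X \<rhd> (Y \<rhd> lunit M ?I) \<cdot> assoc M X Y (?I \<otimes> ?I)"
    using assoc_natural[of "Id M X" "Id M Y" "lunit M ?I" X Y ?I X Y "?I \<otimes> ?I"] by simp
  also have "(X \<rhd> (Y \<rhd> lunit M ?I) \<cdot> assoc M X Y (?I \<otimes> ?I)) \<cdot> assoc M (X \<otimes> Y) ?I ?I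
    = X \<rhd> (Y \<rhd> lunit M ?I \<cdot> assoc M Y ?I ?I) \<cdot> assoc M X (Y \<otimes> ?I) ?I \<cdot> (assoc M X Y ?I \<boxtimes> Id M ?I)"
    by (simp add: pentagon wh_Comp)
  also have "\<dots> = (X \<rhd> (runit M Y \<boxtimes> Id M ?I) \<cdot> assoc M X (Y \<otimes> ?I) ?I) \<cdot> (assoc M X Y ?I \<boxtimes> Id M ?I)"
    by (simp add: triangle')
  also have "\<dots> = assoc M X Y ?I \<cdot> ((X \<rhd> runit M Y \<cdot> assoc M X Y ?I) \<boxtimes> Id M ?I)"
    by (simp add: Comp_wh pre[OF assoc_tail])
  finally show "(X \<rhd> runit M Y \<cdot> assoc M X Y ?I) \<boxtimes> Id M ?I = runit M (X \<otimes> Y) \<boxtimes> Id M ?I"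
    by (rule cancel_mono[where k = "ai X Y ?I", OF sym]) auto
qed auto

text \<open>Naturality of \<open>lunit\<close> along itself gives
  \<open>lunit M (?I \<otimes> ?I) = ?I \<rhd> lunit M ?I\<close>; inserting this into
  \<open>lunit_tens\<close> and comparing with the triangle gives the claim.\<close>

lemma lunit_unit: "lunit M (unit M) = runit M (unit M)"
proof (rule unit_hw_inject)
  let ?I = "unit M"
  have "lunit M ?I \<cdot> lunit M (?I \<otimes> ?I) = lunit M ?I \<cdot> ?I \<rhd> lunit M ?I"
    by (simp add: lunit_natural)
  then have "lunit M (?I \<otimes> ?I) = ?I \<rhd> lunit M ?I"
    by (rule cancel_mono[where k = "li ?I"]) auto
  then have "lunit M ?I \<boxtimes> Id M ?I = ?I \<rhd> lunit M ?I \<cdot> assoc M ?I ?I ?I"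
    by (simp add: lunit_tens[symmetric])
  then show "lunit M ?I \<boxtimes> Id M ?I = runit M ?I \<boxtimes> Id M ?I"
    by (simp add: triangle')
qed auto

lemma counit_op_unit:
  assumes [simp]: "e \<in> Ar M" "Dom M e = X \<otimes> Y" "Cod M e = unit M" "X \<in> Ob M" "Y \<in> Ob M"
  shows "counit_op e X Y (unit M) \<cdot> X \<rhd> ri Y = e"
proof -
  have "ai X Y (unit M) \<cdot> X \<rhd> ri Y = ri (X \<otimes> Y)"
  proof (rule cancel_mono[where l = "X \<rhd> runit M Y \<cdot> assoc M X Y (unit M)" and k = "ri (X \<otimes> Y)"])
    have "(X \<rhd> runit M Y \<cdot> assoc M X Y (unit M)) \<cdot> ri (X \<otimes> Y) = Id M (X \<otimes> Y)"
      unfolding runit_tens[OF \<open>X \<in> Ob M\<close> \<open>Y \<in> Ob M\<close>] by simp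
    then show "(X \<rhd> runit M Y \<cdot> assoc M X Y (unit M)) \<cdot> ai X Y (unit M) \<cdot> X \<rhd> ri Y
      = (X \<rhd> runit M Y \<cdot> assoc M X Y (unit M)) \<cdot> ri (X \<otimes> Y)"
      by (simp add: wh_inverse[OF runit_ri])
    show "ri (X \<otimes> Y) \<cdot> X \<rhd> runit M Y \<cdot> assoc M X Y (unit M) = Id M ((X \<otimes> Y) \<otimes> unit M)"
      by (simp add: runit_tens)
  qed auto
  then have "counit_op e X Y (unit M) \<cdot> X \<rhd> ri Y = lunit M (unit M) \<cdot> (e \<boxtimes> Id M (unit M)) \<cdot> ri (X \<otimes> Y)"
    by (simp add: counit_op_def l2_def)
  also have "\<dots> = lunit M (unit M) \<cdot> ri (unit M) \<cdot> e"
    by (simp add: ri_natural[where X = "X \<otimes> Y"])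
  also have "\<dots> = e" by (simp add: lunit_unit)
  finally show ?thesis .
qed

lemma counit_op_braid:
  assumes [simp]: "e \<in> Ar M" "Dom M e = X \<otimes> Y" "X \<in> Ob M" "Y \<in> Ob M" "W \<in> Ob M" "Cod M e = unit M"
  shows "counit_op (e \<cdot> braid M Y X) Y X W = counit_op e X Y W \<cdot> sw Y X W"
  by (simp add: counit_op_def l2_def sw_def Comp_wh)

lemma unit_op_braid:
  assumes [simp]: "h \<in> Ar M" "Cod M h = X \<otimes> Y" "Dom M h = unit M" "X \<in> Ob M" "Y \<in> Ob M" "W \<in> Ob M"
  shows "unit_op (braid M X Y \<cdot> h) Y X W = sw X Y W \<cdot> unit_op h X Y W"
  by (simp add: unit_op_def sw_def Comp_wh)

end

section \<open>Dualisable objects and the triangle identities\<close>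

context closed_typed_smc begin

context
  fixes K :: 'o
  assumes dual: "dualisable M K"
begin

lemma K_Ob [simp]: "K \<in> Ob M"
  using dual by (simp add: dualisable_def)

abbreviation D :: 'o where "D \<equiv> dual M K"
abbreviation evK :: 'a where "evK \<equiv> ev M K (unit M)"

lemma D_Ob [simp]: "D \<in> Ob M" by (simp add: dual_def)
lemma
  shows Ar_evK [simp]: "evK \<in> Ar M" and Dom_evK [simp]: "Dom M evK = D \<otimes> K" and Cod_evK [simp]: "Cod M evK = unit M"
  by (simp_all add: dual_def)

text \<open>The preimage of the identity of K under the canonical map to \<open>[K, K]\<close>: the
  dual basis sum.\<close>

definition coev :: 'a where
  "coev = inv_ar M (dual_to_end M K) \<cdot> curry_ar M (unit M) K K (lunit M K)"

lemma dual_to_end_typing: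
  shows "dual_to_end M K \<in> Ar M" "Dom M (dual_to_end M K) = K \<otimes> D" "Cod M (dual_to_end M K) = ihom M K K"
  by (auto simp: dual_to_end_def)

lemma
  shows Ar_coev [simp]: "coev \<in> Ar M" and Dom_coev [simp]: "Dom M coev
    = unit M" and Cod_coev [simp]: "Cod M coev = K \<otimes> D"
  using dual dual_to_end_typing by (auto simp: dualisable_def coev_def Ar_inv_ar Dom_inv_ar Cod_inv_ar)

lemma coev_ev: "runit M K \<cdot> K \<rhd> evK \<cdot> assoc M K D K \<cdot> (coev \<boxtimes> Id M K) = lunit M K"
proof -
  let ?f = "runit M K \<cdot> K \<rhd> evK \<cdot> assoc M K D K"
  have "dual_to_end M K \<cdot> coev = curry_ar M (unit M) K K (lunit M K)"
    using dual dual_to_end_typing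
    by (simp add: coev_def dualisable_def pre1[OF inv_ar_right] Ar_inv_ar Dom_inv_ar Cod_inv_ar)
  then have "curry_ar M (unit M) K K (?f \<cdot> (coev \<boxtimes> Id M K)) = curry_ar M (unit M) K K (lunit M K)"
    by (simp add: dual_to_end_def curry_Comp)
  then have "ev M K K \<cdot> (curry_ar M (unit M) K K (?f \<cdot> (coev \<boxtimes> Id M K)) \<boxtimes> Id M K)
    = ev M K K \<cdot> (curry_ar M (unit M) K K (lunit M K) \<boxtimes> Id M K)" by simp
  then show ?thesis by (simp add: ev_curry)
qed

text \<open>\<open>coev_ev\<close>, the first triangle identity, spread over a tail; the pentagon
  moves the bracketing past the cup and the triangle absorbs the unit.\<close>

lemma zigzag_coev:
  assumes [simp]: "W \<in> Ob M"
  shows "K \<rhd> counit_op evK D K W \<cdot> unit_op coev K D (K \<otimes> W) = Id M (K \<otimes> W)"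
proof -
  have 1: "K \<rhd> (K \<rhd> Id M W) = Id M (K \<otimes> (K \<otimes> W))" by simp
  have "assoc M K D (K \<otimes> W) \<cdot> (coev \<boxtimes> Id M (K \<otimes> W))
     = assoc M K D (K \<otimes> W) \<cdot> assoc M (K \<otimes> D) K W \<cdot> ((coev \<boxtimes> Id M K) \<boxtimes> Id M W) \<cdot> ai (unit M) K W"
    by (simp add: pre[OF assoc_first])
  also have "\<dots> = (K \<rhd> assoc M D K W \<cdot> assoc M K (D \<otimes> K) W \<cdot> (assoc M K D K \<boxtimes> Id M W))
    \<cdot> ((coev \<boxtimes> Id M K) \<boxtimes> Id M W) \<cdot> ai (unit M) K W"
    by (subst pentagon') auto
  finally have "K \<rhd> counit_op evK D K W \<cdot> unit_op coev K D (K \<otimes> W)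
    = K \<rhd> lunit M W \<cdot> (K \<rhd> (evK \<boxtimes> Id M W) \<cdot> assoc M K (D \<otimes> K) W) \<cdot> (assoc M K D K \<boxtimes> Id M W)
      \<cdot> ((coev \<boxtimes> Id M K) \<boxtimes> Id M W) \<cdot> ai (unit M) K W \<cdot> li (K \<otimes> W)"
    by (simp add: counit_op_def unit_op_def l2_def wh_Comp pre[where g = "assoc M K D (K \<otimes> W)"])
  also have "\<dots> = (K \<rhd> lunit M W \<cdot> assoc M K (unit M) W) \<cdot> ((K \<rhd> evK) \<boxtimes> Id M W) \<cdot> (assoc M K D K \<boxtimes> Id M W)
    \<cdot> ((coev \<boxtimes> Id M K) \<boxtimes> Id M W) \<cdot> ai (unit M) K W \<cdot> li (K \<otimes> W)"
    by (simp add: pre[OF assoc_tail])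
  also have "\<dots> = (runit M K \<boxtimes> Id M W) \<cdot> ((K \<rhd> evK \<cdot> assoc M K D K \<cdot> (coev \<boxtimes> Id M K)) \<boxtimes> Id M W)
    \<cdot> ai (unit M) K W \<cdot> li (K \<otimes> W)"
    by (subst triangle') (auto simp: Comp_wh)
  also have "\<dots> = ((runit M K \<cdot> K \<rhd> evK \<cdot> assoc M K D K \<cdot> (coev \<boxtimes> Id M K)) \<boxtimes> Id M W) \<cdot> ai (unit M) K W \<cdot> li (K \<otimes> W)"
    by (simp add: Comp_wh)
  also have "\<dots> = (lunit M K \<boxtimes> Id M W) \<cdot> ai (unit M) K W \<cdot> li (K \<otimes> W)"
    unfolding coev_ev ..
  also have "\<dots> = Id M (K \<otimes> W)"
    by (simp add: lunit_tens[symmetric])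
  finally show ?thesis .
qed

text \<open>The coaction pairs K with D and creates D in front of K, in the opposite order to
  \<open>evK\<close> and \<open>coev\<close>; the braiding converts between the two
  conventions.\<close>

abbreviation eK :: 'a where "eK \<equiv> evK \<cdot> braid M K D"
abbreviation hK :: 'a where "hK \<equiv> braid M K D \<cdot> coev"

lemma
  assumes [simp]: "W \<in> Ob M"
  shows Ar_eK_op [simp]: "counit_op eK K D W \<in> Ar M"
    and Dom_eK_op [simp]: "Dom M (counit_op eK K D W) = K \<otimes> (D \<otimes> W)"
    and Cod_eK_op [simp]: "Cod M (counit_op eK K D W) = W"
    and Ar_hK_op [simp]: "unit_op hK D K W \<in> Ar M"
    and Dom_hK_op [simp]: "Dom M (unit_op hK D K W) = W"
    and Cod_hK_op [simp]: "Cod M (unit_op hK D K W) = D \<otimes> (K \<otimes> W)"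
    and Ar_evK_op [simp]: "counit_op evK D K W \<in> Ar M"
    and Dom_evK_op [simp]: "Dom M (counit_op evK D K W) = D \<otimes> (K \<otimes> W)"
    and Cod_evK_op [simp]: "Cod M (counit_op evK D K W) = W"
    and Ar_coev_op [simp]: "unit_op coev K D W \<in> Ar M"
    and Dom_coev_op [simp]: "Dom M (unit_op coev K D W) = W"
    and Cod_coev_op [simp]: "Cod M (unit_op coev K D W) = K \<otimes> (D \<otimes> W)"
  by (auto simp: Ar_counit_op Dom_counit_op Cod_counit_op Ar_unit_op Dom_unit_op Cod_unit_op)

lemma zigzag_K:
  assumes [simp]: "W \<in> Ob M"
  shows "counit_op eK K D (K \<otimes> W) \<cdot> K \<rhd> unit_op hK D K W = Id M (K \<otimes> W)"
proof -
  have "K \<rhd> unit_op coev K D W = sw K K (D \<otimes> W) \<cdot> sw K K (D \<otimes> W) \<cdot> K \<rhd> unit_op coev K D W"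
    by simp
  also have "\<dots> = sw K K (D \<otimes> W) \<cdot> K \<rhd> sw D K W \<cdot> unit_op coev K D (K \<otimes> W)"
    by (subst unit_op_slide) auto
  finally have "counit_op eK K D (K \<otimes> W) \<cdot> K \<rhd> unit_op hK D K W
     = counit_op evK D K (K \<otimes> W) \<cdot> (sw K D (K \<otimes> W) \<cdot> K \<rhd> sw K D W \<cdot> sw K K (D \<otimes> W)) \<cdot> K \<rhd> sw D K W
       \<cdot> unit_op coev K D (K \<otimes> W)"
    by (simp add: counit_op_braid unit_op_braid wh_Comp)
  also have "\<dots> = counit_op evK D K (K \<otimes> W) \<cdot> (D \<rhd> sw K K W \<cdot> sw K D (K \<otimes> W) \<cdot> K \<rhd> sw K D W) \<cdot> K \<rhd> sw D K W
    \<cdot> unit_op coev K D (K \<otimes> W)"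
    by (subst sw_yang_baxter) auto
  also have "\<dots> = (counit_op evK D K (K \<otimes> W) \<cdot> D \<rhd> sw K K W \<cdot> sw K D (K \<otimes> W)) \<cdot> unit_op coev K D (K \<otimes> W)"
    by simp
  also have "\<dots> = K \<rhd> counit_op evK D K W \<cdot> unit_op coev K D (K \<otimes> W)"
    by (subst counit_op_slide_left) auto
  finally show ?thesis by (simp add: zigzag_coev)
qed

text \<open>The second triangle identity follows from the first and the universal property of
  \<open>D = [K, 1]\<close>: by \<open>zigzag_K\<close> the zigzag \<open>z\<close> does not change
  the pairing with K, and a map into D is determined by that pairing.\<close>

lemma zigzag_D:
  assumes [simp]: "W \<in> Ob M"
  shows "D \<rhd> counit_op eK K D W \<cdot> unit_op hK D K (D \<otimes> W) = Id M (D \<otimes> W)"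
proof -
  let ?I = "unit M"
  define z where "z = (\<lambda>W. D \<rhd> counit_op eK K D W \<cdot> unit_op hK D K (D \<otimes> W))"
  have z [simp]: "z W \<in> Ar M" "Dom M (z W) = D \<otimes> W" "Cod M (z W) = D \<otimes> W" if "W \<in> Ob M" for W
    using that by (auto simp: z_def)
  \<comment> \<open>\<open>g\<close> is the zigzag with tail 1, turned into an endomorphism of D so
    that currying can be used.\<close>
  define g where "g = runit M D \<cdot> z ?I \<cdot> ri D"
  have g [simp]: "g \<in> Ar M" "Dom M g = D" "Cod M g = D" by (auto simp: g_def)
  have "counit_op eK K D ?I \<cdot> K \<rhd> z ?I = (counit_op eK K D ?I \<cdot> K \<rhd> (D \<rhd> counit_op eK K D ?I))
    \<cdot> K \<rhd> unit_op hK D K (D \<otimes> ?I)"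
    by (simp add: z_def wh_Comp)
  also have "\<dots> = counit_op eK K D ?I \<cdot> (counit_op eK K D (K \<otimes> (D \<otimes> ?I)) \<cdot> K \<rhd> unit_op hK D K (D \<otimes> ?I))"
    by (subst counit_op_tail) auto
  also have "\<dots> = counit_op eK K D ?I"
    by (simp add: zigzag_K)
  finally have 1: "counit_op eK K D ?I \<cdot> K \<rhd> z ?I = counit_op eK K D ?I" .
  have "eK \<cdot> K \<rhd> g = (counit_op eK K D ?I \<cdot> K \<rhd> ri D) \<cdot> K \<rhd> g"
    by (subst counit_op_unit) auto
  also have "\<dots> = (counit_op eK K D ?I \<cdot> K \<rhd> z ?I) \<cdot> K \<rhd> ri D"
    by (simp add: g_def wh_Comp wh_inverse'[OF ri_runit])
  also have "\<dots> = eK"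
    unfolding 1 by (subst counit_op_unit) auto
  finally have "(evK \<cdot> (g \<boxtimes> Id M K)) \<cdot> braid M K D = evK \<cdot> braid M K D"
    by (simp add: braid_natural[where X = K and Y = D])
  then have "evK \<cdot> (g \<boxtimes> Id M K) = evK"
    by (rule cancel_epi[where k = "braid M D K"]) (auto simp: symmetry)
  then have "evK \<cdot> (g \<boxtimes> Id M K) = evK \<cdot> (Id M D \<boxtimes> Id M K)" by simp
  then have "g = Id M D"
    by (rule curry_unique) (auto simp: dual_def[symmetric])
  then have "ri D \<cdot> g \<cdot> runit M D = ri D \<cdot> runit M D" by simp
  then have zI: "z ?I = Id M (D \<otimes> ?I)" by (simp add: g_def)
  \<comment> \<open>From tail 1 to the tail \<open>?I \<otimes> W\<close> by strength; naturality
    along \<open>lunit M W\<close> then removes the unit.\<close>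
  have "(z (?I \<otimes> W)) \<cdot> assoc M D ?I W
    = D \<rhd> counit_op eK K D (?I \<otimes> W) \<cdot> (unit_op hK D K (D \<otimes> (?I \<otimes> W)) \<cdot> assoc M D ?I W)"
    by (simp add: z_def)
  also have "\<dots> = D \<rhd> counit_op eK K D (?I \<otimes> W) \<cdot> D \<rhd> (K \<rhd> assoc M D ?I W) \<cdot> unit_op hK D K ((D \<otimes> ?I) \<otimes> W)"
    by (subst unit_op_tail) auto
  also have "\<dots> = D \<rhd> counit_op eK K D (?I \<otimes> W) \<cdot> D \<rhd> (K \<rhd> assoc M D ?I W)
      \<cdot> D \<rhd> assoc M K (D \<otimes> ?I) W \<cdot> assoc M D (K \<otimes> (D \<otimes> ?I)) W \<cdot> (unit_op hK D K (D \<otimes> ?I) \<boxtimes> Id M W)"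
    by (subst unit_op_strength[symmetric]) auto
  also have "\<dots> = (D \<rhd> (counit_op eK K D ?I \<boxtimes> Id M W) \<cdot> assoc M D (K \<otimes> (D \<otimes> ?I)) W)
    \<cdot> (unit_op hK D K (D \<otimes> ?I) \<boxtimes> Id M W)"
    by (subst counit_op_strength) (auto simp: wh_Comp)
  also have "\<dots> = assoc M D ?I W \<cdot> (z ?I \<boxtimes> Id M W)"
    by (simp add: z_def Comp_wh pre[OF assoc_tail])
  finally have "z (?I \<otimes> W) \<cdot> assoc M D ?I W = Id M (D \<otimes> (?I \<otimes> W)) \<cdot> assoc M D ?I W"
    by (simp add: zI)
  then have 2: "z (?I \<otimes> W) = Id M (D \<otimes> (?I \<otimes> W))"
    by (rule cancel_epi[where k = "ai D ?I W"]) auto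
  have "z W \<cdot> D \<rhd> lunit M W = D \<rhd> counit_op eK K D W \<cdot> D \<rhd> (K \<rhd> (D \<rhd> lunit M W)) \<cdot> unit_op hK D K (D \<otimes> (?I \<otimes> W))"
    by (simp add: z_def unit_op_tail)
  also have "\<dots> = D \<rhd> (counit_op eK K D W \<cdot> K \<rhd> (D \<rhd> lunit M W)) \<cdot> unit_op hK D K (D \<otimes> (?I \<otimes> W))"
    by (simp add: wh_Comp)
  also have "\<dots> = D \<rhd> lunit M W \<cdot> z (?I \<otimes> W)"
    by (subst counit_op_tail) (auto simp: z_def wh_Comp)
  finally have "z W \<cdot> D \<rhd> lunit M W = Id M (D \<otimes> W) \<cdot> D \<rhd> lunit M W"
    unfolding 2 by simp
  then have "z W = Id M (D \<otimes> W)"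
    by (rule cancel_epi[where k = "D \<rhd> li W"]) auto
  then show ?thesis by (simp add: z_def)
qed

end

end

section \<open>Coalgebras mapping onto a given object\<close>

locale closed_operad = closed_typed_smc M + operad M P
  for M :: "('o, 'a, 'm) smcat_scheme" (structure) and P :: "('o, 'a) operad" +
  fixes X :: 'o
  assumes X_Ob [simp]: "X \<in> Ob M"
begin

abbreviation "B \<equiv> arity P (Suc 0)"
abbreviation "\<mu> \<equiv> pcomp P (Suc 0) (Suc 0) 0"
abbreviation "\<eta> \<equiv> opunit P"
abbreviation "H \<equiv> ihom M B X"
abbreviation "evB \<equiv> ev M B X"

lemma B_Ob [simp]: "B \<in> Ob M" by (rule arity_Ob)

lemma
  shows Ar_mu [simp]: "\<mu> \<in> Ar M" and Dom_mu [simp]: "Dom M \<mu> = B \<otimes> B" and Cod_mu [simp]: "Cod M \<mu> = B"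
    and Ar_eta [simp]: "\<eta> \<in> Ar M" and Dom_eta [simp]: "Dom M \<eta> = unit M" and Cod_eta [simp]: "Cod M \<eta> = B"
  using pcomp_hom[of 0 "Suc 0" "Suc 0"] opunit_hom by (auto simp: hom_iff)

lemma mu_assoc: "W \<in> Ob M \<Longrightarrow> l2 \<mu> B B W \<cdot> l2 \<mu> B B (B \<otimes> W) = l2 \<mu> B B W \<cdot> B \<rhd> l2 \<mu> B B W"
  using pcomp_sequential[of 0 "Suc 0" 0 "Suc 0" "Suc 0"] by (simp add: l2_l2_left l2_l2_right)

lemma mu_eta_left: "W \<in> Ob M \<Longrightarrow> l2 \<mu> B B W \<cdot> (\<eta> \<boxtimes> Id M (B \<otimes> W)) = lunit M (B \<otimes> W)"
  using l2_dom[of \<mu> B B \<eta> "Id M B" "unit M" B W] pcomp_unit_left[of "Suc 0"]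
  by simp (simp add: l2_def lunit_tens[symmetric])

text \<open>In terms of elements, \<open>(b \<phi>)(b') = \<phi>(b b')\<close>. This is a right
  action, in accordance with the reversed order of composition in \<open>a_a\<close>.\<close>

definition aH :: 'a where
  "aH = curry_ar M (B \<otimes> H) B X (evB \<cdot> H \<rhd> \<mu> \<cdot> assoc M H B B \<cdot> (braid M B H \<boxtimes> Id M B))"

lemma
  shows Ar_aH [simp]: "aH \<in> Ar M" and Dom_aH [simp]: "Dom M aH = B \<otimes> H" and Cod_aH [simp]: "Cod M aH = H"
  by (auto simp: aH_def)

lemma ev_aH:
  assumes [simp]: "W \<in> Ob M"
  shows "l2 evB H B W \<cdot> l2 aH B H (B \<otimes> W) = l2 evB H B W \<cdot> H \<rhd> l2 \<mu> B B W \<cdot> sw B H (B \<otimes> W)"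
proof -
  have "l2 evB H B W \<cdot> l2 aH B H (B \<otimes> W)
    = ((evB \<cdot> H \<rhd> \<mu> \<cdot> assoc M H B B \<cdot> (braid M B H \<boxtimes> Id M B)) \<boxtimes> Id M W) \<cdot> ai (B \<otimes> H) B W \<cdot> ai B H (B \<otimes> W)"
    by (simp add: l2_l2_left) (simp add: aH_def ev_curry)
  also have "\<dots> = ((evB \<cdot> H \<rhd> \<mu> \<cdot> assoc M H B B) \<boxtimes> Id M W) \<cdot> (((braid M B H \<boxtimes> Id M B) \<boxtimes> Id M W)
    \<cdot> ai (B \<otimes> H) B W) \<cdot> ai B H (B \<otimes> W)"
    by (simp add: Comp_wh)
  also have "((braid M B H \<boxtimes> Id M B) \<boxtimes> Id M W) \<cdot> ai (B \<otimes> H) B W = ai (H \<otimes> B) B W \<cdot> (braid M B H \<boxtimes> Id M (B \<otimes> W))"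
    using ai_natural[of "braid M B H" "Id M B" "Id M W" "H \<otimes> B" B W "B \<otimes> H" B W] by simp
  also have "((evB \<cdot> H \<rhd> \<mu> \<cdot> assoc M H B B) \<boxtimes> Id M W) \<cdot> (ai (H \<otimes> B) B W \<cdot> (braid M B H \<boxtimes> Id M (B \<otimes> W)))
    \<cdot> ai B H (B \<otimes> W)
    = (((evB \<cdot> H \<rhd> \<mu> \<cdot> assoc M H B B) \<boxtimes> Id M W) \<cdot> ai (H \<otimes> B) B W \<cdot> ai H B (B \<otimes> W)) \<cdot> sw B H (B \<otimes> W)"
    by (simp add: sw_def)
  also have "((evB \<cdot> H \<rhd> \<mu> \<cdot> assoc M H B B) \<boxtimes> Id M W) \<cdot> ai (H \<otimes> B) B W \<cdot> ai H B (B \<otimes> W)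
    = l2 evB H B W \<cdot> H \<rhd> l2 \<mu> B B W"
    by (simp add: l2_l2_right)
  finally show ?thesis by simp
qed

lemma tail_curry_unique:
  assumes "l2 evB H B (unit M) \<cdot> (g \<boxtimes> Id M (B \<otimes> unit M)) = l2 evB H B (unit M) \<cdot> (h \<boxtimes> Id M (B \<otimes> unit M))"
    and [simp]: "g \<in> Ar M" "h \<in> Ar M" "Cod M g = H" "Cod M h = H" "Dom M g = Z" "Dom M h = Z"
  shows "g = h"
proof -
  have [simp]: "Z \<in> Ob M" using Dom_Ob[of g] by simp
  have *: "l2 evB H B (unit M) \<cdot> (k \<boxtimes> Id M (B \<otimes> unit M)) = ((evB \<cdot> (k \<boxtimes> Id M B)) \<boxtimes> Id M (unit M)) \<cdot> ai Z B (unit M)"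
    if [simp]: "k \<in> Ar M" "Cod M k = H" "Dom M k = Z" for k
    using ai_natural[of k "Id M B" "Id M (unit M)" H B "unit M" Z B "unit M"]
    by (simp add: l2_def Comp_wh)
  have "(evB \<cdot> (g \<boxtimes> Id M B)) \<boxtimes> Id M (unit M) = (evB \<cdot> (h \<boxtimes> Id M B)) \<boxtimes> Id M (unit M)"
    using assms(1) unfolding *[OF assms(2,4,6)] *[OF assms(3,5,7)]
    by (rule cancel_epi[where k = "assoc M Z B (unit M)"]) auto
  then have "evB \<cdot> (g \<boxtimes> Id M B) = evB \<cdot> (h \<boxtimes> Id M B)"
    by (rule unit_hw_inject) auto
  then show ?thesis
    by (rule curry_unique) auto
qed

lemma aH_mu:
  assumes [simp]: "W \<in> Ob M"
  shows "l2 aH B H W \<cdot> l2 \<mu> B B (H \<otimes> W) = l2 aH B H W \<cdot> B \<rhd> l2 aH B H W \<cdot> sw B B (H \<otimes> W)"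
proof -
  let ?I = "unit M"
  let ?g = "aH \<cdot> (\<mu> \<boxtimes> Id M H)" and ?h = "aH \<cdot> B \<rhd> aH \<cdot> assoc M B B H \<cdot> (braid M B B \<boxtimes> Id M H)"
  have L: "l2 aH B H W \<cdot> l2 \<mu> B B (H \<otimes> W) = (?g \<boxtimes> Id M W) \<cdot> ai (B \<otimes> B) H W \<cdot> ai B B (H \<otimes> W)"
    if [simp]: "W \<in> Ob M" for W
    by (simp add: l2_l2_left)
  have R: "l2 aH B H W \<cdot> B \<rhd> l2 aH B H W \<cdot> sw B B (H \<otimes> W) = (?h \<boxtimes> Id M W) \<cdot> ai (B \<otimes> B) H W \<cdot> ai B B (H \<otimes> W)"
    if [simp]: "W \<in> Ob M" for W
  proof -
    have 1: "ai (B \<otimes> B) H W \<cdot> (braid M B B \<boxtimes> Id M (H \<otimes> W)) = ((braid M B B \<boxtimes> Id M H) \<boxtimes> Id M W) \<cdot> ai (B \<otimes> B) H W"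
      using ai_natural[of "braid M B B" "Id M H" "Id M W" "B \<otimes> B" H W "B \<otimes> B" H W] by simp
    have "l2 aH B H W \<cdot> B \<rhd> l2 aH B H W \<cdot> sw B B (H \<otimes> W)
       = (l2 aH B H W \<cdot> B \<rhd> l2 aH B H W) \<cdot> sw B B (H \<otimes> W)" by simp
    also have "\<dots> = ((aH \<cdot> B \<rhd> aH \<cdot> assoc M B B H) \<boxtimes> Id M W) \<cdot> ai (B \<otimes> B) H W \<cdot> (braid M B B \<boxtimes> Id M (H \<otimes> W))
      \<cdot> ai B B (H \<otimes> W)"
      by (simp add: l2_l2_right) (simp add: sw_def)
    also have "\<dots> = (?h \<boxtimes> Id M W) \<cdot> ai (B \<otimes> B) H W \<cdot> ai B B (H \<otimes> W)"
      by (simp add: pre[OF 1] Comp_wh)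
    finally show ?thesis .
  qed
  have slide1: "sw B H (B \<otimes> ?I) \<cdot> l2 \<mu> B B (H \<otimes> (B \<otimes> ?I)) = H \<rhd> l2 \<mu> B B (B \<otimes> ?I) \<cdot> sw B H (B \<otimes> (B \<otimes> ?I))
    \<cdot> B \<rhd> sw B H (B \<otimes> ?I)"
    by (rule l2_slide_right) auto
  have "l2 evB H B ?I \<cdot> l2 aH B H (B \<otimes> ?I) \<cdot> l2 \<mu> B B (H \<otimes> (B \<otimes> ?I))
    = l2 evB H B ?I \<cdot> H \<rhd> l2 \<mu> B B ?I \<cdot> sw B H (B \<otimes> ?I) \<cdot> l2 \<mu> B B (H \<otimes> (B \<otimes> ?I))"
    by (simp add: pre[OF ev_aH])
  also have "\<dots> = l2 evB H B ?I \<cdot> H \<rhd> (l2 \<mu> B B ?I \<cdot> l2 \<mu> B B (B \<otimes> ?I)) \<cdot> sw B H (B \<otimes> (B \<otimes> ?I)) \<cdot> B \<rhd> sw B H (B \<otimes> ?I)"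
    unfolding slide1 by (simp add: wh_Comp)
  also have "\<dots> = l2 evB H B ?I \<cdot> H \<rhd> l2 \<mu> B B ?I \<cdot> (H \<rhd> (B \<rhd> l2 \<mu> B B ?I) \<cdot> sw B H (B \<otimes> (B \<otimes> ?I)))
    \<cdot> B \<rhd> sw B H (B \<otimes> ?I)"
    by (simp add: mu_assoc wh_Comp)
  also have "H \<rhd> (B \<rhd> l2 \<mu> B B ?I) \<cdot> sw B H (B \<otimes> (B \<otimes> ?I)) = sw B H (B \<otimes> ?I) \<cdot> B \<rhd> (H \<rhd> l2 \<mu> B B ?I)"
    by (simp add: sw_tail)
  also have "l2 evB H B ?I \<cdot> H \<rhd> l2 \<mu> B B ?I \<cdot> (sw B H (B \<otimes> ?I) \<cdot> B \<rhd> (H \<rhd> l2 \<mu> B B ?I)) \<cdot> B \<rhd> sw B H (B \<otimes> ?I)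
    = (l2 evB H B ?I \<cdot> l2 aH B H (B \<otimes> ?I)) \<cdot> B \<rhd> (H \<rhd> l2 \<mu> B B ?I) \<cdot> B \<rhd> sw B H (B \<otimes> ?I)"
    by (simp add: ev_aH)
  also have "\<dots> = l2 evB H B ?I \<cdot> (l2 aH B H (B \<otimes> ?I) \<cdot> B \<rhd> (H \<rhd> l2 \<mu> B B ?I)) \<cdot> B \<rhd> sw B H (B \<otimes> ?I)"
    by simp
  also have "\<dots> = l2 evB H B ?I \<cdot> (H \<rhd> l2 \<mu> B B ?I \<cdot> l2 aH B H (B \<otimes> (B \<otimes> ?I))) \<cdot> B \<rhd> sw B H (B \<otimes> ?I)"
    by (subst l2_natural[where W = "B \<otimes> (B \<otimes> ?I)"]) auto
  also have "\<dots> = l2 evB H B ?I \<cdot> H \<rhd> l2 \<mu> B B ?I \<cdot> (l2 aH B H (B \<otimes> (B \<otimes> ?I)) \<cdot> B \<rhd> sw B H (B \<otimes> ?I)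
    \<cdot> sw B B (H \<otimes> (B \<otimes> ?I)))
      \<cdot> sw B B (H \<otimes> (B \<otimes> ?I))"
    by simp
  also have "\<dots> = l2 evB H B ?I \<cdot> H \<rhd> l2 \<mu> B B ?I \<cdot> (sw B H (B \<otimes> ?I) \<cdot> B \<rhd> l2 aH B H (B \<otimes> ?I)) \<cdot> sw B B (H \<otimes> (B \<otimes> ?I))"
    by (subst l2_slide_left) auto
  also have "\<dots> = (l2 evB H B ?I \<cdot> l2 aH B H (B \<otimes> ?I)) \<cdot> B \<rhd> l2 aH B H (B \<otimes> ?I) \<cdot> sw B B (H \<otimes> (B \<otimes> ?I))"
    by (simp add: ev_aH)
  finally have 2: "l2 evB H B ?I \<cdot> (l2 aH B H (B \<otimes> ?I) \<cdot> l2 \<mu> B B (H \<otimes> (B \<otimes> ?I)))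
    = l2 evB H B ?I \<cdot> (l2 aH B H (B \<otimes> ?I) \<cdot> B \<rhd> l2 aH B H (B \<otimes> ?I) \<cdot> sw B B (H \<otimes> (B \<otimes> ?I)))"
    by simp
  \<comment> \<open>Maps into H may be compared after evaluation with tail 1, where associativity of
    \<open>\<mu>\<close> gave fact \<open>2\<close>. \<open>L\<close> and \<open>R\<close> carry the
    result to every tail.\<close>
  have "?g = ?h"
  proof (rule tail_curry_unique)
    let ?k = "ai (B \<otimes> B) H (B \<otimes> ?I) \<cdot> ai B B (H \<otimes> (B \<otimes> ?I))"
    have "(l2 evB H B ?I \<cdot> (?g \<boxtimes> Id M (B \<otimes> ?I))) \<cdot> ?k = (l2 evB H B ?I \<cdot> (?h \<boxtimes> Id M (B \<otimes> ?I))) \<cdot> ?k"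
      using 2 unfolding L[OF tens_Ob[OF B_Ob unit_Ob]] R[OF tens_Ob[OF B_Ob unit_Ob]] by simp
    then show "l2 evB H B ?I \<cdot> (?g \<boxtimes> Id M (B \<otimes> ?I)) = l2 evB H B ?I \<cdot> (?h \<boxtimes> Id M (B \<otimes> ?I))"
      by (rule cancel_epi[where k = "assoc M B B (H \<otimes> (B \<otimes> ?I)) \<cdot> assoc M (B \<otimes> B) H (B \<otimes> ?I)"]) auto
  qed auto
  then show ?thesis
    unfolding L[OF assms] R[OF assms] by simp
qed

lemma aH_eta:
  assumes [simp]: "W \<in> Ob M"
  shows "l2 aH B H W \<cdot> (\<eta> \<boxtimes> Id M (H \<otimes> W)) = lunit M (H \<otimes> W)"
proof -
  let ?I = "unit M"
  have L: "l2 aH B H W \<cdot> (\<eta> \<boxtimes> Id M (H \<otimes> W)) = ((aH \<cdot> (\<eta> \<boxtimes> Id M H)) \<boxtimes> Id M W) \<cdot> ai ?I H W"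
    if [simp]: "W \<in> Ob M" for W
    using l2_dom[of aH B H \<eta> "Id M H" ?I H W] by simp (simp add: l2_def)
  have R: "lunit M (H \<otimes> W) = (lunit M H \<boxtimes> Id M W) \<cdot> ai ?I H W" if [simp]: "W \<in> Ob M" for W
    by (simp add: lunit_tens[symmetric])
  have "l2 evB H B ?I \<cdot> l2 aH B H (B \<otimes> ?I) \<cdot> (\<eta> \<boxtimes> Id M (H \<otimes> (B \<otimes> ?I)))
    = l2 evB H B ?I \<cdot> H \<rhd> l2 \<mu> B B ?I \<cdot> sw B H (B \<otimes> ?I) \<cdot> (\<eta> \<boxtimes> Id M (H \<otimes> (B \<otimes> ?I)))"
    by (simp add: pre[OF ev_aH])
  also have "\<dots> = l2 evB H B ?I \<cdot> H \<rhd> (l2 \<mu> B B ?I \<cdot> (\<eta> \<boxtimes> Id M (B \<otimes> ?I))) \<cdot> sw ?I H (B \<otimes> ?I)"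
    by (simp add: sw_first wh_Comp)
  also have "\<dots> = l2 evB H B ?I \<cdot> lunit M (H \<otimes> (B \<otimes> ?I))"
    unfolding mu_eta_left[OF unit_Ob] by (simp add: sw_unit_left)
  finally have 2: "l2 evB H B ?I \<cdot> (l2 aH B H (B \<otimes> ?I) \<cdot> (\<eta> \<boxtimes> Id M (H \<otimes> (B \<otimes> ?I))))
    = l2 evB H B ?I \<cdot> lunit M (H \<otimes> (B \<otimes> ?I))"
    by simp
  have "aH \<cdot> (\<eta> \<boxtimes> Id M H) = lunit M H"
  proof (rule tail_curry_unique)
    have "(l2 evB H B ?I \<cdot> ((aH \<cdot> (\<eta> \<boxtimes> Id M H)) \<boxtimes> Id M (B \<otimes> ?I))) \<cdot> ai ?I H (B \<otimes> ?I)
      = (l2 evB H B ?I \<cdot> (lunit M H \<boxtimes> Id M (B \<otimes> ?I))) \<cdot> ai ?I H (B \<otimes> ?I)"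
      using 2 unfolding L[OF tens_Ob[OF B_Ob unit_Ob]] R[OF tens_Ob[OF B_Ob unit_Ob]] by simp
    then show "l2 evB H B ?I \<cdot> ((aH \<cdot> (\<eta> \<boxtimes> Id M H)) \<boxtimes> Id M (B \<otimes> ?I)) = l2 evB H B ?I \<cdot> (lunit M H \<boxtimes> Id M (B \<otimes> ?I))"
      by (rule cancel_epi[where k = "assoc M ?I H (B \<otimes> ?I)"]) auto
  qed auto
  then show ?thesis
    unfolding L[OF assms] R[OF assms] by simp
qed

end

section \<open>The coalgebra that maps onto X\<close>

locale additive_closed_smc = additive_smc M pl nul + closed_typed_smc M
  for M :: "('o, 'a, 'm) smcat_scheme" (structure) and pl (infixl "\<oplus>\<oplus>" 60) and nul +
  assumes biproduct_ex: "X \<in> Ob M \<Longrightarrow> Y \<in> Ob M \<Longrightarrow>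
    \<exists>S \<in> Ob M. \<exists>i \<in> hom M X S. \<exists>j \<in> hom M Y S. \<exists>p \<in> hom M S X. \<exists>q \<in> hom M S Y.
      p \<cdot> i = Id M X \<and> q \<cdot> j = Id M Y \<and> p \<cdot> j = nul Y X \<and> q \<cdot> i = nul X Y \<and> (i \<cdot> p) \<oplus>\<oplus> (j \<cdot> q) = Id M S"

lemma (in additive_closed_smc) coalgebra_onto:
  assumes P: "operad M P" and dual: "dualisable M (arity P 0)" and X: "X \<in> Ob M"
    and epi: "epi M (ev M (arity P 1) X \<cdot> ihom M (arity P 1) X \<rhd> opunit P \<cdot> ri (ihom M (arity P 1) X))"
  shows "\<exists>V f. is_coalg M P V \<and> f \<in> hom M (carr V) X \<and> epi M f"
proof -
  interpret closed_operad M P X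
    using P X by unfold_locales (auto simp: operad_def)
  let ?K = "arity P 0" and ?D = "dual M (arity P 0)"
  have [simp]: "?K \<in> Ob M" "?D \<in> Ob M" using dual arity_Ob by (auto simp: dualisable_def dual_def)
  obtain V iD jH pD qH where V: "V \<in> Ob M" "iD \<in> hom M ?D V" "jH \<in> hom M H V" "pD \<in> hom M V ?D" "qH \<in> hom M V H"
    and b: "pD \<cdot> iD = Id M ?D" "qH \<cdot> jH = Id M H" "pD \<cdot> jH = nul H ?D" "qH \<cdot> iD = nul ?D H"
      "(iD \<cdot> pD) \<oplus>\<oplus> (jH \<cdot> qH) = Id M V"
    using biproduct_ex[of ?D H] by auto
  then have [simp]: "V \<in> Ob M" "iD \<in> Ar M" "Dom M iD = ?D" "Cod M iD = V" "jH \<in> Ar M" "Dom M jH = H" "Cod M jH = V"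
    "pD \<in> Ar M" "Dom M pD = V" "Cod M pD = ?D" "qH \<in> Ar M" "Dom M qH = V" "Cod M qH = H"
    by (auto simp: hom_iff)
  note [simp] = b(1-4)
  note pre_b [simp] = pre1[OF b(1)] pre1[OF b(2)] pre1[OF b(3)] pre1[OF b(4)]
  let ?w = "ev M ?K (unit M) \<cdot> braid M ?K ?D" and ?h = "braid M ?K ?D \<cdot> coev ?K"
  note [simp] = Ar_evK[OF dual] Dom_evK[OF dual] Cod_evK[OF dual] Ar_coev[OF dual] Dom_coev[OF dual] Cod_coev[OF dual]
    Ar_eK_op[OF dual] Dom_eK_op[OF dual] Cod_eK_op[OF dual] Ar_hK_op[OF dual] Dom_hK_op[OF dual] Cod_hK_op[OF dual]
  \<comment> \<open>The pairing is extended by zero to H along \<open>pD\<close>, and the action by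
    zero to D along \<open>qH\<close> and \<open>jH\<close>. The axioms thereby reduce to the
    biproduct identities, the two zigzags and the module laws of H.\<close>
  let ?e = "ev M ?K (unit M) \<cdot> braid M ?K ?D \<cdot> ?K \<rhd> pD" and ?a = "jH \<cdot> aH \<cdot> B \<rhd> qH"
  have e: "counit_op ?e ?K V W = counit_op ?w ?K ?D W \<cdot> ?K \<rhd> (pD \<boxtimes> Id M W)" if [simp]: "W \<in> Ob M" for W
    using l2_dom[of ?w ?K ?D "Id M ?K" pD ?K V W] by (simp add: counit_op_def)
  have a: "l2 ?a B V W = (jH \<boxtimes> Id M W) \<cdot> l2 aH B H W \<cdot> B \<rhd> (qH \<boxtimes> Id M W)" if [simp]: "W \<in> Ob M" for W
    using l2_dom[of aH B H "Id M B" qH B V W] by (simp add: l2_cod)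
  have q_j: "B \<rhd> (qH \<boxtimes> Id M W) \<cdot> B \<rhd> (jH \<boxtimes> Id M W) = Id M (B \<otimes> (H \<otimes> W))" if [simp]: "W \<in> Ob M" for W
    by (simp add: wh_Comp[symmetric] Comp_wh[symmetric])
  interpret truncated_coalgebra M P V ?D ?e ?h iD pl nul ?a
  proof unfold_locales
    fix W assume [simp]: "W \<in> Ob M"
    have 1: "?K \<rhd> (pD \<boxtimes> Id M (?K \<otimes> W)) \<cdot> ?K \<rhd> (iD \<boxtimes> Id M (?K \<otimes> W)) = Id M (?K \<otimes> (?D \<otimes> (?K \<otimes> W)))"
      by (simp add: wh_Comp[symmetric] Comp_wh[symmetric])
    show "counit_op ?e ?K V (?K \<otimes> W) \<cdot> ?K \<rhd> (iD \<boxtimes> Id M (?K \<otimes> W)) \<cdot> ?K \<rhd> unit_op ?h ?D ?K W = Id M (?K \<otimes> W)"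
      by (simp add: e pre1[OF 1] zigzag_K[OF dual])
    have 2: "?K \<rhd> (pD \<boxtimes> Id M W) \<cdot> ?K \<rhd> (jH \<boxtimes> Id M W) = nul (?K \<otimes> (H \<otimes> W)) (?K \<otimes> (?D \<otimes> W))"
      by (simp add: wh_Comp[symmetric] Comp_wh[symmetric])
    show "counit_op ?e ?K V W \<cdot> ?K \<rhd> l2 ?a B V W = nul (?K \<otimes> (B \<otimes> (V \<otimes> W))) W"
      by (simp add: e a wh_Comp pre1[OF 2])
    have 3: "l2 \<mu> B B (H \<otimes> W) \<cdot> B \<rhd> (B \<rhd> (qH \<boxtimes> Id M W)) = B \<rhd> (qH \<boxtimes> Id M W) \<cdot> l2 \<mu> B B (V \<otimes> W)"
      by (subst l2_natural[where W = "V \<otimes> W"]) auto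
    have "l2 ?a B V W \<cdot> l2 \<mu> B B (V \<otimes> W)
       = (jH \<boxtimes> Id M W) \<cdot> (l2 aH B H W \<cdot> l2 \<mu> B B (H \<otimes> W)) \<cdot> B \<rhd> (B \<rhd> (qH \<boxtimes> Id M W))"
      by (simp add: a 3)
    also have "\<dots> = (jH \<boxtimes> Id M W) \<cdot> l2 aH B H W \<cdot> B \<rhd> l2 aH B H W \<cdot> B \<rhd> (B \<rhd> (qH \<boxtimes> Id M W)) \<cdot> sw B B (V \<otimes> W)"
      unfolding aH_mu[OF \<open>W \<in> Ob M\<close>] by (simp add: sw_tail)
    also have "\<dots> = l2 ?a B V W \<cdot> B \<rhd> l2 ?a B V W \<cdot> sw B B (V \<otimes> W)"
      by (simp add: a wh_Comp pre1[OF q_j])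
    finally show "l2 ?a B V W \<cdot> l2 \<mu> B B (V \<otimes> W) = l2 ?a B V W \<cdot> B \<rhd> l2 ?a B V W \<cdot> sw B B (V \<otimes> W)" .
    have "unit_op ?h ?D ?K (?D \<otimes> W) \<cdot> (pD \<boxtimes> Id M W) = ?D \<rhd> (?K \<rhd> (pD \<boxtimes> Id M W)) \<cdot> unit_op ?h ?D ?K (V \<otimes> W)"
      by (subst unit_op_tail) auto
    then have "V \<rhd> counit_op ?e ?K V W \<cdot> (iD \<boxtimes> Id M (?K \<otimes> (V \<otimes> W))) \<cdot> unit_op ?h ?D ?K (V \<otimes> W)
      = (iD \<boxtimes> Id M W) \<cdot> (?D \<rhd> counit_op ?w ?K ?D W \<cdot> unit_op ?h ?D ?K (?D \<otimes> W)) \<cdot> (pD \<boxtimes> Id M W)"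
      by (simp add: e wh_Comp whisker_swap[symmetric, of iD "?K \<rhd> (pD \<boxtimes> Id M W)"] pre[OF whisker_swap[of iD,
        symmetric]]
         pre[OF tens_swap[symmetric, of iD _ ?D V]])
    also have "\<dots> = (iD \<cdot> pD) \<boxtimes> Id M W"
      unfolding zigzag_D[OF dual \<open>W \<in> Ob M\<close>] by (simp add: Comp_wh)
    finally have 4: "V \<rhd> counit_op ?e ?K V W \<cdot> (iD \<boxtimes> Id M (?K \<otimes> (V \<otimes> W))) \<cdot> unit_op ?h ?D ?K (V \<otimes> W)
      = (iD \<cdot> pD) \<boxtimes> Id M W" .
    have "l2 ?a B V W \<cdot> (\<eta> \<boxtimes> Id M (V \<otimes> W)) \<cdot> li (V \<otimes> W)
       = (jH \<boxtimes> Id M W) \<cdot> (l2 aH B H W \<cdot> (\<eta> \<boxtimes> Id M (H \<otimes> W))) \<cdot> unit M \<rhd> (qH \<boxtimes> Id M W) \<cdot> li (V \<otimes> W)"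
      by (simp add: a pre[OF tens_swap[symmetric, of \<eta> "qH \<boxtimes> Id M W" "unit M" B]])
    also have "\<dots> = (jH \<cdot> qH) \<boxtimes> Id M W"
      unfolding aH_eta[OF \<open>W \<in> Ob M\<close>] by (simp add: li_natural[symmetric] Comp_wh)
    finally have 5: "l2 ?a B V W \<cdot> (\<eta> \<boxtimes> Id M (V \<otimes> W)) \<cdot> li (V \<otimes> W) = (jH \<cdot> qH) \<boxtimes> Id M W" .
    show "(V \<rhd> counit_op ?e ?K V W \<cdot> (iD \<boxtimes> Id M (?K \<otimes> (V \<otimes> W))) \<cdot> unit_op ?h ?D ?K (V \<otimes> W))
       \<oplus>\<oplus> (l2 ?a B V W \<cdot> (\<eta> \<boxtimes> Id M (V \<otimes> W)) \<cdot> li (V \<otimes> W)) = Id M (V \<otimes> W)"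
      unfolding 4 5 by (subst pl_wh[symmetric]) (auto simp: b)
  qed (auto simp: wh_Comp[symmetric])
  \<comment> \<open>The projection onto H followed by evaluation at the unit; the projection is
    split by \<open>jH\<close>, so it can be cancelled below.\<close>
  let ?f = "(evB \<cdot> H \<rhd> \<eta> \<cdot> ri H) \<cdot> qH"
  have "is_coalg M P \<lparr>carr = V, coact = coaction\<rparr>" by (rule is_coalg_coaction)
  moreover have "?f \<in> hom M V X" by (simp add: hom_iff)
  moreover have "Defs.epi M ?f"
    unfolding epi_def
  proof (intro conjI ballI impI)
    fix Z g h assume "Z \<in> Ob M" "g \<in> hom M (Cod M ?f) Z" "h \<in> hom M (Cod M ?f) Z" and eq: "g \<cdot> ?f = h \<cdot> ?f"
    then have g [simp]: "g \<in> Ar M" "Dom M g = X" "Cod M g = Z" "h \<in> Ar M" "Dom M h = X" "Cod M h = Z"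
      by (auto simp: hom_iff)
    have "(g \<cdot> evB \<cdot> H \<rhd> \<eta> \<cdot> ri H) \<cdot> qH = (h \<cdot> evB \<cdot> H \<rhd> \<eta> \<cdot> ri H) \<cdot> qH" using eq by simp
    then have "g \<cdot> (evB \<cdot> H \<rhd> \<eta> \<cdot> ri H) = h \<cdot> (evB \<cdot> H \<rhd> \<eta> \<cdot> ri H)"
      by (rule cancel_epi[where k = jH]) auto
    then show "g = h"
      using epi \<open>Z \<in> Ob M\<close> unfolding epi_def by (simp add: hom_iff)
  qed auto
  ultimately show ?thesis by (metis coalg.select_convs(1))
qed

section \<open>The additive monoidal category of chain complexes\<close>

locale closed_additive = additive_category A + symmetric_monoidal A
  for A :: "('o, 'a, 'm) asmcat_scheme" (structure) +
  assumes closed: "has_internal_homs A"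
begin

lemma hom_iff: "f \<in> hom A X Y \<longleftrightarrow> f \<in> Ar A \<and> Dom A f = X \<and> Cod A f = Y"
  by (auto simp: hom_def)

declare Dom_Ob [simp] Cod_Ob [simp] unit_Ob [simp] tens_Ob [simp]

lemma Id_simps [simp]:
  "X \<in> Ob A \<Longrightarrow> Id A X \<in> Ar A" "X \<in> Ob A \<Longrightarrow> Dom A (Id A X) = X" "X \<in> Ob A \<Longrightarrow> Cod A (Id A X) = X"
  using Id_hom[of X] by (auto simp: hom_iff)

lemma Comp_simps [simp]:
  assumes "f \<in> Ar A" "g \<in> Ar A" "Dom A g = Cod A f"
  shows "g \<cdot> f \<in> Ar A" "Dom A (g \<cdot> f) = Dom A f" "Cod A (g \<cdot> f) = Cod A g"
  using Comp_hom[of f _ _ g] assms by (auto simp: hom_iff)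

lemma tens_simps [simp]:
  assumes "f \<in> Ar A" "g \<in> Ar A"
  shows "f \<boxtimes> g \<in> Ar A" "Dom A (f \<boxtimes> g) = Dom A f \<otimes> Dom A g" "Cod A (f \<boxtimes> g) = Cod A f \<otimes> Cod A g"
  using tens_hom[of f _ _ g] assms by (auto simp: hom_iff)

lemma structure_simps [simp]:
  assumes "X \<in> Ob A" "Y \<in> Ob A"
  shows "Z \<in> Ob A \<Longrightarrow> assoc A X Y Z \<in> Ar A" "Z \<in> Ob A \<Longrightarrow> Dom A (assoc A X Y Z) = (X \<otimes> Y) \<otimes> Z"
    "Z \<in> Ob A \<Longrightarrow> Cod A (assoc A X Y Z) = X \<otimes> (Y \<otimes> Z)"
    "lunit A X \<in> Ar A" "Dom A (lunit A X) = unit A \<otimes> X" "Cod A (lunit A X) = X"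
    "runit A X \<in> Ar A" "Dom A (runit A X) = X \<otimes> unit A" "Cod A (runit A X) = X"
    "braid A X Y \<in> Ar A" "Dom A (braid A X Y) = X \<otimes> Y" "Cod A (braid A X Y) = Y \<otimes> X"
  using assms assoc_hom[of X Y Z] lunit_hom[of X] runit_hom[of X] braid_hom[of X Y] by (auto simp: hom_iff)

lemma unit_simps [simp]:
  assumes "X \<in> Ob A"
  shows "lunit A X \<in> Ar A" "Dom A (lunit A X) = unit A \<otimes> X" "Cod A (lunit A X) = X"
    "runit A X \<in> Ar A" "Dom A (runit A X) = X \<otimes> unit A" "Cod A (runit A X) = X"
  using assms lunit_hom[of X] runit_hom[of X] by (auto simp: hom_iff)

lemma Comp_Id_left [simp]: "f \<in> Ar A \<Longrightarrow> Cod A f = Y \<Longrightarrow> Id A Y \<cdot> f = f"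
  using Id_left[of f] by (auto simp: hom_iff)

lemma Comp_Id_right [simp]: "f \<in> Ar A \<Longrightarrow> Dom A f = X \<Longrightarrow> f \<cdot> Id A X = f"
  using Id_right[of f] by (auto simp: hom_iff)

lemma assoc_Comp [simp]:
  "f \<in> Ar A \<Longrightarrow> g \<in> Ar A \<Longrightarrow> h \<in> Ar A \<Longrightarrow> Dom A g = Cod A f \<Longrightarrow> Dom A h = Cod A g
    \<Longrightarrow> (h \<cdot> g) \<cdot> f = h \<cdot> g \<cdot> f"
  using Comp_assoc[of f _ _ g _ h] by (auto simp: hom_iff)

declare tens_Id [simp]

lemma tens_Comp_tens:
  "f \<in> Ar A \<Longrightarrow> f' \<in> Ar A \<Longrightarrow> Dom A f' = Cod A f \<Longrightarrow> g \<in> Ar A \<Longrightarrow> g' \<in> Ar A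
    \<Longrightarrow> Dom A g' = Cod A g \<Longrightarrow> (f' \<boxtimes> g') \<cdot> (f \<boxtimes> g) = (f' \<cdot> f) \<boxtimes> (g' \<cdot> g)"
  using tens_Comp[of f _ _ f' _ g _ _ g'] by (auto simp: hom_iff)

lemma pre:
  assumes "g \<cdot> f = g' \<cdot> f'" "f \<in> Ar A" "g \<in> Ar A" "Dom A g = Cod A f"
    "f' \<in> Ar A" "g' \<in> Ar A" "Dom A g' = Cod A f'" "h \<in> Ar A" "Cod A h = Dom A f"
  shows "g \<cdot> f \<cdot> h = g' \<cdot> f' \<cdot> h"
proof -
  have "Dom A f' = Dom A f"
    using assms Comp_simps(2)[of f g] Comp_simps(2)[of f' g'] by simp
  then show ?thesis
    using assms assoc_Comp[of h f g] assoc_Comp[of h f' g'] by simp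
qed

lemma pre1:
  assumes "g \<cdot> f = k" "f \<in> Ar A" "g \<in> Ar A" "Dom A g = Cod A f" "h \<in> Ar A" "Cod A h = Dom A f"
  shows "g \<cdot> f \<cdot> h = k \<cdot> h"
  using assms assoc_Comp[of h f g] by simp

lemma hzero_simps [simp]:
  assumes "X \<in> Ob A" "Y \<in> Ob A"
  shows "hzero A X Y \<in> Ar A" "Dom A (hzero A X Y) = X" "Cod A (hzero A X Y) = Y"
  using hzero_hom[OF assms] by (auto simp: hom_iff)

lemma hadd_simps [simp]:
  assumes "f \<in> Ar A" "g \<in> Ar A" "Dom A g = Dom A f" "Cod A g = Cod A f"
  shows "f \<oplus> g \<in> Ar A" "Dom A (f \<oplus> g) = Dom A f" "Cod A (f \<oplus> g) = Cod A f"
  using hadd_hom[of f "Dom A f" "Cod A f" g] assms by (auto simp: hom_iff)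

lemma hadd_commute:
  "f \<in> Ar A \<Longrightarrow> g \<in> Ar A \<Longrightarrow> Dom A g = Dom A f \<Longrightarrow> Cod A g = Cod A f \<Longrightarrow> f \<oplus> g = g \<oplus> f"
  using hadd_comm[of f "Dom A f" "Cod A f" g] by (auto simp: hom_iff)

lemma hadd_associative:
  "f \<in> Ar A \<Longrightarrow> g \<in> Ar A \<Longrightarrow> h \<in> Ar A \<Longrightarrow> Dom A g = Dom A f \<Longrightarrow> Cod A g = Cod A f
    \<Longrightarrow> Dom A h = Dom A f \<Longrightarrow> Cod A h = Cod A f \<Longrightarrow> (f \<oplus> g) \<oplus> h = f \<oplus> (g \<oplus> h)"
  using hadd_assoc[of f "Dom A f" "Cod A f" g h] by (auto simp: hom_iff)

lemma hadd_hzero [simp]: "f \<in> Ar A \<Longrightarrow> Dom A f = X \<Longrightarrow> Cod A f = Y \<Longrightarrow> f \<oplus> hzero A X Y = f"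
  using hadd_zero[of f X Y] by (auto simp: hom_iff)

lemma hzero_hadd [simp]: "f \<in> Ar A \<Longrightarrow> Dom A f = X \<Longrightarrow> Cod A f = Y \<Longrightarrow> hzero A X Y \<oplus> f = f"
  by (subst hadd_commute) auto

lemma Comp_hadd:
  "f \<in> Ar A \<Longrightarrow> g \<in> Ar A \<Longrightarrow> h \<in> Ar A \<Longrightarrow> Dom A g = Dom A f \<Longrightarrow> Cod A g = Cod A f \<Longrightarrow> Dom A h = Cod A f
    \<Longrightarrow> h \<cdot> (f \<oplus> g) = (h \<cdot> f) \<oplus> (h \<cdot> g)"
  using Comp_hadd_right[of f "Dom A f" "Cod A f" g h] by (auto simp: hom_iff)

lemma hadd_Comp:
  "f \<in> Ar A \<Longrightarrow> g \<in> Ar A \<Longrightarrow> h \<in> Ar A \<Longrightarrow> Dom A g = Dom A f \<Longrightarrow> Cod A g = Cod A f \<Longrightarrow> Cod A h = Dom A f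
    \<Longrightarrow> (f \<oplus> g) \<cdot> h = (f \<cdot> h) \<oplus> (g \<cdot> h)"
  using Comp_hadd_left[of h _ "Dom A f" f "Cod A f" g] by (auto simp: hom_iff)

lemma neg_exists:
  assumes "f \<in> Ar A"
  obtains g where "g \<in> Ar A" "Dom A g = Dom A f" "Cod A g = Cod A f" "f \<oplus> g = hzero A (Dom A f) (Cod A f)"
  using hadd_neg[of f "Dom A f" "Cod A f"] assms by (auto simp: hom_iff)

lemma neg_unique:
  assumes "f \<in> Ar A" "g \<in> Ar A" "Dom A g = Dom A f" "Cod A g = Cod A f" "f \<oplus> g = hzero A (Dom A f) (Cod A f)"
    "h \<in> Ar A" "Dom A h = Dom A f" "Cod A h = Cod A f" "f \<oplus> h = hzero A (Dom A f) (Cod A f)"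
  shows "g = h"
proof -
  have "g = (f \<oplus> h) \<oplus> g" using assms by simp
  also have "\<dots> = h \<oplus> (f \<oplus> g)"
    using assms hadd_commute[of f h] hadd_associative[of h f g] by simp
  finally show ?thesis using assms by simp
qed

lemma neg_props:
  assumes "f \<in> Ar A"
  shows "neg A f \<in> hom A (Dom A f) (Cod A f) \<and> f \<oplus> neg A f = hzero A (Dom A f) (Cod A f)"
  unfolding neg_def
proof (rule theI')
  show "\<exists>!g. g \<in> hom A (Dom A f) (Cod A f) \<and> f \<oplus> g = hzero A (Dom A f) (Cod A f)"
    using neg_exists[OF assms] neg_unique[OF assms] by (metis hom_iff)
qed

lemma neg_simps [simp]:
  assumes "f \<in> Ar A"
  shows "neg A f \<in> Ar A" "Dom A (neg A f) = Dom A f" "Cod A (neg A f) = Cod A f"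
  using neg_props[OF assms] by (auto simp: hom_iff)

lemma hadd_neg_self: "f \<in> Ar A \<Longrightarrow> f \<oplus> neg A f = hzero A (Dom A f) (Cod A f)"
  using neg_props by blast

lemma neg_eqI:
  "f \<in> Ar A \<Longrightarrow> g \<in> Ar A \<Longrightarrow> Dom A g = Dom A f \<Longrightarrow> Cod A g = Cod A f \<Longrightarrow> f \<oplus> g = hzero A (Dom A f) (Cod A f)
    \<Longrightarrow> neg A f = g"
  by (rule neg_unique[of f]) (auto simp: hadd_neg_self)

lemma neg_neg [simp]: "f \<in> Ar A \<Longrightarrow> neg A (neg A f) = f"
  by (rule neg_eqI) (auto simp: hadd_neg_self hadd_commute[of "neg A f"])

lemma idem_hzero:
  assumes [simp]: "f \<in> Ar A" and f: "f \<oplus> f = f"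
  shows "f = hzero A (Dom A f) (Cod A f)"
proof -
  have "f = f \<oplus> (f \<oplus> neg A f)" by (simp add: hadd_neg_self)
  also have "\<dots> = (f \<oplus> f) \<oplus> neg A f" by (subst hadd_associative) auto
  finally show ?thesis by (simp add: f hadd_neg_self)
qed

lemma Comp_hzero [simp]:
  assumes [simp]: "f \<in> Ar A" "X \<in> Ob A" "Dom A f = Y"
  shows "f \<cdot> hzero A X Y = hzero A X (Cod A f)"
proof -
  have [simp]: "Y \<in> Ob A" using Dom_Ob[of f] by simp
  have "f \<cdot> hzero A X Y \<oplus> f \<cdot> hzero A X Y = f \<cdot> (hzero A X Y \<oplus> hzero A X Y)"
    by (subst Comp_hadd) auto
  then show ?thesis using idem_hzero[of "f \<cdot> hzero A X Y"] by simp
qed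

lemma hzero_Comp [simp]:
  assumes [simp]: "f \<in> Ar A" "Z \<in> Ob A" "Cod A f = Y"
  shows "hzero A Y Z \<cdot> f = hzero A (Dom A f) Z"
proof -
  have [simp]: "Y \<in> Ob A" using Cod_Ob[of f] by simp
  have "hzero A Y Z \<cdot> f \<oplus> hzero A Y Z \<cdot> f = (hzero A Y Z \<oplus> hzero A Y Z) \<cdot> f"
    by (subst hadd_Comp) auto
  then show ?thesis using idem_hzero[of "hzero A Y Z \<cdot> f"] by simp
qed

lemma Comp_neg: "f \<in> Ar A \<Longrightarrow> g \<in> Ar A \<Longrightarrow> Dom A g = Cod A f \<Longrightarrow> g \<cdot> neg A f = neg A (g \<cdot> f)"
  by (rule neg_eqI[symmetric]) (auto simp: Comp_hadd[symmetric] hadd_neg_self)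

lemma neg_Comp: "f \<in> Ar A \<Longrightarrow> g \<in> Ar A \<Longrightarrow> Dom A g = Cod A f \<Longrightarrow> neg A g \<cdot> f = neg A (g \<cdot> f)"
  by (rule neg_eqI[symmetric]) (auto simp: hadd_Comp[symmetric] hadd_neg_self)

lemma neg_hadd:
  assumes [simp]: "f \<in> Ar A" "g \<in> Ar A" "Dom A g = Dom A f" "Cod A g = Cod A f"
  shows "neg A (f \<oplus> g) = neg A f \<oplus> neg A g"
proof (rule neg_eqI)
  have "(f \<oplus> g) \<oplus> (neg A f \<oplus> neg A g) = (f \<oplus> neg A f) \<oplus> (g \<oplus> neg A g)"
    using hadd_commute[of g "neg A f \<oplus> neg A g"] hadd_commute[of g "neg A g"] by (simp add: hadd_associative)
  then show "(f \<oplus> g) \<oplus> (neg A f \<oplus> neg A g) = hzero A (Dom A (f \<oplus> g)) (Cod A (f \<oplus> g))"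
    by (simp add: hadd_neg_self)
qed auto

lemma neg_hzero [simp]: "X \<in> Ob A \<Longrightarrow> Y \<in> Ob A \<Longrightarrow> neg A (hzero A X Y) = hzero A X Y"
  by (rule neg_eqI) auto

section \<open>Additivity of the tensor product\<close>

lemma ihom_ex:
  assumes "X \<in> Ob A" "Y \<in> Ob A"
  obtains H e where "H \<in> Ob A" "e \<in> Ar A" "Dom A e = H \<otimes> X" "Cod A e = Y"
    "\<And>Z f. Z \<in> Ob A \<Longrightarrow> f \<in> hom A (Z \<otimes> X) Y \<Longrightarrow> \<exists>!g. g \<in> hom A Z H \<and> e \<cdot> (g \<boxtimes> Id A X) = f"
  using closed assms unfolding has_internal_homs_def is_ihom_def by (metis hom_iff)

lemma zero_ob: "is_zero_ob A (zero_ob A)"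
  unfolding zero_ob_def using zero_ob_exists by (rule someI_ex)

lemma zero_ob_Ob [simp]: "zero_ob A \<in> Ob A"
  using zero_ob by (simp add: is_zero_ob_def)

lemma from_zero_unique:
  "f \<in> Ar A \<Longrightarrow> g \<in> Ar A \<Longrightarrow> Dom A f = zero_ob A \<Longrightarrow> Dom A g = zero_ob A \<Longrightarrow> Cod A f = Cod A g \<Longrightarrow> f = g"
  using zero_ob unfolding is_zero_ob_def by (metis Cod_Ob hom_iff)

lemma to_zero_unique:
  "f \<in> Ar A \<Longrightarrow> g \<in> Ar A \<Longrightarrow> Cod A f = zero_ob A \<Longrightarrow> Cod A g = zero_ob A \<Longrightarrow> Dom A f = Dom A g \<Longrightarrow> f = g"
  using zero_ob unfolding is_zero_ob_def by (metis Dom_Ob hom_iff)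

lemma Id_zero_ob: "Id A (zero_ob A) = hzero A (zero_ob A) (zero_ob A)"
  by (rule from_zero_unique) auto

text \<open>Tensoring with Z has a right adjoint and therefore preserves jointly epimorphic
  families. Spelled out, the two maps are curried and compared on the family.\<close>

lemma tens_ext:
  assumes epi: "\<And>Y k l. k \<in> hom A S Y \<Longrightarrow> l \<in> hom A S Y \<Longrightarrow> (\<And>i. i \<in> I \<Longrightarrow> k \<cdot> \<iota> i = l \<cdot> \<iota> i) \<Longrightarrow> k = l"
    and \<iota>: "\<And>i. i \<in> I \<Longrightarrow> \<iota> i \<in> Ar A" "\<And>i. i \<in> I \<Longrightarrow> Cod A (\<iota> i) = S" and [simp]: "S \<in> Ob A"
    and f: "f \<in> Ar A" "g \<in> Ar A" "Dom A f = S \<otimes> Z" "Dom A g = S \<otimes> Z" "Cod A g = Cod A f" and [simp]: "Z \<in> Ob A"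
    and eq: "\<And>i. i \<in> I \<Longrightarrow> f \<cdot> (\<iota> i \<boxtimes> Id A Z) = g \<cdot> (\<iota> i \<boxtimes> Id A Z)"
  shows "f = g"
proof -
  let ?Y = "Cod A f"
  obtain H e where He [simp]: "H \<in> Ob A" "e \<in> Ar A" "Dom A e = H \<otimes> Z" "Cod A e = ?Y"
    and u: "\<And>W f. W \<in> Ob A \<Longrightarrow> f \<in> hom A (W \<otimes> Z) ?Y \<Longrightarrow> \<exists>!g. g \<in> hom A W H \<and> e \<cdot> (g \<boxtimes> Id A Z) = f"
    using ihom_ex[of Z ?Y] f by auto
  obtain f' where f' [simp]: "f' \<in> Ar A" "Dom A f' = S" "Cod A f' = H" "e \<cdot> (f' \<boxtimes> Id A Z) = f"
    using u[of S f] f by (auto simp: hom_iff)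
  obtain g' where g' [simp]: "g' \<in> Ar A" "Dom A g' = S" "Cod A g' = H" "e \<cdot> (g' \<boxtimes> Id A Z) = g"
    using u[of S g] f by (auto simp: hom_iff)
  have "f' = g'"
  proof (rule epi)
    fix i assume i: "i \<in> I"
    note [simp] = \<iota>(1)[OF i] \<iota>(2)[OF i]
    have e1: "e \<cdot> ((k \<cdot> \<iota> i) \<boxtimes> Id A Z) = (e \<cdot> (k \<boxtimes> Id A Z)) \<cdot> (\<iota> i \<boxtimes> Id A Z)"
      if [simp]: "k \<in> Ar A" "Dom A k = S" "Cod A k = H" for k
      by (simp add: tens_Comp_tens)
    have "\<exists>!k. k \<in> hom A (Dom A (\<iota> i)) H \<and> e \<cdot> (k \<boxtimes> Id A Z) = f \<cdot> (\<iota> i \<boxtimes> Id A Z)"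
      using f by (intro u) (auto simp: hom_iff)
    moreover have "e \<cdot> ((f' \<cdot> \<iota> i) \<boxtimes> Id A Z) = f \<cdot> (\<iota> i \<boxtimes> Id A Z)" "e \<cdot> ((g' \<cdot> \<iota> i) \<boxtimes> Id A Z) = f \<cdot> (\<iota> i \<boxtimes> Id A Z)"
      using e1[of f'] e1[of g'] eq[OF i] by simp_all
    ultimately show "f' \<cdot> \<iota> i = g' \<cdot> \<iota> i"
      by (metis (no_types, lifting) \<iota>(1)[OF i] \<iota>(2)[OF i] Comp_simps f'(1,2,3) g'(1,2,3) hom_iff)
  qed (auto simp: hom_iff)
  then show ?thesis using f'(4) g'(4) by simp
qed

lemma hzero_tens [simp]:
  assumes [simp]: "X \<in> Ob A" "Y \<in> Ob A" "g \<in> Ar A"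
  shows "hzero A X Y \<boxtimes> g = hzero A (X \<otimes> Dom A g) (Y \<otimes> Cod A g)"
proof -
  let ?z = "zero_ob A"
  \<comment> \<open>The empty family is jointly epimorphic onto the zero object. By
    \<open>tens_ext\<close> it remains so after tensoring, and any two maps out of
    \<open>?z \<otimes> Dom A g\<close> agree.\<close>
  have "k = l" if "k \<in> Ar A" "l \<in> Ar A" "Dom A k = ?z \<otimes> Dom A g" "Dom A l = ?z \<otimes> Dom A g" "Cod A l = Cod A k" for k l
    by (rule tens_ext[of ?z "{}" "\<lambda>_::unit. Id A ?z"]) (use that from_zero_unique in \<open>auto simp: hom_iff\<close>)
  then have 1: "hzero A ?z Y \<boxtimes> g = hzero A (?z \<otimes> Dom A g) (Y \<otimes> Cod A g)" by simp
  have "hzero A X Y \<boxtimes> g = (hzero A ?z Y \<cdot> hzero A X ?z) \<boxtimes> (g \<cdot> Id A (Dom A g))" by simp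
  also have "\<dots> = (hzero A ?z Y \<boxtimes> g) \<cdot> (hzero A X ?z \<boxtimes> Id A (Dom A g))"
    by (subst tens_Comp_tens[symmetric]) auto
  finally show ?thesis unfolding 1 by simp
qed

lemma braid_natural:
  "f \<in> Ar A \<Longrightarrow> g \<in> Ar A \<Longrightarrow> Dom A f = X \<Longrightarrow> Dom A g = Y \<Longrightarrow> Cod A f = X' \<Longrightarrow> Cod A g = Y'
    \<Longrightarrow> braid A X' Y' \<cdot> (f \<boxtimes> g) = (g \<boxtimes> f) \<cdot> braid A X Y"
  using braid_nat[of f X X' g Y Y'] by (auto simp: hom_iff)

lemma tens_via_braid:
  assumes [simp]: "f \<in> Ar A" "g \<in> Ar A"
  shows "f \<boxtimes> g = braid A (Cod A g) (Cod A f) \<cdot> (g \<boxtimes> f) \<cdot> braid A (Dom A f) (Dom A g)"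
proof -
  have "braid A (Cod A g) (Cod A f) \<cdot> (g \<boxtimes> f) = (f \<boxtimes> g) \<cdot> braid A (Dom A g) (Dom A f)"
    by (rule braid_natural) auto
  then have "braid A (Cod A g) (Cod A f) \<cdot> (g \<boxtimes> f) \<cdot> braid A (Dom A f) (Dom A g)
    = (f \<boxtimes> g) \<cdot> braid A (Dom A g) (Dom A f) \<cdot> braid A (Dom A f) (Dom A g)"
    by (rule pre) auto
  then show ?thesis by (simp add: symmetry)
qed

lemma tens_hzero [simp]:
  assumes [simp]: "X \<in> Ob A" "Y \<in> Ob A" "g \<in> Ar A"
  shows "g \<boxtimes> hzero A X Y = hzero A (Dom A g \<otimes> X) (Cod A g \<otimes> Y)"
  by (subst tens_via_braid) auto

text \<open>A consequence of closedness: tensoring with Z preserves the biproduct S of two copies of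
  \<open>?X\<close> (fact \<open>1\<close>), and \<open>f \<oplus> g\<close> is the diagonal
  \<open>i \<oplus> j\<close> followed by \<open>?m\<close>.\<close>

lemma hadd_tens:
  assumes [simp]: "f \<in> Ar A" "g \<in> Ar A" "h \<in> Ar A" "Dom A g = Dom A f" "Cod A g = Cod A f"
  shows "(f \<oplus> g) \<boxtimes> h = (f \<boxtimes> h) \<oplus> (g \<boxtimes> h)"
proof -
  let ?X = "Dom A f" and ?Y = "Cod A f" and ?Z = "Dom A h"
  obtain S i j p q where S: "S \<in> Ob A" "i \<in> hom A ?X S" "j \<in> hom A ?X S" "p \<in> hom A S ?X" "q \<in> hom A S ?X"
    and b: "p \<cdot> i = Id A ?X" "q \<cdot> j = Id A ?X" "p \<cdot> j = hzero A ?X ?X" "q \<cdot> i = hzero A ?X ?X"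
      "(i \<cdot> p) \<oplus> (j \<cdot> q) = Id A S"
    using biproduct_exists[of ?X ?X] by auto
  then have [simp]: "S \<in> Ob A" "i \<in> Ar A" "Dom A i = ?X" "Cod A i = S" "j \<in> Ar A" "Dom A j = ?X" "Cod A j = S"
    "p \<in> Ar A" "Dom A p = S" "Cod A p = ?X" "q \<in> Ar A" "Dom A q = S" "Cod A q = ?X"
    by (auto simp: hom_iff)
  note [simp] = b(1-4)
  note [simp] = pre1[OF b(1)] pre1[OF b(2)] pre1[OF b(3)] pre1[OF b(4)]
  define iota where "iota = (\<lambda>b. if b then i else j)"
  have [simp]: "iota b \<in> Ar A" "Cod A (iota b) = S" "Dom A (iota b) = ?X" for b by (auto simp: iota_def)
  let ?I = "Id A ?Z"
  have 1: "(i \<boxtimes> ?I) \<cdot> (p \<boxtimes> ?I) \<oplus> (j \<boxtimes> ?I) \<cdot> (q \<boxtimes> ?I) = Id A (S \<otimes> ?Z)"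
  proof (rule tens_ext[of S UNIV iota])
    show "k = l" if k: "k \<in> hom A S Y" "l \<in> hom A S Y" "\<And>b. b \<in> UNIV \<Longrightarrow> k \<cdot> iota b = l \<cdot> iota b" for Y k l
    proof -
      have [simp]: "k \<in> Ar A" "l \<in> Ar A" "Dom A k = S" "Dom A l = S" "Cod A k = Y" "Cod A l = Y" using k
        by (auto simp: hom_iff)
      have e: "k \<cdot> i = l \<cdot> i" "k \<cdot> j = l \<cdot> j" using k(3)[of True] k(3)[of False] by (auto simp: iota_def)
      have "k = k \<cdot> (i \<cdot> p \<oplus> j \<cdot> q)" by (simp add: b)
      also have "\<dots> = (k \<cdot> i) \<cdot> p \<oplus> (k \<cdot> j) \<cdot> q" by (simp add: Comp_hadd)
      also have "\<dots> = l \<cdot> (i \<cdot> p \<oplus> j \<cdot> q)" by (simp add: Comp_hadd e)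
      also have "\<dots> = l" by (simp add: b)
      finally show ?thesis .
    qed
    fix b
    show "((i \<boxtimes> ?I) \<cdot> (p \<boxtimes> ?I) \<oplus> (j \<boxtimes> ?I) \<cdot> (q \<boxtimes> ?I)) \<cdot> (iota b \<boxtimes> ?I) = Id A (S \<otimes> ?Z) \<cdot> (iota b \<boxtimes> ?I)"
      by (simp add: iota_def hadd_Comp tens_Comp_tens)
  qed (auto simp: tens_Comp_tens)
  let ?m = "f \<cdot> p \<oplus> g \<cdot> q"
  have 2: "?m \<cdot> (i \<oplus> j) = f \<oplus> g"
    by (simp add: Comp_hadd hadd_Comp)
  have "(f \<oplus> g) \<boxtimes> h = (?m \<boxtimes> h) \<cdot> ((i \<oplus> j) \<boxtimes> ?I)"
    by (simp add: tens_Comp_tens 2)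
  also have "(i \<oplus> j) \<boxtimes> ?I = ((i \<boxtimes> ?I) \<cdot> (p \<boxtimes> ?I) \<oplus> (j \<boxtimes> ?I) \<cdot> (q \<boxtimes> ?I)) \<cdot> ((i \<oplus> j) \<boxtimes> ?I)"
    unfolding 1 by simp
  also have "\<dots> = (i \<boxtimes> ?I) \<oplus> (j \<boxtimes> ?I)"
    by (simp add: hadd_Comp tens_Comp_tens Comp_hadd)
  also have "(?m \<boxtimes> h) \<cdot> ((i \<boxtimes> ?I) \<oplus> (j \<boxtimes> ?I)) = (f \<boxtimes> h) \<oplus> (g \<boxtimes> h)"
    by (simp add: Comp_hadd tens_Comp_tens hadd_Comp)
  finally show ?thesis .
qed

lemma tens_hadd:
  assumes [simp]: "f \<in> Ar A" "g \<in> Ar A" "h \<in> Ar A" "Dom A g = Dom A f" "Cod A g = Cod A f"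
  shows "h \<boxtimes> (f \<oplus> g) = (h \<boxtimes> f) \<oplus> (h \<boxtimes> g)"
  by (subst (1 2 3) tens_via_braid) (auto simp: hadd_tens hadd_Comp Comp_hadd)

lemma neg_tens: "f \<in> Ar A \<Longrightarrow> g \<in> Ar A \<Longrightarrow> neg A f \<boxtimes> g = neg A (f \<boxtimes> g)"
  by (rule neg_eqI[symmetric]) (auto simp: hadd_tens[symmetric] hadd_neg_self)

lemma tens_neg: "f \<in> Ar A \<Longrightarrow> g \<in> Ar A \<Longrightarrow> g \<boxtimes> neg A f = neg A (g \<boxtimes> f)"
  by (rule neg_eqI[symmetric]) (auto simp: tens_hadd[symmetric] hadd_neg_self)

lemma signed_simps [simp]:
  assumes "f \<in> Ar A"
  shows "signed A k f \<in> Ar A" "Dom A (signed A k f) = Dom A f" "Cod A (signed A k f) = Cod A f"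
  using assms by (auto simp: signed_def)

lemma Comp_signed: "f \<in> Ar A \<Longrightarrow> g \<in> Ar A \<Longrightarrow> Dom A g = Cod A f \<Longrightarrow> g \<cdot> signed A k f = signed A k (g \<cdot> f)"
  by (simp add: signed_def Comp_neg)

lemma signed_Comp: "f \<in> Ar A \<Longrightarrow> g \<in> Ar A \<Longrightarrow> Dom A g = Cod A f \<Longrightarrow> signed A k g \<cdot> f = signed A k (g \<cdot> f)"
  by (simp add: signed_def neg_Comp)

lemma signed_tens: "f \<in> Ar A \<Longrightarrow> g \<in> Ar A \<Longrightarrow> signed A k f \<boxtimes> g = signed A k (f \<boxtimes> g)"
  by (simp add: signed_def neg_tens)

lemma tens_signed: "f \<in> Ar A \<Longrightarrow> g \<in> Ar A \<Longrightarrow> g \<boxtimes> signed A k f = signed A k (g \<boxtimes> f)"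
  by (simp add: signed_def tens_neg)

lemma signed_signed: "f \<in> Ar A \<Longrightarrow> signed A k (signed A l f) = signed A (k + l) f"
  by (simp add: signed_def)

lemma signed_hadd:
  "f \<in> Ar A \<Longrightarrow> g \<in> Ar A \<Longrightarrow> Dom A g = Dom A f \<Longrightarrow> Cod A g = Cod A f \<Longrightarrow> signed A k (f \<oplus> g) = signed A k f \<oplus> signed A k g"
  by (simp add: signed_def neg_hadd)

lemma signed_hzero [simp]: "X \<in> Ob A \<Longrightarrow> Y \<in> Ob A \<Longrightarrow> signed A k (hzero A X Y) = hzero A X Y"
  by (simp add: signed_def)

lemma signed_cancel: "f \<in> Ar A \<Longrightarrow> odd (k + l) \<Longrightarrow> signed A k f \<oplus> signed A l f = hzero A (Dom A f) (Cod A f)"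
  by (auto simp: signed_def hadd_neg_self hadd_commute[of "neg A f"])

lemma signed_cong: "even (k + l) \<Longrightarrow> signed A k f = signed A l f"
  by (auto simp: signed_def)

lemma signed_even [simp]: "even k \<Longrightarrow> signed A k f = f"
  by (simp add: signed_def)

lemma tens_ext_left:
  assumes epi: "\<And>Y k l. k \<in> hom A S Y \<Longrightarrow> l \<in> hom A S Y \<Longrightarrow> (\<And>i. i \<in> I \<Longrightarrow> k \<cdot> \<iota> i = l \<cdot> \<iota> i) \<Longrightarrow> k = l"
    and \<iota>: "\<And>i. i \<in> I \<Longrightarrow> \<iota> i \<in> Ar A" "\<And>i. i \<in> I \<Longrightarrow> Cod A (\<iota> i) = S" and [simp]: "S \<in> Ob A"
    and f: "f \<in> Ar A" "g \<in> Ar A" "Dom A f = Z \<otimes> S" "Dom A g = Z \<otimes> S" "Cod A g = Cod A f" and [simp]: "Z \<in> Ob A"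
    and eq: "\<And>i. i \<in> I \<Longrightarrow> f \<cdot> (Id A Z \<boxtimes> \<iota> i) = g \<cdot> (Id A Z \<boxtimes> \<iota> i)"
  shows "f = g"
proof -
  note [simp] = f
  have "f \<cdot> braid A S Z = g \<cdot> braid A S Z"
  proof (rule tens_ext[OF epi \<iota>])
    fix i assume i: "i \<in> I"
    note [simp] = \<iota>(1)[OF i] \<iota>(2)[OF i]
    have "(k \<cdot> braid A S Z) \<cdot> (\<iota> i \<boxtimes> Id A Z) = (k \<cdot> (Id A Z \<boxtimes> \<iota> i)) \<cdot> braid A (Dom A (\<iota> i)) Z"
      if "k \<in> Ar A" "Dom A k = Z \<otimes> S" for k
      using that by (simp add: braid_natural[where X = "Dom A (\<iota> i)" and Y = Z])
    then show "(f \<cdot> braid A S Z) \<cdot> (\<iota> i \<boxtimes> Id A Z) = (g \<cdot> braid A S Z) \<cdot> (\<iota> i \<boxtimes> Id A Z)"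
      using eq[OF i] f(1-4) by metis
  qed auto
  then have "(f \<cdot> braid A S Z) \<cdot> braid A Z S = (g \<cdot> braid A S Z) \<cdot> braid A Z S" by simp
  then show ?thesis by (simp add: symmetry)
qed

end

section \<open>Coproducts and tensor products of complexes\<close>

locale chain_base = closed_additive A for A :: "('o, 'a, 'm) asmcat_scheme" (structure) +
  assumes coproducts: "(\<And>i::int. F i \<in> Ob A) \<Longrightarrow> \<exists>S \<iota>. is_coproduct A F S \<iota>"
begin

lemma coprod:
  assumes "\<And>i::int. F i \<in> Ob A"
  shows "is_coproduct A F (fst (coprod A F)) (snd (coprod A F))"
proof -
  obtain S \<iota> where "is_coproduct A F S \<iota>" using coproducts[of F] assms by auto
  then have "is_coproduct A F (fst (S, \<iota>)) (snd (S, \<iota>))" by simp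
  then show ?thesis unfolding coprod_def by (rule someI)
qed

lemma coprod_ext:
  assumes "\<And>i::int. F i \<in> Ob A" "f \<in> hom A (fst (coprod A F)) Y" "g \<in> hom A (fst (coprod A F)) Y"
    "\<And>i. f \<cdot> snd (coprod A F) i = g \<cdot> snd (coprod A F) i"
  shows "f = g"
proof -
  let ?\<iota> = "snd (coprod A F)"
  have c: "is_coproduct A F (fst (coprod A F)) ?\<iota>" by (rule coprod[OF assms(1)])
  have k: "\<forall>i. f \<cdot> ?\<iota> i \<in> hom A (F i) Y"
  proof
    fix i
    have "?\<iota> i \<in> hom A (F i) (fst (coprod A F))" using c by (simp add: is_coproduct_def)
    then show "f \<cdot> ?\<iota> i \<in> hom A (F i) Y" using assms(2) by (rule Comp_hom)
  qed
  have Y: "Y \<in> Ob A" using assms(2) by (auto simp: hom_iff)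
  have "\<exists>!h. h \<in> hom A (fst (coprod A F)) Y \<and> (\<forall>i. h \<cdot> ?\<iota> i = f \<cdot> ?\<iota> i)"
    using c[unfolded is_coproduct_def, THEN conjunct2, THEN conjunct2, THEN bspec[OF _ Y], THEN spec[of _
      "\<lambda>i. f \<cdot> ?\<iota> i"]] k
    by simp
  then show ?thesis using assms(2-4) by metis
qed

lemma copair:
  assumes "\<And>i::int. F i \<in> Ob A" "Y \<in> Ob A" "\<And>i. \<kappa> i \<in> hom A (F i) Y"
  shows "copair A F Y \<kappa> \<in> hom A (fst (coprod A F)) Y" "copair A F Y \<kappa> \<cdot> snd (coprod A F) i = \<kappa> i"
proof -
  have "\<exists>!h. h \<in> hom A (fst (coprod A F)) Y \<and> (\<forall>i. h \<cdot> snd (coprod A F) i = \<kappa> i)"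
    using coprod[OF assms(1), unfolded is_coproduct_def, THEN conjunct2, THEN conjunct2, THEN bspec[OF _
      assms(2)], THEN spec[of _ \<kappa>]] assms(3)
    by simp
  then have "copair A F Y \<kappa> \<in> hom A (fst (coprod A F)) Y \<and> (\<forall>i. copair A F Y \<kappa> \<cdot> snd (coprod A F) i = \<kappa> i)"
    unfolding copair_def by (rule theI')
  then show "copair A F Y \<kappa> \<in> hom A (fst (coprod A F)) Y" "copair A F Y \<kappa> \<cdot> snd (coprod A F) i = \<kappa> i" by auto
qed

lemma chain_simps [simp]:
  assumes "is_chain A X"
  shows "deg X n \<in> Ob A" "diff X n \<in> Ar A" "Dom A (diff X n) = deg X n" "Cod A (diff X n) = deg X (n - 1)"
  using assms by (auto simp: is_chain_def hom_iff)

lemma diff_diff: "is_chain A X \<Longrightarrow> m = n - 1 \<Longrightarrow> diff X m \<cdot> diff X n = hzero A (deg X n) (deg X (n - 2))"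
  unfolding is_chain_def by blast

lemma chmap_simps [simp]:
  assumes "is_chmap A f"
  shows "is_chain A (src f)" "is_chain A (tgt f)" "at f n \<in> Ar A" "Dom A (at f n) = deg (src f) n"
    "Cod A (at f n) = deg (tgt f) n"
  using assms by (auto simp: is_chmap_def hom_iff)

lemma chmap_diff: "is_chmap A f \<Longrightarrow> X = tgt f \<Longrightarrow> diff X n \<cdot> at f n = at f (n - 1) \<cdot> diff (src f) n"
  unfolding is_chmap_def by blast

text \<open>Normal forms for degrees: the types of components are compared syntactically during
  simplification.\<close>

lemma int_index [simp]: "(p::int) - 1 + q = p + q - 1" "p + (q - 1) = p + q - 1" "p - 1 - 1 = p - 2"
  "p - 2 + q = p + q - 2" "p + (q - 2) = p + q - 2"
  by auto

context
  fixes X Y assumes XY [simp]: "is_chain A X" "is_chain A Y"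
begin

lemma tens_summand_Ob [simp]: "tens_summand A X Y n p \<in> Ob A"
  by (simp add: tens_summand_def)

lemma tens_deg_Ob [simp]: "deg (ch_tens A X Y) n \<in> Ob A"
  using coprod[of "tens_summand A X Y n"] by (simp add: is_coproduct_def ch_tens_def)

lemma tens_inj_simps [simp]:
  "tens_inj A X Y p q \<in> Ar A" "Dom A (tens_inj A X Y p q) = deg X p \<otimes> deg Y q"
  "Cod A (tens_inj A X Y p q) = deg (ch_tens A X Y) (p + q)"
proof -
  have "tens_inj A X Y p q \<in> hom A (tens_summand A X Y (p + q) p) (fst (coprod A (tens_summand A X Y (p + q))))"
    using coprod[of "tens_summand A X Y (p + q)"] unfolding is_coproduct_def tens_inj_def by simp
  then show "tens_inj A X Y p q \<in> Ar A" "Dom A (tens_inj A X Y p q) = deg X p \<otimes> deg Y q"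
    "Cod A (tens_inj A X Y p q) = deg (ch_tens A X Y) (p + q)"
    by (auto simp: hom_iff ch_tens_def tens_summand_def)
qed

lemma ch_tens_ext:
  assumes "f \<in> Ar A" "g \<in> Ar A" "Dom A f = deg (ch_tens A X Y) n" "Dom A g = deg (ch_tens A X Y) n"
    "Cod A g = Cod A f"
    and eq: "\<And>p q. n = p + q \<Longrightarrow> f \<cdot> tens_inj A X Y p q = g \<cdot> tens_inj A X Y p q"
  shows "f = g"
proof (rule coprod_ext[of "tens_summand A X Y n"])
  show "f \<cdot> snd (coprod A (tens_summand A X Y n)) i = g \<cdot> snd (coprod A (tens_summand A X Y n)) i" for i
    using eq[of i "n - i"] by (simp add: tens_inj_def)
qed (use assms in \<open>auto simp: hom_iff ch_tens_def\<close>)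

lemma copair_tens:
  assumes "Z \<in> Ob A" "\<And>p. \<kappa> p \<in> Ar A" "\<And>p. Dom A (\<kappa> p) = deg X p \<otimes> deg Y (n - p)"
    "\<And>p. Cod A (\<kappa> p) = Z"
  shows "copair A (tens_summand A X Y n) Z \<kappa> \<in> Ar A"
    "Dom A (copair A (tens_summand A X Y n) Z \<kappa>) = deg (ch_tens A X Y) n"
    "Cod A (copair A (tens_summand A X Y n) Z \<kappa>) = Z"
    "n = p + q \<Longrightarrow> copair A (tens_summand A X Y n) Z \<kappa> \<cdot> tens_inj A X Y p q = \<kappa> p"
proof -
  have k: "\<kappa> i \<in> hom A (tens_summand A X Y n i) Z" for i
    using assms(2,3,4)[of i] by (simp add: hom_iff tens_summand_def)
  show "copair A (tens_summand A X Y n) Z \<kappa> \<in> Ar A"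
    "Dom A (copair A (tens_summand A X Y n) Z \<kappa>) = deg (ch_tens A X Y) n"
    "Cod A (copair A (tens_summand A X Y n) Z \<kappa>) = Z"
    "n = p + q \<Longrightarrow> copair A (tens_summand A X Y n) Z \<kappa> \<cdot> tens_inj A X Y p q = \<kappa> p"
    using copair[OF _ assms(1) k] by (auto simp: hom_iff ch_tens_def tens_inj_def)
qed

lemma diff_tens_typing [simp]:
  "diff (ch_tens A X Y) n \<in> Ar A" "Dom A (diff (ch_tens A X Y) n) = deg (ch_tens A X Y) n"
  "Cod A (diff (ch_tens A X Y) n) = deg (ch_tens A X Y) (n - 1)"
  and diff_tens_inj: "n = p + q \<Longrightarrow> diff (ch_tens A X Y) n \<cdot> tens_inj A X Y p q
    = (tens_inj A X Y (p - 1) q \<cdot> (diff X p \<boxtimes> Id A (deg Y q))) \<oplus> signed A p (tens_inj A X Y p (q - 1)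
      \<cdot> (Id A (deg X p) \<boxtimes> diff Y q))"
proof -
  have *: "diff (ch_tens A X Y) n = copair A (tens_summand A X Y n) (deg (ch_tens A X Y) (n - 1))
       (\<lambda>p. (tens_inj A X Y (p - 1) (n - p) \<cdot> (diff X p \<boxtimes> Id A (deg Y (n - p))))
         \<oplus> signed A p (tens_inj A X Y p (n - p - 1) \<cdot> (Id A (deg X p) \<boxtimes> diff Y (n - p))))" for n
    by (simp add: ch_tens_def)
  show "diff (ch_tens A X Y) n \<in> Ar A" "Dom A (diff (ch_tens A X Y) n) = deg (ch_tens A X Y) n"
    "Cod A (diff (ch_tens A X Y) n) = deg (ch_tens A X Y) (n - 1)" for n
    unfolding * by (rule copair_tens; simp)+
  show "n = p + q \<Longrightarrow> diff (ch_tens A X Y) n \<cdot> tens_inj A X Y p q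
    = (tens_inj A X Y (p - 1) q \<cdot> (diff X p \<boxtimes> Id A (deg Y q))) \<oplus> signed A p (tens_inj A X Y p (q - 1)
      \<cdot> (Id A (deg X p) \<boxtimes> diff Y q))"
    unfolding * by (subst copair_tens) auto
qed

lemma is_chain_tens [simp]: "is_chain A (ch_tens A X Y)"
  unfolding is_chain_def
proof (intro allI conjI)
  fix n
  show "diff (ch_tens A X Y) (n - 1) \<cdot> diff (ch_tens A X Y) n
    = hzero A (deg (ch_tens A X Y) n) (deg (ch_tens A X Y) (n - 2))"
  proof (rule ch_tens_ext)
    fix p q assume n: "n = p + q"
    let ?t = "tens_inj A X Y"
    \<comment> \<open>The mixed term, in which both differentials act. It occurs twice in the square
      of the differential, with the opposite signs given by \<open>p - 1\<close> and
      \<open>p\<close>.\<close>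
    let ?u = "?t (p - 1) (q - 1) \<cdot> (diff X p \<boxtimes> diff Y q)"
    have 1: "diff (ch_tens A X Y) (n - 1) \<cdot> ?t (p - 1) q \<cdot> (diff X p \<boxtimes> Id A (deg Y q)) = signed A (p - 1) ?u"
    proof -
      have "diff (ch_tens A X Y) (n - 1) \<cdot> ?t (p - 1) q \<cdot> (diff X p \<boxtimes> Id A (deg Y q))
        = (diff (ch_tens A X Y) (n - 1) \<cdot> ?t (p - 1) q) \<cdot> (diff X p \<boxtimes> Id A (deg Y q))" by (simp add: n)
      also have "\<dots> = signed A (p - 1) ?u"
        by (subst diff_tens_inj) (auto simp: n hadd_Comp signed_Comp tens_Comp_tens diff_diff)
      finally show ?thesis .
    qed
    have 2: "diff (ch_tens A X Y) (n - 1) \<cdot> ?t p (q - 1) \<cdot> (Id A (deg X p) \<boxtimes> diff Y q) = ?u"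
    proof -
      have "diff (ch_tens A X Y) (n - 1) \<cdot> ?t p (q - 1) \<cdot> (Id A (deg X p) \<boxtimes> diff Y q)
        = (diff (ch_tens A X Y) (n - 1) \<cdot> ?t p (q - 1)) \<cdot> (Id A (deg X p) \<boxtimes> diff Y q)" by (simp add: n)
      also have "\<dots> = ?u"
        by (subst diff_tens_inj) (auto simp: n hadd_Comp signed_Comp tens_Comp_tens diff_diff)
      finally show ?thesis .
    qed
    have "(diff (ch_tens A X Y) (n - 1) \<cdot> diff (ch_tens A X Y) n) \<cdot> ?t p q
       = signed A (p - 1) ?u \<oplus> signed A p ?u"
      using 1 2 by (simp add: n diff_tens_inj Comp_hadd Comp_signed)
    then show "(diff (ch_tens A X Y) (n - 1) \<cdot> diff (ch_tens A X Y) n) \<cdot> ?t p q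
       = hzero A (deg (ch_tens A X Y) n) (deg (ch_tens A X Y) (n - 2)) \<cdot> ?t p q"
      by (simp add: signed_cancel n)
  qed auto
qed (auto simp: hom_iff)

lemma ch_tens_epi:
  assumes "k \<in> hom A (deg (ch_tens A X Y) n) Z" "l \<in> hom A (deg (ch_tens A X Y) n) Z"
    "\<And>i. i \<in> {(p, q). n = p + q} \<Longrightarrow> k \<cdot> case_prod (tens_inj A X Y) i = l \<cdot> case_prod (tens_inj A X Y) i"
  shows "k = l"
  using assms by (intro ch_tens_ext[of k l n]) (auto simp: hom_iff)

end

lemma ch_tens_ext3:
  assumes [simp]: "is_chain A X" "is_chain A Y" "is_chain A Z"
    and [simp]: "f \<in> Ar A" "g \<in> Ar A" "Dom A f = deg (ch_tens A (ch_tens A X Y) Z) n"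
      "Dom A g = deg (ch_tens A (ch_tens A X Y) Z) n"
      "Cod A g = Cod A f"
    and eq: "\<And>p q r. n = p + q + r \<Longrightarrow> f \<cdot> tens_inj A (ch_tens A X Y) Z (p + q) r \<cdot> (tens_inj A X Y p q \<boxtimes> Id A
      (deg Z r))
      = g \<cdot> tens_inj A (ch_tens A X Y) Z (p + q) r \<cdot> (tens_inj A X Y p q \<boxtimes> Id A (deg Z r))"
  shows "f = g"
proof (rule ch_tens_ext[of "ch_tens A X Y" Z _ _ n])
  fix m r assume n [simp]: "n = m + r"
  show "f \<cdot> tens_inj A (ch_tens A X Y) Z m r = g \<cdot> tens_inj A (ch_tens A X Y) Z m r"
    by (rule tens_ext[where \<iota> = "case_prod (tens_inj A X Y)" and I = "{(p, q). m = p + q}"])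
      (use eq ch_tens_epi[of X Y _ m] in auto)
qed auto

lemma ch_tens_ext3_right:
  assumes [simp]: "is_chain A X" "is_chain A Y" "is_chain A Z"
    and [simp]: "f \<in> Ar A" "g \<in> Ar A" "Dom A f = deg (ch_tens A X (ch_tens A Y Z)) n"
      "Dom A g = deg (ch_tens A X (ch_tens A Y Z)) n"
      "Cod A g = Cod A f"
    and eq: "\<And>p q r. n = p + (q + r) \<Longrightarrow> f \<cdot> tens_inj A X (ch_tens A Y Z) p (q + r)
      \<cdot> (Id A (deg X p) \<boxtimes> tens_inj A Y Z q r)
      = g \<cdot> tens_inj A X (ch_tens A Y Z) p (q + r) \<cdot> (Id A (deg X p) \<boxtimes> tens_inj A Y Z q r)"
  shows "f = g"
proof (rule ch_tens_ext[of X "ch_tens A Y Z" _ _ n])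
  fix p m assume n [simp]: "n = p + m"
  show "f \<cdot> tens_inj A X (ch_tens A Y Z) p m = g \<cdot> tens_inj A X (ch_tens A Y Z) p m"
    by (rule tens_ext_left[where \<iota> = "case_prod (tens_inj A Y Z)" and I = "{(p, q). m = p + q}"])
      (use eq ch_tens_epi[of Y Z _ m] in auto)
qed auto

end

context closed_additive begin

text \<open>The existence half of the fact that tensoring with Z preserves coproducts: the
  components are curried, glued and uncurried.\<close>

lemma coproduct_tens_desc:
  assumes S: "is_coproduct A F S \<iota>" and [simp]: "\<And>i. F i \<in> Ob A" "Z \<in> Ob A"
    "W \<in> Ob A" and \<kappa>: "\<And>i. \<kappa> i \<in> hom A (F i \<otimes> Z) W"
  obtains h where "h \<in> Ar A" "Dom A h = S \<otimes> Z" "Cod A h = W" "\<And>i. h \<cdot> (\<iota> i \<boxtimes> Id A Z) = \<kappa> i"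
proof -
  obtain H e where He [simp]: "H \<in> Ob A" "e \<in> Ar A" "Dom A e = H \<otimes> Z" "Cod A e = W"
    and u: "\<And>V f. V \<in> Ob A \<Longrightarrow> f \<in> hom A (V \<otimes> Z) W \<Longrightarrow> \<exists>!g. g \<in> hom A V H \<and> e \<cdot> (g \<boxtimes> Id A Z) = f"
    using ihom_ex[of Z W] by auto
  have "\<forall>i. \<exists>g. g \<in> hom A (F i) H \<and> e \<cdot> (g \<boxtimes> Id A Z) = \<kappa> i"
    using u \<kappa> by (meson assms(2))
  then obtain k where k: "\<And>i. k i \<in> hom A (F i) H" "\<And>i. e \<cdot> (k i \<boxtimes> Id A Z) = \<kappa> i" by metis
  obtain h where h: "h \<in> hom A S H" "\<And>i. h \<cdot> \<iota> i = k i"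
    using S[unfolded is_coproduct_def, THEN conjunct2, THEN conjunct2, THEN bspec[OF _ He(1)], THEN spec[of
      _ k]] k(1) by auto
  have \<iota> [simp]: "\<iota> i \<in> Ar A" "Cod A (\<iota> i) = S" for i using S by (auto simp: is_coproduct_def hom_iff)
  have [simp]: "h \<in> Ar A" "Dom A h = S" "Cod A h = H" using h by (auto simp: hom_iff)
  show ?thesis
  proof (rule that[of "e \<cdot> (h \<boxtimes> Id A Z)"])
    fix i
    have "(e \<cdot> (h \<boxtimes> Id A Z)) \<cdot> (\<iota> i \<boxtimes> Id A Z) = e \<cdot> ((h \<cdot> \<iota> i) \<boxtimes> Id A Z)"
      by (simp add: tens_Comp_tens)
    then show "(e \<cdot> (h \<boxtimes> Id A Z)) \<cdot> (\<iota> i \<boxtimes> Id A Z) = \<kappa> i" using h k by simp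
  qed auto
qed

lemma inverse_exists:
  assumes "iso A f"
  obtains g where "f \<in> Ar A" "g \<in> Ar A" "Dom A g = Cod A f" "Cod A g = Dom A f" "g \<cdot> f = Id A (Dom A f)"
    "f \<cdot> g = Id A (Cod A f)"
  using assms by (auto simp: iso_def inverse_of_def hom_iff)

end

context chain_base begin

lemma tens_desc:
  assumes [simp]: "is_chain A X" "is_chain A Y" "Z \<in> Ob A" "W \<in> Ob A"
    and k: "\<And>p q. n = p + q \<Longrightarrow> k p q \<in> hom A ((deg X p \<otimes> deg Y q) \<otimes> Z) W"
  obtains h where "h \<in> Ar A" "Dom A h = deg (ch_tens A X Y) n \<otimes> Z" "Cod A h = W"
    "\<And>p q. n = p + q \<Longrightarrow> h \<cdot> (tens_inj A X Y p q \<boxtimes> Id A Z) = k p q"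
proof -
  let ?F = "tens_summand A X Y n"
  have "is_coproduct A ?F (fst (coprod A ?F)) (snd (coprod A ?F))" by (rule coprod) simp
  then obtain h where "h \<in> Ar A" "Dom A h = fst (coprod A ?F) \<otimes> Z" "Cod A h = W"
    "\<And>p. h \<cdot> (snd (coprod A ?F) p \<boxtimes> Id A Z) = k p (n - p)"
    by (rule coproduct_tens_desc[where W = W and \<kappa> = "\<lambda>p. k p (n - p)"]) (use k in \<open>auto simp: tens_summand_def\<close>)
  then show ?thesis by (intro that[of h]) (auto simp: tens_inj_def ch_tens_def)
qed

lemma tens_desc_left:
  assumes [simp]: "is_chain A X" "is_chain A Y" "Z \<in> Ob A" "W \<in> Ob A"
    and k: "\<And>p q. n = p + q \<Longrightarrow> k p q \<in> hom A (Z \<otimes> (deg X p \<otimes> deg Y q)) W"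
  obtains h where "h \<in> Ar A" "Dom A h = Z \<otimes> deg (ch_tens A X Y) n" "Cod A h = W"
    "\<And>p q. n = p + q \<Longrightarrow> h \<cdot> (Id A Z \<boxtimes> tens_inj A X Y p q) = k p q"
proof -
  have k' [simp]: "n = p + q \<Longrightarrow> k p q \<in> Ar A" "n = p + q \<Longrightarrow> Dom A (k p q) = Z \<otimes> (deg X p \<otimes> deg Y q)"
    "n = p + q \<Longrightarrow> Cod A (k p q) = W" for p q
    using k by (auto simp: hom_iff)
  obtain h where [simp]: "h \<in> Ar A" "Dom A h = deg (ch_tens A X Y) n \<otimes> Z" "Cod A h = W"
    and h: "\<And>p q. n = p + q \<Longrightarrow> h \<cdot> (tens_inj A X Y p q \<boxtimes> Id A Z) = k p q \<cdot> braid A (deg X p \<otimes> deg Y q) Z"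
    by (rule tens_desc[of X Y Z W n "\<lambda>p q. k p q \<cdot> braid A (deg X p \<otimes> deg Y q) Z"]) (auto simp: hom_iff)
  show ?thesis
  proof (rule that[of "h \<cdot> braid A Z (deg (ch_tens A X Y) n)"])
    fix p q assume n: "n = p + q"
    have "(h \<cdot> braid A Z (deg (ch_tens A X Y) n)) \<cdot> (Id A Z \<boxtimes> tens_inj A X Y p q)
      = (h \<cdot> (tens_inj A X Y p q \<boxtimes> Id A Z)) \<cdot> braid A Z (deg X p \<otimes> deg Y q)"
      by (simp add: n braid_natural[where X = Z and Y = "deg X p \<otimes> deg Y q"])
    also have "\<dots> = k p q"
      by (subst h[OF n]) (simp add: n symmetry)
    finally show "(h \<cdot> braid A Z (deg (ch_tens A X Y) n)) \<cdot> (Id A Z \<boxtimes> tens_inj A X Y p q) = k p q" .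
  qed auto
qed

section \<open>Chain maps and their tensor products\<close>

lemma chmap_eqI: "src f = src g \<Longrightarrow> tgt f = tgt g \<Longrightarrow> (\<And>n. at f n = at g n) \<Longrightarrow> f = (g :: ('o, 'a) chmap)"
  by (cases f; cases g) auto

lemma is_chmapI:
  assumes "is_chain A (src f)" "is_chain A (tgt f)" "\<And>n. at f n \<in> Ar A" "\<And>n. Dom A (at f n) = deg (src f) n"
    "\<And>n. Cod A (at f n) = deg (tgt f) n" "\<And>n. diff (tgt f) n \<cdot> at f n = at f (n - 1) \<cdot> diff (src f) n"
  shows "is_chmap A f"
  unfolding is_chmap_def hom_iff using assms by blast

abbreviation "T \<equiv> ch_tens A"
abbreviation "t \<equiv> tens_inj A"

lemma chmap_diff_tail:
  "is_chmap A f \<Longrightarrow> h \<in> Ar A \<Longrightarrow> Cod A h = deg (src f) n \<Longrightarrow> diff (tgt f) n \<cdot> at f n \<cdot> h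
    = at f (n - 1) \<cdot> diff (src f) n \<cdot> h"
  by (rule pre[OF chmap_diff]) auto

context
  fixes f g assumes fg [simp]: "is_chmap A f" "is_chmap A g"
begin

lemma tens_map_simps [simp]: "src (ch_tens_map A f g) = T (src f) (src g)" "tgt (ch_tens_map A f g)
  = T (tgt f) (tgt g)"
  by (auto simp: ch_tens_map_def)

lemma tens_map_typing [simp]:
  "at (ch_tens_map A f g) n \<in> Ar A" "Dom A (at (ch_tens_map A f g) n) = deg (T (src f) (src g)) n"
  "Cod A (at (ch_tens_map A f g) n) = deg (T (tgt f) (tgt g)) n"
  and tens_map_inj_aux: "n = p + q \<Longrightarrow> at (ch_tens_map A f g) n \<cdot> t (src f) (src g) p q
    = t (tgt f) (tgt g) p q \<cdot> (at f p \<boxtimes> at g q)"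
proof -
  have *: "at (ch_tens_map A f g) n = copair A (tens_summand A (src f) (src g) n) (deg (T (tgt f) (tgt g)) n)
       (\<lambda>p. t (tgt f) (tgt g) p (n - p) \<cdot> (at f p \<boxtimes> at g (n - p)))" for n
    by (simp add: ch_tens_map_def)
  show "at (ch_tens_map A f g) n \<in> Ar A" "Dom A (at (ch_tens_map A f g) n) = deg (T (src f) (src g)) n"
    "Cod A (at (ch_tens_map A f g) n) = deg (T (tgt f) (tgt g)) n" for n
    unfolding * by (rule copair_tens; simp)+
  show "n = p + q \<Longrightarrow> at (ch_tens_map A f g) n \<cdot> t (src f) (src g) p q = t (tgt f) (tgt g) p q \<cdot> (at f p \<boxtimes> at g q)"
    unfolding * by (subst copair_tens) auto
qed

end

lemma tens_map_inj:
  "is_chmap A f \<Longrightarrow> is_chmap A g \<Longrightarrow> n = p + q \<Longrightarrow> X = src f \<Longrightarrow> Y = src g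
    \<Longrightarrow> at (ch_tens_map A f g) n \<cdot> t X Y p q = t (tgt f) (tgt g) p q \<cdot> (at f p \<boxtimes> at g q)"
  using tens_map_inj_aux by simp

lemma tens_map_inj_tail:
  "is_chmap A f \<Longrightarrow> is_chmap A g \<Longrightarrow> n = p + q \<Longrightarrow> X = src f \<Longrightarrow> Y = src g \<Longrightarrow> h \<in> Ar A \<Longrightarrow> Cod A h = deg X p \<otimes> deg Y q
    \<Longrightarrow> at (ch_tens_map A f g) n \<cdot> t X Y p q \<cdot> h = t (tgt f) (tgt g) p q \<cdot> (at f p \<boxtimes> at g q) \<cdot> h"
  by (rule pre[OF tens_map_inj]) auto

lemma diff_tens_inj_tail:
  assumes [simp]: "is_chain A X" "is_chain A Y" "n = p + q" "h \<in> Ar A" "Cod A h = deg X p \<otimes> deg Y q"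
  shows "diff (T X Y) n \<cdot> t X Y p q \<cdot> h = (t X Y (p - 1) q \<cdot> (diff X p \<boxtimes> Id A (deg Y q)) \<cdot> h)
     \<oplus> signed A p (t X Y p (q - 1) \<cdot> (Id A (deg X p) \<boxtimes> diff Y q) \<cdot> h)"
proof -
  have "diff (T X Y) n \<cdot> t X Y p q \<cdot> h = (diff (T X Y) n \<cdot> t X Y p q) \<cdot> h" by simp
  then show ?thesis by (simp add: diff_tens_inj hadd_Comp signed_Comp)
qed

lemma is_chmap_tens [simp]:
  assumes [simp]: "is_chmap A f" "is_chmap A g"
  shows "is_chmap A (ch_tens_map A f g)"
proof (rule is_chmapI)
  fix n
  show "diff (tgt (ch_tens_map A f g)) n \<cdot> at (ch_tens_map A f g) n = at (ch_tens_map A f g) (n - 1)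
    \<cdot> diff (src (ch_tens_map A f g)) n"
  proof (rule ch_tens_ext[of "src f" "src g" _ _ n])
    fix p q assume n: "n = p + q"
    show "(diff (tgt (ch_tens_map A f g)) n \<cdot> at (ch_tens_map A f g) n) \<cdot> t (src f) (src g) p q
      = (at (ch_tens_map A f g) (n - 1) \<cdot> diff (src (ch_tens_map A f g)) n) \<cdot> t (src f) (src g) p q"
      by (simp add: n tens_map_inj tens_map_inj_tail diff_tens_inj diff_tens_inj_tail Comp_hadd Comp_signed
        tens_Comp_tens chmap_diff)
  qed auto
qed auto

end

context closed_additive begin

lemma assoc_natural:
  "f \<in> Ar A \<Longrightarrow> g \<in> Ar A \<Longrightarrow> h \<in> Ar A
    \<Longrightarrow> Cod A f = X' \<Longrightarrow> Cod A g = Y' \<Longrightarrow> Cod A h = Z'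
    \<Longrightarrow> assoc A X' Y' Z' \<cdot> ((f \<boxtimes> g) \<boxtimes> h) = (f \<boxtimes> (g \<boxtimes> h)) \<cdot> assoc A (Dom A f) (Dom A g) (Dom A h)"
  using assoc_nat[of f "Dom A f" X' g "Dom A g" Y' h "Dom A h" Z'] by (auto simp: hom_iff)

lemma lunit_natural: "f \<in> Ar A \<Longrightarrow> Cod A f = X' \<Longrightarrow> lunit A X' \<cdot> (Id A (unit A) \<boxtimes> f) = f \<cdot> lunit A (Dom A f)"
  using lunit_nat[of f "Dom A f" X'] by (simp add: hom_iff)

lemma runit_natural: "f \<in> Ar A \<Longrightarrow> Cod A f = X' \<Longrightarrow> runit A X' \<cdot> (f \<boxtimes> Id A (unit A)) = f \<cdot> runit A (Dom A f)"
  using runit_nat[of f "Dom A f" X'] by (simp add: hom_iff)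

lemma Comp_tens_Id:
  "f \<in> Ar A \<Longrightarrow> g \<in> Ar A \<Longrightarrow> Z \<in> Ob A \<Longrightarrow> Dom A g = Cod A f
    \<Longrightarrow> (g \<cdot> f) \<boxtimes> Id A Z = (g \<boxtimes> Id A Z) \<cdot> (f \<boxtimes> Id A Z)"
  by (subst tens_Comp_tens) auto

lemma Id_tens_Comp:
  "f \<in> Ar A \<Longrightarrow> g \<in> Ar A \<Longrightarrow> Z \<in> Ob A \<Longrightarrow> Dom A g = Cod A f
    \<Longrightarrow> Id A Z \<boxtimes> (g \<cdot> f) = (Id A Z \<boxtimes> g) \<cdot> (Id A Z \<boxtimes> f)"
  by (subst tens_Comp_tens) auto

end

section \<open>The associator of complexes\<close>

context chain_base begin

text \<open>Justifies the description operator in \<open>ch_assoc\<close>. The map is glued twice,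
  over p and q with the outer degrees fixed by \<open>tens_desc\<close>, then over the outer degrees
  by \<open>copair\<close>; uniqueness is \<open>ch_tens_ext3\<close>.\<close>

lemma assoc_exists:
  assumes [simp]: "is_chain A X" "is_chain A Y" "is_chain A Z"
  shows "\<exists>!h. h \<in> hom A (deg (T (T X Y) Z) n) (deg (T X (T Y Z)) n)
    \<and> (\<forall>p q r. p + q + r = n \<longrightarrow> h \<cdot> t (T X Y) Z (p + q) r \<cdot> (t X Y p q \<boxtimes> Id A (deg Z r))
       = t X (T Y Z) p (q + r) \<cdot> (Id A (deg X p) \<boxtimes> t Y Z q r) \<cdot> assoc A (deg X p) (deg Y q) (deg Z r))"
proof -
  have "\<exists>h. h \<in> Ar A \<and> Dom A h = deg (T X Y) m \<otimes> deg Z r \<and> Cod A h = deg (T X (T Y Z)) (m + r)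
     \<and> (\<forall>p q. m = p + q \<longrightarrow> h \<cdot> (t X Y p q \<boxtimes> Id A (deg Z r))
       = t X (T Y Z) p (q + r) \<cdot> (Id A (deg X p) \<boxtimes> t Y Z q r) \<cdot> assoc A (deg X p) (deg Y q) (deg Z r))" for m r
    by (rule tens_desc[of X Y "deg Z r" "deg (T X (T Y Z)) (m + r)" m
        "\<lambda>p q. t X (T Y Z) p (q + r) \<cdot> (Id A (deg X p) \<boxtimes> t Y Z q r) \<cdot> assoc A (deg X p) (deg Y q) (deg Z r)"])
      (auto simp: hom_iff add.assoc)
  then obtain h where h [simp]: "\<And>m r. h m r \<in> Ar A" "\<And>m r. Dom A (h m r) = deg (T X Y) m \<otimes> deg Z r"
    "\<And>m r. Cod A (h m r) = deg (T X (T Y Z)) (m + r)"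
    and hh: "\<And>m r p q. m = p + q \<Longrightarrow> h m r \<cdot> (t X Y p q \<boxtimes> Id A (deg Z r))
       = t X (T Y Z) p (q + r) \<cdot> (Id A (deg X p) \<boxtimes> t Y Z q r) \<cdot> assoc A (deg X p) (deg Y q) (deg Z r)"
    by metis
  define g where "g = copair A (tens_summand A (T X Y) Z n) (deg (T X (T Y Z)) n) (\<lambda>m. h m (n - m))"
  have g [simp]: "g \<in> Ar A" "Dom A g = deg (T (T X Y) Z) n" "Cod A g = deg (T X (T Y Z)) n"
    unfolding g_def by (rule copair_tens; simp)+
  have gt: "g \<cdot> t (T X Y) Z m r = h m r" if "n = m + r" for m r
    unfolding g_def using that by (subst copair_tens) auto
  have "g \<cdot> t (T X Y) Z (p + q) r \<cdot> (t X Y p q \<boxtimes> Id A (deg Z r))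
       = t X (T Y Z) p (q + r) \<cdot> (Id A (deg X p) \<boxtimes> t Y Z q r) \<cdot> assoc A (deg X p) (deg Y q) (deg Z r)"
         if n: "p + q + r = n" for p q r
  proof -
    have "g \<cdot> t (T X Y) Z (p + q) r \<cdot> (t X Y p q \<boxtimes> Id A (deg Z r)) = (g \<cdot> t (T X Y) Z (p + q) r)
      \<cdot> (t X Y p q \<boxtimes> Id A (deg Z r))"
      by (simp add: n)
    then show ?thesis by (simp add: gt n hh)
  qed
  moreover have "k = l" if k: "k \<in> hom A (deg (T (T X Y) Z) n) (deg (T X (T Y Z)) n)"
    "l \<in> hom A (deg (T (T X Y) Z) n) (deg (T X (T Y Z)) n)"
    "\<And>p q r. p + q + r = n \<Longrightarrow> k \<cdot> t (T X Y) Z (p + q) r \<cdot> (t X Y p q \<boxtimes> Id A (deg Z r))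
      = l \<cdot> t (T X Y) Z (p + q) r \<cdot> (t X Y p q \<boxtimes> Id A (deg Z r))" for k l
    by (rule ch_tens_ext3[of X Y Z _ _ n]) (use k in \<open>auto simp: hom_iff\<close>)
  ultimately show ?thesis
    by (intro ex1I[of _ g]) (auto simp: hom_iff)
qed

context
  fixes X Y Z assumes XYZ [simp]: "is_chain A X" "is_chain A Y" "is_chain A Z"
begin

lemma ch_assoc_simps [simp]: "src (ch_assoc A X Y Z) = T (T X Y) Z" "tgt (ch_assoc A X Y Z) = T X (T Y Z)"
  by (auto simp: ch_assoc_def Let_def)

lemma ch_assoc_at:
  "at (ch_assoc A X Y Z) n \<in> hom A (deg (T (T X Y) Z) n) (deg (T X (T Y Z)) n)
    \<and> (\<forall>p q r. p + q + r = n \<longrightarrow> at (ch_assoc A X Y Z) n \<cdot> t (T X Y) Z (p + q) r \<cdot> (t X Y p q \<boxtimes> Id A (deg Z r))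
       = t X (T Y Z) p (q + r) \<cdot> (Id A (deg X p) \<boxtimes> t Y Z q r) \<cdot> assoc A (deg X p) (deg Y q) (deg Z r))"
  unfolding ch_assoc_def Let_def chmap.simps by (rule theI'[OF assoc_exists[OF XYZ]])

lemma ch_assoc_typing [simp]:
  "at (ch_assoc A X Y Z) n \<in> Ar A" "Dom A (at (ch_assoc A X Y Z) n) = deg (T (T X Y) Z) n"
  "Cod A (at (ch_assoc A X Y Z) n) = deg (T X (T Y Z)) n"
  using ch_assoc_at[of n] by (auto simp: hom_iff)

lemma ch_assoc_inj:
  "n = p + q + r \<Longrightarrow> m = p + q \<Longrightarrow> at (ch_assoc A X Y Z) n \<cdot> t (T X Y) Z m r \<cdot> (t X Y p q \<boxtimes> Id A (deg Z r))
       = t X (T Y Z) p (q + r) \<cdot> (Id A (deg X p) \<boxtimes> t Y Z q r) \<cdot> assoc A (deg X p) (deg Y q) (deg Z r)"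
  using ch_assoc_at[of n] by auto

lemma ch_assoc_inj_tail:
  assumes [simp]: "n = p + q + r" "m = p + q" "h \<in> Ar A" "Cod A h = (deg X p \<otimes> deg Y q) \<otimes> deg Z r"
  shows "at (ch_assoc A X Y Z) n \<cdot> t (T X Y) Z m r \<cdot> (t X Y p q \<boxtimes> Id A (deg Z r)) \<cdot> h
       = t X (T Y Z) p (q + r) \<cdot> (Id A (deg X p) \<boxtimes> t Y Z q r) \<cdot> assoc A (deg X p) (deg Y q) (deg Z r) \<cdot> h"
proof -
  have "at (ch_assoc A X Y Z) n \<cdot> t (T X Y) Z m r \<cdot> (t X Y p q \<boxtimes> Id A (deg Z r)) \<cdot> h
     = (at (ch_assoc A X Y Z) n \<cdot> t (T X Y) Z m r \<cdot> (t X Y p q \<boxtimes> Id A (deg Z r))) \<cdot> h" by simp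
  also have "\<dots> = (t X (T Y Z) p (q + r) \<cdot> (Id A (deg X p) \<boxtimes> t Y Z q r) \<cdot> assoc A (deg X p) (deg Y q) (deg Z r)) \<cdot> h"
    by (subst ch_assoc_inj) auto
  finally show ?thesis by (simp add: add.assoc)
qed

lemma ch_assoc_iso_at: "\<exists>g. g \<in> hom A (deg (T X (T Y Z)) n) (deg (T (T X Y) Z) n)
   \<and> g \<cdot> at (ch_assoc A X Y Z) n = Id A (deg (T (T X Y) Z) n) \<and> at (ch_assoc A X Y Z) n \<cdot> g
     = Id A (deg (T X (T Y Z)) n)"
proof -
  \<comment> \<open>The inverse is glued in the same way from the inverse associators of A, now from
    the right-hand bracketing.\<close>
  have "\<exists>ai. ai \<in> Ar A \<and> Dom A ai = deg X p \<otimes> (deg Y q \<otimes> deg Z r) \<and> Cod A ai = (deg X p \<otimes> deg Y q) \<otimes> deg Z r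
    \<and> ai \<cdot> assoc A (deg X p) (deg Y q) (deg Z r) = Id A ((deg X p \<otimes> deg Y q) \<otimes> deg Z r)
    \<and> assoc A (deg X p) (deg Y q) (deg Z r) \<cdot> ai = Id A (deg X p \<otimes> (deg Y q \<otimes> deg Z r))" for p q r
    using assoc_iso[of "deg X p" "deg Y q" "deg Z r"] by (auto elim!: inverse_exists)
  then obtain ai where ai [simp]: "\<And>p q r. ai p q r \<in> Ar A" "\<And>p q r. Dom A (ai p q r) = deg X p \<otimes> (deg Y q \<otimes> deg Z r)"
     "\<And>p q r. Cod A (ai p q r) = (deg X p \<otimes> deg Y q) \<otimes> deg Z r"
     "\<And>p q r. ai p q r \<cdot> assoc A (deg X p) (deg Y q) (deg Z r) = Id A ((deg X p \<otimes> deg Y q) \<otimes> deg Z r)"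
     "\<And>p q r. assoc A (deg X p) (deg Y q) (deg Z r) \<cdot> ai p q r = Id A (deg X p \<otimes> (deg Y q \<otimes> deg Z r))"
    by metis
  have "\<exists>h. h \<in> Ar A \<and> Dom A h = deg X p \<otimes> deg (T Y Z) m \<and> Cod A h = deg (T (T X Y) Z) (p + m)
     \<and> (\<forall>q r. m = q + r \<longrightarrow> h \<cdot> (Id A (deg X p) \<boxtimes> t Y Z q r)
       = t (T X Y) Z (p + q) r \<cdot> (t X Y p q \<boxtimes> Id A (deg Z r)) \<cdot> ai p q r)" for p m
    by (rule tens_desc_left[of Y Z "deg X p" "deg (T (T X Y) Z) (p + m)" m
        "\<lambda>q r. t (T X Y) Z (p + q) r \<cdot> (t X Y p q \<boxtimes> Id A (deg Z r)) \<cdot> ai p q r"])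
      (auto simp: hom_iff add.assoc)
  then obtain h where h [simp]: "\<And>p m. h p m \<in> Ar A" "\<And>p m. Dom A (h p m) = deg X p \<otimes> deg (T Y Z) m"
    "\<And>p m. Cod A (h p m) = deg (T (T X Y) Z) (p + m)"
    and hh: "\<And>p m q r. m = q + r \<Longrightarrow> h p m \<cdot> (Id A (deg X p) \<boxtimes> t Y Z q r)
       = t (T X Y) Z (p + q) r \<cdot> (t X Y p q \<boxtimes> Id A (deg Z r)) \<cdot> ai p q r"
    by metis
  define g where "g = copair A (tens_summand A X (T Y Z) n) (deg (T (T X Y) Z) n) (\<lambda>p. h p (n - p))"
  have g [simp]: "g \<in> Ar A" "Dom A g = deg (T X (T Y Z)) n" "Cod A g = deg (T (T X Y) Z) n"
    unfolding g_def by (rule copair_tens; simp)+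
  have gt: "g \<cdot> t X (T Y Z) p m = h p m" if "n = p + m" for p m
    unfolding g_def using that by (subst copair_tens) auto
  have g3: "g \<cdot> t X (T Y Z) p (q + r) \<cdot> (Id A (deg X p) \<boxtimes> t Y Z q r)
       = t (T X Y) Z (p + q) r \<cdot> (t X Y p q \<boxtimes> Id A (deg Z r)) \<cdot> ai p q r" if n: "n = p + (q + r)" for p q r
  proof -
    have "g \<cdot> t X (T Y Z) p (q + r) \<cdot> (Id A (deg X p) \<boxtimes> t Y Z q r) = (g \<cdot> t X (T Y Z) p (q + r))
      \<cdot> (Id A (deg X p) \<boxtimes> t Y Z q r)"
      by (simp add: n)
    then show ?thesis by (simp add: gt n hh)
  qed
  have g3': "g \<cdot> t X (T Y Z) p (q + r) \<cdot> (Id A (deg X p) \<boxtimes> t Y Z q r) \<cdot> k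
       = t (T X Y) Z (p + q) r \<cdot> (t X Y p q \<boxtimes> Id A (deg Z r)) \<cdot> ai p q r \<cdot> k"
    if n: "n = p + (q + r)" and [simp]: "k \<in> Ar A" "Cod A k = deg X p \<otimes> (deg Y q \<otimes> deg Z r)" for p q r k
  proof -
    have "g \<cdot> t X (T Y Z) p (q + r) \<cdot> (Id A (deg X p) \<boxtimes> t Y Z q r) \<cdot> k = (g \<cdot> t X (T Y Z) p (q + r)
      \<cdot> (Id A (deg X p) \<boxtimes> t Y Z q r)) \<cdot> k"
      by (simp add: n)
    also have "\<dots> = (t (T X Y) Z (p + q) r \<cdot> (t X Y p q \<boxtimes> Id A (deg Z r)) \<cdot> ai p q r) \<cdot> k"
      by (subst g3[OF n]) simp
    finally show ?thesis by (simp add: n add.assoc)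
  qed
  have "g \<cdot> at (ch_assoc A X Y Z) n = Id A (deg (T (T X Y) Z) n)"
    by (rule ch_tens_ext3[of X Y Z _ _ n]) (auto simp: ch_assoc_inj g3' add.assoc)
  moreover have "at (ch_assoc A X Y Z) n \<cdot> g = Id A (deg (T X (T Y Z)) n)"
    by (rule ch_tens_ext3_right[of X Y Z _ _ n]) (auto simp: ch_assoc_inj_tail g3 add.assoc)
  ultimately show ?thesis by (intro exI[of _ g]) (auto simp: hom_iff)
qed

lemma diff_tens_wh:
  "(diff (T X Y) (p + q) \<boxtimes> Id A (deg Z r)) \<cdot> (t X Y p q \<boxtimes> Id A (deg Z r))
    = ((t X Y (p - 1) q \<boxtimes> Id A (deg Z r)) \<cdot> ((diff X p \<boxtimes> Id A (deg Y q)) \<boxtimes> Id A (deg Z r)))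
      \<oplus> signed A p ((t X Y p (q - 1) \<boxtimes> Id A (deg Z r)) \<cdot> ((Id A (deg X p) \<boxtimes> diff Y q) \<boxtimes> Id A (deg Z r)))"
  by (simp add: tens_Comp_tens diff_tens_inj hadd_tens signed_tens)

lemma wh_diff_tens:
  "(Id A (deg X p) \<boxtimes> diff (T Y Z) (q + r)) \<cdot> (Id A (deg X p) \<boxtimes> t Y Z q r)
    = ((Id A (deg X p) \<boxtimes> t Y Z (q - 1) r) \<cdot> (Id A (deg X p) \<boxtimes> (diff Y q \<boxtimes> Id A (deg Z r))))
      \<oplus> signed A q ((Id A (deg X p) \<boxtimes> t Y Z q (r - 1)) \<cdot> (Id A (deg X p) \<boxtimes> (Id A (deg Y q) \<boxtimes> diff Z r)))"
  by (simp add: tens_Comp_tens diff_tens_inj tens_hadd tens_signed)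

lemma is_chmap_assoc [simp]: "is_chmap A (ch_assoc A X Y Z)"
proof (rule is_chmapI)
  fix n
  show "diff (tgt (ch_assoc A X Y Z)) n \<cdot> at (ch_assoc A X Y Z) n = at (ch_assoc A X Y Z) (n - 1)
    \<cdot> diff (src (ch_assoc A X Y Z)) n"
  proof (rule ch_tens_ext3[of X Y Z _ _ n])
    fix p q r assume n: "n = p + q + r"
    let ?X = "deg X p" and ?Y = "deg Y q" and ?Z = "deg Z r"
    \<comment> \<open>The contributions of the differentials of X, Y and Z. In both bracketings they
      carry the signs of the exponents 0, \<open>p\<close> and \<open>p + q\<close>.\<close>
    let ?x = "t X (T Y Z) (p - 1) (q + r) \<cdot> (Id A (deg X (p - 1)) \<boxtimes> t Y Z q r) \<cdot> (diff X p \<boxtimes> (Id A ?Y \<boxtimes> Id A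
      ?Z)) \<cdot> assoc A ?X ?Y ?Z"
    let ?y = "t X (T Y Z) p (q + r - 1) \<cdot> (Id A ?X \<boxtimes> t Y Z (q - 1) r) \<cdot> (Id A ?X \<boxtimes> (diff Y q \<boxtimes> Id A ?Z))
      \<cdot> assoc A ?X ?Y ?Z"
    let ?z = "t X (T Y Z) p (q + r - 1) \<cdot> (Id A ?X \<boxtimes> t Y Z q (r - 1)) \<cdot> (Id A ?X \<boxtimes> (Id A ?Y \<boxtimes> diff Z r))
      \<cdot> assoc A ?X ?Y ?Z"
    have sum: "p + (q + r) = p + q + r" "p + (q + r - 1) = p + q + r - 1" by auto
    have 1: "(diff X p \<boxtimes> Id A (deg (T Y Z) (q + r))) \<cdot> (Id A ?X \<boxtimes> t Y Z q r)
      = (Id A (deg X (p - 1)) \<boxtimes> t Y Z q r) \<cdot> (diff X p \<boxtimes> (Id A ?Y \<boxtimes> Id A ?Z))"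
      by (simp add: tens_Comp_tens)
    have "(diff (T X (T Y Z)) n \<cdot> at (ch_assoc A X Y Z) n) \<cdot> t (T X Y) Z (p + q) r \<cdot> (t X Y p q \<boxtimes> Id A ?Z)
      = diff (T X (T Y Z)) n \<cdot> t X (T Y Z) p (q + r) \<cdot> (Id A ?X \<boxtimes> t Y Z q r) \<cdot> assoc A ?X ?Y ?Z"
      by (simp add: ch_assoc_inj n)
    also have "\<dots> = (t X (T Y Z) (p - 1) (q + r) \<cdot> (diff X p \<boxtimes> Id A (deg (T Y Z) (q + r)))
      \<cdot> (Id A ?X \<boxtimes> t Y Z q r) \<cdot> assoc A ?X ?Y ?Z)
      \<oplus> signed A p (t X (T Y Z) p (q + r - 1) \<cdot> (Id A ?X \<boxtimes> diff (T Y Z) (q + r)) \<cdot> (Id A ?X \<boxtimes> t Y Z q r)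
        \<cdot> assoc A ?X ?Y ?Z)"
      by (subst diff_tens_inj_tail) (auto simp: n)
    also have "\<dots> = ?x \<oplus> (signed A p ?y \<oplus> signed A (p + q) ?z)"
      by (simp add: pre[OF 1] pre1[OF wh_diff_tens] hadd_Comp Comp_hadd signed_Comp Comp_signed signed_hadd
        signed_signed sum
          del: tens_Id)
    finally have L: "(diff (T X (T Y Z)) n \<cdot> at (ch_assoc A X Y Z) n) \<cdot> t (T X Y) Z (p + q) r \<cdot> (t X Y p q \<boxtimes> Id A ?Z)
      = ?x \<oplus> (signed A p ?y \<oplus> signed A (p + q) ?z)" .
    have 2: "(Id A (deg (T X Y) (p + q)) \<boxtimes> diff Z r) \<cdot> (t X Y p q \<boxtimes> Id A ?Z)
      = (t X Y p q \<boxtimes> Id A (deg Z (r - 1))) \<cdot> ((Id A ?X \<boxtimes> Id A ?Y) \<boxtimes> diff Z r)"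
      by (simp add: tens_Comp_tens)
    have "(at (ch_assoc A X Y Z) (n - 1) \<cdot> diff (T (T X Y) Z) n) \<cdot> t (T X Y) Z (p + q) r \<cdot> (t X Y p q \<boxtimes> Id A ?Z)
      = at (ch_assoc A X Y Z) (n - 1) \<cdot> (t (T X Y) Z (p + q - 1) r \<cdot> (diff (T X Y) (p + q) \<boxtimes> Id A ?Z)
        \<cdot> (t X Y p q \<boxtimes> Id A ?Z)
       \<oplus> signed A (p + q) (t (T X Y) Z (p + q) (r - 1) \<cdot> (Id A (deg (T X Y) (p + q)) \<boxtimes> diff Z r)
         \<cdot> (t X Y p q \<boxtimes> Id A ?Z)))"
      by (simp add: diff_tens_inj_tail n)
    also have "\<dots> = (t X (T Y Z) (p - 1) (q + r) \<cdot> (Id A (deg X (p - 1)) \<boxtimes> t Y Z q r)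
      \<cdot> assoc A (deg X (p - 1)) ?Y ?Z \<cdot> ((diff X p \<boxtimes> Id A ?Y) \<boxtimes> Id A ?Z)
      \<oplus> signed A p (t X (T Y Z) p (q + r - 1) \<cdot> (Id A ?X \<boxtimes> t Y Z (q - 1) r) \<cdot> assoc A ?X (deg Y (q - 1)) ?Z
        \<cdot> ((Id A ?X \<boxtimes> diff Y q) \<boxtimes> Id A ?Z)))
      \<oplus> signed A (p + q) (t X (T Y Z) p (q + r - 1) \<cdot> (Id A ?X \<boxtimes> t Y Z q (r - 1)) \<cdot> assoc A ?X ?Y (deg Z (r
        - 1)) \<cdot> ((Id A ?X \<boxtimes> Id A ?Y) \<boxtimes> diff Z r))"
      by (simp add: diff_tens_wh 2 Comp_hadd Comp_signed ch_assoc_inj_tail n sum del: tens_Id)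
    also have "\<dots> = (?x \<oplus> signed A p ?y) \<oplus> signed A (p + q) ?z"
      by (simp add: assoc_natural sum del: tens_Id)
    finally show "(diff (tgt (ch_assoc A X Y Z)) n \<cdot> at (ch_assoc A X Y Z) n) \<cdot> t (T X Y) Z (p + q) r
      \<cdot> (t X Y p q \<boxtimes> Id A ?Z)
      = (at (ch_assoc A X Y Z) (n - 1) \<cdot> diff (src (ch_assoc A X Y Z)) n) \<cdot> t (T X Y) Z (p + q) r
        \<cdot> (t X Y p q \<boxtimes> Id A ?Z)"
      using L by (simp add: hadd_associative sum)
  qed auto
qed auto

end

section \<open>The category of complexes and its unit\<close>

lemma Ch_simps [simp]:
  "Ob (Ch A) = {X. is_chain A X}" "Ar (Ch A) = {f. is_chmap A f}" "Dom (Ch A) = src" "Cod (Ch A) = tgt"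
  "unit (Ch A) = ch_unit A" "tensO (Ch A) = ch_tens A" "tensA (Ch A) = ch_tens_map A"
  "assoc (Ch A) = ch_assoc A" "lunit (Ch A) = ch_lunit A" "runit (Ch A) = ch_runit A" "braid (Ch A) = ch_braid A"
  by (simp_all add: Ch_def)

lemma Ch_Id [simp]: "src (Id (Ch A) X) = X" "tgt (Id (Ch A) X) = X" "at (Id (Ch A) X) n = Id A (deg X n)"
  by (simp_all add: Ch_def)

lemma Ch_Comp [simp]: "src (g \<cdot>\<^bsub>Ch A\<^esub> f) = src f" "tgt (g \<cdot>\<^bsub>Ch A\<^esub> f) = tgt g" "at (g \<cdot>\<^bsub>Ch A\<^esub> f) n = at g n \<cdot> at f n"
  by (simp_all add: Ch_def)

lemma is_chmap_Id [simp]: "is_chain A X \<Longrightarrow> is_chmap A (Id (Ch A) X)"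
  by (rule is_chmapI) auto

lemma is_chmap_Comp [simp]:
  assumes [simp]: "is_chmap A f" "is_chmap A g" "src g = tgt f"
  shows "is_chmap A (g \<cdot>\<^bsub>Ch A\<^esub> f)"
proof (rule is_chmapI)
  fix n
  show "diff (tgt (g \<cdot>\<^bsub>Ch A\<^esub> f)) n \<cdot> at (g \<cdot>\<^bsub>Ch A\<^esub> f) n = at (g \<cdot>\<^bsub>Ch A\<^esub> f) (n - 1) \<cdot> diff (src (g \<cdot>\<^bsub>Ch A\<^esub> f)) n"
    by (simp add: chmap_diff chmap_diff_tail)
qed auto

lemma Ch_iso:
  assumes [simp]: "is_chmap A f"
    and ex: "\<And>n. \<exists>g \<in> hom A (deg (tgt f) n) (deg (src f) n). g \<cdot> at f n = Id A (deg (src f) n) \<and> at f n \<cdot> g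
      = Id A (deg (tgt f) n)"
  shows "iso (Ch A) f"
proof -
  obtain g where g: "\<And>n. g n \<in> hom A (deg (tgt f) n) (deg (src f) n)" "\<And>n. g n \<cdot> at f n = Id A (deg (src f) n)"
    "\<And>n. at f n \<cdot> g n = Id A (deg (tgt f) n)"
    using ex by metis
  have [simp]: "g n \<in> Ar A" "Dom A (g n) = deg (tgt f) n" "Cod A (g n) = deg (src f) n" for n
    using g(1) by (auto simp: hom_iff)
  note [simp] = g(2,3)
  let ?g = "\<lparr>src = tgt f, tgt = src f, at = g\<rparr>"
  have "is_chmap A ?g"
  proof (rule is_chmapI)
    fix n
    have "diff (src f) n \<cdot> g n = (g (n - 1) \<cdot> at f (n - 1)) \<cdot> diff (src f) n \<cdot> g n" by simp
    also have "\<dots> = g (n - 1) \<cdot> (at f (n - 1) \<cdot> diff (src f) n) \<cdot> g n" by (simp del: g(2))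
    also have "\<dots> = g (n - 1) \<cdot> diff (tgt f) n \<cdot> at f n \<cdot> g n" by (subst chmap_diff[symmetric]) auto
    finally show "diff (tgt ?g) n \<cdot> at ?g n = at ?g (n - 1) \<cdot> diff (src ?g) n" by simp
  qed auto
  moreover have "?g \<cdot>\<^bsub>Ch A\<^esub> f = Id (Ch A) (src f)" "f \<cdot>\<^bsub>Ch A\<^esub> ?g = Id (Ch A) (tgt f)"
    by (rule chmap_eqI; simp)+
  ultimately show ?thesis
    unfolding iso_def inverse_of_def by (intro exI[of _ ?g]) (simp add: hom_def)
qed

lemma from_zero_tens:
  assumes "f \<in> Ar A" "g \<in> Ar A" "Dom A f = zero_ob A \<otimes> Y" "Dom A g = zero_ob A \<otimes> Y" "Cod A f = Cod A g" "Y \<in> Ob A"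
  shows "f = g"
proof -
  have 1: "Id A (zero_ob A \<otimes> Y) = hzero A (zero_ob A \<otimes> Y) (zero_ob A \<otimes> Y)"
    using assms by (simp add: tens_Id[symmetric] Id_zero_ob del: tens_Id)
  have "f = f \<cdot> Id A (zero_ob A \<otimes> Y)" "g = g \<cdot> Id A (zero_ob A \<otimes> Y)" using assms by simp_all
  then show ?thesis unfolding 1 using assms by simp
qed

lemma from_tens_zero:
  assumes "f \<in> Ar A" "g \<in> Ar A" "Dom A f = Y \<otimes> zero_ob A" "Dom A g = Y \<otimes> zero_ob A" "Cod A f = Cod A g" "Y \<in> Ob A"
  shows "f = g"
proof -
  have 1: "Id A (Y \<otimes> zero_ob A) = hzero A (Y \<otimes> zero_ob A) (Y \<otimes> zero_ob A)"
    using assms by (simp add: tens_Id[symmetric] Id_zero_ob del: tens_Id)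
  have "f = f \<cdot> Id A (Y \<otimes> zero_ob A)" "g = g \<cdot> Id A (Y \<otimes> zero_ob A)" using assms by simp_all
  then show ?thesis unfolding 1 using assms by simp
qed

lemma unit_deg [simp]: "deg (ch_unit A) 0 = unit A" "n \<noteq> 0 \<Longrightarrow> deg (ch_unit A) n = zero_ob A"
  "deg (ch_unit A) n \<in> Ob A"
  by (auto simp: ch_unit_def Let_def)

lemma unit_diff: "diff (ch_unit A) n = hzero A (deg (ch_unit A) n) (deg (ch_unit A) (n - 1))"
  by (auto simp: ch_unit_def Let_def)

lemma is_chain_unit [simp]: "is_chain A (ch_unit A)"
  by (auto simp: is_chain_def unit_diff hom_iff)

context
  fixes X assumes X [simp]: "is_chain A X"
begin

lemma lunit_simps [simp]: "src (ch_lunit A X) = T (ch_unit A) X" "tgt (ch_lunit A X) = X"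
  "src (ch_runit A X) = T X (ch_unit A)" "tgt (ch_runit A X) = X"
  by (auto simp: ch_lunit_def ch_runit_def)

lemma ch_lunit_typing [simp]:
  "at (ch_lunit A X) n \<in> Ar A" "Dom A (at (ch_lunit A X) n) = deg (T (ch_unit A) X) n"
    "Cod A (at (ch_lunit A X) n) = deg X n"
  and ch_lunit_inj: "at (ch_lunit A X) n \<cdot> t (ch_unit A) X 0 n = lunit A (deg X n)"
proof -
  have *: "at (ch_lunit A X) n = copair A (tens_summand A (ch_unit A) X n) (deg X n)
       (\<lambda>p. if p = 0 then lunit A (deg X n) else hzero A (tens_summand A (ch_unit A) X n p) (deg X n))" for n
    by (simp add: ch_lunit_def)
  show "at (ch_lunit A X) n \<in> Ar A" "Dom A (at (ch_lunit A X) n) = deg (T (ch_unit A) X) n"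
    "Cod A (at (ch_lunit A X) n) = deg X n" for n
    unfolding * by (rule copair_tens; simp add: tens_summand_def)+
  show "at (ch_lunit A X) n \<cdot> t (ch_unit A) X 0 n = lunit A (deg X n)"
    unfolding * by (subst copair_tens) (auto simp: tens_summand_def)
qed

lemma ch_runit_typing [simp]:
  "at (ch_runit A X) n \<in> Ar A" "Dom A (at (ch_runit A X) n) = deg (T X (ch_unit A)) n"
    "Cod A (at (ch_runit A X) n) = deg X n"
  and ch_runit_inj: "at (ch_runit A X) n \<cdot> t X (ch_unit A) n 0 = runit A (deg X n)"
proof -
  have *: "at (ch_runit A X) n = copair A (tens_summand A X (ch_unit A) n) (deg X n)
       (\<lambda>p. if p = n then runit A (deg X n) else hzero A (tens_summand A X (ch_unit A) n p) (deg X n))" for n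
    by (simp add: ch_runit_def)
  show "at (ch_runit A X) n \<in> Ar A" "Dom A (at (ch_runit A X) n) = deg (T X (ch_unit A)) n"
    "Cod A (at (ch_runit A X) n) = deg X n" for n
    unfolding * by (rule copair_tens; simp add: tens_summand_def)+
  show "at (ch_runit A X) n \<cdot> t X (ch_unit A) n 0 = runit A (deg X n)"
    unfolding * by (subst copair_tens) (auto simp: tens_summand_def)
qed

lemma ch_lunit_inj_tail:
  "h \<in> Ar A \<Longrightarrow> Cod A h = unit A \<otimes> deg X n \<Longrightarrow> at (ch_lunit A X) n \<cdot> t (ch_unit A) X 0 n \<cdot> h = lunit A (deg X n) \<cdot> h"
  by (rule pre1[OF ch_lunit_inj]) auto

lemma ch_runit_inj_tail:
  "h \<in> Ar A \<Longrightarrow> Cod A h = deg X n \<otimes> unit A \<Longrightarrow> at (ch_runit A X) n \<cdot> t X (ch_unit A) n 0 \<cdot> h = runit A (deg X n) \<cdot> h"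
  by (rule pre1[OF ch_runit_inj]) auto

text \<open>The unit complex lives in degree 0, so every other component starts from a tensor
  product with a zero object.\<close>

lemma ch_unit_tens_ext:
  assumes f: "f \<in> Ar A" "g \<in> Ar A" "Dom A f = deg (T (ch_unit A) X) n" "Dom A g = deg (T (ch_unit A) X) n"
    "Cod A g = Cod A f"
    and eq: "f \<cdot> t (ch_unit A) X 0 n = g \<cdot> t (ch_unit A) X 0 n"
  shows "f = g"
proof (rule ch_tens_ext[of "ch_unit A" X _ _ n])
  fix p q assume n: "n = p + q"
  show "f \<cdot> t (ch_unit A) X p q = g \<cdot> t (ch_unit A) X p q"
  proof (cases "p = 0")
    case False
    then show ?thesis using f n by (intro from_zero_tens) auto
  qed (use eq n in simp)
qed (use f in auto)

lemma ch_tens_unit_ext: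
  assumes f: "f \<in> Ar A" "g \<in> Ar A" "Dom A f = deg (T X (ch_unit A)) n" "Dom A g = deg (T X (ch_unit A)) n"
    "Cod A g = Cod A f"
    and eq: "f \<cdot> t X (ch_unit A) n 0 = g \<cdot> t X (ch_unit A) n 0"
  shows "f = g"
proof (rule ch_tens_ext[of X "ch_unit A" _ _ n])
  fix p q assume n: "n = p + q"
  show "f \<cdot> t X (ch_unit A) p q = g \<cdot> t X (ch_unit A) p q"
  proof (cases "q = 0")
    case False
    then show ?thesis using f n by (intro from_tens_zero) auto
  qed (use eq n in simp)
qed (use f in auto)

lemma is_chmap_lunit [simp]: "is_chmap A (ch_lunit A X)"
proof (rule is_chmapI)
  fix n
  show "diff (tgt (ch_lunit A X)) n \<cdot> at (ch_lunit A X) n = at (ch_lunit A X) (n - 1) \<cdot> diff (src (ch_lunit A X)) n"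
    by (rule ch_unit_tens_ext[of _ _ n])
      (auto simp: ch_lunit_inj ch_lunit_inj_tail diff_tens_inj unit_diff Comp_hadd lunit_natural)
qed auto

lemma is_chmap_runit [simp]: "is_chmap A (ch_runit A X)"
proof (rule is_chmapI)
  fix n
  show "diff (tgt (ch_runit A X)) n \<cdot> at (ch_runit A X) n = at (ch_runit A X) (n - 1) \<cdot> diff (src (ch_runit A X)) n"
    by (rule ch_tens_unit_ext[of _ _ n])
      (auto simp: ch_runit_inj ch_runit_inj_tail diff_tens_inj unit_diff Comp_hadd Comp_signed runit_natural)
qed auto

lemma iso_ch_lunit: "iso (Ch A) (ch_lunit A X)"
proof (rule Ch_iso)
  fix n
  obtain g where g [simp]: "g \<in> Ar A" "Dom A g = deg X n" "Cod A g = unit A \<otimes> deg X n"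
    "g \<cdot> lunit A (deg X n) = Id A (unit A \<otimes> deg X n)" "lunit A (deg X n) \<cdot> g = Id A (deg X n)"
    using lunit_iso[of "deg X n"] by (auto elim!: inverse_exists)
  have "(t (ch_unit A) X 0 n \<cdot> g) \<cdot> at (ch_lunit A X) n = Id A (deg (T (ch_unit A) X) n)"
    by (rule ch_unit_tens_ext[of _ _ n]) (auto simp: ch_lunit_inj)
  then show "\<exists>g \<in> hom A (deg (tgt (ch_lunit A X)) n) (deg (src (ch_lunit A X)) n).
    g \<cdot> at (ch_lunit A X) n = Id A (deg (src (ch_lunit A X)) n) \<and> at (ch_lunit A X) n \<cdot> g
      = Id A (deg (tgt (ch_lunit A X)) n)"
    by (intro bexI[of _ "t (ch_unit A) X 0 n \<cdot> g"]) (auto simp: ch_lunit_inj_tail hom_iff)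
qed simp

lemma iso_ch_runit: "iso (Ch A) (ch_runit A X)"
proof (rule Ch_iso)
  fix n
  obtain g where g [simp]: "g \<in> Ar A" "Dom A g = deg X n" "Cod A g = deg X n \<otimes> unit A"
    "g \<cdot> runit A (deg X n) = Id A (deg X n \<otimes> unit A)" "runit A (deg X n) \<cdot> g = Id A (deg X n)"
    using runit_iso[of "deg X n"] by (auto elim!: inverse_exists)
  have "(t X (ch_unit A) n 0 \<cdot> g) \<cdot> at (ch_runit A X) n = Id A (deg (T X (ch_unit A)) n)"
    by (rule ch_tens_unit_ext[of _ _ n]) (auto simp: ch_runit_inj)
  then show "\<exists>g \<in> hom A (deg (tgt (ch_runit A X)) n) (deg (src (ch_runit A X)) n).
    g \<cdot> at (ch_runit A X) n = Id A (deg (src (ch_runit A X)) n) \<and> at (ch_runit A X) n \<cdot> g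
      = Id A (deg (tgt (ch_runit A X)) n)"
    by (intro bexI[of _ "t X (ch_unit A) n 0 \<cdot> g"]) (auto simp: ch_runit_inj_tail hom_iff)
qed simp

end

lemma iso_ch_assoc: "is_chain A X \<Longrightarrow> is_chain A Y \<Longrightarrow> is_chain A Z \<Longrightarrow> iso (Ch A) (ch_assoc A X Y Z)"
  using ch_assoc_iso_at[of X Y Z] by (intro Ch_iso) auto

section \<open>The braiding of complexes\<close>

context
  fixes X Y assumes XY [simp]: "is_chain A X" "is_chain A Y"
begin

lemma ch_braid_simps [simp]: "src (ch_braid A X Y) = T X Y" "tgt (ch_braid A X Y) = T Y X"
  by (auto simp: ch_braid_def)

lemma ch_braid_typing [simp]:
  "at (ch_braid A X Y) n \<in> Ar A" "Dom A (at (ch_braid A X Y) n) = deg (T X Y) n"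
    "Cod A (at (ch_braid A X Y) n) = deg (T Y X) n"
  and ch_braid_inj: "n = p + q \<Longrightarrow> at (ch_braid A X Y) n \<cdot> t X Y p q = signed A (p * q) (t Y X q p
    \<cdot> braid A (deg X p) (deg Y q))"
proof -
  have *: "at (ch_braid A X Y) n = copair A (tens_summand A X Y n) (deg (T Y X) n)
       (\<lambda>p. signed A (p * (n - p)) (t Y X (n - p) p \<cdot> braid A (deg X p) (deg Y (n - p))))" for n
    by (simp add: ch_braid_def)
  show "at (ch_braid A X Y) n \<in> Ar A" "Dom A (at (ch_braid A X Y) n) = deg (T X Y) n"
    "Cod A (at (ch_braid A X Y) n) = deg (T Y X) n" for n
    unfolding * by (rule copair_tens; simp)+
  show "n = p + q \<Longrightarrow> at (ch_braid A X Y) n \<cdot> t X Y p q = signed A (p * q) (t Y X q p \<cdot> braid A (deg X p) (deg Y q))"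
    unfolding * by (subst copair_tens) auto
qed

lemma ch_braid_inj_tail:
  assumes "n = p + q" "h \<in> Ar A" "Cod A h = deg X p \<otimes> deg Y q"
  shows "at (ch_braid A X Y) n \<cdot> t X Y p q \<cdot> h = signed A (p * q) (t Y X q p \<cdot> braid A (deg X p) (deg Y q) \<cdot> h)"
proof -
  have "at (ch_braid A X Y) n \<cdot> t X Y p q \<cdot> h = (at (ch_braid A X Y) n \<cdot> t X Y p q) \<cdot> h" using assms by simp
  then show ?thesis using assms by (simp add: ch_braid_inj signed_Comp)
qed

lemma is_chmap_braid [simp]: "is_chmap A (ch_braid A X Y)"
proof (rule is_chmapI)
  fix n
  show "diff (tgt (ch_braid A X Y)) n \<cdot> at (ch_braid A X Y) n = at (ch_braid A X Y) (n - 1)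
    \<cdot> diff (src (ch_braid A X Y)) n"
  proof (rule ch_tens_ext[of X Y _ _ n])
    fix p q assume n: "n = p + q"
    have comm: "q + p = p + q" "q + p - 1 = p + q - 1" by auto
    let ?x = "t Y X (q - 1) p \<cdot> (diff Y q \<boxtimes> Id A (deg X p)) \<cdot> braid A (deg X p) (deg Y q)"
    let ?y = "t Y X q (p - 1) \<cdot> (Id A (deg Y q) \<boxtimes> diff X p) \<cdot> braid A (deg X p) (deg Y q)"
    have "(diff (T Y X) n \<cdot> at (ch_braid A X Y) n) \<cdot> t X Y p q = signed A (p * q) ?x \<oplus> signed A (p * q + q) ?y"
      by (simp add: n ch_braid_inj Comp_signed comm diff_tens_inj_tail signed_hadd signed_signed)
    moreover have "(at (ch_braid A X Y) (n - 1) \<cdot> diff (T X Y) n) \<cdot> t X Y p q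
      = signed A ((p - 1) * q) ?y \<oplus> signed A (p + p * (q - 1)) ?x"
      by (simp add: n diff_tens_inj Comp_hadd Comp_signed ch_braid_inj_tail braid_natural comm signed_signed)
    \<comment> \<open>Only parities matter: \<open>(p - 1) * q\<close> agrees with
      \<open>p * q + q\<close>, and \<open>p + p * (q - 1)\<close> is \<open>p * q\<close>.\<close>
    moreover have "signed A ((p - 1) * q) ?y = signed A (p * q + q) ?y" "signed A (p + p * (q - 1)) ?x
      = signed A (p * q) ?x"
      by (rule signed_cong; simp add: algebra_simps)+
    ultimately show "(diff (tgt (ch_braid A X Y)) n \<cdot> at (ch_braid A X Y) n) \<cdot> t X Y p q
      = (at (ch_braid A X Y) (n - 1) \<cdot> diff (src (ch_braid A X Y)) n) \<cdot> t X Y p q"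
      by (simp add: n comm hadd_commute[of "signed A (p * q) ?x"])
  qed auto
qed auto

end

section \<open>The symmetric monoidal axioms for complexes\<close>

lemma ch_tens_ext4:
  assumes [simp]: "is_chain A W" "is_chain A X" "is_chain A Y" "is_chain A Z"
    and [simp]: "f \<in> Ar A" "g \<in> Ar A" "Dom A f = deg (T (T (T W X) Y) Z) n"
      "Dom A g = deg (T (T (T W X) Y) Z) n" "Cod A g = Cod A f"
    and eq: "\<And>w x y z. n = w + x + y + z \<Longrightarrow>
        f \<cdot> t (T (T W X) Y) Z (w + x + y) z \<cdot> (t (T W X) Y (w + x) y \<boxtimes> Id A (deg Z z))
          \<cdot> ((t W X w x \<boxtimes> Id A (deg Y y)) \<boxtimes> Id A (deg Z z))
      = g \<cdot> t (T (T W X) Y) Z (w + x + y) z \<cdot> (t (T W X) Y (w + x) y \<boxtimes> Id A (deg Z z))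
        \<cdot> ((t W X w x \<boxtimes> Id A (deg Y y)) \<boxtimes> Id A (deg Z z))"
  shows "f = g"
proof (rule ch_tens_ext[of "T (T W X) Y" Z _ _ n])
  fix m z assume n [simp]: "n = m + z"
  show "f \<cdot> t (T (T W X) Y) Z m z = g \<cdot> t (T (T W X) Y) Z m z"
  proof (rule tens_ext[where \<iota> = "\<lambda>(w, x, y). t (T W X) Y (w + x) y \<cdot> (t W X w x \<boxtimes> Id A (deg Y y))" and I
    = "{(w, x, y). m = w + x + y}"
        and S = "deg (T (T W X) Y) m" and Z = "deg Z z"])
    fix U k l
    assume "k \<in> hom A (deg (T (T W X) Y) m) U" "l \<in> hom A (deg (T (T W X) Y) m) U"
      "\<And>i. i \<in> {(w, x, y). m = w + x + y} \<Longrightarrow> k \<cdot> (case i of (w, x, y) \<Rightarrow> t (T W X) Y (w + x) y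
        \<cdot> (t W X w x \<boxtimes> Id A (deg Y y)))
        = l \<cdot> (case i of (w, x, y) \<Rightarrow> t (T W X) Y (w + x) y \<cdot> (t W X w x \<boxtimes> Id A (deg Y y)))"
    then show "k = l"
      by (intro ch_tens_ext3[of W X Y k l m]) (auto simp: hom_iff)
  next
    fix i assume "i \<in> {(w, x, y). m = w + x + y}"
    then obtain w x y where i: "i = (w, x, y)" "m = w + x + y" by auto
    show "(f \<cdot> t (T (T W X) Y) Z m z) \<cdot> ((case i of (w, x, y) \<Rightarrow> t (T W X) Y (w + x) y
      \<cdot> (t W X w x \<boxtimes> Id A (deg Y y))) \<boxtimes> Id A (deg Z z))
      = (g \<cdot> t (T (T W X) Y) Z m z) \<cdot> ((case i of (w, x, y) \<Rightarrow> t (T W X) Y (w + x) y \<cdot> (t W X w x \<boxtimes> Id A (deg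
        Y y))) \<boxtimes> Id A (deg Z z))"
      using eq[of w x y z] by (simp add: i Comp_tens_Id)
  qed auto
qed auto

lemma tens_map_wh:
  assumes [simp]: "is_chmap A f" "is_chmap A g" "m = p + q" "X = src f" "Y = src g" "h \<in> Ar A" "Dom A h = Z"
  shows "(at (ch_tens_map A f g) m \<boxtimes> h) \<cdot> (t X Y p q \<boxtimes> Id A Z) = (t (tgt f) (tgt g) p q \<boxtimes> Id A (Cod A h))
    \<cdot> ((at f p \<boxtimes> at g q) \<boxtimes> h)"
proof -
  have "Z \<in> Ob A" using Dom_Ob[of h] by simp
  then show ?thesis by (simp add: tens_Comp_tens tens_map_inj)
qed

lemma wh_tens_map:
  assumes [simp]: "is_chmap A f" "is_chmap A g" "m = p + q" "X = src f" "Y = src g" "h \<in> Ar A" "Dom A h = Z"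
  shows "(h \<boxtimes> at (ch_tens_map A f g) m) \<cdot> (Id A Z \<boxtimes> t X Y p q) = (Id A (Cod A h) \<boxtimes> t (tgt f) (tgt g) p q)
    \<cdot> (h \<boxtimes> (at f p \<boxtimes> at g q))"
proof -
  have "Z \<in> Ob A" using Dom_Ob[of h] by simp
  then show ?thesis by (simp add: tens_Comp_tens tens_map_inj)
qed

lemma ch_tens_Id:
  assumes [simp]: "is_chain A X" "is_chain A Y"
  shows "ch_tens_map A (Id (Ch A) X) (Id (Ch A) Y) = Id (Ch A) (T X Y)"
proof (rule chmap_eqI)
  fix n
  show "at (ch_tens_map A (Id (Ch A) X) (Id (Ch A) Y)) n = at (Id (Ch A) (T X Y)) n"
    by (rule ch_tens_ext[of X Y _ _ n]) (auto simp: tens_map_inj)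
qed auto

lemma ch_tens_Comp:
  assumes [simp]: "is_chmap A f" "is_chmap A f'" "src f' = tgt f" "is_chmap A g" "is_chmap A g'" "src g' = tgt g"
  shows "ch_tens_map A (f' \<cdot>\<^bsub>Ch A\<^esub> f) (g' \<cdot>\<^bsub>Ch A\<^esub> g) = ch_tens_map A f' g' \<cdot>\<^bsub>Ch A\<^esub> ch_tens_map A f g"
proof (rule chmap_eqI)
  fix n
  show "at (ch_tens_map A (f' \<cdot>\<^bsub>Ch A\<^esub> f) (g' \<cdot>\<^bsub>Ch A\<^esub> g)) n = at (ch_tens_map A f' g' \<cdot>\<^bsub>Ch A\<^esub> ch_tens_map A f g) n"
    by (rule ch_tens_ext[of "src f" "src g" _ _ n]) (auto simp: tens_map_inj tens_map_inj_tail tens_Comp_tens)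
qed auto

lemma ch_assoc_natural:
  assumes [simp]: "is_chmap A f" "is_chmap A g" "is_chmap A h"
  shows "ch_assoc A (tgt f) (tgt g) (tgt h) \<cdot>\<^bsub>Ch A\<^esub> ch_tens_map A (ch_tens_map A f g) h
    = ch_tens_map A f (ch_tens_map A g h) \<cdot>\<^bsub>Ch A\<^esub> ch_assoc A (src f) (src g) (src h)"
proof (rule chmap_eqI)
  fix n
  show "at (ch_assoc A (tgt f) (tgt g) (tgt h) \<cdot>\<^bsub>Ch A\<^esub> ch_tens_map A (ch_tens_map A f g) h) n
    = at (ch_tens_map A f (ch_tens_map A g h) \<cdot>\<^bsub>Ch A\<^esub> ch_assoc A (src f) (src g) (src h)) n"
    by (rule ch_tens_ext3[of "src f" "src g" "src h" _ _ n])
      (auto simp: tens_map_inj_tail tens_map_wh wh_tens_map pre[OF wh_tens_map] ch_assoc_inj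
        ch_assoc_inj_tail assoc_natural add.assoc)
qed auto

lemma ch_lunit_natural:
  assumes [simp]: "is_chmap A f"
  shows "ch_lunit A (tgt f) \<cdot>\<^bsub>Ch A\<^esub> ch_tens_map A (Id (Ch A) (ch_unit A)) f = f \<cdot>\<^bsub>Ch A\<^esub> ch_lunit A (src f)"
proof (rule chmap_eqI)
  fix n
  show "at (ch_lunit A (tgt f) \<cdot>\<^bsub>Ch A\<^esub> ch_tens_map A (Id (Ch A) (ch_unit A)) f) n
    = at (f \<cdot>\<^bsub>Ch A\<^esub> ch_lunit A (src f)) n"
    by (rule ch_unit_tens_ext[of "src f" _ _ n]) (auto simp: tens_map_inj ch_lunit_inj ch_lunit_inj_tail
      lunit_natural)
qed auto

lemma ch_runit_natural:
  assumes [simp]: "is_chmap A f"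
  shows "ch_runit A (tgt f) \<cdot>\<^bsub>Ch A\<^esub> ch_tens_map A f (Id (Ch A) (ch_unit A)) = f \<cdot>\<^bsub>Ch A\<^esub> ch_runit A (src f)"
proof (rule chmap_eqI)
  fix n
  show "at (ch_runit A (tgt f) \<cdot>\<^bsub>Ch A\<^esub> ch_tens_map A f (Id (Ch A) (ch_unit A))) n
    = at (f \<cdot>\<^bsub>Ch A\<^esub> ch_runit A (src f)) n"
    by (rule ch_tens_unit_ext[of "src f" _ _ n]) (auto simp: tens_map_inj ch_runit_inj ch_runit_inj_tail
      runit_natural)
qed auto

lemma ch_braid_natural:
  assumes [simp]: "is_chmap A f" "is_chmap A g"
  shows "ch_braid A (tgt f) (tgt g) \<cdot>\<^bsub>Ch A\<^esub> ch_tens_map A f g = ch_tens_map A g f \<cdot>\<^bsub>Ch A\<^esub> ch_braid A (src f) (src g)"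
proof (rule chmap_eqI)
  fix n
  show "at (ch_braid A (tgt f) (tgt g) \<cdot>\<^bsub>Ch A\<^esub> ch_tens_map A f g) n
    = at (ch_tens_map A g f \<cdot>\<^bsub>Ch A\<^esub> ch_braid A (src f) (src g)) n"
    by (rule ch_tens_ext[of "src f" "src g" _ _ n])
      (auto simp: tens_map_inj tens_map_inj_tail ch_braid_inj ch_braid_inj_tail braid_natural Comp_signed add.commute)
qed auto

lemma ch_symmetry:
  assumes [simp]: "is_chain A X" "is_chain A Y"
  shows "ch_braid A Y X \<cdot>\<^bsub>Ch A\<^esub> ch_braid A X Y = Id (Ch A) (T X Y)"
proof (rule chmap_eqI)
  fix n
  show "at (ch_braid A Y X \<cdot>\<^bsub>Ch A\<^esub> ch_braid A X Y) n = at (Id (Ch A) (T X Y)) n"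
    by (rule ch_tens_ext[of X Y _ _ n])
      (auto simp: ch_braid_inj ch_braid_inj_tail Comp_signed add.commute signed_signed symmetry mult.commute)
qed auto

lemma ch_triangle:
  assumes [simp]: "is_chain A X" "is_chain A Y"
  shows "ch_tens_map A (Id (Ch A) X) (ch_lunit A Y) \<cdot>\<^bsub>Ch A\<^esub> ch_assoc A X (ch_unit A) Y
    = ch_tens_map A (ch_runit A X) (Id (Ch A) Y)"
proof (rule chmap_eqI)
  fix n
  show "at (ch_tens_map A (Id (Ch A) X) (ch_lunit A Y) \<cdot>\<^bsub>Ch A\<^esub> ch_assoc A X (ch_unit A) Y) n
    = at (ch_tens_map A (ch_runit A X) (Id (Ch A) Y)) n"
  proof (rule ch_tens_ext3[of X "ch_unit A" Y _ _ n])
    fix p q r assume n: "n = p + q + r"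
    show "at (ch_tens_map A (Id (Ch A) X) (ch_lunit A Y) \<cdot>\<^bsub>Ch A\<^esub> ch_assoc A X (ch_unit A) Y) n
       \<cdot> t (T X (ch_unit A)) Y (p + q) r \<cdot> (t X (ch_unit A) p q \<boxtimes> Id A (deg Y r))
     = at (ch_tens_map A (ch_runit A X) (Id (Ch A) Y)) n \<cdot> t (T X (ch_unit A)) Y (p + q) r
       \<cdot> (t X (ch_unit A) p q \<boxtimes> Id A (deg Y r))"
    proof (cases "q = 0")
      case True
      have 1: "(Id A (deg X p) \<boxtimes> at (ch_lunit A Y) r) \<cdot> (Id A (deg X p) \<boxtimes> t (ch_unit A) Y 0 r)
        = Id A (deg X p) \<boxtimes> lunit A (deg Y r)"
        by (simp add: tens_Comp_tens ch_lunit_inj)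
      have 2: "(at (ch_runit A X) p \<boxtimes> Id A (deg Y r)) \<cdot> (t X (ch_unit A) p 0 \<boxtimes> Id A (deg Y r))
        = runit A (deg X p) \<boxtimes> Id A (deg Y r)"
        by (simp add: tens_Comp_tens ch_runit_inj)
      show ?thesis
        using ch_assoc_inj[of X "ch_unit A" Y n p 0 r p] 1 2
        by (simp add: True n tens_map_inj_tail pre1[OF 1] triangle)
    next
      case False
      \<comment> \<open>If q is nonzero, the middle factor is a zero object, hence so is the whole
        source, and both maps vanish.\<close>
      have *: "k = l" if "k \<in> Ar A" "l \<in> Ar A" "Dom A k = (deg X p \<otimes> zero_ob A) \<otimes> deg Y r"
        "Dom A l = (deg X p \<otimes> zero_ob A) \<otimes> deg Y r"
        "Cod A k = Cod A l" for k l
      proof -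
        have 1: "Id A ((deg X p \<otimes> zero_ob A) \<otimes> deg Y r) = hzero A ((deg X p \<otimes> zero_ob A) \<otimes> deg Y r) ((deg X
          p \<otimes> zero_ob A) \<otimes> deg Y r)"
          by (simp add: tens_Id[symmetric] Id_zero_ob del: tens_Id)
        have "k = k \<cdot> Id A ((deg X p \<otimes> zero_ob A) \<otimes> deg Y r)"
          "l = l \<cdot> Id A ((deg X p \<otimes> zero_ob A) \<otimes> deg Y r)" using that by simp_all
        then show ?thesis unfolding 1 using that by simp
      qed
      show ?thesis by (rule *) (use False n in auto)
    qed
  qed auto
qed auto

text \<open>On each component this is the hexagon of A; the Koszul signs agree because
  \<open>p * (q + r) = p * q + p * r\<close>.\<close>

lemma ch_hexagon:
  assumes [simp]: "is_chain A X" "is_chain A Y" "is_chain A Z"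
  shows "ch_assoc A Y Z X \<cdot>\<^bsub>Ch A\<^esub> ch_braid A X (T Y Z) \<cdot>\<^bsub>Ch A\<^esub> ch_assoc A X Y Z
        = ch_tens_map A (Id (Ch A) Y) (ch_braid A X Z) \<cdot>\<^bsub>Ch A\<^esub> ch_assoc A Y X Z
          \<cdot>\<^bsub>Ch A\<^esub> ch_tens_map A (ch_braid A X Y) (Id (Ch A) Z)"
proof (rule chmap_eqI)
  fix n
  show "at (ch_assoc A Y Z X \<cdot>\<^bsub>Ch A\<^esub> ch_braid A X (T Y Z) \<cdot>\<^bsub>Ch A\<^esub> ch_assoc A X Y Z) n
        = at (ch_tens_map A (Id (Ch A) Y) (ch_braid A X Z) \<cdot>\<^bsub>Ch A\<^esub> ch_assoc A Y X Z
          \<cdot>\<^bsub>Ch A\<^esub> ch_tens_map A (ch_braid A X Y) (Id (Ch A) Z)) n"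
  proof (rule ch_tens_ext3[of X Y Z _ _ n])
    fix p q r assume n: "n = p + q + r"
    let ?X = "deg X p" and ?Y = "deg Y q" and ?Z = "deg Z r"
    let ?i = "t (T X Y) Z (p + q) r \<cdot> (t X Y p q \<boxtimes> Id A ?Z)"
    have s: "p + (q + r) = p + q + r" "q + r + p = p + q + r" "q + (r + p) = p + q + r" "r + p = p + r"
      "q + p = p + q" "q + (p + r) = p + q + r" by auto
    have n': "n = q + r + p" "n = q + p + r" "n = q + (p + r)" "n = p + (q + r)" using n by auto
    have 1: "braid A ?X (deg (T Y Z) (q + r)) \<cdot> (Id A ?X \<boxtimes> t Y Z q r) = (t Y Z q r \<boxtimes> Id A ?X) \<cdot> braid A ?X (?Y \<otimes> ?Z)"
      by (rule braid_natural) auto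
    have "at (ch_assoc A Y Z X \<cdot>\<^bsub>Ch A\<^esub> ch_braid A X (T Y Z) \<cdot>\<^bsub>Ch A\<^esub> ch_assoc A X Y Z) n \<cdot> ?i
      = at (ch_assoc A Y Z X) n \<cdot> at (ch_braid A X (T Y Z)) n \<cdot> t X (T Y Z) p (q + r)
        \<cdot> (Id A ?X \<boxtimes> t Y Z q r) \<cdot> assoc A ?X ?Y ?Z"
      by (simp add: ch_assoc_inj n)
    also have "\<dots> = signed A (p * (q + r)) (at (ch_assoc A Y Z X) n \<cdot> t (T Y Z) X (q + r) p
      \<cdot> (t Y Z q r \<boxtimes> Id A ?X) \<cdot> braid A ?X (?Y \<otimes> ?Z) \<cdot> assoc A ?X ?Y ?Z)"
      by (simp add: ch_braid_inj_tail n'(4) pre[OF 1] Comp_signed s)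
    also have "\<dots> = signed A (p * (q + r)) (t Y (T Z X) q (r + p) \<cdot> (Id A ?Y \<boxtimes> t Z X r p) \<cdot> assoc A ?Y ?Z ?X
      \<cdot> braid A ?X (?Y \<otimes> ?Z) \<cdot> assoc A ?X ?Y ?Z)"
      by (subst ch_assoc_inj_tail) (auto simp: n' s)
    also have "\<dots> = signed A (p * (q + r)) (t Y (T Z X) q (r + p) \<cdot> (Id A ?Y \<boxtimes> t Z X r p)
      \<cdot> (Id A ?Y \<boxtimes> braid A ?X ?Z) \<cdot> assoc A ?Y ?X ?Z \<cdot> (braid A ?X ?Y \<boxtimes> Id A ?Z))"
      by (simp add: hexagon)
    finally have L: "at (ch_assoc A Y Z X \<cdot>\<^bsub>Ch A\<^esub> ch_braid A X (T Y Z) \<cdot>\<^bsub>Ch A\<^esub> ch_assoc A X Y Z) n \<cdot> ?i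
      = signed A (p * (q + r)) (t Y (T Z X) q (r + p) \<cdot> (Id A ?Y \<boxtimes> t Z X r p) \<cdot> (Id A ?Y \<boxtimes> braid A ?X ?Z)
        \<cdot> assoc A ?Y ?X ?Z \<cdot> (braid A ?X ?Y \<boxtimes> Id A ?Z))" .
    have 2: "(at (ch_braid A X Y) (p + q) \<boxtimes> Id A ?Z) \<cdot> (t X Y p q \<boxtimes> Id A ?Z)
      = signed A (p * q) ((t Y X q p \<boxtimes> Id A ?Z) \<cdot> (braid A ?X ?Y \<boxtimes> Id A ?Z))"
      by (simp add: tens_Comp_tens ch_braid_inj signed_tens s)
    have 3: "(Id A ?Y \<boxtimes> at (ch_braid A X Z) (p + r)) \<cdot> (Id A ?Y \<boxtimes> t X Z p r)
      = signed A (p * r) ((Id A ?Y \<boxtimes> t Z X r p) \<cdot> (Id A ?Y \<boxtimes> braid A ?X ?Z))"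
      by (simp add: tens_Comp_tens ch_braid_inj tens_signed s)
    have "at (ch_tens_map A (Id (Ch A) Y) (ch_braid A X Z) \<cdot>\<^bsub>Ch A\<^esub> ch_assoc A Y X Z
      \<cdot>\<^bsub>Ch A\<^esub> ch_tens_map A (ch_braid A X Y) (Id (Ch A) Z)) n \<cdot> ?i
      = at (ch_tens_map A (Id (Ch A) Y) (ch_braid A X Z)) n \<cdot> at (ch_assoc A Y X Z) n \<cdot> t (T Y X) Z (p + q) r
         \<cdot> (at (ch_braid A X Y) (p + q) \<boxtimes> Id A ?Z) \<cdot> (t X Y p q \<boxtimes> Id A ?Z)"
      by (simp add: tens_map_inj_tail n)
    also have "\<dots> = signed A (p * q) (at (ch_tens_map A (Id (Ch A) Y) (ch_braid A X Z)) n
      \<cdot> at (ch_assoc A Y X Z) n \<cdot> t (T Y X) Z (p + q) r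
         \<cdot> (t Y X q p \<boxtimes> Id A ?Z) \<cdot> (braid A ?X ?Y \<boxtimes> Id A ?Z))"
      unfolding 2 by (simp add: Comp_signed n s)
    also have "\<dots> = signed A (p * q) (at (ch_tens_map A (Id (Ch A) Y) (ch_braid A X Z)) n \<cdot> t Y (T X Z) q (p + r)
         \<cdot> (Id A ?Y \<boxtimes> t X Z p r) \<cdot> assoc A ?Y ?X ?Z \<cdot> (braid A ?X ?Y \<boxtimes> Id A ?Z))"
      by (subst ch_assoc_inj_tail) (auto simp: n' s)
    also have "\<dots> = signed A (p * q) (t Y (T Z X) q (p + r) \<cdot> ((Id A ?Y \<boxtimes> at (ch_braid A X Z) (p + r))
      \<cdot> (Id A ?Y \<boxtimes> t X Z p r))
         \<cdot> assoc A ?Y ?X ?Z \<cdot> (braid A ?X ?Y \<boxtimes> Id A ?Z))"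
      by (simp add: tens_map_inj_tail n s)
    also have "\<dots> = signed A (p * q + p * r) (t Y (T Z X) q (r + p) \<cdot> (Id A ?Y \<boxtimes> t Z X r p)
      \<cdot> (Id A ?Y \<boxtimes> braid A ?X ?Z) \<cdot> assoc A ?Y ?X ?Z \<cdot> (braid A ?X ?Y \<boxtimes> Id A ?Z))"
      unfolding 3 by (simp add: Comp_signed signed_Comp signed_signed s)
    finally show "at (ch_assoc A Y Z X \<cdot>\<^bsub>Ch A\<^esub> ch_braid A X (T Y Z) \<cdot>\<^bsub>Ch A\<^esub> ch_assoc A X Y Z) n \<cdot> ?i
      = at (ch_tens_map A (Id (Ch A) Y) (ch_braid A X Z) \<cdot>\<^bsub>Ch A\<^esub> ch_assoc A Y X Z
        \<cdot>\<^bsub>Ch A\<^esub> ch_tens_map A (ch_braid A X Y) (Id (Ch A) Z)) n \<cdot> ?i"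
      using L by (simp add: distrib_left)
  qed auto
qed auto

text \<open>On each component both sides become \<open>?r\<close> after one side of the pentagon of
  A; no signs arise.\<close>

lemma ch_pentagon:
  assumes [simp]: "is_chain A W" "is_chain A X" "is_chain A Y" "is_chain A Z"
  shows "ch_assoc A W X (T Y Z) \<cdot>\<^bsub>Ch A\<^esub> ch_assoc A (T W X) Y Z
        = ch_tens_map A (Id (Ch A) W) (ch_assoc A X Y Z) \<cdot>\<^bsub>Ch A\<^esub> ch_assoc A W (T X Y) Z
          \<cdot>\<^bsub>Ch A\<^esub> ch_tens_map A (ch_assoc A W X Y) (Id (Ch A) Z)"
proof (rule chmap_eqI)
  fix n
  show "at (ch_assoc A W X (T Y Z) \<cdot>\<^bsub>Ch A\<^esub> ch_assoc A (T W X) Y Z) n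
        = at (ch_tens_map A (Id (Ch A) W) (ch_assoc A X Y Z) \<cdot>\<^bsub>Ch A\<^esub> ch_assoc A W (T X Y) Z
          \<cdot>\<^bsub>Ch A\<^esub> ch_tens_map A (ch_assoc A W X Y) (Id (Ch A) Z)) n"
  proof (rule ch_tens_ext4[of W X Y Z _ _ n])
    fix w x y z assume n: "n = w + x + y + z"
    let ?W = "deg W w" and ?X = "deg X x" and ?Y = "deg Y y" and ?Z = "deg Z z"
    let ?i = "t (T (T W X) Y) Z (w + x + y) z \<cdot> (t (T W X) Y (w + x) y \<boxtimes> Id A ?Z) \<cdot> ((t W X w x \<boxtimes> Id A ?Y) \<boxtimes> Id A ?Z)"
    have s: "w + (x + y) = w + x + y" "w + (x + y + z) = w + x + y + z" "w + x + (y + z) = w + x + y + z"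
      "w + (x + (y + z)) = w + x + y + z"
      "x + (y + z) = x + y + z" by auto
    let ?r = "t W (T X (T Y Z)) w (x + y + z) \<cdot> (Id A ?W \<boxtimes> t X (T Y Z) x (y + z)) \<cdot> (Id A ?W \<boxtimes> (Id A ?X \<boxtimes> t Y Z y z))"
    have 1: "(Id A (deg (T W X) (w + x)) \<boxtimes> t Y Z y z) \<cdot> (t W X w x \<boxtimes> (Id A ?Y \<boxtimes> Id A ?Z))
       = (t W X w x \<boxtimes> Id A (deg (T Y Z) (y + z))) \<cdot> ((Id A ?W \<boxtimes> Id A ?X) \<boxtimes> t Y Z y z)"
      by (simp add: tens_Comp_tens)
    have "at (ch_assoc A W X (T Y Z) \<cdot>\<^bsub>Ch A\<^esub> ch_assoc A (T W X) Y Z) n \<cdot> ?i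
      = at (ch_assoc A W X (T Y Z)) n \<cdot> t (T W X) (T Y Z) (w + x) (y + z) \<cdot> (Id A (deg (T W X) (w + x)) \<boxtimes> t Y Z y z)
         \<cdot> assoc A (deg (T W X) (w + x)) ?Y ?Z \<cdot> ((t W X w x \<boxtimes> Id A ?Y) \<boxtimes> Id A ?Z)"
      by (simp add: ch_assoc_inj_tail n s)
    also have "\<dots> = at (ch_assoc A W X (T Y Z)) n \<cdot> t (T W X) (T Y Z) (w + x) (y + z)
      \<cdot> ((Id A (deg (T W X) (w + x)) \<boxtimes> t Y Z y z)
         \<cdot> (t W X w x \<boxtimes> (Id A ?Y \<boxtimes> Id A ?Z))) \<cdot> assoc A (?W \<otimes> ?X) ?Y ?Z"
      by (simp add: assoc_natural n s del: tens_Id)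
    also have "\<dots> = at (ch_assoc A W X (T Y Z)) n \<cdot> t (T W X) (T Y Z) (w + x) (y + z)
      \<cdot> (t W X w x \<boxtimes> Id A (deg (T Y Z) (y + z)))
         \<cdot> ((Id A ?W \<boxtimes> Id A ?X) \<boxtimes> t Y Z y z) \<cdot> assoc A (?W \<otimes> ?X) ?Y ?Z"
      unfolding 1 by (simp add: n s)
    also have "\<dots> = t W (T X (T Y Z)) w (x + (y + z)) \<cdot> (Id A ?W \<boxtimes> t X (T Y Z) x (y + z))
      \<cdot> assoc A ?W ?X (deg (T Y Z) (y + z))
         \<cdot> ((Id A ?W \<boxtimes> Id A ?X) \<boxtimes> t Y Z y z) \<cdot> assoc A (?W \<otimes> ?X) ?Y ?Z"
      by (subst ch_assoc_inj_tail) (auto simp: n s)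
    also have "\<dots> = ?r \<cdot> assoc A ?W ?X (?Y \<otimes> ?Z) \<cdot> assoc A (?W \<otimes> ?X) ?Y ?Z"
      by (simp add: pre[OF assoc_natural] s del: tens_Id)
    finally have L: "at (ch_assoc A W X (T Y Z) \<cdot>\<^bsub>Ch A\<^esub> ch_assoc A (T W X) Y Z) n \<cdot> ?i
      = ?r \<cdot> assoc A ?W ?X (?Y \<otimes> ?Z) \<cdot> assoc A (?W \<otimes> ?X) ?Y ?Z" .
    have 2: "(at (ch_assoc A W X Y) (w + x + y) \<boxtimes> Id A ?Z) \<cdot> (t (T W X) Y (w + x) y \<boxtimes> Id A ?Z)
      \<cdot> ((t W X w x \<boxtimes> Id A ?Y) \<boxtimes> Id A ?Z)
      = (t W (T X Y) w (x + y) \<boxtimes> Id A ?Z) \<cdot> ((Id A ?W \<boxtimes> t X Y x y) \<boxtimes> Id A ?Z) \<cdot> (assoc A ?W ?X ?Y \<boxtimes> Id A ?Z)"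
      by (simp add: Comp_tens_Id[symmetric] ch_assoc_inj s)
    have 3: "(Id A ?W \<boxtimes> at (ch_assoc A X Y Z) (x + y + z)) \<cdot> (Id A ?W \<boxtimes> t (T X Y) Z (x + y) z)
      \<cdot> (Id A ?W \<boxtimes> (t X Y x y \<boxtimes> Id A ?Z))
      = (Id A ?W \<boxtimes> t X (T Y Z) x (y + z)) \<cdot> (Id A ?W \<boxtimes> (Id A ?X \<boxtimes> t Y Z y z)) \<cdot> (Id A ?W \<boxtimes> assoc A ?X ?Y ?Z)"
      by (simp add: Id_tens_Comp[symmetric] ch_assoc_inj s)
    have "at (ch_tens_map A (Id (Ch A) W) (ch_assoc A X Y Z) \<cdot>\<^bsub>Ch A\<^esub> ch_assoc A W (T X Y) Z
      \<cdot>\<^bsub>Ch A\<^esub> ch_tens_map A (ch_assoc A W X Y) (Id (Ch A) Z)) n \<cdot> ?i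
      = at (ch_tens_map A (Id (Ch A) W) (ch_assoc A X Y Z)) n \<cdot> at (ch_assoc A W (T X Y) Z) n
        \<cdot> t (T W (T X Y)) Z (w + x + y) z
         \<cdot> ((at (ch_assoc A W X Y) (w + x + y) \<boxtimes> Id A ?Z) \<cdot> (t (T W X) Y (w + x) y \<boxtimes> Id A ?Z)
           \<cdot> ((t W X w x \<boxtimes> Id A ?Y) \<boxtimes> Id A ?Z))"
      by (simp add: tens_map_inj_tail n)
    also have "\<dots> = at (ch_tens_map A (Id (Ch A) W) (ch_assoc A X Y Z)) n \<cdot> at (ch_assoc A W (T X Y) Z) n
      \<cdot> t (T W (T X Y)) Z (w + x + y) z
         \<cdot> (t W (T X Y) w (x + y) \<boxtimes> Id A ?Z) \<cdot> ((Id A ?W \<boxtimes> t X Y x y) \<boxtimes> Id A ?Z) \<cdot> (assoc A ?W ?X ?Y \<boxtimes> Id A ?Z)"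
      unfolding 2 by (simp add: n s)
    also have "\<dots> = at (ch_tens_map A (Id (Ch A) W) (ch_assoc A X Y Z)) n \<cdot> t W (T (T X Y) Z) w (x + y + z)
      \<cdot> (Id A ?W \<boxtimes> t (T X Y) Z (x + y) z)
         \<cdot> (assoc A ?W (deg (T X Y) (x + y)) ?Z \<cdot> ((Id A ?W \<boxtimes> t X Y x y) \<boxtimes> Id A ?Z)) \<cdot> (assoc A ?W ?X ?Y \<boxtimes> Id A ?Z)"
      by (subst ch_assoc_inj_tail) (auto simp: n s)
    also have "\<dots> = t W (T X (T Y Z)) w (x + y + z) \<cdot> ((Id A ?W \<boxtimes> at (ch_assoc A X Y Z) (x + y + z))
      \<cdot> (Id A ?W \<boxtimes> t (T X Y) Z (x + y) z)
         \<cdot> (Id A ?W \<boxtimes> (t X Y x y \<boxtimes> Id A ?Z))) \<cdot> assoc A ?W (?X \<otimes> ?Y) ?Z \<cdot> (assoc A ?W ?X ?Y \<boxtimes> Id A ?Z)"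
      by (simp add: assoc_natural tens_map_inj_tail n s)
    also have "\<dots> = ?r \<cdot> (Id A ?W \<boxtimes> assoc A ?X ?Y ?Z) \<cdot> assoc A ?W (?X \<otimes> ?Y) ?Z \<cdot> (assoc A ?W ?X ?Y \<boxtimes> Id A ?Z)"
      unfolding 3 by (simp add: s)
    finally show "at (ch_assoc A W X (T Y Z) \<cdot>\<^bsub>Ch A\<^esub> ch_assoc A (T W X) Y Z) n \<cdot> ?i
        = at (ch_tens_map A (Id (Ch A) W) (ch_assoc A X Y Z) \<cdot>\<^bsub>Ch A\<^esub> ch_assoc A W (T X Y) Z
          \<cdot>\<^bsub>Ch A\<^esub> ch_tens_map A (ch_assoc A W X Y) (Id (Ch A) Z)) n \<cdot> ?i"
      using L by (simp add: pentagon)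
  qed auto
qed auto

end

section \<open>The additive structure of complexes\<close>

definition ch_add :: "('o, 'a, 'm) asmcat_scheme \<Rightarrow> ('o, 'a) chmap \<Rightarrow> ('o, 'a) chmap \<Rightarrow> ('o, 'a) chmap" where
  "ch_add A f g = \<lparr>src = src f, tgt = tgt f, at = (\<lambda>n. at f n \<oplus>\<^bsub>A\<^esub> at g n)\<rparr>"

definition ch_zero :: "('o, 'a, 'm) asmcat_scheme \<Rightarrow> ('o, 'a) chain \<Rightarrow> ('o, 'a) chain \<Rightarrow> ('o, 'a) chmap" where
  "ch_zero A X Y = \<lparr>src = X, tgt = Y, at = (\<lambda>n. hzero A (deg X n) (deg Y n))\<rparr>"

context chain_base begin

lemma ch_add_simps [simp]: "src (ch_add A f g) = src f" "tgt (ch_add A f g) = tgt f" "at (ch_add A f g) n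
  = at f n \<oplus> at g n"
  by (auto simp: ch_add_def)

lemma ch_zero_simps [simp]: "src (ch_zero A X Y) = X" "tgt (ch_zero A X Y) = Y" "at (ch_zero A X Y) n
  = hzero A (deg X n) (deg Y n)"
  by (auto simp: ch_zero_def)

lemma is_chmap_add [simp]:
  assumes [simp]: "is_chmap A f" "is_chmap A g" "src g = src f" "tgt g = tgt f"
  shows "is_chmap A (ch_add A f g)"
proof (rule is_chmapI)
  fix n
  show "diff (tgt (ch_add A f g)) n \<cdot> at (ch_add A f g) n = at (ch_add A f g) (n - 1) \<cdot> diff (src (ch_add A f g)) n"
    using chmap_diff[of f "tgt f" n] chmap_diff[of g "tgt f" n] by (simp add: Comp_hadd hadd_Comp)
qed auto

lemma is_chmap_zero [simp]: "is_chain A X \<Longrightarrow> is_chain A Y \<Longrightarrow> is_chmap A (ch_zero A X Y)"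
  by (rule is_chmapI) auto

lemma biproduct_chain:
  assumes [simp]: "is_chain A X" "is_chain A Y"
  shows "\<exists>S \<in> Ob (Ch A). \<exists>i \<in> hom (Ch A) X S. \<exists>j \<in> hom (Ch A) Y S. \<exists>p \<in> hom (Ch A) S X. \<exists>q \<in> hom (Ch A) S Y.
      p \<cdot>\<^bsub>Ch A\<^esub> i = Id (Ch A) X \<and> q \<cdot>\<^bsub>Ch A\<^esub> j = Id (Ch A) Y \<and> p \<cdot>\<^bsub>Ch A\<^esub> j = ch_zero A Y X \<and> q \<cdot>\<^bsub>Ch A\<^esub> i
        = ch_zero A X Y
      \<and> ch_add A (i \<cdot>\<^bsub>Ch A\<^esub> p) (j \<cdot>\<^bsub>Ch A\<^esub> q) = Id (Ch A) S"
proof -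
  have "\<forall>n. \<exists>S i j p q. S \<in> Ob A \<and> i \<in> hom A (deg X n) S \<and> j \<in> hom A (deg Y n) S \<and> p \<in> hom A S (deg X n)
    \<and> q \<in> hom A S (deg Y n)
     \<and> p \<cdot> i = Id A (deg X n) \<and> q \<cdot> j = Id A (deg Y n) \<and> p \<cdot> j = hzero A (deg Y n) (deg X n)
       \<and> q \<cdot> i = hzero A (deg X n) (deg Y n)
        \<and> (i \<cdot> p) \<oplus> (j \<cdot> q) = Id A S"
    using biproduct_exists[of "deg X n" "deg Y n" for n] by (metis assms chain_simps(1) biproduct_exists)
  then obtain S i j p q where b: "\<And>n. S n \<in> Ob A" "\<And>n. i n \<in> hom A (deg X n) (S n)" "\<And>n. j n \<in> hom A (deg Y n) (S n)"
     "\<And>n. p n \<in> hom A (S n) (deg X n)" "\<And>n. q n \<in> hom A (S n) (deg Y n)"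
     "\<And>n. p n \<cdot> i n = Id A (deg X n)" "\<And>n. q n \<cdot> j n = Id A (deg Y n)" "\<And>n. p n \<cdot> j n
       = hzero A (deg Y n) (deg X n)" "\<And>n. q n \<cdot> i n = hzero A (deg X n) (deg Y n)"
     and sum: "\<And>n. (i n \<cdot> p n) \<oplus> (j n \<cdot> q n) = Id A (S n)"
    by metis
  then have [simp]: "i n \<in> Ar A" "Dom A (i n) = deg X n" "Cod A (i n) = S n" "j n \<in> Ar A" "Dom A (j n)
    = deg Y n" "Cod A (j n) = S n"
    "p n \<in> Ar A" "Cod A (p n) = deg X n" "Dom A (p n) = S n" "q n \<in> Ar A" "Cod A (q n) = deg Y n"
      "Dom A (q n) = S n" for n
    by (auto simp: hom_iff)
  note [simp] = b(1,6-9) b(6-9)[THEN pre1]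
  \<comment> \<open>The biproducts are chosen degree by degree, so the differential is the diagonal
    one, carried through the chosen projections and injections.\<close>
  let ?S = "\<lparr>deg = S, diff = (\<lambda>n. i (n - 1) \<cdot> diff X n \<cdot> p n \<oplus> j (n - 1) \<cdot> diff Y n \<cdot> q n)\<rparr>"
  have dd: "diff X (n - 1) \<cdot> diff X n \<cdot> h = hzero A (Dom A h) (deg X (n - 2))" if "h \<in> Ar A"
    "Cod A h = deg X n" "is_chain A X" for X h n
    using that by (subst pre1[OF diff_diff]) auto
  have S [simp]: "is_chain A ?S"
    unfolding is_chain_def by (auto simp: hom_iff Comp_hadd hadd_Comp dd)
  let ?i = "\<lparr>src = X, tgt = ?S, at = i\<rparr>" and ?j = "\<lparr>src = Y, tgt = ?S, at = j\<rparr>"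
    and ?p = "\<lparr>src = ?S, tgt = X, at = p\<rparr>" and ?q = "\<lparr>src = ?S, tgt = Y, at = q\<rparr>"
  have "is_chmap A ?i" "is_chmap A ?j" "is_chmap A ?p" "is_chmap A ?q"
    by (rule is_chmapI; simp add: Comp_hadd hadd_Comp)+
  moreover have "?p \<cdot>\<^bsub>Ch A\<^esub> ?i = Id (Ch A) X" "?q \<cdot>\<^bsub>Ch A\<^esub> ?j = Id (Ch A) Y" "?p \<cdot>\<^bsub>Ch A\<^esub> ?j = ch_zero A Y X"
    "?q \<cdot>\<^bsub>Ch A\<^esub> ?i = ch_zero A X Y"
      "ch_add A (?i \<cdot>\<^bsub>Ch A\<^esub> ?p) (?j \<cdot>\<^bsub>Ch A\<^esub> ?q) = Id (Ch A) ?S"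
    by (rule chmap_eqI; simp add: sum)+
  ultimately show ?thesis
    by (intro bexI[of _ ?S] bexI[of _ ?i] bexI[of _ ?j] bexI[of _ ?p] bexI[of _ ?q]) (auto simp: hom_def)
qed

lemma ch_add_wh:
  assumes [simp]: "is_chmap A f" "is_chmap A g" "src g = src f" "tgt g = tgt f" "is_chmap A h"
  shows "ch_tens_map A h (ch_add A f g) = ch_add A (ch_tens_map A h f) (ch_tens_map A h g)"
    and "ch_tens_map A (ch_add A f g) h = ch_add A (ch_tens_map A f h) (ch_tens_map A g h)"
proof -
  have "at (ch_tens_map A h (ch_add A f g)) n = at (ch_add A (ch_tens_map A h f) (ch_tens_map A h g)) n" for n
    by (rule ch_tens_ext[of "src h" "src f" _ _ n]) (auto simp: tens_map_inj hadd_Comp Comp_hadd tens_hadd)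
  then show "ch_tens_map A h (ch_add A f g) = ch_add A (ch_tens_map A h f) (ch_tens_map A h g)"
    by (intro chmap_eqI) auto
  have "at (ch_tens_map A (ch_add A f g) h) n = at (ch_add A (ch_tens_map A f h) (ch_tens_map A g h)) n" for n
    by (rule ch_tens_ext[of "src f" "src h" _ _ n]) (auto simp: tens_map_inj hadd_Comp Comp_hadd hadd_tens)
  then show "ch_tens_map A (ch_add A f g) h = ch_add A (ch_tens_map A f h) (ch_tens_map A g h)"
    by (intro chmap_eqI) auto
qed

lemma ch_zero_wh:
  assumes [simp]: "is_chain A X" "is_chain A Y" "is_chmap A h"
  shows "ch_tens_map A h (ch_zero A X Y) = ch_zero A (T (src h) X) (T (tgt h) Y)"
    and "ch_tens_map A (ch_zero A X Y) h = ch_zero A (T X (src h)) (T Y (tgt h))"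
proof -
  have "at (ch_tens_map A h (ch_zero A X Y)) n = at (ch_zero A (T (src h) X) (T (tgt h) Y)) n" for n
    by (rule ch_tens_ext[of "src h" X _ _ n]) (auto simp: tens_map_inj)
  then show "ch_tens_map A h (ch_zero A X Y) = ch_zero A (T (src h) X) (T (tgt h) Y)"
    by (intro chmap_eqI) auto
  have "at (ch_tens_map A (ch_zero A X Y) h) n = at (ch_zero A (T X (src h)) (T Y (tgt h))) n" for n
    by (rule ch_tens_ext[of X "src h" _ _ n]) (auto simp: tens_map_inj)
  then show "ch_tens_map A (ch_zero A X Y) h = ch_zero A (T X (src h)) (T Y (tgt h))"
    by (intro chmap_eqI) auto
qed

lemma ch_add_laws:
  assumes [simp]: "is_chmap A f" "is_chmap A g" "src g = src f" "tgt g = tgt f"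
  shows "ch_add A f g = ch_add A g f"
    and "is_chmap A h \<Longrightarrow> src h = src f \<Longrightarrow> tgt h = tgt f \<Longrightarrow> ch_add A (ch_add A f g) h = ch_add A f (ch_add A g h)"
    and "ch_add A f (ch_zero A (src f) (tgt f)) = f"
    and "is_chmap A k \<Longrightarrow> src k = tgt f \<Longrightarrow> k \<cdot>\<^bsub>Ch A\<^esub> ch_add A f g = ch_add A (k \<cdot>\<^bsub>Ch A\<^esub> f) (k \<cdot>\<^bsub>Ch A\<^esub> g)"
    and "is_chmap A l \<Longrightarrow> tgt l = src f \<Longrightarrow> ch_add A f g \<cdot>\<^bsub>Ch A\<^esub> l = ch_add A (f \<cdot>\<^bsub>Ch A\<^esub> l) (g \<cdot>\<^bsub>Ch A\<^esub> l)"
  subgoal by (rule chmap_eqI) (auto simp: hadd_commute[of "at f n" "at g n" for n])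
  by (rule chmap_eqI; simp add: Comp_hadd hadd_Comp hadd_associative)+

lemma ch_zero_Comp:
  assumes [simp]: "is_chmap A f" "is_chain A X"
  shows "f \<cdot>\<^bsub>Ch A\<^esub> ch_zero A X (src f) = ch_zero A X (tgt f)" "ch_zero A (tgt f) X \<cdot>\<^bsub>Ch A\<^esub> f = ch_zero A (src f) X"
  by (rule chmap_eqI; simp)+

text \<open>Holds for arbitrary arguments, well formed or not; \<open>typed_smc\<close> asks for
  sources and targets in this form.\<close>

lemma ch_structure_unconditional:
  "src (ch_tens_map A f g) = T (src f) (src g)" "tgt (ch_tens_map A f g) = T (tgt f) (tgt g)"
  "src (ch_assoc A X Y Z) = T (T X Y) Z" "tgt (ch_assoc A X Y Z) = T X (T Y Z)"
  "src (ch_lunit A X) = T (ch_unit A) X" "tgt (ch_lunit A X) = X"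
  "src (ch_runit A X) = T X (ch_unit A)" "tgt (ch_runit A X) = X"
  "src (ch_braid A X Y) = T X Y" "tgt (ch_braid A X Y) = T Y X"
  by (auto simp: ch_tens_map_def ch_assoc_def ch_lunit_def ch_runit_def ch_braid_def Let_def)

lemma ch_hom_iff: "f \<in> hom (Ch A) X Y \<longleftrightarrow> is_chmap A f \<and> src f = X \<and> tgt f = Y"
  by (auto simp: hom_def)

lemma symmetric_monoidal_Ch: "symmetric_monoidal (Ch A)"
proof -
  note [simp] = ch_hom_iff ch_structure_unconditional
  show ?thesis
  proof (unfold_locales, goal_cases)
    case (7 f W X g Y h Z)
    then show ?case by (intro chmap_eqI) auto
  qed (auto simp: ch_tens_Id ch_tens_Comp iso_ch_assoc ch_assoc_natural iso_ch_lunit iso_ch_runit ch_lunit_natural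
      ch_runit_natural ch_braid_natural ch_symmetry ch_triangle ch_pentagon ch_hexagon intro!: chmap_eqI)
qed

end

locale closed_chain_base = chain_base A for A :: "('o, 'a, 'm) asmcat_scheme" (structure) +
  assumes closed_Ch: "has_internal_homs (Ch A)"

text \<open>From here on the abstract results apply to complexes, with the Koszul signs contained in
  the braiding.\<close>

sublocale closed_chain_base \<subseteq> Ch: additive_closed_smc "Ch A" "ch_add A" "ch_zero A"
proof -
  interpret symmetric_monoidal "Ch A" by (rule symmetric_monoidal_Ch)
  note [simp] = ch_structure_unconditional
  show "additive_closed_smc (Ch A) (ch_add A) (ch_zero A)"
  proof (unfold_locales, goal_cases)
  qed (use biproduct_chain in \<open>auto simp: closed_Ch ch_add_laws(2-) ch_zero_Comp ch_add_wh ch_zero_wh intro: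
    ch_add_laws(1)\<close>)
qed

section \<open>Operads concentrated in arity one\<close>

text \<open>A monoid regarded as an operad with unary operations only. The unit operad and the zero
  operad are instances, and so is the acyclic operad of case (2).\<close>

definition concentrated_operad :: "('o, 'a, 'm) smcat_scheme \<Rightarrow> 'o \<Rightarrow> 'a \<Rightarrow> 'a \<Rightarrow> ('o, 'a) operad" where
  "concentrated_operad M B \<mu> \<eta> = (let I = (\<lambda>n. if n = 1 then B else zero_ob M) in \<lparr>
     arity = I,
     act = (\<lambda>n \<sigma>. Id M (I n)),
     pcomp = (\<lambda>m n i. if m = 1 \<and> n = 1 then \<mu> else zero_ar M (I m \<otimes>\<^bsub>M\<^esub> I n) (I (m + n - 1))),
     opunit = \<eta>\<rparr>)"

lemma unit_operad_eq: "unit_operad M = concentrated_operad M (unit M) (lunit M (unit M)) (Id M (unit M))"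
  by (simp add: unit_operad_def concentrated_operad_def Let_def)

section \<open>Composites of operad morphisms and restriction of coalgebras\<close>

context typed_smc begin

text \<open>\<open>sw_unit_right\<close> with tail 1, combined with the triangle.\<close>

lemma lunit_braid:
  assumes [simp]: "U \<in> Ob M"
  shows "lunit M U \<cdot> braid M U (unit M) = runit M U"
proof (rule unit_hw_inject)
  let ?I = "unit M"
  have "((lunit M U \<cdot> braid M U ?I) \<boxtimes> Id M ?I) \<cdot> ai U ?I ?I = (lunit M (U \<otimes> ?I) \<cdot> sw U ?I ?I)"
    by (simp add: Comp_wh lunit_tens[symmetric] sw_def)
  also have "\<dots> = (U \<rhd> lunit M ?I \<cdot> assoc M U ?I ?I) \<cdot> ai U ?I ?I"
    by (simp add: sw_unit_right)
  also have "\<dots> = (runit M U \<boxtimes> Id M ?I) \<cdot> ai U ?I ?I"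
    by (simp only: triangle'[OF assms unit_Ob])
  finally show "(lunit M U \<cdot> braid M U ?I) \<boxtimes> Id M ?I = runit M U \<boxtimes> Id M ?I"
    by (rule cancel_epi[where k = "assoc M U ?I ?I"]) auto
qed auto

lemma braid_unit: "braid M (unit M) (unit M) = Id M (unit M \<otimes> unit M)"
proof -
  have "lunit M (unit M) \<cdot> braid M (unit M) (unit M) = lunit M (unit M) \<cdot> Id M (unit M \<otimes> unit M)"
    using lunit_braid[OF unit_Ob] by (simp add: lunit_unit)
  then show ?thesis
    by (rule cancel_mono[where k = "li (unit M)"]) auto
qed

text \<open>The target R is only required to be well typed, so that \<open>Coend M V\<close> may
  take its place on the strength of its typing lemmas.\<close>

lemma operad_hom_comp:
  assumes P: "operad M P" and Q: "operad M Q" and f: "operad_hom M P Q f" and g: "operad_hom M Q R g"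
    and R: "\<And>n \<sigma>. \<sigma> permutes {..<n} \<Longrightarrow> act R n \<sigma> \<in> hom M (arity R n) (arity R n)"
      "\<And>m n i. i < m \<Longrightarrow> pcomp R m n i \<in> hom M (arity R m \<otimes> arity R n) (arity R (m + n - 1))"
  shows "operad_hom M P R (\<lambda>n. g n \<cdot> f n)"
proof -
  interpret P: operad M P by (rule P)
  interpret Q: operad M Q by (rule Q)
  have f' [simp]: "f n \<in> Ar M" "Dom M (f n) = arity P n" "Cod M (f n) = arity Q n" for n
    using f by (auto simp: operad_hom_def hom_iff)
  have g' [simp]: "g n \<in> Ar M" "Dom M (g n) = arity Q n" "Cod M (g n) = arity R n" for n
    using g by (auto simp: operad_hom_def hom_iff)
  show ?thesis
    unfolding operad_hom_def
  proof (intro conjI allI impI)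
    show "g n \<cdot> f n \<in> hom M (arity P n) (arity R n)" for n by (simp add: hom_iff)
    fix n :: nat and \<sigma> :: "nat \<Rightarrow> nat" assume s: "\<sigma> permutes {..<n}"
    have [simp]: "act P n \<sigma> \<in> Ar M" "Dom M (act P n \<sigma>) = arity P n" "Cod M (act P n \<sigma>) = arity P n"
      "act Q n \<sigma> \<in> Ar M" "Dom M (act Q n \<sigma>) = arity Q n" "Cod M (act Q n \<sigma>) = arity Q n"
      "act R n \<sigma> \<in> Ar M" "Dom M (act R n \<sigma>) = arity R n" "Cod M (act R n \<sigma>) = arity R n"
      using P.act_hom[OF s] Q.act_hom[OF s] R(1)[OF s] by (auto simp: hom_iff)
    have 1: "f n \<cdot> act P n \<sigma> = act Q n \<sigma> \<cdot> f n" and 2: "g n \<cdot> act Q n \<sigma> = act R n \<sigma> \<cdot> g n"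
      using f g s by (auto simp: operad_hom_def)
    show "(g n \<cdot> f n) \<cdot> act P n \<sigma> = act R n \<sigma> \<cdot> g n \<cdot> f n"
      by (simp add: 1 pre[OF 2])
  next
    fix m n i :: nat assume i: "i < m"
    have [simp]: "pcomp P m n i \<in> Ar M" "Dom M (pcomp P m n i) = arity P m \<otimes> arity P n"
      "Cod M (pcomp P m n i) = arity P (m + n - 1)"
      "pcomp Q m n i \<in> Ar M" "Dom M (pcomp Q m n i) = arity Q m \<otimes> arity Q n" "Cod M (pcomp Q m n i)
        = arity Q (m + n - 1)"
      "pcomp R m n i \<in> Ar M" "Dom M (pcomp R m n i) = arity R m \<otimes> arity R n" "Cod M (pcomp R m n i)
        = arity R (m + n - 1)"
      using P.pcomp_hom[OF i] Q.pcomp_hom[OF i] R(2)[OF i] by (auto simp: hom_iff)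
    have 1: "f (m + n - 1) \<cdot> pcomp P m n i = pcomp Q m n i \<cdot> (f m \<boxtimes> f n)" and 2: "g (m + n - 1)
      \<cdot> pcomp Q m n i = pcomp R m n i \<cdot> (g m \<boxtimes> g n)"
      using f g i by (auto simp: operad_hom_def)
    have "(g (m + n - 1) \<cdot> f (m + n - 1)) \<cdot> pcomp P m n i = g (m + n - 1) \<cdot> pcomp Q m n i \<cdot> (f m \<boxtimes> f n)"
      unfolding 1[symmetric] by (rule assoc_Comp) auto
    also have "\<dots> = pcomp R m n i \<cdot> (g m \<boxtimes> g n) \<cdot> (f m \<boxtimes> f n)"
      by (rule pre[OF 2]) auto
    finally show "(g (m + n - 1) \<cdot> f (m + n - 1)) \<cdot> pcomp P m n i = pcomp R m n i \<cdot> ((g m \<cdot> f m) \<boxtimes> (g n \<cdot> f n))"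
      by (simp add: tens_Comp_tens)
  next
    have [simp]: "opunit P \<in> Ar M" "Dom M (opunit P) = unit M" "Cod M (opunit P) = arity P (Suc 0)"
      using P.opunit_hom by (auto simp: hom_iff)
    show "(g 1 \<cdot> f 1) \<cdot> opunit P = opunit R"
      using f g by (simp add: operad_hom_def)
  qed
qed

end

context closed_typed_smc begin

lemma to_front_typing: "V \<in> Ob M \<Longrightarrow> k \<le> n \<Longrightarrow> to_front M V k n \<in> Ar M \<and> Dom M (to_front M V k n)
  = tpow M V (Suc n) \<and> Cod M (to_front M V k n) = tpow M V (Suc n)"
proof (induction k arbitrary: n)
  case (Suc k)
  then obtain n' where "n = Suc n'" by (cases n) auto
  with Suc show ?case by (simp add: Let_def)
qed auto

lemma tperm_typing: "V \<in> Ob M \<Longrightarrow> \<sigma> permutes {..<n} \<Longrightarrow> tperm M V n \<sigma> \<in> Ar M \<and> Dom M (tperm M V n \<sigma>)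
  = tpow M V n \<and> Cod M (tperm M V n \<sigma>) = tpow M V n"
proof (induction n arbitrary: \<sigma>)
  case (Suc n)
  have "\<sigma> 0 \<le> n" using permutes_in_image[OF Suc.prems(2), of 0] by simp
  then show ?case
    using Suc.IH[OF Suc.prems(1) tail_perm_permutes[OF Suc.prems(2)]] to_front_typing[OF Suc.prems(1), of "\<sigma>
      0" n] Suc.prems
    by (simp add: tail_perm_def)
qed auto

lemma tconcat_typing: "V \<in> Ob M \<Longrightarrow> tconcat M V a b \<in> Ar M \<and> Dom M (tconcat M V a b) = tpow M V a \<otimes> tpow M V b
  \<and> Cod M (tconcat M V a b) = tpow M V (a + b)"
  by (induction a) auto

lemma ev_at_typing: "V \<in> Ob M \<Longrightarrow> i \<le> m \<Longrightarrow> ev_at M V n i (Suc m) \<in> Ar M \<and> Dom M (ev_at M V n i (Suc m))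
  = ihom M V (tpow M V n) \<otimes> tpow M V (Suc m)
    \<and> Cod M (ev_at M V n i (Suc m)) = tpow M V (m + n)"
proof (induction i arbitrary: m)
  case 0
  then show ?case using tconcat_typing[of V n m] by (simp add: Let_def add.commute)
next
  case (Suc i)
  then obtain m' where "m = Suc m'" by (cases m) auto
  with Suc show ?case by (simp add: Let_def)
qed

lemma Coend_act_hom: "V \<in> Ob M \<Longrightarrow> \<sigma> permutes {..<n}
  \<Longrightarrow> act (Coend M V) n \<sigma> \<in> hom M (arity (Coend M V) n) (arity (Coend M V) n)"
  using tperm_typing[of V \<sigma> n] by (simp add: Coend_def Let_def hom_iff)

lemma Coend_pcomp_hom:
  assumes "V \<in> Ob M" "i < m"
  shows "pcomp (Coend M V) m n i \<in> hom M (arity (Coend M V) m \<otimes> arity (Coend M V) n) (arity (Coend M V) (m + n - 1))"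
proof -
  obtain m' where m: "m = Suc m'" using assms(2) by (cases m) auto
  show ?thesis
    using ev_at_typing[of V i m' n] assms by (simp add: Coend_def Let_def hom_iff m)
qed

lemma Coend_opunit_hom: "V \<in> Ob M \<Longrightarrow> opunit (Coend M V) \<in> hom M (unit M) (arity (Coend M V) 1)"
  by (simp add: Coend_def Let_def hom_iff)

lemma restrict_coalg_is_coalg:
  assumes P: "operad M P" and Q: "operad M Q" and f: "operad_hom M P Q f" and V: "is_coalg M Q V"
  shows "is_coalg M P (restrict_coalg M f V)"
proof -
  have "carr V \<in> Ob M" using V by (simp add: is_coalg_def)
  then show ?thesis
    using operad_hom_comp[OF P Q f, of "Coend M (carr V)" "coact V"] V Coend_act_hom Coend_pcomp_hom
    by (simp add: is_coalg_def restrict_coalg_def)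
qed

end

section \<open>Monoids, null objects and the zero operad\<close>

locale monoid_in = typed_smc M
  for M :: "('o, 'a, 'm) smcat_scheme" (structure) +
  fixes B :: 'o and \<mu> \<eta> :: 'a
  assumes B_Ob [simp]: "B \<in> Ob M"
    and mult_hom: "\<mu> \<in> hom M (B \<otimes> B) B"
    and unit_hom: "\<eta> \<in> hom M (unit M) B"
    and mult_unit_left: "\<mu> \<cdot> (\<eta> \<boxtimes> Id M B) = lunit M B"
    and mult_unit_right: "\<mu> \<cdot> B \<rhd> \<eta> = runit M B"
    and mult_assoc: "\<mu> \<cdot> (\<mu> \<boxtimes> Id M B) = \<mu> \<cdot> B \<rhd> \<mu> \<cdot> assoc M B B B"

locale pointed_closed_smc = additive_closed_smc M pl nul
  for M :: "('o, 'a, 'm) smcat_scheme" (structure)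
    and pl :: "'a \<Rightarrow> 'a \<Rightarrow> 'a" (infixl "\<oplus>\<oplus>" 60) and nul :: "'o \<Rightarrow> 'o \<Rightarrow> 'a" +
  assumes zero_exists: "\<exists>z. is_zero_ob M z"
begin

text \<open>Unlike being the chosen \<open>zero_ob\<close>, this property passes to tensor products;
  any two parallel maps from or to such an object agree.\<close>

definition null :: "'o \<Rightarrow> bool" where
  "null X \<longleftrightarrow> X \<in> Ob M \<and> Id M X = nul X X"

lemma null_dom_eq:
  assumes "null X" and "f \<in> hom M X Y" "g \<in> hom M X Y"
  shows "f = g"
proof -
  have "f = f \<cdot> Id M X" "g = g \<cdot> Id M X" using assms by (auto simp: hom_iff)
  then show ?thesis using assms by (auto simp: null_def hom_iff)
qed

lemma null_cod_eq:
  assumes "null Y" and "f \<in> hom M X Y" "g \<in> hom M X Y"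
  shows "f = g"
proof -
  have "f = Id M Y \<cdot> f" "g = Id M Y \<cdot> g" using assms by (auto simp: hom_iff)
  then show ?thesis using assms by (auto simp: null_def hom_iff)
qed

lemma null_tens: "null X \<Longrightarrow> Y \<in> Ob M \<Longrightarrow> null (X \<otimes> Y)" "null X \<Longrightarrow> Y \<in> Ob M \<Longrightarrow> null (Y \<otimes> X)"
  by (auto simp: null_def tens_Id[symmetric])

lemma zero_ob: "is_zero_ob M (zero_ob M)"
  unfolding zero_ob_def using zero_exists by (rule someI_ex)

lemma zero_ob_Ob [simp]: "zero_ob M \<in> Ob M"
  using zero_ob by (simp add: is_zero_ob_def)

lemma null_zero_ob: "null (zero_ob M)"
proof -
  have "\<exists>!f. f \<in> hom M (zero_ob M) (zero_ob M)"
    using zero_ob by (simp add: is_zero_ob_def)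
  moreover have "Id M (zero_ob M) \<in> hom M (zero_ob M) (zero_ob M)"
    "nul (zero_ob M) (zero_ob M) \<in> hom M (zero_ob M) (zero_ob M)"
    by (auto simp: hom_iff)
  ultimately show ?thesis by (auto simp: null_def)
qed

lemma zero_ar_eq:
  assumes "X \<in> Ob M" "Y \<in> Ob M"
  shows "zero_ar M X Y = nul X Y"
proof -
  have "(THE f. f \<in> hom M (zero_ob M) Y) = nul (zero_ob M) Y" "(THE f. f \<in> hom M X (zero_ob M)) = nul X (zero_ob M)"
    using assms null_dom_eq[OF null_zero_ob] null_cod_eq[OF null_zero_ob]
    by (auto intro!: the_equality simp: hom_iff)
  then show ?thesis using assms by (simp add: zero_ar_def)
qed

text \<open>The canonical map goes between null objects, and the zero map is inverse to it. The
  internal hom out of a zero object is null because maps into it are curried maps out of a null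
  object.\<close>

lemma dualisable_zero_ob: "dualisable M (zero_ob M)"
proof -
  let ?z = "zero_ob M"
  have null_hom: "null (ihom M ?z Y)" if [simp]: "Y \<in> Ob M" for Y
    unfolding null_def
  proof (intro conjI)
    show "Id M (ihom M ?z Y) = nul (ihom M ?z Y) (ihom M ?z Y)"
    proof (rule curry_unique)
      show "ev M ?z Y \<cdot> (Id M (ihom M ?z Y) \<boxtimes> Id M ?z) = ev M ?z Y \<cdot> (nul (ihom M ?z Y) (ihom M ?z Y) \<boxtimes> Id M ?z)"
        by (rule null_dom_eq[OF null_tens(2)[OF null_zero_ob]]) (auto simp: hom_iff)
    qed auto
  qed auto
  have "null (?z \<otimes> dual M ?z)" by (rule null_tens[OF null_zero_ob]) (simp add: dual_def)
  then have "inverse_of M (dual_to_end M ?z) (nul (ihom M ?z ?z) (?z \<otimes> dual M ?z))"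
    using null_hom[of ?z]
    by (auto simp: inverse_of_def dual_to_end_def dual_def hom_iff null_def)
  then show ?thesis unfolding dualisable_def iso_def by auto
qed

end

locale concentrated = pointed_closed_smc M pl nul + monoid_in M B \<mu> \<eta>
  for M :: "('o, 'a, 'm) smcat_scheme" (structure)
    and pl :: "'a \<Rightarrow> 'a \<Rightarrow> 'a" (infixl "\<oplus>\<oplus>" 60) and nul :: "'o \<Rightarrow> 'o \<Rightarrow> 'a"
    and B :: 'o and \<mu> \<eta> :: 'a
begin

abbreviation "C \<equiv> concentrated_operad M B \<mu> \<eta>"

lemma concentrated_arity: "arity C (Suc 0) = B" "n \<noteq> Suc 0 \<Longrightarrow> arity C n = zero_ob M"
  by (auto simp: concentrated_operad_def Let_def)

lemma concentrated_arity_Ob [simp]: "arity C n \<in> Ob M"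
  by (cases "n = Suc 0") (auto simp: concentrated_arity)

lemma null_concentrated_arity: "n \<noteq> Suc 0 \<Longrightarrow> null (arity C n)"
  by (simp add: concentrated_arity null_zero_ob)

lemma concentrated_act: "act C n \<sigma> = Id M (arity C n)"
  by (simp add: concentrated_operad_def Let_def)

lemma concentrated_unit [simp]: "opunit C = \<eta>"
  by (simp add: concentrated_operad_def Let_def)

lemma
  shows Ar_unit [simp]: "\<eta> \<in> Ar M" and Dom_unit [simp]: "Dom M \<eta> = unit M" and Cod_unit [simp]: "Cod M \<eta> = B"
    and Ar_mult [simp]: "\<mu> \<in> Ar M" and Dom_mult [simp]: "Dom M \<mu> = B \<otimes> B" and Cod_mult [simp]: "Cod M \<mu> = B"
  using unit_hom mult_hom by (auto simp: hom_iff)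

lemma concentrated_pcomp_1: "pcomp C (Suc 0) (Suc 0) i = \<mu>"
  by (simp add: concentrated_operad_def Let_def)

lemma concentrated_pcomp_hom: "pcomp C m n i \<in> hom M (arity C m \<otimes> arity C n) (arity C (m + n - 1))"
  by (auto simp: concentrated_operad_def Let_def hom_iff zero_ar_eq)

lemma concentrated_pcomp_typing [simp]:
  "pcomp C m n i \<in> Ar M" "Dom M (pcomp C m n i) = arity C m \<otimes> arity C n" "Cod M (pcomp C m n i) = arity C (m + n - 1)"
  using concentrated_pcomp_hom[of m n i] by (auto simp: hom_iff)

lemma concentrated_pcomp_index: "pcomp C m n i = pcomp C m n j"
  by (simp add: concentrated_operad_def)

lemma concentrated_sequential:
  assumes "i < l" "j < m"
  shows "pcomp C (l + m - 1) n (i + j) \<cdot> (pcomp C l m i \<boxtimes> Id M (arity C n))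
        = pcomp C l (m + n - 1) i \<cdot> arity C l \<rhd> pcomp C m n j \<cdot> assoc M (arity C l) (arity C m) (arity C n)"
proof (cases "l = Suc 0 \<and> m = Suc 0 \<and> n = Suc 0")
  case True
  then show ?thesis using mult_assoc by (simp add: concentrated_arity concentrated_pcomp_1)
next
  case False
  then have "null ((arity C l \<otimes> arity C m) \<otimes> arity C n)"
    using null_concentrated_arity null_tens by auto
  moreover have "l + m - 1 + n - 1 = l + (m + n - 1) - 1" using assms by simp
  ultimately show ?thesis by (elim null_dom_eq) (auto simp: hom_iff)
qed

text \<open>As soon as some arity differs from one, the source of the axiom is null and both sides
  agree. What is left in arity one are the monoid laws.\<close>

lemma operad_concentrated: "operad M C"
proof (unfold_locales, goal_cases)
  case (7 i m \<sigma> \<tau> n)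
  then show ?case using concentrated_pcomp_index[of m n i "\<sigma> i"] by (simp add: concentrated_act)
next
  case (8 n)
  show ?case
  proof (cases "n = Suc 0")
    case True
    then show ?thesis using mult_unit_left by (simp add: concentrated_arity concentrated_pcomp_1)
  next
    case False
    show ?thesis
      by (rule null_dom_eq[OF null_tens(2)[OF null_concentrated_arity[OF False] unit_Ob]]) (auto simp:
        hom_iff concentrated_arity)
  qed
next
  case (9 i m)
  show ?case
  proof (cases "m = Suc 0")
    case True
    then show ?thesis using mult_unit_right by (simp add: concentrated_arity concentrated_pcomp_1)
  next
    case False
    show ?thesis
      by (rule null_dom_eq[OF null_tens(1)[OF null_concentrated_arity[OF False] unit_Ob]]) (auto simp:
        hom_iff concentrated_arity)
  qed
next
  case (10 i l j m n)
  then show ?case by (rule concentrated_sequential)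
next
  case (11 i k l m n)
  then have "null (arity C l)" by (intro null_concentrated_arity) auto
  then have "null ((arity C l \<otimes> arity C m) \<otimes> arity C n)" by (intro null_tens) auto
  moreover have "l + m - 1 + n - 1 = l + n - 1 + m - 1" using 11 by simp
  ultimately show ?case by (elim null_dom_eq) (auto simp: hom_iff)
qed (auto simp: concentrated_act hom_iff concentrated_pcomp_hom concentrated_arity)

text \<open>The conditions on \<open>f\<close> say that it is a morphism of monoids in arity one. R
  is again only assumed to be well typed, with \<open>Coend\<close> in mind.\<close>

lemma operad_hom_from_concentrated:
  assumes R_Ob: "\<And>n. arity R n \<in> Ob M"
    and act: "\<And>n \<sigma>. \<sigma> permutes {..<n} \<Longrightarrow> act R n \<sigma> \<in> hom M (arity R n) (arity R n)"
    and pcomp: "\<And>m n i. i < m \<Longrightarrow> pcomp R m n i \<in> hom M (arity R m \<otimes> arity R n) (arity R (m + n - 1))"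
    and f: "f \<in> hom M B (arity R 1)" and unit: "f \<cdot> \<eta> = opunit R"
    and mult: "f \<cdot> \<mu> = pcomp R 1 1 0 \<cdot> (f \<boxtimes> f)" and act_1: "act R 1 id \<cdot> f = f"
  shows "operad_hom M C R (\<lambda>n. if n = 1 then f else zero_ar M (zero_ob M) (arity R n))"
proof -
  define g where "g = (\<lambda>n. if n = 1 then f else zero_ar M (zero_ob M) (arity R n))"
  have g: "g n \<in> hom M (arity C n) (arity R n)" for n
    using f R_Ob by (auto simp: concentrated_arity zero_ar_eq hom_iff g_def)
  have [simp]: "g n \<in> Ar M" "Dom M (g n) = arity C n" "Cod M (g n) = arity R n" for n
    using g[of n] by (auto simp: hom_iff)
  have g_1: "g (Suc 0) = f" by (simp add: g_def)
  have "operad_hom M C R g"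
    unfolding operad_hom_def
  proof (intro conjI allI impI)
    fix n and \<sigma> :: "nat \<Rightarrow> nat" assume s: "\<sigma> permutes {..<n}"
    have [simp]: "act R n \<sigma> \<in> Ar M" "Dom M (act R n \<sigma>) = arity R n" "Cod M (act R n \<sigma>) = arity R n"
      using act[OF s] by (auto simp: hom_iff)
    show "g n \<cdot> act C n \<sigma> = act R n \<sigma> \<cdot> g n"
    proof (cases "n = Suc 0")
      case True
      then have "\<sigma> = id" using s by (metis lessThan_Suc lessThan_0 permutes_sing)
      then show ?thesis using f act_1 True by (auto simp: concentrated_act concentrated_arity hom_iff g_1)
    next
      case False
      show ?thesis
        by (rule null_dom_eq[OF null_concentrated_arity[OF False]]) (auto simp: hom_iff concentrated_act)
    qed
  next
    fix m n i :: nat assume i: "i < m"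
    have [simp]: "pcomp R m n i \<in> Ar M" "Dom M (pcomp R m n i) = arity R m \<otimes> arity R n"
      "Cod M (pcomp R m n i) = arity R (m + n - 1)"
      using pcomp[OF i] by (auto simp: hom_iff)
    show "g (m + n - 1) \<cdot> pcomp C m n i = pcomp R m n i \<cdot> (g m \<boxtimes> g n)"
    proof (cases "m = Suc 0 \<and> n = Suc 0")
      case True
      then show ?thesis using mult i by (simp add: concentrated_pcomp_1 g_1)
    next
      case False
      then have "null (arity C m \<otimes> arity C n)"
        using null_concentrated_arity null_tens by auto
      then show ?thesis by (rule null_dom_eq) (auto simp: hom_iff)
    qed
  qed (use g unit in \<open>auto simp: g_1\<close>)
  then show ?thesis by (simp only: g_def)
qed

end

section \<open>The unit operad and its coalgebras\<close>

context pointed_closed_smc begin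

lemma concentrated_unit_operad: "concentrated M pl nul (unit M) (lunit M (unit M)) (Id M (unit M))"
proof (unfold_locales, goal_cases)
  case 6
  show ?case by (simp only: triangle'[OF unit_Ob unit_Ob] lunit_unit[symmetric])
qed (auto simp: hom_iff lunit_unit)

lemma operad_unit_operad: "operad M (unit_operad M)"
  unfolding unit_operad_eq by (rule concentrated.operad_concentrated[OF concentrated_unit_operad])

lemma concentrated_zero_ob: "concentrated M pl nul (zero_ob M) (nul (zero_ob M \<otimes> zero_ob M) (zero_ob M))
  (nul (unit M) (zero_ob M))"
  by unfold_locales (auto simp: hom_iff intro: null_cod_eq[OF null_zero_ob])

lemma operad_hom_to_zero:
  assumes "operad M P"
  defines "R \<equiv> concentrated_operad M (zero_ob M) (nul (zero_ob M \<otimes> zero_ob M) (zero_ob M)) (nul (unit M) (zero_ob M))"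
  shows "operad_hom M P R (\<lambda>n. nul (arity P n) (zero_ob M))"
proof -
  interpret P: operad M P by fact
  interpret R: concentrated M pl nul "zero_ob M" "nul (zero_ob M \<otimes> zero_ob M) (zero_ob M)" "nul (unit M) (zero_ob M)"
    by (rule concentrated_zero_ob)
  have R [simp]: "arity R n = zero_ob M" for n
    by (simp add: R_def concentrated_operad_def)
  have [simp]: "arity P n \<in> Ob M" for n by (rule P.arity_Ob)
  show ?thesis
    unfolding operad_hom_def
  proof (intro conjI allI impI)
    fix n and \<sigma> :: "nat \<Rightarrow> nat" assume s: "\<sigma> permutes {..<n}"
    show "nul (arity P n) (zero_ob M) \<cdot> act P n \<sigma> = act R n \<sigma> \<cdot> nul (arity P n) (zero_ob M)"
      using P.act_hom[OF s] R.concentrated_act[folded R_def] R by (simp add: hom_iff)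
  next
    fix m n i :: nat assume i: "i < m"
    show "nul (arity P (m + n - 1)) (zero_ob M) \<cdot> pcomp P m n i
        = pcomp R m n i \<cdot> (nul (arity P m) (zero_ob M) \<boxtimes> nul (arity P n) (zero_ob M))"
      by (rule null_cod_eq[OF null_zero_ob])
        (use P.pcomp_hom[OF i] R.concentrated_pcomp_typing[folded R_def] R in \<open>auto simp: hom_iff\<close>)
  qed (use P.opunit_hom R.concentrated_unit[folded R_def] in \<open>auto simp: hom_iff\<close>)
qed

abbreviation "U \<equiv> unit_operad M"

lemma unit_operad_arity: "arity U n = (if n = Suc 0 then unit M else zero_ob M)"
  by (simp add: unit_operad_def Let_def)

lemma opunit_unit_operad [simp]: "opunit U = Id M (unit M)"
  by (simp add: unit_operad_def Let_def)

lemma unit_operad_hom_1: "unit_operad_hom M R (Suc 0) = opunit R"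
  by (simp add: unit_operad_hom_def)

lemma unit_operad_hom_operad_hom:
  assumes "\<And>n. arity R n \<in> Ob M"
    and "\<And>n \<sigma>. \<sigma> permutes {..<n} \<Longrightarrow> act R n \<sigma> \<in> hom M (arity R n) (arity R n)"
    and "\<And>m n i. i < m \<Longrightarrow> pcomp R m n i \<in> hom M (arity R m \<otimes> arity R n) (arity R (m + n - 1))"
    and "opunit R \<in> hom M (unit M) (arity R 1)"
    and "opunit R \<cdot> lunit M (unit M) = pcomp R 1 1 0 \<cdot> (opunit R \<boxtimes> opunit R)"
    and "act R 1 id \<cdot> opunit R = opunit R"
  shows "operad_hom M U R (unit_operad_hom M R)"
  unfolding unit_operad_eq unit_operad_hom_def
  by (rule concentrated.operad_hom_from_concentrated[OF concentrated_unit_operad])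
    (use assms in \<open>auto simp: hom_iff\<close>)

lemma operad_hom_from_unit_operad:
  assumes "operad M P"
  shows "operad_hom M U P (unit_operad_hom M P)"
proof -
  interpret P: operad M P by fact
  have [simp]: "opunit P \<in> Ar M" "Dom M (opunit P) = unit M" "Cod M (opunit P) = arity P (Suc 0)"
    "arity P n \<in> Ob M" for n
    using P.opunit_hom P.arity_Ob by (auto simp: hom_iff)
  have [simp]: "pcomp P (Suc 0) (Suc 0) 0 \<in> Ar M" "Dom M (pcomp P (Suc 0) (Suc 0) 0)
    = arity P (Suc 0) \<otimes> arity P (Suc 0)"
    "Cod M (pcomp P (Suc 0) (Suc 0) 0) = arity P (Suc 0)"
    using P.pcomp_hom[of 0 "Suc 0" "Suc 0"] by (auto simp: hom_iff)
  have "opunit P \<cdot> lunit M (unit M) = lunit M (arity P (Suc 0)) \<cdot> unit M \<rhd> opunit P"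
    by (simp add: lunit_natural)
  also have "\<dots> = pcomp P (Suc 0) (Suc 0) 0 \<cdot> (opunit P \<boxtimes> Id M (arity P (Suc 0))) \<cdot> unit M \<rhd> opunit P"
    using P.pcomp_unit_left[of "Suc 0"] by (subst pre1) auto
  also have "\<dots> = pcomp P (Suc 0) (Suc 0) 0 \<cdot> (opunit P \<boxtimes> opunit P)"
    by (simp add: tens_Comp_tens)
  finally show ?thesis
    using P.act_hom P.pcomp_hom P.opunit_hom P.act_id[of "Suc 0"]
    by (intro unit_operad_hom_operad_hom) auto
qed

lemma Coend_arity: "arity (Coend M V) n = ihom M V (tpow M V n)"
  by (simp add: Coend_def Let_def)

lemma Coend_opunit: "opunit (Coend M V) = curry_ar M (unit M) V (V \<otimes> unit M) (ri V \<cdot> lunit M V)"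
  by (simp add: Coend_def Let_def)

lemma Coend_act_id_1: "V \<in> Ob M \<Longrightarrow> act (Coend M V) (Suc 0) id = Id M (ihom M V (V \<otimes> unit M))"
  by (simp add: Coend_def Let_def curry_eqI[symmetric])

text \<open>The identity of V is idempotent in \<open>Coend M V\<close>. This is the
  multiplicativity that turns the unit of \<open>Coend M V\<close> into a morphism from the unit
  operad.\<close>

lemma Coend_opunit_mult:
  assumes [simp]: "V \<in> Ob M"
  shows "opunit (Coend M V) \<cdot> lunit M (unit M) = pcomp (Coend M V) 1 1 0 \<cdot> (opunit (Coend M V) \<boxtimes> opunit (Coend M V))"
proof (rule curry_unique[where X = V and Y = "V \<otimes> unit M"])
  let ?I = "unit M" and ?E = "ihom M V (V \<otimes> unit M)" and ?e = "ev M V (V \<otimes> unit M)"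
  define \<eta> where "\<eta> = opunit (Coend M V)"
  have \<eta> [simp]: "\<eta> \<in> Ar M" "Dom M \<eta> = ?I" "Cod M \<eta> = ?E"
    by (auto simp: \<eta>_def Coend_opunit)
  have ev_\<eta>: "?e \<cdot> (\<eta> \<boxtimes> Id M V) = ri V \<cdot> lunit M V"
    by (simp add: \<eta>_def Coend_opunit ev_curry)
  have at: "ev_at M V (Suc 0) 0 (Suc 0) = (runit M V \<boxtimes> Id M ?I) \<cdot> (?e \<boxtimes> Id M ?I) \<cdot> ai ?E V ?I"
    by (simp add: Let_def pre1[OF triangle'])
  have at_\<eta>: "ev_at M V (Suc 0) 0 (Suc 0) \<cdot> (\<eta> \<boxtimes> Id M (V \<otimes> ?I)) = lunit M (V \<otimes> ?I)"
  proof -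
    have "ev_at M V (Suc 0) 0 (Suc 0) \<cdot> (\<eta> \<boxtimes> Id M (V \<otimes> ?I))
      = (runit M V \<boxtimes> Id M ?I) \<cdot> (?e \<boxtimes> Id M ?I) \<cdot> ai ?E V ?I \<cdot> (\<eta> \<boxtimes> (Id M V \<boxtimes> Id M ?I))"
      unfolding at by simp
    also have "\<dots> = (runit M V \<boxtimes> Id M ?I) \<cdot> ((?e \<cdot> (\<eta> \<boxtimes> Id M V)) \<boxtimes> Id M ?I) \<cdot> ai ?I V ?I"
      by (subst ai_natural[where X = ?I and Y = V and Z = ?I]) (auto simp: Comp_wh)
    also have "\<dots> = (lunit M V \<boxtimes> Id M ?I) \<cdot> ai ?I V ?I"
      unfolding ev_\<eta> by (subst pre1[OF tens_Comp_tens]) auto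
    also have "\<dots> = lunit M (V \<otimes> ?I)"
      by (simp add: lunit_tens[symmetric])
    finally show ?thesis .
  qed
  have ev_pcomp: "?e \<cdot> (pcomp (Coend M V) (Suc 0) (Suc 0) 0 \<boxtimes> Id M V)
    = ev_at M V (Suc 0) 0 (Suc 0) \<cdot> ?E \<rhd> ?e \<cdot> assoc M ?E ?E V \<cdot> (braid M ?E ?E \<boxtimes> Id M V)"
    using ev_at_typing[of V 0 0 "Suc 0"] by (simp add: Coend_def Let_def ev_curry)
  \<comment> \<open>The braiding acts on two copies of the unit, where it is the identity by
    \<open>braid_unit\<close>.\<close>
  have br: "(braid M ?E ?E \<boxtimes> Id M V) \<cdot> ((\<eta> \<boxtimes> \<eta>) \<boxtimes> Id M V) = (\<eta> \<boxtimes> \<eta>) \<boxtimes> Id M V"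
    by (simp add: tens_Comp_tens braid_natural[where X = ?I and Y = ?I] braid_unit)
  have pc [simp]: "pcomp (Coend M V) (Suc 0) (Suc 0) 0 \<in> Ar M" "Dom M (pcomp (Coend M V) (Suc 0) (Suc 0) 0) = ?E \<otimes> ?E"
    "Cod M (pcomp (Coend M V) (Suc 0) (Suc 0) 0) = ?E"
    using Coend_pcomp_hom[of V 0 "Suc 0" "Suc 0"] by (auto simp: hom_iff Coend_arity)
  have at_typing [simp]: "ev_at M V (Suc 0) 0 (Suc 0) \<in> Ar M" "Dom M (ev_at M V (Suc 0) 0 (Suc 0)) = ?E \<otimes> V \<otimes> ?I"
    "Cod M (ev_at M V (Suc 0) 0 (Suc 0)) = V \<otimes> ?I"
    using ev_at_typing[of V 0 0 "Suc 0"] by (auto simp del: ev_at.simps)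
  have "?e \<cdot> ((pcomp (Coend M V) (Suc 0) (Suc 0) 0 \<cdot> (\<eta> \<boxtimes> \<eta>)) \<boxtimes> Id M V)
    = ev_at M V (Suc 0) 0 (Suc 0) \<cdot> ?E \<rhd> ?e \<cdot> assoc M ?E ?E V \<cdot> ((\<eta> \<boxtimes> \<eta>) \<boxtimes> Id M V)"
    by (simp add: Comp_wh pre1[OF ev_pcomp] br del: ev_at.simps)
  also have "\<dots> = ev_at M V (Suc 0) 0 (Suc 0) \<cdot> (\<eta> \<boxtimes> (?e \<cdot> (\<eta> \<boxtimes> Id M V))) \<cdot> assoc M ?I ?I V"
    by (simp add: assoc_natural[where X = ?I and Y = ?I and Z = V] pre1[OF tens_Comp_tens] del: ev_at.simps)
  also have "\<dots> = ev_at M V (Suc 0) 0 (Suc 0) \<cdot> (\<eta> \<boxtimes> Id M (V \<otimes> ?I)) \<cdot> ?I \<rhd> (ri V \<cdot> lunit M V) \<cdot> assoc M ?I ?I V"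
    unfolding ev_\<eta> by (subst pre1[OF tens_Comp_tens]) (auto simp del: ev_at.simps)
  also have "\<dots> = lunit M (V \<otimes> ?I) \<cdot> ?I \<rhd> (ri V \<cdot> lunit M V) \<cdot> assoc M ?I ?I V"
    by (subst pre1[OF at_\<eta>]) (auto simp del: ev_at.simps)
  also have "\<dots> = (ri V \<cdot> lunit M V) \<cdot> lunit M (?I \<otimes> V) \<cdot> assoc M ?I ?I V"
    by (subst pre[OF lunit_natural]) auto
  also have "\<dots> = ri V \<cdot> lunit M V \<cdot> (lunit M ?I \<boxtimes> Id M V)"
    by (simp add: lunit_tens)
  also have "\<dots> = ?e \<cdot> ((\<eta> \<cdot> lunit M ?I) \<boxtimes> Id M V)"
    by (simp add: Comp_wh pre1[OF ev_\<eta>])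
  finally show "?e \<cdot> ((opunit (Coend M V) \<cdot> lunit M ?I) \<boxtimes> Id M V)
    = ?e \<cdot> ((pcomp (Coend M V) 1 1 0 \<cdot> (opunit (Coend M V) \<boxtimes> opunit (Coend M V))) \<boxtimes> Id M V)"
    by (simp add: \<eta>_def)
  show "opunit (Coend M V) \<cdot> lunit M (unit M) \<in> Ar M"
    "pcomp (Coend M V) 1 1 0 \<cdot> (opunit (Coend M V) \<boxtimes> opunit (Coend M V)) \<in> Ar M"
    "Cod M (pcomp (Coend M V) 1 1 0 \<cdot> (opunit (Coend M V) \<boxtimes> opunit (Coend M V))) = ihom M V (V \<otimes> unit M)"
    "Cod M (opunit (Coend M V) \<cdot> lunit M (unit M)) = ihom M V (V \<otimes> unit M)"
    "Dom M (opunit (Coend M V) \<cdot> lunit M (unit M)) = Dom M (pcomp (Coend M V) 1 1 0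
      \<cdot> (opunit (Coend M V) \<boxtimes> opunit (Coend M V)))"
    unfolding \<eta>_def[symmetric] by auto
qed auto

definition triv :: "'o \<Rightarrow> ('o, 'a) coalg" where
  "triv X = \<lparr>carr = X, coact = unit_operad_hom M (Coend M X)\<rparr>"

lemma carr_triv [simp]: "carr (triv X) = X"
  by (simp add: triv_def)

lemma is_coalg_triv:
  assumes [simp]: "X \<in> Ob M"
  shows "is_coalg M U (triv X)"
proof -
  have "operad_hom M U (Coend M X) (unit_operad_hom M (Coend M X))"
  proof (rule unit_operad_hom_operad_hom)
    show "act (Coend M X) 1 id \<cdot> opunit (Coend M X) = opunit (Coend M X)"
      by (simp add: Coend_act_id_1 Coend_opunit)
    show "arity (Coend M X) n \<in> Ob M" for n by (simp add: Coend_arity)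
  qed (auto simp: Coend_act_hom Coend_pcomp_hom Coend_opunit_hom Coend_opunit_mult simp del: One_nat_def)
  then show ?thesis by (simp add: is_coalg_def triv_def)
qed

text \<open>In arity one the structure is forced by the operad unit, and in the other arities it
  starts from a zero object. Coalgebras over the unit operad are therefore the same as objects of
  M.\<close>

lemma coalg_unit_operad_eq:
  assumes V: "is_coalg M U V"
  shows "V = triv (carr V)"
proof -
  have hom: "operad_hom M U (Coend M (carr V)) (coact V)" and [simp]: "carr V \<in> Ob M"
    using V by (auto simp: is_coalg_def)
  have "coact V n = unit_operad_hom M (Coend M (carr V)) n" for n
  proof (cases "n = Suc 0")
    case True
    have "coact V (Suc 0) \<cdot> Id M (unit M) = opunit (Coend M (carr V))"
      "coact V (Suc 0) \<in> hom M (unit M) (arity (Coend M (carr V)) (Suc 0))"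
      using hom unit_operad_arity[of "Suc 0"] by (auto simp: operad_hom_def) metis
    then show ?thesis by (simp add: True unit_operad_hom_1 hom_iff)
  next
    case False
    have "coact V n \<in> hom M (arity U n) (arity (Coend M (carr V)) n)"
      using hom by (simp add: operad_hom_def)
    then show ?thesis
      using False by (intro null_dom_eq[OF null_zero_ob])
       (auto simp: unit_operad_hom_def unit_operad_arity hom_iff zero_ar_eq Coend_arity)
  qed
  then show ?thesis
    by (cases V) (auto simp: triv_def)
qed

definition triv_map :: "'a \<Rightarrow> ('o, 'a) coalg_map" where
  "triv_map f = \<lparr>csrc = triv (Dom M f), ctgt = triv (Cod M f), cmap = f\<rparr>"

lemma cooperation_triv_1: "X \<in> Ob M \<Longrightarrow> cooperation M (triv X) (Suc 0) = ri X \<cdot> lunit M X"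
  by (simp add: cooperation_def triv_def unit_operad_hom_1 Coend_opunit ev_curry)

lemma cooperation_typing:
  assumes "is_coalg M R V" "arity R n \<in> Ob M"
  shows "cooperation M V n \<in> hom M (arity R n \<otimes> carr V) (tpow M (carr V) n)"
proof -
  have "coact V n \<in> hom M (arity R n) (ihom M (carr V) (tpow M (carr V) n))" "carr V \<in> Ob M"
    using assms by (auto simp: is_coalg_def operad_hom_def Coend_arity)
  then show ?thesis by (simp add: cooperation_def hom_iff)
qed

lemma is_coalg_map_triv_map:
  assumes [simp]: "f \<in> Ar M"
  shows "is_coalg_map M U (triv_map f)"
proof -
  have [simp]: "tpow_map M f n \<in> Ar M \<and> Dom M (tpow_map M f n) = tpow M (Dom M f) n \<and> Cod M (tpow_map M f n)
    = tpow M (Cod M f) n" for n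
    by (induction n) auto
  have "tpow_map M f n \<cdot> cooperation M (triv (Dom M f)) n = cooperation M (triv (Cod M f)) n
    \<cdot> (Id M (arity U n) \<boxtimes> f)" for n
  proof (cases "n = Suc 0")
    case True
    then show ?thesis
      by (simp add: cooperation_triv_1 unit_operad_arity lunit_natural[where X' = "Cod M f" and X = "Dom M f"]
        pre[OF ri_natural[OF assms refl refl]])
  next
    case False
    have "null (arity U n \<otimes> Dom M f)"
      using False by (simp add: null_tens null_zero_ob unit_operad_arity)
    then show ?thesis
      using cooperation_typing[OF is_coalg_triv, of "Dom M f" n] cooperation_typing[OF is_coalg_triv, of
        "Cod M f" n] False
      by (elim null_dom_eq) (auto simp: hom_iff unit_operad_arity)
  qed
  then show ?thesis
    by (simp add: is_coalg_map_def triv_map_def is_coalg_triv hom_iff)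
qed

end

section \<open>Sanity from epimorphisms out of coalgebras\<close>

lemma right_adjointE:
  assumes "right_adjoint C D F G"
  obtains \<epsilon> where "is_functor D C G"
    and "\<And>Y. Y \<in> Ob D \<Longrightarrow> \<epsilon> Y \<in> hom D (fob F (fob G Y)) Y"
    and "\<And>Y Z g. g \<in> hom D Y Z \<Longrightarrow> \<epsilon> Z \<cdot>\<^bsub>D\<^esub> far F (far G g) = g \<cdot>\<^bsub>D\<^esub> \<epsilon> Y"
    and "\<And>X Y f. X \<in> Ob C \<Longrightarrow> Y \<in> Ob D \<Longrightarrow> f \<in> hom D (fob F X) Y
      \<Longrightarrow> \<exists>!g. g \<in> hom C X (fob G Y) \<and> \<epsilon> Y \<cdot>\<^bsub>D\<^esub> far F g = f"
proof -
  have G: "is_functor D C G"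
    and ex: "\<exists>\<epsilon>. (\<forall>Y \<in> Ob D. \<epsilon> Y \<in> hom D (fob F (fob G Y)) Y)
      \<and> (\<forall>Y Z. \<forall>g \<in> hom D Y Z. \<epsilon> Z \<cdot>\<^bsub>D\<^esub> far F (far G g) = g \<cdot>\<^bsub>D\<^esub> \<epsilon> Y)
      \<and> (\<forall>X \<in> Ob C. \<forall>Y \<in> Ob D. \<forall>f \<in> hom D (fob F X) Y. \<exists>!g. g \<in> hom C X (fob G Y) \<and> \<epsilon> Y \<cdot>\<^bsub>D\<^esub> far F g = f)"
    using assms by (simp_all only: right_adjoint_def)
  from ex obtain \<epsilon> where "\<forall>Y \<in> Ob D. \<epsilon> Y \<in> hom D (fob F (fob G Y)) Y"
    "\<forall>Y Z. \<forall>g \<in> hom D Y Z. \<epsilon> Z \<cdot>\<^bsub>D\<^esub> far F (far G g) = g \<cdot>\<^bsub>D\<^esub> \<epsilon> Y"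
    "\<forall>X \<in> Ob C. \<forall>Y \<in> Ob D. \<forall>f \<in> hom D (fob F X) Y. \<exists>!g. g \<in> hom C X (fob G Y) \<and> \<epsilon> Y \<cdot>\<^bsub>D\<^esub> far F g = f"
    by (elim exE conjE)
  then show thesis
    by (intro that[OF G]) blast+
qed

lemma Coalg_hom_iff: "h \<in> hom (Coalg M P) V W \<longleftrightarrow> is_coalg_map M P h \<and> csrc h = V \<and> ctgt h = W"
  by (auto simp: hom_def Coalg_def)

lemma Coalg_simps:
  "V \<in> Ob (Coalg M P) \<longleftrightarrow> is_coalg M P V"
  "csrc (Id (Coalg M P) V) = V" "ctgt (Id (Coalg M P) V) = V" "cmap (Id (Coalg M P) V) = Id M (carr V)"
  "csrc (g \<cdot>\<^bsub>Coalg M P\<^esub> f) = csrc f" "ctgt (g \<cdot>\<^bsub>Coalg M P\<^esub> f) = ctgt g" "cmap (g \<cdot>\<^bsub>Coalg M P\<^esub> f) = cmap g \<cdot>\<^bsub>M\<^esub> cmap f"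
  by (auto simp: Coalg_def)

lemma Forget_simps [simp]: "fob Forget = carr" "far Forget = cmap"
  by (auto simp: Forget_def)

lemma Restrict_simps:
  "fob (Restrict M f) V = restrict_coalg M f V"
  "csrc (far (Restrict M f) h) = restrict_coalg M f (csrc h)" "ctgt (far (Restrict M f) h)
    = restrict_coalg M f (ctgt h)"
  "cmap (far (Restrict M f) h) = cmap h"
  by (auto simp: Restrict_def)

lemma coalg_map_eqI: "csrc g = csrc h \<Longrightarrow> ctgt g = ctgt h \<Longrightarrow> cmap g = cmap h \<Longrightarrow> g = h"
  for g h :: "('o, 'a) coalg_map"
  by simp

lemma carr_restrict_coalg [simp]: "carr (restrict_coalg M f V) = carr V"
  by (simp add: restrict_coalg_def)

context pointed_closed_smc begin

lemma is_functor_Forget: "is_functor (Coalg M P) M Forget"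
  unfolding is_functor_def
  by (auto simp: Coalg_hom_iff Coalg_simps is_coalg_map_def is_coalg_def)

lemma triv_map_hom: "f \<in> hom M X Y \<Longrightarrow> triv_map f \<in> hom (Coalg M U) (triv X) (triv Y)"
  using is_coalg_map_triv_map[of f] by (auto simp: Coalg_hom_iff hom_iff triv_map_def)

lemma triv_map_Id: "triv_map (Id M X) = Id (Coalg M U) (triv X)"
  by (simp add: triv_map_def Coalg_def)

lemma triv_map_Comp: "triv_map (g \<cdot> f) = triv_map g \<cdot>\<^bsub>Coalg M U\<^esub> triv_map f"
  by (simp add: triv_map_def Coalg_def)

text \<open>The standing assumption concerns restriction functors, while \<open>Cofree\<close> is
  adjoint to \<open>Forget\<close>. Restriction along the unit is \<open>Forget\<close> followed by
  \<open>triv\<close>, so its adjoint, precomposed with \<open>triv\<close>, is adjoint to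
  \<open>Forget\<close>.\<close>

lemma right_adjoint_Forget:
  assumes P: "operad M P" and adj: "right_adjoint (Coalg M P) (Coalg M U) (Restrict M (unit_operad_hom M P)) G"
  shows "right_adjoint (Coalg M P) M Forget \<lparr>fob = fob G \<circ> triv, far = far G \<circ> triv_map\<rparr>"
    (is "right_adjoint _ _ _ ?G")
proof (rule right_adjointE[OF adj])
  let ?R = "Restrict M (unit_operad_hom M P)" and ?U = "Coalg M U" and ?P = "Coalg M P"
  fix \<epsilon> assume G: "is_functor ?U ?P G"
    and \<epsilon>: "\<And>Y. Y \<in> Ob ?U \<Longrightarrow> \<epsilon> Y \<in> hom ?U (fob ?R (fob G Y)) Y"
    and nat: "\<And>Y Z g. g \<in> hom ?U Y Z \<Longrightarrow> \<epsilon> Z \<cdot>\<^bsub>?U\<^esub> far ?R (far G g) = g \<cdot>\<^bsub>?U\<^esub> \<epsilon> Y"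
    and univ: "\<And>X Y f. X \<in> Ob ?P \<Longrightarrow> Y \<in> Ob ?U \<Longrightarrow> f \<in> hom ?U (fob ?R X) Y \<Longrightarrow> \<exists>!g. g \<in> hom ?P X (fob G Y)
      \<and> \<epsilon> Y \<cdot>\<^bsub>?U\<^esub> far ?R g = f"
  have triv_Ob: "X \<in> Ob M \<Longrightarrow> triv X \<in> Ob ?U" for X
    by (simp add: Coalg_simps is_coalg_triv)
  have "is_functor M ?P ?G"
    using G triv_map_hom unfolding is_functor_def by (auto simp: triv_Ob triv_map_Id triv_map_Comp) blast
  moreover have "cmap (\<epsilon> (triv Y)) \<in> hom M (carr (fob ?G Y)) Y" if "Y \<in> Ob M" for Y
    using \<epsilon>[OF triv_Ob[OF that]] by (auto simp: Coalg_hom_iff is_coalg_map_def Restrict_simps)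
  moreover have "cmap (\<epsilon> (triv Z)) \<cdot> cmap (far ?G g) = g \<cdot> cmap (\<epsilon> (triv Y))" if "g \<in> hom M Y Z" for Y Z g
    using arg_cong[OF nat[OF triv_map_hom[OF that]], of cmap]
      by (simp add: Coalg_simps Restrict_simps) (simp add: triv_map_def)
  moreover have "\<exists>!g. g \<in> hom ?P X (fob ?G Y) \<and> cmap (\<epsilon> (triv Y)) \<cdot> cmap g = f"
    if X: "X \<in> Ob ?P" and Y: "Y \<in> Ob M" and f: "f \<in> hom M (carr X) Y" for X Y f
  proof -
    have "is_coalg M U (restrict_coalg M (unit_operad_hom M P) X)"
      using X by (intro restrict_coalg_is_coalg[OF operad_unit_operad P operad_hom_from_unit_operad[OF P]])
        (simp add: Coalg_simps)
    from coalg_unit_operad_eq[OF this] have R: "fob ?R X = triv (carr X)"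
      by (simp add: Restrict_simps)
    have "\<exists>!g. g \<in> hom ?P X (fob G (triv Y)) \<and> \<epsilon> (triv Y) \<cdot>\<^bsub>?U\<^esub> far ?R g = triv_map f"
      using triv_map_hom[OF f] by (intro univ[OF X triv_Ob[OF Y]]) (simp add: R)
    \<comment> \<open>Maps of trivial coalgebras are determined by their underlying maps, so the two
      universal properties single out the same \<open>g\<close>.\<close>
    moreover have "\<epsilon> (triv Y) \<cdot>\<^bsub>?U\<^esub> far ?R g = triv_map f \<longleftrightarrow> cmap (\<epsilon> (triv Y)) \<cdot> cmap g = f"
      if g: "g \<in> hom ?P X (fob G (triv Y))" for g
    proof
      assume "\<epsilon> (triv Y) \<cdot>\<^bsub>?U\<^esub> far ?R g = triv_map f"
      then show "cmap (\<epsilon> (triv Y)) \<cdot> cmap g = f"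
        by (metis Coalg_simps(7) Restrict_simps(4) triv_map_def coalg_map.select_convs(3))
    next
      assume "cmap (\<epsilon> (triv Y)) \<cdot> cmap g = f"
      then show "\<epsilon> (triv Y) \<cdot>\<^bsub>?U\<^esub> far ?R g = triv_map f"
        using g f \<epsilon>[OF triv_Ob[OF Y]] R
        by (intro coalg_map_eqI) (auto simp: Coalg_simps Restrict_simps Coalg_hom_iff triv_map_def hom_iff)
    qed
    ultimately show ?thesis by auto
  qed
  ultimately show ?thesis
    unfolding right_adjoint_def using is_functor_Forget
    by (intro conjI exI[of _ "\<lambda>Y. cmap (\<epsilon> (triv Y))"] allI ballI) auto
qed

text \<open>Naturality of the counit makes two maps with equal images under \<open>Cofree\<close>
  agree after the counit, hence after any map from a P-coalgebra, which factors through it. One such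
  map is epi.\<close>

lemma sane_if_onto:
  assumes adj: "right_adjoint (Coalg M P) M Forget G"
    and onto: "\<And>X. X \<in> Ob M \<Longrightarrow> \<exists>V f. is_coalg M P V \<and> f \<in> hom M (carr V) X \<and> Defs.epi M f"
  shows "sane M P"
proof -
  let ?C = "Cofree M P"
  have "right_adjoint (Coalg M P) M Forget ?C"
    \<comment> \<open>\<open>Cofree\<close> is an arbitrary choice among right adjoints, and the
      existence of G makes the choice meaningful.\<close>
    unfolding Cofree_def using adj by (rule someI)
  then show ?thesis
  proof (rule right_adjointE, unfold Forget_simps)
    fix \<epsilon> assume C: "is_functor M (Coalg M P) ?C"
      and \<epsilon>: "\<And>Y. Y \<in> Ob M \<Longrightarrow> \<epsilon> Y \<in> hom M (carr (fob ?C Y)) Y"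
      and nat: "\<And>Y Z g. g \<in> hom M Y Z \<Longrightarrow> \<epsilon> Z \<cdot> cmap (far ?C g) = g \<cdot> \<epsilon> Y"
      and univ: "\<And>X Y f. X \<in> Ob (Coalg M P) \<Longrightarrow> Y \<in> Ob M \<Longrightarrow> f \<in> hom M (carr X) Y
        \<Longrightarrow> \<exists>!g. g \<in> hom (Coalg M P) X (fob ?C Y) \<and> \<epsilon> Y \<cdot> cmap g = f"
    have "f = g" if X: "X \<in> Ob M" and f: "f \<in> hom M X Y" "g \<in> hom M X Y" and eq: "far ?C f = far ?C g" for X Y f g
    proof -
      obtain V e where V: "is_coalg M P V" "e \<in> hom M (carr V) X" "Defs.epi M e"
        using onto[OF X] by blast
      obtain h where h: "h \<in> hom (Coalg M P) V (fob ?C X)" "\<epsilon> X \<cdot> cmap h = e"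
        using ex1_implies_ex[OF univ[OF _ X V(2)]] V(1) by (auto simp: Coalg_simps)
      have [simp]: "cmap h \<in> Ar M" "Cod M (cmap h) = carr (fob ?C X)" "\<epsilon> X \<in> Ar M" "Dom M (\<epsilon> X)
        = carr (fob ?C X)" "Cod M (\<epsilon> X) = X"
        using h(1) \<epsilon>[OF X] by (auto simp: Coalg_hom_iff is_coalg_map_def hom_iff)
      have "f \<cdot> \<epsilon> X = g \<cdot> \<epsilon> X"
        using nat[OF f(1)] nat[OF f(2)] eq by simp
      then have "(f \<cdot> \<epsilon> X) \<cdot> cmap h = (g \<cdot> \<epsilon> X) \<cdot> cmap h" by simp
      then have "f \<cdot> e = g \<cdot> e"
        using f h(2) by (simp add: hom_iff)
      then show ?thesis
        using V f Cod_Ob[of f] unfolding epi_def by (auto simp: hom_iff)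
    qed
    then show ?thesis
      unfolding sane_def faithful_def inj_on_def using C by blast
  qed
qed

proposition sane_if_epi:
  assumes P: "operad M P" and Q: "operad M Q" and f: "operad_hom M P Q f"
    and dual: "dualisable M (arity Q 0)"
    and epi: "\<And>X. X \<in> Ob M \<Longrightarrow> Defs.epi M (ev M (arity Q 1) X \<cdot> ihom M (arity Q 1) X \<rhd> opunit Q
      \<cdot> ri (ihom M (arity Q 1) X))"
    and adj: "right_adjoint (Coalg M P) (Coalg M U) (Restrict M (unit_operad_hom M P)) G"
  shows "sane M P"
proof (rule sane_if_onto[OF right_adjoint_Forget[OF P adj]])
  fix X assume "X \<in> Ob M"
  then obtain V g where "is_coalg M Q V" "g \<in> hom M (carr V) X" "Defs.epi M g"
    using coalgebra_onto[OF Q dual _ epi] by blast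
  then show "\<exists>V f. is_coalg M P V \<and> f \<in> hom M (carr V) X \<and> Defs.epi M f"
    using restrict_coalg_is_coalg[OF P Q f] by (intro exI[of _ "restrict_coalg M f V"]) auto
qed

end

section \<open>Disks and evaluation at the unit\<close>

context chain_base begin

definition disk :: "int \<Rightarrow> 'o \<Rightarrow> ('o, 'a) chain" where
  "disk k N = (let D = (\<lambda>n. if n = k \<or> n = k - 1 then N else zero_ob A)
     in \<lparr>deg = D, diff = (\<lambda>n. if n = k then Id A N else hzero A (D n) (D (n - 1)))\<rparr>)"

lemma disk_deg [simp]: "deg (disk k N) k = N" "deg (disk k N) (k - 1) = N" "n \<noteq> k \<Longrightarrow> n \<noteq> k - 1
  \<Longrightarrow> deg (disk k N) n = zero_ob A"
  by (auto simp: disk_def Let_def)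

lemma disk_diff: "diff (disk k N) k = Id A N" "n \<noteq> k \<Longrightarrow> diff (disk k N) n
  = hzero A (deg (disk k N) n) (deg (disk k N) (n - 1))"
  by (auto simp: disk_def Let_def)

lemma is_chain_disk [simp]:
  assumes [simp]: "N \<in> Ob A"
  shows "is_chain A (disk k N)"
proof -
  have [simp]: "deg (disk k N) n \<in> Ob A" for n by (auto simp: disk_def Let_def)
  have [simp]: "diff (disk k N) n \<in> Ar A \<and> Dom A (diff (disk k N) n) = deg (disk k N) n
    \<and> Cod A (diff (disk k N) n) = deg (disk k N) (n - 1)" for n
    by (cases "n = k") (auto simp: disk_diff)
  have "diff (disk k N) (n - 1) \<cdot> diff (disk k N) n = hzero A (deg (disk k N) n) (deg (disk k N) (n - 2))" for n
    by (cases "n = k") (auto simp: disk_diff(2))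
  then show ?thesis by (auto simp: is_chain_def hom_iff)
qed

lemma disk_null:
  assumes "p \<noteq> k" "p \<noteq> k - 1" "f \<in> Ar A" "g \<in> Ar A" "Dom A f = deg (disk k N) p \<otimes> Y"
    "Dom A g = deg (disk k N) p \<otimes> Y" "Cod A f = Cod A g" "Y \<in> Ob A"
  shows "f = g"
  using assms by (intro from_zero_tens[of f g Y]) auto

text \<open>The components \<open>a q\<close> on the top degree of the disk are free; those on the
  lower degree are then forced.\<close>

lemma disk_tens_desc:
  assumes [simp]: "N \<in> Ob A" "is_chain A X" "is_chain A Y"
    and a: "\<And>q. a q \<in> hom A (N \<otimes> deg X q) (deg Y (k + q))"
  obtains \<phi> where "is_chmap A \<phi>" "src \<phi> = T (disk k N) X" "tgt \<phi> = Y"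
    "\<And>q. at \<phi> (k + q) \<cdot> t (disk k N) X k q = a q"
    "\<And>q. at \<phi> (k - 1 + q) \<cdot> t (disk k N) X (k - 1) q = (diff Y (k + q) \<cdot> a q) \<oplus> signed A (k + 1) (a (q - 1)
      \<cdot> (Id A N \<boxtimes> diff X q))"
proof -
  let ?D = "disk k N"
  note [simp] = a[unfolded hom_iff, THEN conjunct1] a[unfolded hom_iff, THEN conjunct2, THEN conjunct1]
    a[unfolded hom_iff, THEN conjunct2, THEN conjunct2]
  \<comment> \<open>Solved from compatibility with the differential on
    \<open>N \<otimes> deg X q\<close>, with N in degree k: \<open>d a = c + (-1)^k a d\<close>.
    This explains the exponent \<open>k + 1\<close>.\<close>
  define c where "c q = (diff Y (k + q) \<cdot> a q) \<oplus> signed A (k + 1) (a (q - 1) \<cdot> (Id A N \<boxtimes> diff X q))" for q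
  have c [simp]: "c q \<in> Ar A" "Dom A (c q) = N \<otimes> deg X q" "Cod A (c q) = deg Y (k + q - 1)" for q
    by (auto simp: c_def)
  define \<kappa> where "\<kappa> n p = (if p = k then a (n - p) else
    if p = k - 1 then c (n - p) else hzero A (deg ?D p \<otimes> deg X (n - p)) (deg Y n))" for n p
  have \<kappa> [simp]: "\<kappa> n p \<in> Ar A" "Dom A (\<kappa> n p) = deg ?D p \<otimes> deg X (n - p)" "Cod A (\<kappa> n p) = deg Y n" for n p
    by (auto simp: \<kappa>_def)
  define \<phi> where "\<phi> = \<lparr>src = T ?D X, tgt = Y, at = (\<lambda>n. copair A (tens_summand A ?D X n) (deg Y n) (\<kappa> n))\<rparr>"
  have \<phi> [simp]: "src \<phi> = T ?D X" "tgt \<phi> = Y" "at \<phi> n \<in> Ar A" "Dom A (at \<phi> n) = deg (T ?D X) n"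
    "Cod A (at \<phi> n) = deg Y n" for n
    unfolding \<phi>_def by (auto simp: copair_tens)
  have \<phi>_inj: "n = p + q \<Longrightarrow> at \<phi> n \<cdot> t ?D X p q = \<kappa> n p" for n p q
    unfolding \<phi>_def by (simp add: copair_tens)
  have \<phi>_k: "n = k + q \<Longrightarrow> at \<phi> n \<cdot> t ?D X k q = a q" for n q
    by (simp add: \<phi>_inj \<kappa>_def)
  have \<phi>_k1: "n = k + q - 1 \<Longrightarrow> at \<phi> n \<cdot> t ?D X (k - 1) q = c q" for n q
    by (simp add: \<phi>_inj \<kappa>_def)
  have "is_chmap A \<phi>"
  proof (rule is_chmapI)
    fix n
    have "diff Y n \<cdot> at \<phi> n = at \<phi> (n - 1) \<cdot> diff (T ?D X) n"
    proof (rule ch_tens_ext)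
      fix p q assume n: "n = p + q"
      consider "p = k" | "p = k - 1" | "p \<noteq> k" "p \<noteq> k - 1" by auto
      then show "(diff Y n \<cdot> at \<phi> n) \<cdot> t ?D X p q = (at \<phi> (n - 1) \<cdot> diff (T ?D X) n) \<cdot> t ?D X p q"
      proof cases
        case 1
        have "at \<phi> (n - 1) \<cdot> diff (T ?D X) n \<cdot> t ?D X k q = c q \<oplus> signed A k (a (q - 1) \<cdot> (Id A N \<boxtimes> diff X q))"
          by (simp add: n 1 diff_tens_inj disk_diff Comp_hadd Comp_signed \<phi>_k1 pre1[OF \<phi>_k])
        also have "\<dots> = diff Y (k + q) \<cdot> a q"
          by (simp add: c_def hadd_associative signed_cancel)
        finally show ?thesis by (simp add: n 1 \<phi>_k)
      next
        case 2
        have "at \<phi> (n - 1) \<cdot> diff (T ?D X) n \<cdot> t ?D X (k - 1) q = signed A (k - 1) (c (q - 1) \<cdot> (Id A N \<boxtimes> diff X q))"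
          by (simp add: n 2 diff_tens_inj disk_diff Comp_hadd Comp_signed pre1[OF \<phi>_k1])
        also have "\<dots> = signed A (k - 1) (diff Y (k + q - 1) \<cdot> a (q - 1) \<cdot> (Id A N \<boxtimes> diff X q))"
          by (simp add: c_def hadd_Comp signed_Comp tens_Comp_tens diff_diff)
        also have "\<dots> = diff Y (k + q - 1) \<cdot> c q"
          by (simp add: c_def Comp_hadd Comp_signed pre1[OF diff_diff] signed_cong[of "k - 1" "k + 1"])
        finally show ?thesis by (simp add: n 2 \<phi>_k1)
      next
        case 3
        then show ?thesis by (intro disk_null[of p k _ _ N "deg X q"]) (auto simp: n)
      qed
    qed auto
    then show "diff (tgt \<phi>) n \<cdot> at \<phi> n = at \<phi> (n - 1) \<cdot> diff (src \<phi>) n" by simp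
  qed auto
  then show thesis
    by (rule that) (auto simp: \<phi>_k \<phi>_k1 c_def)
qed

lemma epiD:
  assumes "epi A f" "g \<cdot> f = h \<cdot> f" "g \<in> Ar A" "h \<in> Ar A" "Dom A g = Cod A f" "Dom A h = Cod A f" "Cod A g = Cod A h"
  shows "g = h"
  using assms(1,2) bspec[of "Ob A" _ "Cod A g"] assms(3-) unfolding epi_def by (metis Cod_Ob hom_iff)

lemma epi_ChI:
  assumes [simp]: "is_chmap A f" and epi: "\<And>n. epi A (at f n)"
  shows "epi (Ch A) f"
  unfolding epi_def
proof (intro conjI ballI impI)
  fix Z g h assume "Z \<in> Ob (Ch A)" and gh: "g \<in> hom (Ch A) (Cod (Ch A) f) Z" "h \<in> hom (Ch A) (Cod (Ch A) f) Z"
    and eq: "g \<cdot>\<^bsub>Ch A\<^esub> f = h \<cdot>\<^bsub>Ch A\<^esub> f"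
  then have [simp]: "is_chmap A g" "is_chmap A h" "src g = tgt f" "src h = tgt f" "tgt g = Z" "tgt h = Z"
    "is_chain A Z"
    by (auto simp: ch_hom_iff)
  have "at g n = at h n" for n
    by (rule epiD[OF epi[of n]]) (use arg_cong[OF eq, of "\<lambda>f. at f n"] in auto)
  then show "g = h" by (intro chmap_eqI) auto
qed auto

lemma split_epi:
  assumes [simp]: "f \<in> Ar A" "s \<in> Ar A" "Dom A s = Cod A f" "Cod A s = Dom A f" and "f \<cdot> s = Id A (Cod A f)"
  shows "epi A f"
  unfolding epi_def
proof (intro conjI ballI impI)
  fix Z g h assume gh: "g \<in> hom A (Cod A f) Z" "h \<in> hom A (Cod A f) Z" and "g \<cdot> f = h \<cdot> f"
  then have "(g \<cdot> f) \<cdot> s = (h \<cdot> f) \<cdot> s" by simp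
  then show "g = h" using gh assms by (simp add: hom_iff)
qed auto

definition zero_chain :: "('o, 'a) chain" where
  "zero_chain = \<lparr>deg = (\<lambda>n. zero_ob A), diff = (\<lambda>n. hzero A (zero_ob A) (zero_ob A))\<rparr>"

lemma is_zero_ob_Ch: "is_zero_ob (Ch A) zero_chain"
proof -
  have [simp]: "is_chain A zero_chain" "deg zero_chain n = zero_ob A" for n
    by (auto simp: zero_chain_def is_chain_def hom_iff)
  have "f = ch_zero A zero_chain X" if "is_chmap A f" "src f = zero_chain" "tgt f = X" "is_chain A X" for f X
    using that by (intro chmap_eqI from_zero_unique) auto
  moreover have "f = ch_zero A X zero_chain" if "is_chmap A f" "tgt f = zero_chain" "src f = X" "is_chain A X" for f X
    using that by (intro chmap_eqI to_zero_unique) auto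
  ultimately have "\<exists>!f. f \<in> hom (Ch A) zero_chain X" "\<exists>!f. f \<in> hom (Ch A) X zero_chain" if "is_chain A X" for X
    using that by (intro ex1I[of _ "ch_zero A zero_chain X"] ex1I[of _ "ch_zero A X zero_chain"]; simp add:
      ch_hom_iff)+
  then show ?thesis
    by (simp add: is_zero_ob_def)
qed

end

sublocale closed_chain_base \<subseteq> Ch: pointed_closed_smc "Ch A" "ch_add A" "ch_zero A"
  by unfold_locales (use is_zero_ob_Ch in auto)

context closed_chain_base begin

lemma null_deg: "Ch.null X \<Longrightarrow> Id A (deg X n) = hzero A (deg X n) (deg X n)"
  unfolding Ch.null_def by (metis Ch_Id(3) ch_zero_simps(3))

text \<open>Maps out of \<open>disk k N\<close> detect degree \<open>k\<close>, and a map from \<open>disk k N \<otimes> B\<close> is a family of maps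
  from \<open>N \<otimes> B\<^sub>q\<close>; so every map from \<open>N\<close> to \<open>X\<^sub>k\<close> factors through evaluation at the unit.\<close>

lemma epi_ev_unit:
  assumes [simp]: "is_chain A B" "is_chain A X" "is_chmap A \<eta>" "src \<eta> = ch_unit A" "tgt \<eta> = B"
    and split: "split_mono A (at \<eta> 0)"
  shows "epi (Ch A) (ev (Ch A) B X \<cdot>\<^bsub>Ch A\<^esub> Ch.wh (ihom (Ch A) B X) \<eta> \<cdot>\<^bsub>Ch A\<^esub> Ch.ri (ihom (Ch A) B X))"
    (is "epi _ ?e")
proof (rule epi_ChI)
  let ?H = "ihom (Ch A) B X"
  have [simp]: "?H \<in> Ob (Ch A)" "X \<in> Ob (Ch A)" "B \<in> Ob (Ch A)" "\<eta> \<in> Ar (Ch A)" "Dom (Ch A) \<eta> = unit (Ch A)"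
    "Cod (Ch A) \<eta> = B"
    using Ch.ihom_Ob[of B X] by auto
  have e: "?e \<in> Ar (Ch A)" "Dom (Ch A) ?e = ?H" "Cod (Ch A) ?e = X"
    by (simp_all del: Ch_simps)
  then show "is_chmap A ?e" by simp
  obtain r where r [simp]: "r \<in> Ar A" "Dom A r = deg B 0" "Cod A r = unit A" "r \<cdot> at \<eta> 0 = Id A (unit A)"
    using split by (auto simp: split_mono_def hom_iff)
  fix k
  let ?N = "deg X k" and ?D = "disk k (deg X k)"
  \<comment> \<open>The retraction \<open>r\<close> of the unit, extended by zero to the other
    degrees of B. It need not respect the differential of B, since the lower degree of the disk
    absorbs the defect.\<close>
  define a where "a q = (if q = 0 then runit A ?N \<cdot> (Id A ?N \<boxtimes> r) else hzero A (?N \<otimes> deg B q) (deg X (k + q)))" for q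
  obtain \<phi> where \<phi> [simp]: "is_chmap A \<phi>" "src \<phi> = T ?D B" "tgt \<phi> = X" "\<And>q. at \<phi> (k + q) \<cdot> t ?D B k q = a q"
    by (rule disk_tens_desc[of ?N B X a k]) (auto simp: a_def hom_iff)
  have [simp]: "\<phi> \<in> Ar (Ch A)" "Dom (Ch A) \<phi> = tensO (Ch A) ?D B" "Cod (Ch A) \<phi> = X" "?D \<in> Ob (Ch A)" by auto
  let ?g = "curry_ar (Ch A) ?D B X \<phi>"
  have g: "?g \<in> Ar (Ch A)" "Dom (Ch A) ?g = ?D" "Cod (Ch A) ?g = ?H" by (simp_all del: Ch_simps)
  \<comment> \<open>Evaluating the curried map at the unit restricts \<open>\<phi>\<close> along
    \<open>\<eta>\<close>, which in degree k leaves \<open>r \<cdot> at \<eta> 0\<close>, the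
    identity.\<close>
  have "?e \<cdot>\<^bsub>Ch A\<^esub> ?g = \<phi> \<cdot>\<^bsub>Ch A\<^esub> Ch.wh ?D \<eta> \<cdot>\<^bsub>Ch A\<^esub> Ch.ri ?D"
  proof -
    have "?e \<cdot>\<^bsub>Ch A\<^esub> ?g = ev (Ch A) B X \<cdot>\<^bsub>Ch A\<^esub> Ch.wh ?H \<eta> \<cdot>\<^bsub>Ch A\<^esub> tensA (Ch A) ?g (Id (Ch A) (unit (Ch A)))
      \<cdot>\<^bsub>Ch A\<^esub> Ch.ri ?D"
      by (simp add: Ch.ri_natural[of ?g ?D ?H] del: Ch_simps)
    also have "\<dots> = ev (Ch A) B X \<cdot>\<^bsub>Ch A\<^esub> tensA (Ch A) ?g (Id (Ch A) B) \<cdot>\<^bsub>Ch A\<^esub> Ch.wh ?D \<eta> \<cdot>\<^bsub>Ch A\<^esub> Ch.ri ?D"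
      by (simp add: Ch.pre[OF Ch.tens_swap[symmetric, of ?g \<eta> ?D ?H "unit (Ch A)" B]] del: Ch_simps)
    also have "\<dots> = \<phi> \<cdot>\<^bsub>Ch A\<^esub> Ch.wh ?D \<eta> \<cdot>\<^bsub>Ch A\<^esub> Ch.ri ?D"
      by (simp add: Ch.pre1[OF Ch.ev_curry] del: Ch_simps)
    finally show ?thesis .
  qed
  then have "at ?e k \<cdot> at ?g k = at (\<phi> \<cdot>\<^bsub>Ch A\<^esub> Ch.wh ?D \<eta> \<cdot>\<^bsub>Ch A\<^esub> Ch.ri ?D) k"
    by (metis Ch_Comp(3))
  also have "\<dots> = at (\<phi> \<cdot>\<^bsub>Ch A\<^esub> Ch.wh ?D \<eta>) k \<cdot> at (Ch.ri ?D) k"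
    using Ch.Ar_ri[of ?D] Ch.Cod_ri[of ?D] by simp
  also have "at (\<phi> \<cdot>\<^bsub>Ch A\<^esub> Ch.wh ?D \<eta>) k = at (ch_runit A ?D) k"
  proof (rule ch_tens_unit_ext[of ?D])
    show "at (\<phi> \<cdot>\<^bsub>Ch A\<^esub> Ch.wh ?D \<eta>) k \<cdot> t ?D (ch_unit A) k 0 = at (ch_runit A ?D) k \<cdot> t ?D (ch_unit A) k 0"
      using \<phi>(4)[of 0] by (simp add: ch_runit_inj tens_map_inj pre1 a_def tens_Comp_tens)
  qed auto
  also have "at (ch_runit A ?D) k \<cdot> at (Ch.ri ?D) k = Id A ?N"
    using arg_cong[OF Ch.runit_ri[of ?D], of "\<lambda>f. at f k"] by simp
  finally have "at ?e k \<cdot> at ?g k = Id A ?N" .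
  \<comment> \<open>\<open>at ?g k\<close> is a section of the evaluation in degree k. The disk, and
    with it the section, depends on k, so the epimorphism is obtained degree by degree. The variable
    \<open>E\<close> shields the composite from being unfolded.\<close>
  moreover have "epi A (at E k)"
    if "E \<in> Ar (Ch A)" "Dom (Ch A) E = ?H" "Cod (Ch A) E = X" "at E k \<cdot> at ?g k = Id A ?N" for E
    using that g by (intro split_epi[where s = "at ?g k"]) auto
  ultimately show "epi A (at ?e k)" using e by blast
qed

end

section \<open>The acyclic monoid\<close>

context closed_additive begin

definition null_ob :: "'o \<Rightarrow> bool" where
  "null_ob X \<longleftrightarrow> X \<in> Ob A \<and> Id A X = hzero A X X"

lemma null_ob_Ob [simp]: "null_ob X \<Longrightarrow> X \<in> Ob A"
  by (simp add: null_ob_def)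

lemma null_ob_zero_ob [simp]: "null_ob (zero_ob A)"
  by (simp add: null_ob_def Id_zero_ob)

lemma null_ob_tens: "null_ob X \<Longrightarrow> Y \<in> Ob A \<Longrightarrow> null_ob (X \<otimes> Y)" "null_ob X \<Longrightarrow> Y \<in> Ob A \<Longrightarrow> null_ob (Y \<otimes> X)"
  by (auto simp: null_ob_def tens_Id[symmetric] simp del: tens_Id)

lemma from_null_ob:
  assumes "null_ob (Dom A f)" "f \<in> Ar A"
  shows "f = hzero A (Dom A f) (Cod A f)"
proof -
  have "f = f \<cdot> hzero A (Dom A f) (Dom A f)" using assms by (metis null_ob_def Comp_Id_right)
  then show ?thesis using assms by simp
qed

lemma to_null_ob:
  assumes "null_ob (Cod A f)" "f \<in> Ar A"
  shows "f = hzero A (Dom A f) (Cod A f)"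
proof -
  have "f = hzero A (Cod A f) (Cod A f) \<cdot> f" using assms by (metis null_ob_def Comp_Id_left)
  then show ?thesis using assms by simp
qed

lemma null_ob_eq:
  assumes "f \<in> Ar A" "g \<in> Ar A" "Dom A f = Dom A g" "Cod A f = Cod A g" "null_ob (Dom A g) \<or> null_ob (Cod A g)"
  shows "f = g"
  using assms from_null_ob[of f] from_null_ob[of g] to_null_ob[of f] to_null_ob[of g] by auto

lemma epi_to_null_ob: "f \<in> Ar A \<Longrightarrow> null_ob (Cod A f) \<Longrightarrow> epi A f"
  unfolding epi_def by (auto simp: hom_iff intro: null_ob_eq)

lemma iso_null_ob: "f \<in> Ar A \<Longrightarrow> null_ob (Dom A f) \<Longrightarrow> null_ob (Cod A f) \<Longrightarrow> iso A f"
  unfolding iso_def inverse_of_def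
  by (intro exI[of _ "hzero A (Cod A f) (Dom A f)"]) (auto simp: hom_iff null_ob_def)

end

context chain_base begin

text \<open>The homology has to exist as well as vanish, because \<open>quasi_iso\<close> asks for
  its existence in every degree.\<close>

definition acyclic :: "('o, 'a) chain \<Rightarrow> bool" where
  "acyclic X \<longleftrightarrow> is_chain A X \<and> (\<forall>n. \<exists>z \<pi>. homology_data A X n z \<pi> \<and> null_ob (Cod A \<pi>))"

lemma homology_data_null:
  assumes [simp]: "is_chain A X" and null: "null_ob (deg X n)"
  shows "homology_data A X n (Id A (deg X n)) (Id A (deg X n))"
proof -
  have Id: "Id A (deg X n) = hzero A (deg X n) (deg X n)" using null by (simp add: null_ob_def)
  have d: "diff X n = hzero A (deg X n) (deg X (n - 1))" "diff X (n + 1) = hzero A (deg X (n + 1)) (deg X n)"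
    using from_null_ob[of "diff X n"] to_null_ob[of "diff X (n + 1)"] null by auto
  have "is_kernel A (diff X n) (Id A (deg X n))"
    unfolding is_kernel_def by (auto simp: hom_iff d intro!: ex1I)
  moreover have "is_cokernel A (diff X (n + 1)) (Id A (deg X n))"
    unfolding is_cokernel_def by (auto simp: hom_iff d intro!: ex1I)
  ultimately show ?thesis
    unfolding homology_data_def by (auto simp: hom_iff intro!: bexI[of _ "diff X (n + 1)"])
qed

lemma acyclic_null: "is_chain A X \<Longrightarrow> (\<And>n. null_ob (deg X n)) \<Longrightarrow> acyclic X"
  unfolding acyclic_def using homology_data_null by fastforce

lemma is_kernel_Id:
  assumes [simp]: "N \<in> Ob A"
  shows "is_kernel A (Id A N) (hzero A (zero_ob A) N)"
proof -
  have "\<exists>!h. h \<in> hom A W (zero_ob A) \<and> hzero A (zero_ob A) N \<cdot> h = hzero A W N" if "W \<in> Ob A" for W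
    using that by (intro ex1I[of _ "hzero A W (zero_ob A)"]) (auto simp: hom_iff intro: to_zero_unique)
  then show ?thesis unfolding is_kernel_def by (auto simp: hom_iff)
qed

lemma is_cokernel_Id:
  assumes [simp]: "N \<in> Ob A"
  shows "is_cokernel A (Id A N) (hzero A N (zero_ob A))"
proof -
  have "\<exists>!h. h \<in> hom A (zero_ob A) W \<and> h \<cdot> hzero A N (zero_ob A) = hzero A N W" if "W \<in> Ob A" for W
    using that by (intro ex1I[of _ "hzero A (zero_ob A) W"]) (auto simp: hom_iff intro: from_zero_unique)
  then show ?thesis unfolding is_cokernel_def by (auto simp: hom_iff)
qed

text \<open>The differential out of degree k is an identity: there are no cycles in degree k, and in
  degree \<open>k - 1\<close> every cycle is a boundary.\<close>

lemma acyclic_disk: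
  assumes [simp]: "N \<in> Ob A"
  shows "acyclic (disk k N)"
  unfolding acyclic_def
proof (intro conjI allI)
  let ?X = "disk k N"
  fix n
  have [simp]: "deg ?X (n + 1) \<in> Ob A" for n by (rule chain_simps) simp
  consider "n = k" | "n = k - 1" | "n \<noteq> k" "n \<noteq> k - 1" by auto
  then show "\<exists>z \<pi>. homology_data A ?X n z \<pi> \<and> null_ob (Cod A \<pi>)"
  proof cases
    case 1
    have "is_kernel A (Id A N) (hzero A (zero_ob A) N)"
      by (rule is_kernel_Id) simp
    moreover have "is_cokernel A (hzero A (zero_ob A) (zero_ob A)) (Id A (zero_ob A))"
      unfolding is_cokernel_def by (auto simp: hom_iff intro!: ex1I)
    moreover have "deg ?X (k + 1) = zero_ob A" "diff ?X (k + 1) = hzero A (zero_ob A) N"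
      by (auto simp: disk_diff)
    ultimately have "homology_data A ?X k (hzero A (zero_ob A) N) (Id A (zero_ob A))"
      unfolding homology_data_def by (auto simp: hom_iff disk_diff intro!: bexI[of _ "hzero A (zero_ob A)
        (zero_ob A)"])
    then show ?thesis unfolding 1 by (intro exI conjI) auto
  next
    case 2
    have "is_kernel A (diff ?X n) (Id A N)"
      unfolding is_kernel_def 2 using chain_simps[OF is_chain_disk[OF assms], of "k - 1" k]
      by (auto simp: hom_iff disk_diff intro!: ex1I)
    moreover have "is_cokernel A (Id A N) (hzero A N (zero_ob A))"
      by (rule is_cokernel_Id) simp
    ultimately have "homology_data A ?X n (Id A N) (hzero A N (zero_ob A))"
      unfolding homology_data_def 2 by (auto simp: hom_iff disk_diff intro!: bexI[of _ "Id A N"])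
    then show ?thesis by (intro exI conjI) auto
  next
    case 3
    then have "null_ob (deg ?X n)" by simp
    from homology_data_null[OF _ this] this show ?thesis by (intro exI conjI) auto
  qed
qed simp

text \<open>On cycles the map is induced by the kernel property; on homology it goes between null
  objects, where the zero map is invertible.\<close>

lemma quasi_iso_acyclic:
  assumes [simp]: "is_chmap A f" and "acyclic (src f)" "acyclic (tgt f)"
  shows "quasi_iso A f"
  unfolding quasi_iso_def
proof (intro conjI allI)
  fix n
  obtain z \<pi> z' \<pi>' where H: "homology_data A (src f) n z \<pi>" "null_ob (Cod A \<pi>)"
    "homology_data A (tgt f) n z' \<pi>'" "null_ob (Cod A \<pi>')"
    using assms unfolding acyclic_def by meson
  have [simp]: "z \<in> Ar A" "Cod A z = deg (src f) n" "z' \<in> Ar A" "Cod A z' = deg (tgt f) n"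
    and [simp]: "diff (src f) n \<cdot> z = hzero A (Dom A z) (deg (src f) (n - 1))"
    using H(1,3) unfolding homology_data_def is_kernel_def by auto
  have [simp]: "\<pi> \<in> Ar A" "\<pi>' \<in> Ar A" "Dom A \<pi> = Dom A z" "Dom A \<pi>' = Dom A z'"
    using H(1,3) unfolding homology_data_def is_cokernel_def by (auto simp: hom_iff)
  have "diff (tgt f) n \<cdot> at f n \<cdot> z = at f (n - 1) \<cdot> diff (src f) n \<cdot> z"
    by (rule chmap_diff_tail) auto
  then have "at f n \<cdot> z \<in> hom A (Dom A z) (deg (tgt f) n) \<and> diff (tgt f) n \<cdot> at f n \<cdot> z
    = hzero A (Dom A z) (deg (tgt f) (n - 1))"
    by (simp add: hom_iff)
  then obtain c where c: "c \<in> hom A (Dom A z) (Dom A z')" "z' \<cdot> c = at f n \<cdot> z"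
    using H(3) unfolding homology_data_def is_kernel_def
    by (metis Dom_Ob \<open>z \<in> Ar A\<close> assms(1) chain_simps(3,4) chmap_simps(2))
  have [simp]: "c \<in> Ar A" "Dom A c = Dom A z" "Cod A c = Dom A z'" using c(1) by (auto simp: hom_iff)
  let ?h = "hzero A (Cod A \<pi>) (Cod A \<pi>')"
  have "?h \<cdot> \<pi> = \<pi>' \<cdot> c" by (rule null_ob_eq) (use H in auto)
  then show "\<exists>z \<pi> z' \<pi>' c h. homology_data A (src f) n z \<pi> \<and> homology_data A (tgt f) n z' \<pi>'
     \<and> c \<in> hom A (Dom A z) (Dom A z') \<and> z' \<cdot> c = at f n \<cdot> z
     \<and> h \<in> hom A (Cod A \<pi>) (Cod A \<pi>') \<and> h \<cdot> \<pi> = \<pi>' \<cdot> c \<and> iso A h"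
    using H c iso_null_ob[of ?h]
    by (intro exI[of _ z] exI[of _ \<pi>] exI[of _ z'] exI[of _ \<pi>'] exI[of _ c] exI[of _ ?h]) (simp add: hom_iff)
qed simp

end

section \<open>The contractible monoid and the cofibrant case\<close>

context closed_chain_base begin

text \<open>\<open>lunit_unit\<close> was proved for \<open>typed_smc\<close>, which is available
  for \<open>Ch A\<close>; the identity in A is read off from its component in bidegree (0,
  0).\<close>

lemma lunit_unit_eq: "runit A (unit A) = lunit A (unit A)"
proof -
  have "at (ch_lunit A (ch_unit A)) 0 = at (ch_runit A (ch_unit A)) 0"
    using Ch.lunit_unit by simp
  then have "at (ch_lunit A (ch_unit A)) 0 \<cdot> t (ch_unit A) (ch_unit A) 0 0 = at (ch_runit A (ch_unit A)) 0
    \<cdot> t (ch_unit A) (ch_unit A) 0 0"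
    by simp
  then show ?thesis by (simp add: ch_lunit_inj ch_runit_inj)
qed

abbreviation "cone \<equiv> disk 1 (unit A)"

lemma cone_deg: "deg cone 0 = unit A" "deg cone 1 = unit A" "n \<noteq> 0 \<Longrightarrow> n \<noteq> 1 \<Longrightarrow> deg cone n = zero_ob A"
  using disk_deg(2)[of 1 "unit A"] by auto

definition cone_unit :: "('o, 'a) chmap" where
  "cone_unit = \<lparr>src = ch_unit A, tgt = cone, at = (\<lambda>n.
    if n = 0 then Id A (unit A) else hzero A (deg (ch_unit A) n) (deg cone n))\<rparr>"

lemma cone_unit_simps [simp]: "src cone_unit = ch_unit A" "tgt cone_unit = cone" "at cone_unit 0 = Id A (unit A)"
  by (auto simp: cone_unit_def)

lemma is_chmap_cone_unit [simp]: "is_chmap A cone_unit"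
proof (rule is_chmapI)
  have c: "at cone_unit n \<in> Ar A \<and> Dom A (at cone_unit n) = deg (ch_unit A) n \<and> Cod A (at cone_unit n)
    = deg cone n" for n
    by (simp add: cone_unit_def cone_deg)
  then show "at cone_unit n \<in> Ar A" "Dom A (at cone_unit n) = deg (src cone_unit) n" "Cod A (at cone_unit n)
    = deg (tgt cone_unit) n" for n
    by auto
  have "diff cone n \<cdot> at cone_unit n = at cone_unit (n - 1) \<cdot> diff (ch_unit A) n" for n
  proof (cases "n = 0")
    case True
    then show ?thesis using c[of "-1"] by (simp add: disk_diff unit_diff cone_deg)
  next
    case False
    then show ?thesis using c[of n] c[of "n - 1"] by (intro from_zero_unique) auto
  qed
  then show "diff (tgt cone_unit) n \<cdot> at cone_unit n = at cone_unit (n - 1) \<cdot> diff (src cone_unit) n" for n by simp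
qed auto

text \<open>By \<open>disk_tens_desc\<close> only the products with \<open>h\<close> on the left are
  prescribed: \<open>h 1 = h\<close>, and \<open>h h = 0\<close> for want of a target. The products
  with 1 on the left are then forced by the Leibniz rule and \<open>d h = 1\<close>.\<close>

lemma cone_multiplication:
  obtains \<mu> where "is_chmap A \<mu>" "src \<mu> = T cone cone" "tgt \<mu> = cone"
    "at \<mu> 0 \<cdot> t cone cone 0 0 = lunit A (unit A)" "at \<mu> 1 \<cdot> t cone cone 1 0 = lunit A (unit A)"
    "at \<mu> 1 \<cdot> t cone cone 0 1 = lunit A (unit A)"
proof -
  define a where "a q = (if q = 0 then lunit A (unit A) else hzero A (unit A \<otimes> deg cone q) (deg cone (1 + q)))" for q
  have a: "a q \<in> hom A (unit A \<otimes> deg cone q) (deg cone (1 + q))" for q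
    by (auto simp: a_def hom_iff cone_deg)
  obtain \<mu> where \<mu>: "is_chmap A \<mu>" "src \<mu> = T cone cone" "tgt \<mu> = cone"
    and 1: "\<And>q. at \<mu> (1 + q) \<cdot> t cone cone 1 q = a q"
    and 0: "\<And>q. at \<mu> (1 - 1 + q) \<cdot> t cone cone (1 - 1) q = (diff cone (1 + q) \<cdot> a q) \<oplus> signed A (1 + 1) (a
      (q - 1) \<cdot> (Id A (unit A) \<boxtimes> diff cone q))"
    by (rule disk_tens_desc[of "unit A" cone cone a 1]) (auto simp: a)
  have "at \<mu> 1 \<cdot> t cone cone 1 0 = lunit A (unit A)"
    using 1[of 0] by (simp add: a_def)
  moreover have "at \<mu> 0 \<cdot> t cone cone 0 0 = lunit A (unit A)"
    using 0[of 0] by (simp add: a_def disk_diff cone_deg)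
  moreover have "at \<mu> 1 \<cdot> t cone cone 0 1 = lunit A (unit A)"
    using 0[of 1] by (simp add: a_def disk_diff cone_deg)
  ultimately show thesis
    by (intro that[OF \<mu>])
qed

lemma null_cone: "n \<noteq> 0 \<Longrightarrow> n \<noteq> 1 \<Longrightarrow> null_ob (deg cone n)"
  by (simp add: cone_deg)

lemma cone_monoid: "\<exists>\<mu>. concentrated (Ch A) (ch_add A) (ch_zero A) cone \<mu> cone_unit"
proof -
  obtain \<mu> where \<mu> [simp]: "is_chmap A \<mu>" "src \<mu> = T cone cone" "tgt \<mu> = cone"
    and \<mu>_01: "at \<mu> 0 \<cdot> t cone cone 0 0 = lunit A (unit A)" "at \<mu> 1 \<cdot> t cone cone 1 0 = lunit A (unit A)"
      "at \<mu> 1 \<cdot> t cone cone 0 1 = lunit A (unit A)"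
    by (rule cone_multiplication)
  have \<mu>_inj: "at \<mu> n \<cdot> t cone cone p q = lunit A (unit A)"
    if "n = p + q" "p \<in> {0, 1}" "q \<in> {0, 1}" "n \<in> {0, 1}" for p q n
    using that \<mu>_01 by auto
  have C [simp]: "is_chain A cone" by simp
  have "\<mu> \<cdot>\<^bsub>Ch A\<^esub> ch_tens_map A cone_unit (Id (Ch A) cone) = ch_lunit A cone"
  proof (rule chmap_eqI)
    fix n
    show "at (\<mu> \<cdot>\<^bsub>Ch A\<^esub> ch_tens_map A cone_unit (Id (Ch A) cone)) n = at (ch_lunit A cone) n"
    proof (rule ch_unit_tens_ext[of cone])
      show "at (\<mu> \<cdot>\<^bsub>Ch A\<^esub> ch_tens_map A cone_unit (Id (Ch A) cone)) n \<cdot> t (ch_unit A) cone 0 n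
        = at (ch_lunit A cone) n \<cdot> t (ch_unit A) cone 0 n"
      proof (cases "n \<in> {0, 1}")
        case True
        then show ?thesis by (auto simp: ch_lunit_inj tens_map_inj \<mu>_inj cone_deg)
      next
        case False
        show ?thesis by (rule null_ob_eq) (use False null_cone[of n] in auto)
      qed
    qed auto
  qed auto
  moreover have "\<mu> \<cdot>\<^bsub>Ch A\<^esub> ch_tens_map A (Id (Ch A) cone) cone_unit = ch_runit A cone"
  proof (rule chmap_eqI)
    fix n
    show "at (\<mu> \<cdot>\<^bsub>Ch A\<^esub> ch_tens_map A (Id (Ch A) cone) cone_unit) n = at (ch_runit A cone) n"
    proof (rule ch_tens_unit_ext[of cone])
      show "at (\<mu> \<cdot>\<^bsub>Ch A\<^esub> ch_tens_map A (Id (Ch A) cone) cone_unit) n \<cdot> t cone (ch_unit A) n 0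
        = at (ch_runit A cone) n \<cdot> t cone (ch_unit A) n 0"
      proof (cases "n \<in> {0, 1}")
        case True
        then show ?thesis by (auto simp: ch_runit_inj tens_map_inj \<mu>_inj cone_deg lunit_unit_eq)
      next
        case False
        show ?thesis by (rule null_ob_eq) (use False null_cone[of n] in auto)
      qed
    qed auto
  qed auto
  moreover have "\<mu> \<cdot>\<^bsub>Ch A\<^esub> ch_tens_map A \<mu> (Id (Ch A) cone)
    = \<mu> \<cdot>\<^bsub>Ch A\<^esub> ch_tens_map A (Id (Ch A) cone) \<mu> \<cdot>\<^bsub>Ch A\<^esub> ch_assoc A cone cone cone" (is "?f = ?g")
  proof (rule chmap_eqI)
    fix n
    show "at ?f n = at ?g n"
    proof (rule ch_tens_ext3[of cone cone cone])
      fix p q r assume n: "n = p + q + r"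
      let ?i = "t (T cone cone) cone (p + q) r \<cdot> (t cone cone p q \<boxtimes> Id A (deg cone r))"
      have f: "at ?f n \<cdot> ?i = (at \<mu> n \<cdot> t cone cone (p + q) r) \<cdot> ((at \<mu> (p + q) \<cdot> t cone cone p q) \<boxtimes> Id A
        (deg cone r))"
        by (simp add: n tens_map_inj_tail tens_Comp_tens)
      have g: "at ?g n \<cdot> ?i = (at \<mu> n \<cdot> t cone cone p (q + r)) \<cdot> (Id A (deg cone p) \<boxtimes> (at \<mu> (q + r)
        \<cdot> t cone cone q r)) \<cdot> assoc A (deg cone p) (deg cone q) (deg cone r)"
        by (simp add: n ch_assoc_inj tens_map_inj_tail add.assoc pre1[OF tens_Comp_tens])
      show "at ?f n \<cdot> ?i = at ?g n \<cdot> ?i"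
      \<comment> \<open>When all degrees and their sum are 0 or 1, every product is
        \<open>lunit\<close> and associativity is the triangle of A. Otherwise a factor or the
        target is null, for example two copies of \<open>h\<close> land in degree 2.\<close>
      proof (cases "p \<in> {0, 1} \<and> q \<in> {0, 1} \<and> r \<in> {0, 1} \<and> n \<in> {0, 1}")
        case True
        then have [simp]: "deg cone p = unit A" "deg cone q = unit A" "deg cone r = unit A"
          "deg cone (p + q) = unit A" "deg cone (q + r) = unit A"
          using n by (auto simp: cone_deg)
        have "p + q \<in> {0, 1}" "q + r \<in> {0, 1}" using True n by auto
        then have 1: "at \<mu> (p + q) \<cdot> t cone cone p q = lunit A (unit A)" "at \<mu> (q + r) \<cdot> t cone cone q r
          = lunit A (unit A)"
          "at \<mu> n \<cdot> t cone cone (p + q) r = lunit A (unit A)" "at \<mu> n \<cdot> t cone cone p (q + r) = lunit A (unit A)"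
          using True by (auto intro!: \<mu>_inj simp: n)
        show ?thesis
          unfolding f g 1 using triangle[of "unit A" "unit A"]
          by (simp add: lunit_unit_eq)
      next
        case False
        have null: "null_ob ((deg cone p \<otimes> deg cone q) \<otimes> deg cone r) \<or> null_ob (deg cone n)"
          using False null_cone[of p] null_cone[of q] null_cone[of r] null_cone[of n] null_ob_tens tens_Ob
            chain_simps(1)[OF C] by blast
        show ?thesis by (rule null_ob_eq) (use null in \<open>auto simp: n\<close>)
      qed
    qed auto
  qed auto
  ultimately have "concentrated (Ch A) (ch_add A) (ch_zero A) cone \<mu> cone_unit"
    by unfold_locales (auto simp: ch_hom_iff)
  then show ?thesis ..
qed

lemma null_ob_deg_zero_ob: "null_ob (deg (zero_ob (Ch A)) n)"
  using null_deg[OF Ch.null_zero_ob] Ch.zero_ob_Ob by (simp add: null_ob_def)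

lemma cofibrant_operad_hom:
  assumes P: "operad (Ch A) P" and cof: "cofibrant A P"
  shows "\<exists>Q g. operad (Ch A) Q \<and> operad_hom (Ch A) P Q g \<and> dualisable (Ch A) (arity Q 0)
    \<and> split_mono A (at (opunit Q) 0)"
proof -
  obtain \<mu> where "concentrated (Ch A) (ch_add A) (ch_zero A) cone \<mu> cone_unit"
    using cone_monoid by auto
  then interpret Q: concentrated "Ch A" "ch_add A" "ch_zero A" cone \<mu> cone_unit .
  let ?z = "zero_ob (Ch A)"
  let ?R = "concentrated_operad (Ch A) ?z (ch_zero A (tensO (Ch A) ?z ?z) ?z) (ch_zero A (unit (Ch A)) ?z)"
  define p where "p n = ch_zero A (arity Q.C n) ?z" for n
  have [simp]: "is_chain A ?z" "is_chain A (arity Q.C n)" for n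
    using Ch.zero_ob_Ob Q.concentrated_arity_Ob[of n] by auto
  have [simp]: "is_chmap A (p n)" "src (p n) = arity Q.C n" "tgt (p n) = ?z" for n
    by (auto simp: p_def)
  \<comment> \<open>In arity one this is the disk; in the other arities and throughout the zero
    operad the complexes are null. Hence every map between them is a quasi-isomorphism.\<close>
  have "acyclic (arity Q.C n)" for n
    by (cases "n = Suc 0") (auto simp: Q.concentrated_arity acyclic_disk acyclic_null null_ob_deg_zero_ob)
  then have "quasi_iso A (p n)" for n
    by (intro quasi_iso_acyclic) (auto simp: acyclic_null null_ob_deg_zero_ob)
  moreover have "epi A (at (p n) k)" for n k
    by (intro epi_to_null_ob) (auto simp: null_ob_deg_zero_ob)
  moreover have "operad_hom (Ch A) Q.C ?R p"
    unfolding p_def by (rule Ch.operad_hom_to_zero[OF Q.operad_concentrated])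
  moreover have "operad (Ch A) ?R"
    by (rule concentrated.operad_concentrated[OF Ch.concentrated_zero_ob])
  ultimately obtain g where "operad_hom (Ch A) P Q.C g"
    using cof Q.operad_concentrated Ch.operad_hom_to_zero[OF P] unfolding cofibrant_def by meson
  moreover have "dualisable (Ch A) (arity Q.C 0)"
    using Ch.dualisable_zero_ob by (simp add: Q.concentrated_arity)
  \<comment> \<open>In degree 0 the unit of the cone is the identity of
    \<open>unit A\<close>.\<close>
  moreover have "split_mono A (at (opunit Q.C) 0)"
    using Q.concentrated_unit by (auto simp: split_mono_def hom_iff)
  ultimately show ?thesis using Q.operad_concentrated by blast
qed

lemma sane_if_split_unit:
  assumes P: "operad (Ch A) P" and Q: "operad (Ch A) Q" and g: "operad_hom (Ch A) P Q g"
    and dual: "dualisable (Ch A) (arity Q 0)" and split: "split_mono A (at (opunit Q) 0)"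
    and adj: "right_adjoint (Coalg (Ch A) P) (Coalg (Ch A) (unit_operad (Ch A))) (Restrict (Ch A)
      (unit_operad_hom (Ch A) P)) G"
  shows "sane (Ch A) P"
proof (rule Ch.sane_if_epi[OF P Q g dual _ adj])
  interpret Q: operad "Ch A" Q by (rule Q)
  fix X assume "X \<in> Ob (Ch A)"
  then show "epi (Ch A) (ev (Ch A) (arity Q 1) X \<cdot>\<^bsub>Ch A\<^esub> Ch.wh (ihom (Ch A) (arity Q 1) X) (opunit Q)
    \<cdot>\<^bsub>Ch A\<^esub> Ch.ri (ihom (Ch A) (arity Q 1) X))"
    using Q.opunit_hom Q.arity_Ob[of 1] split by (intro epi_ev_unit) (auto simp: ch_hom_iff)
qed

end

section \<open>Coproducts indexed by the integers from cocompleteness\<close>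

lemma cocomplete_coproduct:
  fixes C :: "('o, 'a, 'm) cat_scheme" and F :: "int \<Rightarrow> 'o"
  assumes "category C" and inf: "infinite (UNIV :: 's set)" and cocomplete: "cocomplete TYPE('s) C"
    and F: "\<And>i. F i \<in> Ob C"
  shows "\<exists>S \<iota>. is_coproduct C F S \<iota>"
proof -
  interpret category C by fact
  \<comment> \<open>Diagrams are indexed by the type \<open>'s\<close>; being infinite, it contains
    a copy of the integers, embedded by \<open>e\<close>.\<close>
  obtain h :: "nat \<Rightarrow> 's" where h: "inj h"
    using infinite_countable_subset[OF inf] by auto
  define e where "e = h \<circ> int_encode"
  have e: "inj e"
    using inj_compose[OF h inj_int_encode] by (simp add: e_def)
  \<comment> \<open>The discrete category on this copy: every object serves as its own identity
    arrow, and a cocone over it is just a family of maps.\<close>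
  define J :: "('s, 's) cat" where "J = \<lparr>Ob = range e, Ar = range e, Dom = (\<lambda>s. s), Cod = (\<lambda>s. s), Id
    = (\<lambda>s. s), Comp = (\<lambda>g f. f)\<rparr>"
  define D where "D = \<lparr>fob = (\<lambda>s. F (inv e s)), far = (\<lambda>s. Id C (F (inv e s)))\<rparr>"
  have [simp]: "inv e (e i) = i" for i using e by simp
  have homJ: "u \<in> hom J x y \<longleftrightarrow> u \<in> range e \<and> x = u \<and> y = u" for u x y
    by (auto simp: J_def hom_def)
  have [simp]: "Ob J = range e" "Id J u = u" "v \<cdot>\<^bsub>J\<^esub> u = u" for u v
    by (auto simp: J_def)
  have "category J"
    by unfold_locales (auto simp: J_def hom_def)
  moreover have "is_functor J C D"
    unfolding is_functor_def Ball_def homJ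
    by (auto simp: D_def F Id_hom intro!: Id_left[OF Id_hom, symmetric])
  ultimately obtain S \<iota> where col: "is_colimit J C D S \<iota>"
    using cocomplete unfolding cocomplete_def by blast
  have cocone: "cocone J C D Y \<kappa> \<longleftrightarrow> Y \<in> Ob C \<and> (\<forall>i. \<kappa> (e i) \<in> hom C (F i) Y)" for Y \<kappa>
    unfolding cocone_def Ball_def homJ
    by (auto simp: D_def) (metis \<open>\<And>i. inv e (e i) = i\<close> rangeI, metis Id_right)
  have "is_coproduct C F S (\<iota> \<circ> e)"
    unfolding is_coproduct_def
  proof (intro conjI allI ballI impI)
    show "S \<in> Ob C" "(\<iota> \<circ> e) i \<in> hom C (F i) S" for i
      using col by (auto simp: is_colimit_def cocone)
    fix Y \<kappa> assume "Y \<in> Ob C" "\<forall>i. \<kappa> i \<in> hom C (F i) Y"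
    then have "cocone J C D Y (\<kappa> \<circ> inv e)" by (simp add: cocone)
    then have "\<exists>!h. h \<in> hom C S Y \<and> (\<forall>j\<in>Ob J. h \<cdot>\<^bsub>C\<^esub> \<iota> j = (\<kappa> \<circ> inv e) j)"
      using col unfolding is_colimit_def by blast
    then show "\<exists>!h. h \<in> hom C S Y \<and> (\<forall>i. h \<cdot>\<^bsub>C\<^esub> (\<iota> \<circ> e) i = \<kappa> i)"
      by simp
  qed
  then show ?thesis by blast
qed

theorem mainTheorem2:
  fixes A :: "('o, 'a) asmcat"
    and P :: "('o, 'a) dg_operad"
  assumes "additive_category A"
    and "symmetric_monoidal A"
    and "has_internal_homs A"
    and "infinite (UNIV :: 's set)"
    and "cocomplete TYPE('s) A"
    and "has_internal_homs (Ch A)"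
    and right_adjoints: "\<And>(Q :: ('o, 'a) dg_operad) Q' f.
      operad (Ch A) Q \<Longrightarrow> operad (Ch A) Q' \<Longrightarrow> operad_hom (Ch A) Q Q' f
      \<Longrightarrow> \<exists>G. right_adjoint (Coalg (Ch A) Q') (Coalg (Ch A) Q) (Restrict (Ch A) f) G"
    and "operad (Ch A) P"
    and "(\<exists>a. operad_hom (Ch A) P (unit_operad (Ch A)) a)
      \<or> cofibrant A P
      \<or> (dualisable (Ch A) (arity P 0)
          \<and> (\<forall>n k. split_mono A (at (unit_operad_hom (Ch A) P n) k)))"
  shows "sane (Ch A) P"
proof -
  interpret additive_category A by fact
  interpret symmetric_monoidal A by fact
  interpret closed_chain_base A
    by unfold_locales (use assms(3,6) cocomplete_coproduct[OF category_axioms assms(4,5)] in auto)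
  \<comment> \<open>The instance of the standing assumption for the unit morphism, from which
    \<open>Cofree\<close> arises.\<close>
  obtain G where adj: "right_adjoint (Coalg (Ch A) P) (Coalg (Ch A) (unit_operad (Ch A))) (Restrict (Ch A)
    (unit_operad_hom (Ch A) P)) G"
    using right_adjoints Ch.operad_unit_operad Ch.operad_hom_from_unit_operad \<open>operad (Ch A) P\<close> by blast
  have "\<exists>Q g. operad (Ch A) Q \<and> operad_hom (Ch A) P Q g \<and> dualisable (Ch A) (arity Q 0)
    \<and> split_mono A (at (opunit Q) 0)"
    using assms(9)
  proof (elim disjE exE conjE)
    fix a assume "operad_hom (Ch A) P (unit_operad (Ch A)) a"
    moreover have "dualisable (Ch A) (arity (unit_operad (Ch A)) 0)"
      "split_mono A (at (opunit (unit_operad (Ch A))) 0)"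
      using Ch.dualisable_zero_ob Ch.opunit_unit_operad by (auto simp: Ch.unit_operad_arity split_mono_def hom_iff)
    ultimately show ?thesis using Ch.operad_unit_operad by blast
  next
    assume "cofibrant A P"
    then show ?thesis using cofibrant_operad_hom \<open>operad (Ch A) P\<close> by blast
  next
    assume dual: "dualisable (Ch A) (arity P 0)" and split: "\<forall>n k. split_mono A (at (unit_operad_hom (Ch A) P n) k)"
    interpret P: operad "Ch A" P by fact
    have "operad_hom (Ch A) P P (\<lambda>n. Id (Ch A) (arity P n))"
      unfolding operad_hom_def
    proof (intro conjI allI impI)
      fix m n i :: nat assume i: "i < m"
      show "Id (Ch A) (arity P (m + n - 1)) \<cdot>\<^bsub>Ch A\<^esub> pcomp P m n i
        = pcomp P m n i \<cdot>\<^bsub>Ch A\<^esub> tensA (Ch A) (Id (Ch A) (arity P m)) (Id (Ch A) (arity P n))"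
        using P.pcomp_hom[OF i] P.arity_Ob by (simp add: Ch.hom_iff Ch.tens_Id_Id del: Ch_simps)
    qed (use P.act_hom P.opunit_hom P.arity_Ob in \<open>auto simp: Ch.hom_iff simp del: Ch_simps\<close>)
    \<comment> \<open>In arity one \<open>unit_operad_hom\<close> is the operad unit itself.\<close>
    moreover have "split_mono A (at (opunit P) 0)"
      using spec[OF spec[OF split, of 1], of 0] by (simp add: unit_operad_hom_def)
    ultimately show ?thesis using dual \<open>operad (Ch A) P\<close> by blast
  qed
  then show ?thesis
    using sane_if_split_unit[OF \<open>operad (Ch A) P\<close> _ _ _ _ adj] by blast
qed

end
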